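(* Let $X$ be a compact toric variety of complex dimension $N$, let $n\ge 3$, and let $\gamma_1,\dots,\gamma_n\in\Omega^*_{\rm trop}(X)$ be representatives (of even degree) of the Poincaré duals of cycles on $X$. Then the generating function of $n$-point tropical Gromov--Witten invariants of $X$ equals the total amplitude of the corresponding mirror states in the B-model higher topological quantum mechanics with mirror superpotential determined by the compactifying divisors $B_X$: $$\sum_{\beta\in H_2(X)}q^\beta\,\langle\gamma_1,\dots,\gamma_n\rangle^X_\beta=\bigl\langle\Psi^X_{\gamma_1},\dots,\Psi^X_{\gamma_n}\bigr\rangle_{Q^X},$$ where $$\Psi^X_\gamma=\sum_{d=0}^\infty(2\pi KG_-\mathcal{O}_X)^d\,\Psi_\gamma,\qquad Q^X=Q+2\pi i\,\frac{\partial W_X}{\partial Y_j}\frac{\partial}{\partial\psi^j_\Phi},\qquad W_X=\sum_{\vec b\in B_X}q_b\,e^{i\langle\vec b,\vec Y\rangle}.$$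
   Context: **Toric data.** $X$ is viewed as a compactification of $(\mathbb{C}^* )^N=\mathbb{R}^N\times\mathbb{T}^N$ (radial coordinates $r^j$, angular coordinates $\phi^j$) by toric hyperplanes at infinity; $B_X\subset\mathbb{Z}^N$ is the finite set of primitive integer normal vectors of these hyperplanes, and $H_b$ is the hyperplane with normal $\vec b$. $\Omega^*_{\rm trop}(X)$ is the space of $U(1)^N$-invariant smooth differential forms on $(\mathbb{C}^* )^N$ that extend to $X$. The toric moduli $q_b$, $\vec b\in B_X$, are (formal) parameters, and $q^\beta=\prod_{\vec b\in B_X}q_b^{\beta\cdot H_b}$. **Tropical Gromov--Witten invariants.** A discrete type $\vec\Gamma$ of genus zero tropical curves with $n$ marked points is a connected tree with vertices of valence $1,2,3$ only, whose 2-valent vertices are labelled $1,\dots,n$, with oriented edges and a vector $\vec m_e\in\mathbb{Z}^N$ on each edge such that: external edges (at 1-valent vertices) are oriented away from the 1-valent vertex and have $\vec m_e\in B_X$; internal edges have $\vec m_e\neq0$; at each 2- or 3-valent vertex the sums of $\vec m_e$ over incoming and over outgoing edges agree. Types are identified under reversing an internal edge together with $\vec m_e\to-\vec m_e$. Its degree is $\beta$ if $\beta\cdot H_b$ is the number of external edges with $\vec m_e=\vec b$ for each $\vec b\in B_X$. After choosing a non-leaf vertex $R$ (sink), $\mathcal{M}_{0,n}(X,\beta;\vec\Gamma)=\mathbb{R}^N\times\mathbb{T}^N\times(\mathbb{R}^+\times S^1)^{I(\Gamma)}$ ($I(\Gamma)$ the internal edges) with coordinates $(\vec r_c,\vec\phi_c)$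 and $(\tau_e,\varphi_e)$; ${\rm ev}_\alpha$ maps to $(\vec r_c+\sum\pm\vec m_e\tau_e,\ \vec\phi_c+\sum\pm\vec m_e\varphi_e)$, sums over edges on the path from $R$ to the marked vertex $\alpha$, sign $+$ iff the edge is oriented along the path. Factors $\mathbb{R}^+\times S^1$ are oriented by $d\varphi\wedge d\tau$. For $\beta\ne0$, $$\langle\gamma_1,\dots,\gamma_n\rangle^X_\beta=\sum_{\vec\Gamma}\int_{\mathcal{M}_{0,n}(X,\beta;\vec\Gamma)}\bigwedge_{\alpha=1}^n{\rm ev}_\alpha^*\gamma_\alpha,$$ sum over all types of degree $\beta$ with $n$ marked points. For $\beta=0$ the invariant is $\int_X\gamma_1\wedge\gamma_2\wedge\gamma_3$ if $n=3$ and $0$ if $n>3$. **A-model.** $V$ is the span of symbols $|\omega,\vec m\rangle$ (linear in $\omega$), $\omega\in\Omega^*_{\rm trop}(X)$, $\vec m\in\mathbb{Z}^N$. With $\iota^R_{\vec m},\iota^\Phi_{\vec m}$ the contractions with $m^i\partial_{r^i}$, $m^i\partial_{\phi^i}$: $Q|\omega,\vec m\rangle=|d\omega,\vec m\rangle$ ($d=\sum dr^i\partial_{r^i}$), $G_+|\omega,\vec m\rangle=|\iota^R_{\vec m}\omega,\vec m\rangle$, $G_-|\omega,\vec m\rangle=|\iota^\Phi_{\vec m}\omega,\vec m\rangle$, $g(|\omega_1,\vec m_1\rangle,|\omega_2,\vec m_2\rangle)=\delta_{\vec m_1+\vec m_2,\vec0}\int_X\omega_1\wedge\omega_2$, $\mu_2(|\omega_1,\vec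 m_1\rangle,|\omega_2,\vec m_2\rangle)=|\omega_1\wedge\omega_2,\vec m_1+\vec m_2\rangle$. $H=QG_++G_+Q$, $K=\int_0^\infty dt\,e^{-tH}G_+$, where $e^{-tH}$ pulls $\omega$ back along $\vec r\mapsto\vec r-\vec mt$. Evaluation state $\Psi_\gamma=|\gamma,\vec0\rangle$, divisor state $\Psi_b=|1,\vec b\rangle$, $\Psi_X=\sum_{\vec b\in B_X}q_b\Psi_b$, and $\mathcal{O}_X=\mu_2(\Psi_X,\cdot)$. **Dual variables.** By Fourier transform, $|\omega,\vec m\rangle$ is represented as $e^{i\langle\vec m,\vec Y\rangle}\omega$, with $Y_j\in S^1$, and $dr^j,d\phi^j$ in $\omega$ are written as Grassmann variables $\psi_R^j,\psi_\Phi^j$. Then $Q=\psi_R^k\partial_{r^k}$, $G_-=-i\,\partial_{Y_k}\partial_{\psi_\Phi^k}$, $G_+=-i\,\partial_{Y_k}\partial_{\psi_R^k}$, $\mu_2$ is multiplication of functions, and $\mathcal{O}_X$ is multiplication by $W_X$. In these terms $Q^X=Q-2\pi[G_-,\mathcal{O}_X]$. **B-model and total amplitudes.** The B-model is $(V,Q^X,G_\pm,g,\mu_2)$, i.e. the A-model with $Q$ replaced by $Q^X$; its propagator is $K^X=\int_0^\infty dt\,e^{-tH^X}G_+$ with $H^X=Q^XG_++G_+Q^X$ (understood as a series in the $q_b$ around $K$). For a model with propagator $\mathcal K$ ($\mathcal K=K$ for $Q$, $\mathcal K=K^X$ for $Q^X$) and a tree $\Gamma$ with $n$ leaves and all other vertices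 3-valent, choose a 3-valent sink and direct all edges toward it; the amplitude $\mathcal{A}_\Gamma(\Psi_1,\dots,\Psi_n)$ is obtained by placing the states on the leaves, $2\pi\mathcal K G_-$ on each internal edge, the identity on external edges, $\mu_2$ at non-sink vertices and $\mu_3^0(u,v,w)=g(u,\mu_2(v,w))$ at the sink, and composing (the result is independent of the sink). The total amplitude is $$\langle\Psi_1,\dots,\Psi_n\rangle=\sum_{\Gamma}\sum_{\sigma\in S_n}\frac{\mathcal{A}_\Gamma(\Psi_{\sigma(1)},\dots,\Psi_{\sigma(n)})}{|{\rm Aut}(\Gamma)|},$$ sum over isomorphism classes of such (unlabelled, sink forgotten) trees $\Gamma$ with $n$ leaves, i.e. a sum over leaf-labelled trivalent trees; the subscript ($Q$ or $Q^X$) indicates the differential. *)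

theory Defs
  imports
    "HOL-Analysis.Analysis"
    "HOL-Library.Function_Algebras"
    "HOL-Library.Multiset"
    "HOL-Combinatorics.Permutations"
begin

section \<open>Exterior algebra\<close>

text \<open>
  An element of the complex exterior algebra on linearly ordered generators is given by its
  coefficients: \<open>a S\<close> is the coefficient of the product of the generators in the finite set
  \<open>S\<close>, taken in increasing order.
\<close>

type_synonym 'g ext = "'g set \<Rightarrow> complex"

definition gone :: "'g ext" where
  "gone S = (if S = {} then 1 else 0)"

definition ggen :: "'g \<Rightarrow> 'g ext" where
  "ggen g S = (if S = {g} then 1 else 0)"

definition gwedge :: "'g::linorder ext \<Rightarrow> 'g ext \<Rightarrow> 'g ext" (infixr \<open>\<and>\<^sub>g\<close> 70) where
  "(a \<and>\<^sub>g b) S =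
     (\<Sum>T\<in>Pow S. (-1) ^ card {(t, u). t \<in> T \<and> u \<in> S - T \<and> u < t} * a T * b (S - T))"

definition gprod :: "'g::linorder ext list \<Rightarrow> 'g ext" where
  "gprod as = foldr gwedge as gone"

text \<open>Contraction with the dual of the generator \<open>g\<close>, i.e. the left derivative by \<open>g\<close>.\<close>

definition gcontr :: "'g::linorder \<Rightarrow> 'g ext \<Rightarrow> 'g ext" where
  "gcontr g a S = (if g \<in> S then 0 else (-1) ^ card {h \<in> S. h < g} * a (insert g S))"

text \<open>
  The algebra homomorphism sending each generator \<open>g \<in> J\<close> to \<open>\<theta> g\<close>; the generators of the
  source algebra are the elements of \<open>J\<close>.
\<close>

definition gsubst :: "'g::linorder set \<Rightarrow> ('g \<Rightarrow> 'h::linorder ext) \<Rightarrow> 'g ext \<Rightarrow> 'h ext" where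
  "gsubst J \<theta> a S = (\<Sum>T\<in>Pow J. a T * gprod (map \<theta> (sorted_list_of_set T)) S)"

text \<open>
  Generators belonging to radial and angular coordinates.  In the order below \<open>Rad i\<close> is directly
  followed by \<open>Ang i\<close>, so the coefficient at the set of all generators is the coefficient with
  respect to the volume form \<open>\<Prod>\<^sub>i dr\<^sup>i \<and> d\<phi>\<^sup>i\<close>.
\<close>

datatype 'i gen = Rad (gidx: 'i) | Ang (gidx: 'i)

instantiation gen :: (linorder) linorder
begin

definition less_eq_gen :: "'a gen \<Rightarrow> 'a gen \<Rightarrow> bool" where
  "x \<le> y \<longleftrightarrow> gidx x < gidx y \<or> gidx x = gidx y \<and> (is_Rad x \<or> \<not> is_Rad y)"

definition less_gen :: "'a gen \<Rightarrow> 'a gen \<Rightarrow> bool" where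
  "x < y \<longleftrightarrow> gidx x < gidx y \<or> gidx x = gidx y \<and> is_Rad x \<and> \<not> is_Rad y"

instance
  by standard (auto simp: less_eq_gen_def less_gen_def gen.expand)

end

section \<open>Compact toric varieties and their divisors\<close>

type_synonym 'n rvec = "real^'n"

type_synonym 'n lvec = "int^'n"

definition rvec :: "int^'n \<Rightarrow> real^'n" where
  "rvec m = (\<chi> j. real_of_int (m $ j))"

definition toric_cone :: "(real^'n) set \<Rightarrow> bool" where
  "toric_cone \<sigma> \<longleftrightarrow> (\<exists>S. finite S \<and> \<sigma> = convex_cone hull (rvec ` S)) \<and>
     (\<forall>x. x \<in> \<sigma> \<and> - x \<in> \<sigma> \<longrightarrow> x = 0)"

definition fan :: "(real^'n) set set \<Rightarrow> bool" where
  "fan \<Delta> \<longleftrightarrow> finite \<Delta> \<and> \<Delta> \<noteq> {} \<and>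
     (\<forall>\<sigma>\<in>\<Delta>. toric_cone \<sigma>) \<and>
     (\<forall>\<sigma>\<in>\<Delta>. \<forall>\<tau>. \<tau> face_of \<sigma> \<and> \<tau> \<noteq> {} \<longrightarrow> \<tau> \<in> \<Delta>) \<and>
     (\<forall>\<sigma>\<in>\<Delta>. \<forall>\<tau>\<in>\<Delta>. (\<sigma> \<inter> \<tau>) face_of \<sigma> \<and> (\<sigma> \<inter> \<tau>) face_of \<tau>)"

text \<open>The toric variety of a fan is compact iff the fan is complete.\<close>

definition complete_fan :: "(real^'n) set set \<Rightarrow> bool" where
  "complete_fan \<Delta> \<longleftrightarrow> fan \<Delta> \<and> \<Union>\<Delta> = UNIV"

text \<open>
  The set \<open>B\<^sub>X\<close>: primitive generators of the one-dimensional cones.  The hyperplane \<open>H\<^sub>b\<close> is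
  approached by the one-parameter subgroup \<open>t\<^sup>b\<close> as \<open>t \<rightarrow> 0\<close>, i.e. in the direction \<open>r \<rightarrow> - \<infinity> b\<close>
  of the radial coordinates (\<open>z\<^sub>j = exp (r\<^sup>j + \<i> \<phi>\<^sup>j)\<close>).
\<close>

definition rays :: "(real^'n) set set \<Rightarrow> (int^'n) set" where
  "rays \<Delta> = {b. Gcd (range (\<lambda>j. b $ j)) = 1 \<and> convex_cone hull {rvec b} \<in> \<Delta>}"

text \<open>
  A class in \<open>H\<^sub>2(X)\<close> is represented by its intersection numbers \<open>\<beta> b = \<beta> \<cdot> H\<^sub>b\<close>.  They satisfy
  \<open>\<Sum>\<^sub>b (\<beta> \<cdot> H\<^sub>b) b = 0\<close>, because the divisors of the characters are principal, and for
  nonsingular complete \<open>X\<close> this identifies \<open>H\<^sub>2(X)\<close> with the lattice of integral relations.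
\<close>

definition H2 :: "(real^'n) set set \<Rightarrow> (int^'n \<Rightarrow> int) set" where
  "H2 \<Delta> = {\<beta>. (\<forall>b. b \<notin> rays \<Delta> \<longrightarrow> \<beta> b = 0) \<and> (\<Sum>b\<in>rays \<Delta>. \<beta> b *s b) = 0}"

section \<open>Torus-invariant differential forms\<close>

text \<open>
  An invariant form on \<open>(\<complex>\<^sup>*)\<^sup>N\<close>, with \<open>N = CARD('n)\<close>: its coefficients with respect to the
  \<open>dr\<^sup>j\<close> and \<open>d\<phi>\<^sup>j\<close> depend on \<open>r\<close> only.  The linear order on \<open>'n\<close> merely fixes the order of
  factors in these products; everything below is independent of it, volume forms included.
\<close>

type_synonym 'n form = "real^'n \<Rightarrow> 'n gen ext"

definition homogeneous :: "nat \<Rightarrow> ('n::finite) form \<Rightarrow> bool" where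
  "homogeneous p \<omega> \<longleftrightarrow> (\<forall>r S. \<omega> r S \<noteq> 0 \<longrightarrow> card S = p)"

definition fwedge :: "('n::{finite,linorder}) form \<Rightarrow> 'n form \<Rightarrow> 'n form" where
  "fwedge \<omega> \<eta> r = \<omega> r \<and>\<^sub>g \<eta> r"

definition dform :: "('n::{finite,linorder}) form \<Rightarrow> 'n form" where
  "dform \<omega> r = (\<Sum>j\<in>UNIV. ggen (Rad j) \<and>\<^sub>g
     (\<lambda>S. vector_derivative (\<lambda>t. \<omega> (r + t *\<^sub>R axis j 1) S) (at 0)))"

definition contrR :: "'n lvec \<Rightarrow> ('n::{finite,linorder}) form \<Rightarrow> 'n form" where
  "contrR m \<omega> r S = (\<Sum>j\<in>UNIV. of_int (m $ j) * gcontr (Rad j) (\<omega> r) S)"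

definition contrPhi :: "'n lvec \<Rightarrow> ('n::{finite,linorder}) form \<Rightarrow> 'n form" where
  "contrPhi m \<omega> r S = (\<Sum>j\<in>UNIV. of_int (m $ j) * gcontr (Ang j) (\<omega> r) S)"

text \<open>
  \<open>\<integral>\<^sub>X \<omega>\<close> for the complex orientation; integrating the coefficients, which do not depend on the
  angles, over the torus \<open>(\<real> / 2\<pi>\<int>)\<^sup>N\<close> gives the factor \<open>(2\<pi>)\<^sup>N\<close>.
\<close>

definition int_X :: "('n::{finite,linorder}) form \<Rightarrow> complex" where
  "int_X \<omega> = (2 * of_real pi) ^ CARD('n) * (LINT r|lborel. \<omega> r UNIV)"

subsection \<open>Forms that extend to the toric variety\<close>

definition dual_monoid :: "(real^'n) set \<Rightarrow> (int^'n) set" where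
  "dual_monoid \<sigma> = {a. \<forall>x\<in>\<sigma>. rvec a \<bullet> x \<ge> 0}"

definition monoid_gens :: "(real^'n) set \<Rightarrow> (int^'n) list \<Rightarrow> bool" where
  "monoid_gens \<sigma> as \<longleftrightarrow> set as \<subseteq> dual_monoid \<sigma> \<and>
     (\<forall>a\<in>dual_monoid \<sigma>. \<exists>c :: nat \<Rightarrow> nat. a = (\<Sum>i<length as. of_nat (c i) *s (as ! i)))"

text \<open>Smooth functions of the real coordinates with indices in \<open>J\<close>.\<close>

definition partial :: "nat \<Rightarrow> ((nat \<Rightarrow> real) \<Rightarrow> complex) \<Rightarrow> (nat \<Rightarrow> real) \<Rightarrow> complex" where
  "partial j F x = vector_derivative (\<lambda>t. F (x(j := t))) (at (x j))"

definition smooth_coords :: "nat set \<Rightarrow> ((nat \<Rightarrow> real) \<Rightarrow> complex) \<Rightarrow> bool" where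
  "smooth_coords J F \<longleftrightarrow> (\<forall>js\<in>lists J. continuous_on UNIV (foldr partial js F) \<and>
     (\<forall>j\<in>J. \<forall>x. (\<lambda>t. foldr partial js F (x(j := t))) differentiable (at (x j))))"

text \<open>
  The affine chart \<open>U\<^sub>\<sigma>\<close> is embedded in \<open>\<complex>\<^sup>k\<close> by the characters \<open>z\<^sup>a\<close> for a list of \<open>k\<close>
  generators \<open>a\<close> of the dual monoid; the real coordinates \<open>2 i\<close> and \<open>2 i + 1\<close> of \<open>\<complex>\<^sup>k\<close> are the
  real and imaginary part of the \<open>i\<close>-th character.  The first function is this embedding on the
  torus, the second one is the pullback of the differentials of the coordinates.
\<close>

definition character :: "int^'n \<Rightarrow> real^'n \<Rightarrow> real^'n \<Rightarrow> complex" where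
  "character a r \<phi> = exp (Complex (rvec a \<bullet> r) (rvec a \<bullet> \<phi>))"

definition chart_point :: "(int^'n) list \<Rightarrow> real^'n \<Rightarrow> real^'n \<Rightarrow> nat \<Rightarrow> real" where
  "chart_point as r \<phi> k =
     (if k < 2 * length as
      then (if even k then Re else Im) (character (as ! (k div 2)) r \<phi>)
      else 0)"

definition chart_diff ::
  "'n lvec list \<Rightarrow> 'n rvec \<Rightarrow> 'n rvec \<Rightarrow> nat \<Rightarrow> ('n::finite) gen ext" where
  "chart_diff as r \<phi> k S =
     (let a = as ! (k div 2); z = character a r \<phi>
      in \<Sum>j\<in>UNIV. of_int (a $ j) *
           (if even k
            then of_real (Re z) * ggen (Rad j) S - of_real (Im z) * ggen (Ang j) S
            else of_real (Im z) * ggen (Rad j) S + of_real (Re z) * ggen (Ang j) S))"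

text \<open>
  A smooth form on the closed subvariety \<open>U\<^sub>\<sigma>\<close> of \<open>\<complex>\<^sup>k\<close> is the restriction of a smooth form
  \<open>\<Sum>\<^sub>S F S dx\<^sup>S\<close> on \<open>\<complex>\<^sup>k\<close>; where \<open>U\<^sub>\<sigma>\<close> is nonsingular these are the smooth forms on the manifold
  \<open>U\<^sub>\<sigma>\<close>.
\<close>

definition extends_to :: "'n rvec set \<Rightarrow> ('n::{finite,linorder}) form \<Rightarrow> bool" where
  "extends_to \<sigma> \<omega> \<longleftrightarrow> (\<exists>as F. monoid_gens \<sigma> as \<and>
     (\<forall>S\<subseteq>{..<2 * length as}. smooth_coords {..<2 * length as} (F S)) \<and>
     (\<forall>r \<phi>. \<omega> r =
        gsubst {..<2 * length as} (chart_diff as r \<phi>) (\<lambda>S. F S (chart_point as r \<phi>))))"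

definition Omega_trop :: "'n rvec set set \<Rightarrow> ('n::{finite,linorder}) form set" where
  "Omega_trop \<Delta> = {\<omega>. \<forall>\<sigma>\<in>\<Delta>. extends_to \<sigma> \<omega>}"

text \<open>
  A \<open>k\<close>-cycle enters through the integrals over it, i.e. as a closed de Rham current \<open>C\<close> of
  dimension \<open>k\<close> (with complex coefficients); only its values on invariant forms matter.
\<close>

definition cycle_on ::
  "'n rvec set set \<Rightarrow> nat \<Rightarrow> (('n::{finite,linorder}) form \<Rightarrow> complex) \<Rightarrow> bool" where
  "cycle_on \<Delta> k C \<longleftrightarrow>
     (\<forall>\<eta>\<in>Omega_trop \<Delta>. \<forall>\<theta>\<in>Omega_trop \<Delta>. C (\<eta> + \<theta>) = C \<eta> + C \<theta>) \<and>
     (\<forall>\<eta>\<in>Omega_trop \<Delta>. \<forall>c. C (\<lambda>r S. c * \<eta> r S) = c * C \<eta>) \<and>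
     (\<forall>\<eta>\<in>Omega_trop \<Delta>. \<forall>l. homogeneous l \<eta> \<and> l \<noteq> k \<longrightarrow> C \<eta> = 0) \<and>
     (\<forall>\<eta>\<in>Omega_trop \<Delta>. C (dform \<eta>) = 0)"

definition represents_poincare_dual ::
  "'n rvec set set \<Rightarrow> (('n::{finite,linorder}) form \<Rightarrow> complex) \<Rightarrow> 'n form \<Rightarrow> bool" where
  "represents_poincare_dual \<Delta> C \<gamma> \<longleftrightarrow> \<gamma> \<in> Omega_trop \<Delta> \<and> dform \<gamma> = 0 \<and>
     (\<forall>\<eta>\<in>Omega_trop \<Delta>. dform \<eta> = 0 \<longrightarrow> C \<eta> = int_X (fwedge \<gamma> \<eta>))"

section \<open>Trees\<close>

text \<open>Simple graphs on natural numbers; the adjacency relation is symmetric.\<close>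

record graph =
  verts :: "nat set"
  adj :: "(nat \<times> nat) set"

definition nbrs :: "graph \<Rightarrow> nat \<Rightarrow> nat set" where
  "nbrs G v = {u. (u, v) \<in> adj G}"

definition valence :: "graph \<Rightarrow> nat \<Rightarrow> nat" where
  "valence G v = card (nbrs G v)"

definition leaves :: "graph \<Rightarrow> nat set" where
  "leaves G = {v \<in> verts G. valence G v = 1}"

definition is_path :: "graph \<Rightarrow> nat \<Rightarrow> nat list \<Rightarrow> nat \<Rightarrow> bool" where
  "is_path G u p v \<longleftrightarrow> p \<noteq> [] \<and> hd p = u \<and> last p = v \<and> distinct p \<and> set p \<subseteq> verts G \<and>
     successively (\<lambda>x y. (x, y) \<in> adj G) p"

definition is_tree :: "graph \<Rightarrow> bool" where
  "is_tree G \<longleftrightarrow> finite (verts G) \<and> verts G \<noteq> {} \<and>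
     adj G \<subseteq> verts G \<times> verts G \<and> sym (adj G) \<and> irrefl (adj G) \<and>
     (\<forall>u\<in>verts G. \<forall>v\<in>verts G. \<exists>!p. is_path G u p v)"

definition the_path :: "graph \<Rightarrow> nat \<Rightarrow> nat \<Rightarrow> nat list" where
  "the_path G u v = (THE p. is_path G u p v)"

definition steps :: "nat list \<Rightarrow> (nat \<times> nat) list" where
  "steps p = zip p (tl p)"

text \<open>Internal edges, each listed once with its smaller end first.\<close>

definition internal_edges :: "graph \<Rightarrow> (nat \<times> nat) set" where
  "internal_edges G = {(u, v) \<in> adj G. u < v \<and> u \<notin> leaves G \<and> v \<notin> leaves G}"

definition graph_iso :: "(nat \<Rightarrow> nat) \<Rightarrow> graph \<Rightarrow> graph \<Rightarrow> bool" where
  "graph_iso f G H \<longleftrightarrow> bij_betw f (verts G) (verts H) \<and>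
     (\<forall>u\<in>verts G. \<forall>v\<in>verts G. (u, v) \<in> adj G \<longleftrightarrow> (f u, f v) \<in> adj H)"

section \<open>Tropical Gromov--Witten invariants\<close>

text \<open>
  A type consists of a tree, the vertices carrying the marked points and the edge vectors.
  \<open>flow u v\<close> is the vector \<open>m\<^sub>e\<close> of the edge between \<open>u\<close> and \<open>v\<close> when it is oriented from
  \<open>u\<close> to \<open>v\<close>.  It is antisymmetric, which takes care of the identification of types under the
  reversal of an edge together with the sign of its vector.
\<close>

datatype ('n::finite) trop =
  Trop (tree: graph) (mark: "nat \<Rightarrow> nat") (flow: "nat \<Rightarrow> nat \<Rightarrow> int^'n")

definition trop_type :: "'n lvec set \<Rightarrow> nat \<Rightarrow> ('n::finite) trop \<Rightarrow> bool" where
  "trop_type B n T \<longleftrightarrow> is_tree (tree T) \<and>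
     (\<forall>v\<in>verts (tree T). valence (tree T) v \<in> {1, 2, 3}) \<and>
     bij_betw (mark T) {1..n} {v \<in> verts (tree T). valence (tree T) v = 2} \<and>
     (\<forall>(u, v)\<in>adj (tree T). flow T v u = - flow T u v) \<and>
     (\<forall>(u, v)\<in>adj (tree T). u \<in> leaves (tree T) \<longrightarrow> flow T u v \<in> B) \<and>
     (\<forall>(u, v)\<in>internal_edges (tree T). flow T u v \<noteq> 0) \<and>
     (\<forall>v\<in>verts (tree T). v \<notin> leaves (tree T) \<longrightarrow> (\<Sum>u\<in>nbrs (tree T) v. flow T u v) = 0)"

definition has_degree :: "'n lvec set \<Rightarrow> ('n lvec \<Rightarrow> int) \<Rightarrow> ('n::finite) trop \<Rightarrow> bool" where
  "has_degree B \<beta> T \<longleftrightarrow> (\<forall>b\<in>B. \<beta> b =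
     int (card {(u, v) \<in> adj (tree T). u \<in> leaves (tree T) \<and> flow T u v = b}))"

definition trop_types :: "'n lvec set \<Rightarrow> nat \<Rightarrow> ('n lvec \<Rightarrow> int) \<Rightarrow> ('n::finite) trop set" where
  "trop_types B n \<beta> = {T. trop_type B n T \<and> has_degree B \<beta> T}"

definition trop_iso :: "'n lvec set \<Rightarrow> nat \<Rightarrow> ('n lvec \<Rightarrow> int) \<Rightarrow>
    (('n::finite) trop \<times> 'n trop) set" where
  "trop_iso B n \<beta> = {(S, T) \<in> trop_types B n \<beta> \<times> trop_types B n \<beta>.
     \<exists>f. graph_iso f (tree S) (tree T) \<and>
       (\<forall>\<alpha>\<in>{1..n}. f (mark S \<alpha>) = mark T \<alpha>) \<and>
       (\<forall>(u, v)\<in>adj (tree S). flow T (f u) (f v) = flow S u v)}"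

text \<open>
  Coordinate pairs on the moduli space \<open>\<real>\<^sup>N \<times> \<T>\<^sup>N \<times> (\<real>\<^sup>+ \<times> S\<^sup>1)\<^sup>I\<close>: \<open>Rad (Ctr j)\<close>, \<open>Ang (Ctr j)\<close>
  belong to \<open>r\<^sub>c\<^sup>j\<close>, \<open>\<phi>\<^sub>c\<^sup>j\<close>, and \<open>Rad (Edg u v)\<close>, \<open>Ang (Edg u v)\<close> to \<open>\<tau>\<^sub>e\<close>, \<open>\<phi>\<^sub>e\<close> for the internal
  edge \<open>e\<close> with ends \<open>u < v\<close>.
\<close>

datatype 'n mcoord = Ctr 'n | Edg nat nat

instantiation mcoord :: (linorder) linorder
begin

fun less_eq_mcoord :: "'a mcoord \<Rightarrow> 'a mcoord \<Rightarrow> bool" where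
  "Ctr i \<le> Ctr j \<longleftrightarrow> i \<le> j"
| "Ctr i \<le> Edg u v \<longleftrightarrow> True"
| "Edg u v \<le> Ctr i \<longleftrightarrow> False"
| "Edg u v \<le> Edg u' v' \<longleftrightarrow> u < u' \<or> u = u' \<and> v \<le> v'"

definition less_mcoord :: "'a mcoord \<Rightarrow> 'a mcoord \<Rightarrow> bool" where
  "x < y \<longleftrightarrow> x \<le> y \<and> \<not> y \<le> x" for x y :: "'a mcoord"

instance
proof
  fix x y z :: "'a mcoord"
  show "x < y \<longleftrightarrow> x \<le> y \<and> \<not> y \<le> x"
    by (fact less_mcoord_def)
  show "x \<le> x"
    by (cases x) auto
  show "x \<le> z" if "x \<le> y" "y \<le> z"
    using that by (cases x; cases y; cases z) auto
  show "x = y" if "x \<le> y" "y \<le> x"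
    using that by (cases x; cases y) auto
  show "x \<le> y \<or> y \<le> x"
    by (cases x; cases y) auto
qed

end

definition edge :: "nat \<Rightarrow> nat \<Rightarrow> nat \<times> nat" where
  "edge u v = (min u v, max u v)"

text \<open>
  Along a path from the sink every step \<open>u \<rightarrow> v\<close> contributes \<open>flow u v\<close>, which is \<open>m\<^sub>e\<close> or \<open>- m\<^sub>e\<close>
  according to whether the chosen orientation of the edge agrees with the path.
  Radial part of the evaluation map at the marked point \<open>\<alpha>\<close>, and the pullback of the generators
  under the evaluation map.
\<close>

definition ev_rad :: "('n::finite) trop \<Rightarrow> nat \<Rightarrow> nat \<Rightarrow>
    'n rvec \<Rightarrow> (nat \<times> nat \<Rightarrow> real) \<Rightarrow> 'n rvec" where
  "ev_rad T R \<alpha> rc \<tau> = rc +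
     (\<Sum>(u, v) \<leftarrow> steps (the_path (tree T) R (mark T \<alpha>)). \<tau> (edge u v) *\<^sub>R rvec (flow T u v))"

definition ev_gen :: "('n::{finite,linorder}) trop \<Rightarrow> nat \<Rightarrow> nat \<Rightarrow>
    'n gen \<Rightarrow> 'n mcoord gen ext" where
  "ev_gen T R \<alpha> g S =
     (let c = (case g of Rad _ \<Rightarrow> Rad | Ang _ \<Rightarrow> Ang); j = gidx g
      in ggen (c (Ctr j)) S +
         (\<Sum>(u, v) \<leftarrow> steps (the_path (tree T) R (mark T \<alpha>)).
            of_int (flow T u v $ j) * ggen (c (Edg (min u v) (max u v))) S))"

definition ev_pullback :: "('n::{finite,linorder}) trop \<Rightarrow> nat \<Rightarrow> nat \<Rightarrow> 'n form \<Rightarrow>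
    'n rvec \<Rightarrow> (nat \<times> nat \<Rightarrow> real) \<Rightarrow> 'n mcoord gen ext" where
  "ev_pullback T R \<alpha> \<gamma> rc \<tau> = gsubst UNIV (ev_gen T R \<alpha>) (\<gamma> (ev_rad T R \<alpha> rc \<tau>))"

definition moduli_gens :: "('n::finite) trop \<Rightarrow> 'n mcoord gen set" where
  "moduli_gens T = (let C = range Ctr \<union> (\<lambda>(u, v). Edg u v) ` internal_edges (tree T)
     in Rad ` C \<union> Ang ` C)"

text \<open>
  The integral over the moduli space.  The factors \<open>\<real>\<^sup>+ \<times> S\<^sup>1\<close> are oriented by \<open>d\<phi> \<and> d\<tau>\<close>, whence
  one sign for each internal edge; the coefficient does not depend on the angles, so that each
  circle contributes \<open>2\<pi>\<close>.
\<close>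

definition trop_integral :: "('n::{finite,linorder}) trop \<Rightarrow> nat \<Rightarrow> nat \<Rightarrow>
    (nat \<Rightarrow> 'n form) \<Rightarrow> complex" where
  "trop_integral T R n \<gamma> = (let I = internal_edges (tree T) in
     (-1) ^ card I * (2 * of_real pi) ^ (CARD('n) + card I) *
     (LINT (rc, \<tau>)|(lborel \<Otimes>\<^sub>M (\<Pi>\<^sub>M e\<in>I. lborel)).
        of_bool (\<forall>e\<in>I. \<tau> e > 0) *
        gprod (map (\<lambda>\<alpha>. ev_pullback T R \<alpha> (\<gamma> \<alpha>) rc \<tau>) [1..<Suc n]) (moduli_gens T)))"

definition trop_sink :: "('n::finite) trop \<Rightarrow> nat" where
  "trop_sink T = (SOME R. R \<in> verts (tree T) \<and> R \<notin> leaves (tree T))"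

definition gw :: "'n rvec set set \<Rightarrow> nat \<Rightarrow> ('n lvec \<Rightarrow> int) \<Rightarrow>
    (nat \<Rightarrow> ('n::{finite,linorder}) form) \<Rightarrow> complex" where
  "gw \<Delta> n \<beta> \<gamma> =
     (if \<beta> = 0 then (if n = 3 then int_X (fwedge (\<gamma> 1) (fwedge (\<gamma> 2) (\<gamma> 3))) else 0)
      else (\<Sum>C\<in>trop_types (rays \<Delta>) n \<beta> // trop_iso (rays \<Delta>) n \<beta>.
              let T = (SOME T. T \<in> C) in trop_integral T (trop_sink T) n \<gamma>))"

text \<open>
  \<open>\<Sum>\<^sub>\<beta> q\<^sup>\<beta> \<langle>\<gamma>\<^sub>1, \<dots>, \<gamma>\<^sub>n\<rangle>\<^sub>\<beta>\<close> as a function of the exponents of the \<open>q\<^sub>b\<close>.  A class is represented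
  by the exponents of \<open>q\<^sup>\<beta>\<close>, so at most one class contributes to each coefficient.
\<close>

definition gw_generating :: "'n rvec set set \<Rightarrow> nat \<Rightarrow>
    (nat \<Rightarrow> ('n::{finite,linorder}) form) \<Rightarrow> ('n lvec \<Rightarrow> int) \<Rightarrow> complex" where
  "gw_generating \<Delta> n \<gamma> e = (\<Sum>\<beta> | \<beta> \<in> H2 \<Delta> \<and> \<beta> = e. gw \<Delta> n \<beta> \<gamma>)"

section \<open>States and formal power series in the toric moduli\<close>

text \<open>
  The state \<open>\<Sum>\<^sub>m |v m, m\<rangle>\<close>, equivalently \<open>\<Sum>\<^sub>m exp (\<i> \<langle>m, Y\<rangle>) v m\<close> in the dual variables.  The
  states in the span of the symbols \<open>|\<omega>, m\<rangle>\<close> are those with \<open>v m = 0\<close> for almost all \<open>m\<close>.  The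
  propagator does not preserve smoothness at the intersections of the divisors, so arbitrary
  invariant forms on the torus are admitted.
\<close>

type_synonym 'n state = "int^'n \<Rightarrow> 'n form"

definition ket :: "('n::finite) form \<Rightarrow> 'n lvec \<Rightarrow> 'n state" where
  "ket \<omega> m k = (if k = m then \<omega> else 0)"

definition mu2 :: "('n::{finite,linorder}) state \<Rightarrow> 'n state \<Rightarrow> 'n state" where
  "mu2 u v m = (\<Sum>k | u k \<noteq> 0. fwedge (u k) (v (m - k)))"

definition pairing :: "('n::{finite,linorder}) state \<Rightarrow> 'n state \<Rightarrow> complex" where
  "pairing u v = (\<Sum>k | u k \<noteq> 0. int_X (fwedge (u k) (v (- k))))"

text \<open>
  Formal power series in the \<open>q\<^sub>b\<close>: a multiset \<open>M\<close> stands for the monomial \<open>\<Prod>\<^sub>b q\<^sub>b\<^bsup>count M b\<^esup>\<close>.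
\<close>

type_synonym 'n monom = "(int^'n) multiset"

type_synonym 'n qstate = "'n monom \<Rightarrow> 'n state"

definition qmonom :: "('n::finite) monom \<Rightarrow> 'n state \<Rightarrow> 'n qstate" where
  "qmonom A v M = (if M = A then v else 0)"

definition qmu2 :: "('n::{finite,linorder}) qstate \<Rightarrow> 'n qstate \<Rightarrow> 'n qstate" where
  "qmu2 u v M = (\<Sum>A | A \<subseteq># M. mu2 (u A) (v (M - A)))"

definition qpairing :: "('n::{finite,linorder}) qstate \<Rightarrow> 'n qstate \<Rightarrow> 'n monom \<Rightarrow> complex" where
  "qpairing u v M = (\<Sum>A | A \<subseteq># M. pairing (u A) (v (M - A)))"

definition scale :: "complex \<Rightarrow> ('n::finite) qstate \<Rightarrow> 'n qstate" where
  "scale c v M m r S = c * v M m r S"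

definition opQ :: "('n::{finite,linorder}) qstate \<Rightarrow> 'n qstate" where
  "opQ v M m = dform (v M m)"

definition Gplus :: "('n::{finite,linorder}) qstate \<Rightarrow> 'n qstate" where
  "Gplus v M m = contrR m (v M m)"

definition Gminus :: "('n::{finite,linorder}) qstate \<Rightarrow> 'n qstate" where
  "Gminus v M m = contrPhi m (v M m)"

text \<open>The operator \<open>exp (- t H)\<close> of the A-model.\<close>

definition heat :: "real \<Rightarrow> ('n::finite) qstate \<Rightarrow> 'n qstate" where
  "heat t v M m r = v M m (r - t *\<^sub>R rvec m)"

definition propK :: "('n::{finite,linorder}) qstate \<Rightarrow> 'n qstate" where
  "propK v M m r S = (LINT t:{0..}|lborel. heat t (Gplus v) M m r S)"

definition ev_state :: "('n::finite) form \<Rightarrow> 'n qstate" where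
  "ev_state \<gamma> = qmonom {#} (ket \<gamma> 0)"

definition div_state :: "'n lvec \<Rightarrow> ('n::finite) state" where
  "div_state b = ket (\<lambda>r. gone) b"

definition PsiX :: "'n lvec set \<Rightarrow> ('n::finite) qstate" where
  "PsiX B = (\<Sum>b\<in>B. qmonom {#b#} (div_state b))"

definition OX :: "'n lvec set \<Rightarrow> ('n::{finite,linorder}) qstate \<Rightarrow> 'n qstate" where
  "OX B v = qmu2 (PsiX B) v"

text \<open>\<open>\<Psi>\<^sup>X\<^sub>\<gamma>\<close>; in each power of \<open>q\<close> only finitely many terms of the sum are nonzero.\<close>

definition mirror_state :: "'n lvec set \<Rightarrow> ('n::{finite,linorder}) form \<Rightarrow> 'n qstate" where
  "mirror_state B \<gamma> M m r S =
     (\<Sum>d. (((\<lambda>v. scale (2 * of_real pi) (propK (Gminus (OX B v)))) ^^ d) (ev_state \<gamma>)) M m r S)"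

section \<open>Superpotential and the deformed differential\<close>

text \<open>
  Power series in the \<open>q\<^sub>b\<close> whose coefficients are trigonometric polynomials in \<open>Y\<close>, given by their
  Fourier coefficients.
\<close>

type_synonym 'n qfun = "'n monom \<Rightarrow> int^'n \<Rightarrow> complex"

definition fourier :: "(int^'n \<Rightarrow> complex) \<Rightarrow> real^'n \<Rightarrow> complex" where
  "fourier f Y = (\<Sum>m | f m \<noteq> 0. f m * exp (\<i> * of_real (rvec m \<bullet> Y)))"

definition WX :: "'n lvec set \<Rightarrow> ('n::finite) qfun" where
  "WX B M m = (\<Sum>b\<in>B. if M = {#b#} \<and> m = b then 1 else 0)"

definition dY :: "'n \<Rightarrow> ('n::finite) qfun \<Rightarrow> 'n qfun" where
  "dY j f M m = \<i> * of_int (m $ j) * f M m"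

definition fmult :: "('n::finite) qfun \<Rightarrow> 'n qstate \<Rightarrow> 'n qstate" where
  "fmult f v M m r S =
     (\<Sum>A | A \<subseteq># M. \<Sum>k | f A k \<noteq> 0. f A k * v (M - A) (m - k) r S)"

definition dpsiPhi :: "'n \<Rightarrow> ('n::{finite,linorder}) qstate \<Rightarrow> 'n qstate" where
  "dpsiPhi j v M m r = gcontr (Ang j) (v M m r)"

definition QX :: "'n lvec set \<Rightarrow> ('n::{finite,linorder}) qstate \<Rightarrow> 'n qstate" where
  "QX B v = opQ v + scale (2 * of_real pi * \<i>) (\<Sum>j\<in>UNIV. fmult (dY j (WX B)) (dpsiPhi j v))"

lemma fourier_WX:
  assumes "finite B" "b \<in> B"
  shows "fourier (WX B {#b#}) Y = exp (\<i> * of_real (rvec b \<bullet> Y))"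
proof -
  have W: "WX B {#b#} m = (if m = b then 1 else 0)" for m
  proof -
    have "WX B {#b#} m = (\<Sum>c\<in>B. if c = b then (if m = b then 1 else 0) else 0)"
      unfolding WX_def by (intro sum.cong) auto
    then show ?thesis
      using assms by simp
  qed
  then have "{m. WX B {#b#} m \<noteq> 0} = {b}"
    by auto
  then show ?thesis
    by (simp add: fourier_def W)
qed

lemma fourier_dY:
  fixes f :: "('n::finite) qfun"
  assumes "finite {m. f M m \<noteq> 0}"
  shows "((\<lambda>t. fourier (f M) (Y + t *\<^sub>R axis j 1)) has_vector_derivative
           fourier (dY j f M) (Y + t *\<^sub>R axis j 1)) (at t)"
proof -
  let ?S = "{m. f M m \<noteq> 0}"
  have sub: "fourier (dY j f M) Z = (\<Sum>m\<in>?S. dY j f M m * exp (\<i> * of_real (rvec m \<bullet> Z)))" for Z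
    unfolding fourier_def by (rule sum.mono_neutral_left) (use assms in \<open>auto simp: dY_def\<close>)
  have "((\<lambda>t. exp (\<i> * of_real (rvec m \<bullet> (Y + t *\<^sub>R axis j 1)))) has_vector_derivative
      \<i> * of_int (m $ j) * exp (\<i> * of_real (rvec m \<bullet> (Y + t *\<^sub>R axis j 1)))) (at t)" for m
  proof -
    have eq: "rvec m \<bullet> (Y + s *\<^sub>R axis j 1) = rvec m \<bullet> Y + s * of_int (m $ j)" for s
      by (simp add: inner_add_right inner_axis rvec_def)
    have "((\<lambda>z. exp (\<i> * (of_real (rvec m \<bullet> Y) + z * of_int (m $ j)))) has_field_derivative
        \<i> * of_int (m $ j) * exp (\<i> * (of_real (rvec m \<bullet> Y) + of_real t * of_int (m $ j))))
        (at (of_real t))"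
      by (auto intro!: derivative_eq_intros)
    from has_vector_derivative_real_field[OF this] show ?thesis
      by (simp add: eq)
  qed
  then show ?thesis
    unfolding sub unfolding fourier_def
    by (auto intro!: derivative_eq_intros simp: dY_def mult_ac)
qed

lemma finite_submultisets: "finite {A. A \<subseteq># M}"
proof (induction M)
  case (add x M)
  have "{A. A \<subseteq># add_mset x M} \<subseteq> {A. A \<subseteq># M} \<union> add_mset x ` {A. A \<subseteq># M}"
  proof
    fix A assume "A \<in> {A. A \<subseteq># add_mset x M}"
    then have A: "A \<subseteq># add_mset x M"
      by simp
    show "A \<in> {A. A \<subseteq># M} \<union> add_mset x ` {A. A \<subseteq># M}"
    proof (cases "x \<in># A")
      case True
      then obtain A' where "A = add_mset x A'"
        by (auto dest: multi_member_split)
      with A show ?thesis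
        by auto
    next
      case False
      with A have "A \<subseteq># M"
        by (metis add_mset_add_single diff_single_trivial subset_eq_diff_conv)
      then show ?thesis
        by simp
    qed
  qed
  with add show ?case
    by (auto intro: finite_subset)
qed simp

lemma sum_linear_monomials:
  fixes G :: "'a multiset \<Rightarrow> 'a \<Rightarrow> 'c::comm_monoid_add"
  assumes "finite B" "\<And>A k. F A k \<noteq> 0 \<Longrightarrow> k \<in> B \<and> A = {#k#}"
    and "\<And>b. b \<in> B \<Longrightarrow> F {#b#} b = 0 \<Longrightarrow> G {#b#} b = 0"
  shows "(\<Sum>A | A \<subseteq># M. \<Sum>k | F A k \<noteq> 0. G A k) = (\<Sum>b\<in>B. if b \<in># M then G {#b#} b else 0)"
proof -
  have "(\<Sum>k | F A k \<noteq> 0. G A k) = (\<Sum>b\<in>B. if A = {#b#} then G A b else 0)" for A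
    by (rule sum.mono_neutral_cong_left) (use assms in auto)
  then have "(\<Sum>A | A \<subseteq># M. \<Sum>k | F A k \<noteq> 0. G A k) =
      (\<Sum>b\<in>B. \<Sum>A | A \<subseteq># M. if A = {#b#} then G A b else 0)"
    by (simp add: sum.swap[of _ "{A. A \<subseteq># M}"])
  also have "\<dots> = (\<Sum>b\<in>B. if b \<in># M then G {#b#} b else 0)"
    by (intro sum.cong) (auto simp: finite_submultisets intro!: sum.neutral)
  finally show ?thesis .
qed

lemma finite_gen_set:
  fixes S :: "('n::finite) gen set"
  shows "finite S"
proof (rule finite_subset)
  show "S \<subseteq> range Rad \<union> range Ang"
  proof
    fix g show "g \<in> range Rad \<union> range Ang" if "g \<in> S"
      by (cases g) auto
  qed
qed simp

lemma gone_wedge: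
  assumes "finite S"
  shows "(gone \<and>\<^sub>g a) S = a S"
proof -
  have "(gone \<and>\<^sub>g a) S = (\<Sum>T\<in>Pow S. if T = {} then a S else 0)"
    unfolding gwedge_def by (intro sum.cong) (auto simp: gone_def)
  then show ?thesis
    using assms by simp
qed

lemma PsiX_apply:
  fixes B :: "('n::finite) lvec set"
  assumes "finite B"
  shows "PsiX B A k = (if k \<in> B \<and> A = {#k#} then (\<lambda>r. gone) else 0)"
proof -
  have *: "sum f B A k = (\<Sum>b\<in>B. f b A k)" for f :: "'n lvec \<Rightarrow> 'n qstate"
    by (induction B rule: infinite_finite_induct) auto
  have "PsiX B A k = (\<Sum>b\<in>B. if b = k then (if A = {#k#} then (\<lambda>r. gone) else 0) else 0)"
    unfolding PsiX_def * by (intro sum.cong) (auto simp: qmonom_def div_state_def ket_def)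
  then show ?thesis
    using assms by simp
qed

lemma OX_apply:
  fixes v :: "('n::{finite,linorder}) qstate"
  assumes "finite B"
  shows "OX B v M m r S = (\<Sum>b\<in>B. if b \<in># M then v (M - {#b#}) (m - b) r S else 0)"
proof -
  have 0: "(\<lambda>r::'n rvec. gone) \<noteq> (0 :: 'n form)"
    by (auto simp: fun_eq_iff gone_def)
  have eq: "OX B v M m r S = (\<Sum>A | A \<subseteq># M. \<Sum>k | PsiX B A k \<noteq> 0.
      fwedge (PsiX B A k) (v (M - A) (m - k)) r S)"
  proof -
    have 1: "sum f X r S = (\<Sum>x\<in>X. f x r S)" for f :: "'x \<Rightarrow> 'n form" and X
      by (induction X rule: infinite_finite_induct) auto
    have 2: "sum f X m = (\<Sum>x\<in>X. f x m)" for f :: "'x \<Rightarrow> 'n state" and X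
      by (induction X rule: infinite_finite_induct) auto
    show ?thesis
      by (simp add: OX_def qmu2_def mu2_def 1 2)
  qed
  show ?thesis
    unfolding eq
    by (subst sum_linear_monomials[OF assms])
       (auto simp: PsiX_apply[OF assms] 0 fwedge_def gone_wedge finite_gen_set
          split: if_splits intro!: sum.cong)
qed

lemma fmult_dY_WX:
  fixes v :: "('n::{finite,linorder}) qstate"
  assumes "finite B"
  shows "fmult (dY j (WX B)) v M m r S =
    (\<Sum>b\<in>B. if b \<in># M then \<i> * of_int (b $ j) * v (M - {#b#}) (m - b) r S else 0)"
proof -
  have W: "WX B A k = (if k \<in> B \<and> A = {#k#} then 1 else 0)" for A k
  proof -
    have "WX B A k = (\<Sum>c\<in>B. if c = k then (if A = {#k#} then 1 else 0) else 0)"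
      unfolding WX_def by (intro sum.cong) auto
    then show ?thesis
      using assms by simp
  qed
  show ?thesis
    unfolding fmult_def
    by (subst sum_linear_monomials[OF assms])
       (auto simp: dY_def W split: if_splits intro!: sum.cong)
qed

text \<open>The deformed differential is \<open>Q - 2\<pi> [G\<^sub>-, O\<^sub>X]\<close>.\<close>

lemma QX_eq_commutator:
  fixes v :: "('n::{finite,linorder}) qstate"
  assumes "finite B"
  shows "QX B v = opQ v - scale (2 * of_real pi) (Gminus (OX B v) - OX B (Gminus v))"
proof (intro ext)
  fix M m r S
  define c where "c b j = gcontr (Ang j) (v (M - {#b#}) (m - b) r) S" for b and j :: 'n
  have sumq: "sum f X M m r S = (\<Sum>x\<in>X. f x M m r S)" for f :: "'n \<Rightarrow> 'n qstate" and X
    by (induction X rule: infinite_finite_induct) auto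
  have "gcontr (Ang j) (OX B v M m r) S = (\<Sum>b\<in>B. if b \<in># M then c b j else 0)" for j
    unfolding gcontr_def OX_apply[OF assms] c_def
    by (cases "Ang j \<in> S") (auto simp: sum_distrib_left if_distrib[of "\<lambda>x. _ * x"] intro!: sum.cong sum.neutral)
  then have "Gminus (OX B v) M m r S =
      (\<Sum>j\<in>UNIV. \<Sum>b\<in>B. if b \<in># M then of_int (m $ j) * c b j else 0)"
    unfolding Gminus_def contrPhi_def
    by (auto simp: sum_distrib_left intro!: sum.cong)
  moreover have "OX B (Gminus v) M m r S =
      (\<Sum>j\<in>UNIV. \<Sum>b\<in>B. if b \<in># M then of_int ((m - b) $ j) * c b j else 0)"
    unfolding OX_apply[OF assms] Gminus_def contrPhi_def c_def
    by (subst sum.swap) (auto intro!: sum.cong)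
  ultimately have comm: "Gminus (OX B v) M m r S - OX B (Gminus v) M m r S =
      (\<Sum>j\<in>UNIV. \<Sum>b\<in>B. if b \<in># M then of_int (b $ j) * c b j else 0)"
    by (simp only: sum_subtractf[symmetric])
       (intro sum.cong refl, simp add: left_diff_distrib)
  have "\<i> * (\<Sum>j\<in>UNIV. fmult (dY j (WX B)) (dpsiPhi j v)) M m r S =
      - (\<Sum>j\<in>UNIV. \<Sum>b\<in>B. if b \<in># M then of_int (b $ j) * c b j else 0)"
    unfolding sumq fmult_dY_WX[OF assms] dpsiPhi_def c_def sum_distrib_left sum_negf[symmetric]
    by (intro sum.cong refl) (simp add: mult.assoc[symmetric])
  then show "QX B v M m r S =
      (opQ v - scale (2 * of_real pi) (Gminus (OX B v) - OX B (Gminus v))) M m r S"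
    by (simp only: QX_def scale_def plus_fun_apply minus_apply comm mult.assoc) simp
qed

section \<open>Propagators and amplitudes\<close>

text \<open>
  For a differential \<open>D\<close> (here \<open>Q\<close> or \<open>Q\<^sup>X\<close>) put \<open>H\<^sub>D = D G\<^sub>+ + G\<^sub>+ D\<close>.  Then \<open>exp (- t H\<^sub>D)\<close> is
  expanded around \<open>exp (- t H)\<close> into its Dyson series, the solution of
  \<open>(d/dt + H) U\<^sub>d\<^sub>+\<^sub>1 = - (H\<^sub>D - H) U\<^sub>d\<close>, \<open>U\<^sub>d\<^sub>+\<^sub>1(0) = 0\<close>.  For \<open>D = Q\<^sup>X\<close> the term of order \<open>d\<close> is
  homogeneous of degree \<open>d\<close> in the \<open>q\<^sub>b\<close>.
\<close>

definition hamiltonian ::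
  "(('n::{finite,linorder}) qstate \<Rightarrow> 'n qstate) \<Rightarrow> 'n qstate \<Rightarrow> 'n qstate" where
  "hamiltonian D v = D (Gplus v) + Gplus (D v)"

primrec dyson ::
  "(('n::{finite,linorder}) qstate \<Rightarrow> 'n qstate) \<Rightarrow> nat \<Rightarrow> real \<Rightarrow> 'n qstate \<Rightarrow> 'n qstate" where
  "dyson D 0 = heat"
| "dyson D (Suc d) = (\<lambda>t v M m r S. - (LINT s:{0..t}|lborel.
     heat (t - s) (hamiltonian D (dyson D d s v) - hamiltonian opQ (dyson D d s v)) M m r S))"

definition propagator ::
  "(('n::{finite,linorder}) qstate \<Rightarrow> 'n qstate) \<Rightarrow> 'n qstate \<Rightarrow> 'n qstate" where
  "propagator D v M m r S = (\<Sum>d. LINT t:{0..}|lborel. dyson D d t (Gplus v) M m r S)"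

lemma propagator_opQ: "propagator opQ = propK"
proof (intro ext)
  fix v :: "('n::{finite,linorder}) qstate" and M m r S
  have "dyson opQ (Suc d) t w M m r S = 0" for d t and w :: "'n qstate"
    by (simp add: heat_def)
  then have "(LINT t:{0..}|lborel. dyson opQ d t (Gplus v) M m r S) = 0" if "d \<notin> {0}" for d
    using that by (cases d) (auto simp del: dyson.simps)
  then show "propagator opQ v M m r S = propK v M m r S"
    unfolding propagator_def propK_def by (subst suminf_finite[of "{0}"]) auto
qed

text \<open>
  \<open>branch D G \<Psi> k p v\<close> is the state carried by the edge from \<open>v\<close> to its successor \<open>p\<close> on the way
  to the sink.  The number \<open>k\<close> bounds the depth of the recursion; the number of vertices of the
  tree suffices.
\<close>

primrec branch :: "(('n::{finite,linorder}) qstate \<Rightarrow> 'n qstate) \<Rightarrow> graph \<Rightarrow>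
    (nat \<Rightarrow> 'n qstate) \<Rightarrow> nat \<Rightarrow> nat \<Rightarrow> nat \<Rightarrow> 'n qstate" where
  "branch D G \<Psi> 0 p v = 0"
| "branch D G \<Psi> (Suc k) p v =
     (if v \<in> leaves G then \<Psi> v
      else scale (2 * of_real pi) (propagator D (Gminus
        (case sorted_list_of_set (nbrs G v - {p}) of
           [a, b] \<Rightarrow> qmu2 (branch D G \<Psi> k v a) (branch D G \<Psi> k v b)
         | _ \<Rightarrow> 0))))"

definition amplitude :: "(('n::{finite,linorder}) qstate \<Rightarrow> 'n qstate) \<Rightarrow> graph \<Rightarrow> nat \<Rightarrow>
    (nat \<Rightarrow> 'n qstate) \<Rightarrow> 'n monom \<Rightarrow> complex" where
  "amplitude D G R \<Psi> =
     (let br = branch D G \<Psi> (card (verts G)) R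
      in case sorted_list_of_set (nbrs G R) of
           [a, b, c] \<Rightarrow> qpairing (br a) (qmu2 (br b) (br c))
         | _ \<Rightarrow> 0)"

text \<open>
  A tree with \<open>n\<close> leaves and trivalent vertices otherwise has \<open>2 n - 2\<close> vertices; up to
  isomorphism its leaves are the vertices \<open>1, \<dots>, n\<close>.  The isomorphisms below ignore this
  enumeration of the leaves.
\<close>

definition trivalent_trees :: "nat \<Rightarrow> graph set" where
  "trivalent_trees n = {G. is_tree G \<and> verts G = {1..2 * n - 2} \<and> leaves G = {1..n} \<and>
     (\<forall>v\<in>verts G - leaves G. valence G v = 3)}"

definition tree_iso :: "nat \<Rightarrow> (graph \<times> graph) set" where
  "tree_iso n = {(G, H) \<in> trivalent_trees n \<times> trivalent_trees n. \<exists>f. graph_iso f G H}"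

definition automorphisms :: "graph \<Rightarrow> (nat \<Rightarrow> nat) set" where
  "automorphisms G = {f. f permutes verts G \<and> graph_iso f G G}"

definition tree_sink :: "graph \<Rightarrow> nat" where
  "tree_sink G = (SOME R. R \<in> verts G \<and> valence G R = 3)"

definition total_amplitude :: "(('n::{finite,linorder}) qstate \<Rightarrow> 'n qstate) \<Rightarrow> nat \<Rightarrow>
    (nat \<Rightarrow> 'n qstate) \<Rightarrow> 'n monom \<Rightarrow> complex" where
  "total_amplitude D n \<Psi> M =
     (\<Sum>C\<in>trivalent_trees n // tree_iso n. let G = (SOME G. G \<in> C) in
        \<Sum>\<sigma> | \<sigma> permutes {1..n}.
          amplitude D G (tree_sink G) (\<lambda>i. \<Psi> (\<sigma> i)) M / of_nat (card (automorphisms G)))"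

text \<open>A power series in the \<open>q\<^sub>b\<close> as a function of arbitrary integral exponents.\<close>

definition qcoeff :: "(('n::finite) monom \<Rightarrow> complex) \<Rightarrow> ('n lvec \<Rightarrow> int) \<Rightarrow> complex" where
  "qcoeff F e = (\<Sum>M | (\<lambda>b. int (count M b)) = e. F M)"

end

theory Submission
	imports Defs
begin

text \<open>
  A form that extends to the toric variety decays exponentially along covectors whose common kernel
  annihilates it, so all integrals over edge lengths converge and Fubini applies.  Integrating the
  pulled back forms over the length and the angle of an internal edge produces the propagator
  \<open>2\<pi> K G\<^sub>-\<close>; since the propagator is self-adjoint up to the sign of the edge vector, trees may be
  rerooted at the mark \<open>1\<close>, and a type contributes the trace of a product over its rooted shape.
  The states propagated by \<open>K\<^sup>X G\<^sub>-\<close> are annihilated by \<open>G\<^sub>+\<close> and \<open>G\<^sub>-\<close>, so its Dyson series is the geometric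
  series in \<open>2\<pi> K G\<^sub>- O\<^sub>X\<close>; hence mirror states and deformed propagators are the unique solutions of
  \<open>y = u + K (W y)\<close>.  Branches without marks contribute only when they are single external edges, and
  then they contribute \<open>W\<close>.  Induction on the set of marks, with this fixed point equation,
  matches the sum over tropical shapes with the sum over leaf-labelled trivalent trees.
\<close>

section \<open>Exterior algebra\<close>

text \<open>A propagated form need not extend smoothly to \<open>X\<close>, so the analysis takes
  place in a larger class of forms that is closed under products and under flows. In top degree each
  summand of such a form vanishes or is integrable. Even forms commute, so the value of a tree is a
  product over unordered branches in a commutative ring. The vector of an edge is the sum of the
  divisor vectors beyond it and can be read off from the monomial in the \<open>q\<close>, which
  reduces states to power series over this ring.

  Marks are 2-valent vertices in tropical types but leaves in B-model trees. The bridge is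
  \<open>Fb A = Es A + Ph A\<close>: a B-model branch with marks \<open>A\<close> is the tropical
  branch plus, for a single mark, the bare state without propagator. A product of two bare states
  does not involve \<open>q\<close> and is killed by the propagator, so it survives only at the root
  and only for \<open>n = 3\<close>, as the invariant of degree zero. Encoding trees with multisets
  of children makes isomorphism classes into elements, and automorphism factors cancel against
  labellings.\<close>

definition isg :: "'g::linorder set => 'g set => complex" where
	"isg T U = (-1) ^ card {(t, u). t \<in> T & u \<in> U & u < t}"

lemma gwedge_isg: "(a \<and>\<^sub>g b) S = (\<Sum>T\<in>Pow S. isg T (S - T) * a T * b (S - T))" by (simp add: gwedge_def isg_def)

lemma finite_pairs_less: "finite T ==> finite U ==> finite {(t, u). t \<in> T & u \<in> U & (u::'a::linorder) < t}"
	by (rule finite_subset[of _ "T \<times> U"]) auto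

lemma isg_union_left:
	assumes "finite A" "finite B" "finite C" "A \<inter> B = {}"
	shows "isg (A \<union> B) C = isg A C * isg B C"
proof -
	have "{(t, u). t \<in> A \<union> B & u \<in> C & u < t} =
			{(t, u). t \<in> A & u \<in> C & u < t} \<union> {(t, u). t \<in> B & u \<in> C & u < t}" by auto
	thus ?thesis unfolding isg_def power_add[symmetric] by (simp only:) (subst card_Un_disjoint, use assms finite_pairs_less in auto)
qed

lemma isg_union_right:
	assumes "finite A" "finite B" "finite C" "B \<inter> C = {}"
	shows "isg A (B \<union> C) = isg A B * isg A C"
proof -
	have "{(t, u). t \<in> A & u \<in> B \<union> C & u < t} =
			{(t, u). t \<in> A & u \<in> B & u < t} \<union> {(t, u). t \<in> A & u \<in> C & u < t}" by auto
	thus ?thesis unfolding isg_def power_add[symmetric] by (simp only:) (subst card_Un_disjoint, use assms finite_pairs_less in auto)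
qed

lemma isg_empty [simp]: "isg {} U = 1" "isg T {} = 1" by (simp_all add: isg_def)

lemma isg_singleton_left: "isg {g} U = (-1) ^ card {u \<in> U. u < g}"
proof -
	have "{(t, u). t \<in> {g} & u \<in> U & u < t} = Pair g ` {u \<in> U. u < g}" by auto
	thus ?thesis unfolding isg_def by (simp add: card_image inj_on_def)
qed

lemma isg_singleton_right: "isg T {g} = (-1) ^ card {t \<in> T. g < t}"
proof -
	have "{(t, u). t \<in> T & u \<in> {g} & u < t} = (%t. (t, g)) ` {t \<in> T. g < t}" by auto
	thus ?thesis unfolding isg_def by (simp add: card_image inj_on_def)
qed

lemma isg_square: "isg A B * isg A B = 1" by (simp add: isg_def power_add[symmetric] flip: mult_2)

text \<open>Each pair in \<open>T \<times> U\<close> is an inversion in exactly one of the two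
  orders, so the two inversion counts add up to \<open>card T * card U\<close>.\<close>

lemma isg_swap:
	assumes "finite T" "finite U" "T \<inter> U = {}"
	shows "isg T U = (-1) ^ (card T * card U) * isg U T"
proof -
	let ?P = "{(t, u). t \<in> T & u \<in> U & u < t}" and ?Q = "{(t, u). t \<in> U & u \<in> T & u < t}"
	have eq: "T \<times> U = ?P \<union> prod.swap ` ?Q" using assms(3) by (auto simp: image_iff)
	have "card (T \<times> U) = card ?P + card (prod.swap ` ?Q)"
		unfolding eq by (rule card_Un_disjoint) (use assms in "auto intro: finite_pairs_less")
	also have "card (prod.swap ` ?Q) = card ?Q" by (rule card_image) (auto simp: inj_on_def)
	finally have "isg T U * isg U T = (-1) ^ (card T * card U)" using assms by (simp add: isg_def power_add[symmetric])
	hence "isg T U * (isg U T * isg U T) = (-1) ^ (card T * card U) * isg U T" by (simp add: mult.assoc[symmetric])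
	thus ?thesis by (simp add: isg_square)
qed

lemma gwedge_infinite: "infinite S ==> (a \<and>\<^sub>g b) S = 0" by (simp add: gwedge_def finite_Pow_iff)

text \<open>Both sides become sums over ordered partitions of \<open>S\<close> into three sets. The
  signs agree because \<open>isg\<close> is multiplicative over disjoint unions in either
  argument.\<close>

lemma gwedge_assoc: "(a \<and>\<^sub>g b) \<and>\<^sub>g c = a \<and>\<^sub>g (b \<and>\<^sub>g c)"
proof
	fix S
	show "((a \<and>\<^sub>g b) \<and>\<^sub>g c) S = (a \<and>\<^sub>g (b \<and>\<^sub>g c)) S"
	proof (cases "finite S")
		case False
		thus ?thesis by (simp add: gwedge_infinite)
	next case fin: True
		note sub = finite_subset[OF _ fin]
		have "((a \<and>\<^sub>g b) \<and>\<^sub>g c) S = (\<Sum>T\<in>Pow S. \<Sum>A\<in>Pow T.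
				isg T (S - T) * (isg A (T - A) * a A * b (T - A)) * c (S - T))" by (simp add: gwedge_isg sum_distrib_left sum_distrib_right)
		also have "... = (\<Sum>(T, A)\<in>(SIGMA T:Pow S. Pow T).
				isg T (S - T) * (isg A (T - A) * a A * b (T - A)) * c (S - T))" by (subst sum.Sigma) (auto simp: fin intro: sub)
		also have "... = (\<Sum>(A, B)\<in>(SIGMA A:Pow S. Pow (S - A)).
				isg A (S - A) * a A * (isg B (S - A - B) * b B * c (S - A - B)))"
		proof (rule sum.reindex_bij_witness[where j = "%(T, A). (A, T - A)" and i = "%(A, B). (A \<union> B, A)"],
				goal_cases)
			case (5 p)
			obtain T A where p: "p = (T, A)" "T \<subseteq> S" "A \<subseteq> T" using 5 by auto
			let ?B = "T - A" and ?C = "S - T"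
			have T: "T = A \<union> ?B" and SA: "S - A = ?B \<union> ?C" and C: "S - A - (T - A) = ?C" using p by auto
			have f: "finite A" "finite ?B" "finite ?C" using p by (auto intro: sub)
			have "isg T ?C = isg A ?C * isg ?B ?C" by (subst T, rule isg_union_left) (use f in auto)
			moreover have "isg A (S - A) = isg A ?B * isg A ?C" by (subst SA, rule isg_union_right) (use f in auto)
			ultimately show ?case unfolding p(1) by (simp add: C)
		qed auto
		also have "... = (\<Sum>A\<in>Pow S. \<Sum>B\<in>Pow (S - A).
				isg A (S - A) * a A * (isg B (S - A - B) * b B * c (S - A - B)))" by (subst sum.Sigma) (auto simp: fin intro: sub)
		also have "... = (a \<and>\<^sub>g (b \<and>\<^sub>g c)) S" by (simp add: gwedge_isg sum_distrib_left)
		finally show ?thesis .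
	qed
qed

lemma gwedge_swap:
	assumes "!!S. a S ~= 0 ==> finite S ==> even (card S)"
	shows "a \<and>\<^sub>g b = b \<and>\<^sub>g a"
proof
	fix S
	show "(a \<and>\<^sub>g b) S = (b \<and>\<^sub>g a) S"
	proof (cases "finite S")
		case True
		show ?thesis unfolding gwedge_isg
		proof (rule sum.reindex_bij_witness[where i = "%T. S - T" and j = "%T. S - T"], goal_cases)
			case (5 T)
			hence fin: "finite T" "finite (S - T)" and eq: "S - (S - T) = T" using True by (auto intro: finite_subset)
			show ?case
			proof (cases "a T = 0")
				case False
				thus ?thesis unfolding eq using isg_swap[OF fin] assms[OF _ fin(1)] by auto
			qed (simp add: eq)
		qed auto
	qed (simp add: gwedge_infinite)
qed

lemma gwedge_swap_odd:
	assumes "!!S. a S ~= 0 ==> finite S ==> odd (card S)" "!!S. b S ~= 0 ==> finite S ==> odd (card S)"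
	shows "(a \<and>\<^sub>g b) S = - (b \<and>\<^sub>g a) S"
proof (cases "finite S")
	case True
	show ?thesis unfolding gwedge_isg sum_negf[symmetric]
	proof (rule sum.reindex_bij_witness[where i = "%T. S - T" and j = "%T. S - T"], goal_cases)
		case (5 T)
		hence fin: "finite T" "finite (S - T)" and eq: "S - (S - T) = T" using True by (auto intro: finite_subset)
		show ?case
		proof (cases "a T = 0 | b (S - T) = 0")
			case False
			thus ?thesis unfolding eq using isg_swap[OF fin] assms(1)[OF _ fin(1)] assms(2)[OF _ fin(2)] by auto
		qed (auto simp: eq)
	qed auto
qed (simp add: gwedge_infinite)

lemma gwedge_add_left: "(a + b) \<and>\<^sub>g c = a \<and>\<^sub>g c + b \<and>\<^sub>g c"
	by (rule ext) (simp add: gwedge_def algebra_simps sum.distrib)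

lemma gwedge_add_right: "a \<and>\<^sub>g (b + c) = a \<and>\<^sub>g b + a \<and>\<^sub>g c"
	by (rule ext) (simp add: gwedge_def algebra_simps sum.distrib)

lemma gwedge_zero [simp]: "0 \<and>\<^sub>g c = 0" "c \<and>\<^sub>g 0 = 0" by (rule ext, simp add: gwedge_def)+

lemma gwedge_cmult_left: "(%S. k * a S) \<and>\<^sub>g b = (%S. k * (a \<and>\<^sub>g b) S)"
	by (rule ext) (simp add: gwedge_def sum_distrib_left mult_ac)

lemma gwedge_cmult_right: "a \<and>\<^sub>g (%S. k * b S) = (%S. k * (a \<and>\<^sub>g b) S)"
	by (rule ext) (simp add: gwedge_def sum_distrib_left mult_ac)

lemma gwedge_sum_left: "(%S. \<Sum>i\<in>I. f i S) \<and>\<^sub>g b = (%S. \<Sum>i\<in>I. (f i \<and>\<^sub>g b) S)"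
	by (rule ext) (simp add: gwedge_def sum_distrib_left sum_distrib_right, subst sum.swap, rule refl)

lemma gwedge_sum_right: "a \<and>\<^sub>g (%S. \<Sum>i\<in>I. f i S) = (%S. \<Sum>i\<in>I. (a \<and>\<^sub>g f i) S)"
	by (rule ext) (simp add: gwedge_def sum_distrib_left sum_distrib_right, subst sum.swap, rule refl)

lemma gone_gwedge:
	assumes "!!S. infinite S ==> a S = 0"
	shows "gone \<and>\<^sub>g a = a"
proof
	fix S show "(gone \<and>\<^sub>g a) S = a S" by (cases "finite S") (use assms in "auto simp: gone_wedge gwedge_infinite")
qed

subsection \<open>Contraction as a graded derivation\<close>

definition ginvol :: "'g ext => 'g ext" where
	"ginvol a S = (-1) ^ card S * a S"

lemma card_less_greater:
	assumes "finite T" "(g::'a::linorder) ~: T"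
	shows "card {t \<in> T. t < g} + card {t \<in> T. g < t} = card T"
proof -
	have "T = {t \<in> T. t < g} \<union> {t \<in> T. g < t}" using assms by (auto simp: not_less order_le_less)
	thus ?thesis using card_Un_disjoint[of "{t \<in> T. t < g}" "{t \<in> T. g < t}"] assms(1) by fastforce
qed

text \<open>If \<open>g \<in> S\<close>, the left side is zero and the two products cancel summand
  by summand. Otherwise the subsets of \<open>insert g S\<close> are split according to whether they
  contain \<open>g\<close>, and the two halves are the two products. \<open>ginvol\<close> carries
  the sign of moving the contraction past the first factor.\<close>

lemma gcontr_wedge:
	assumes fin: "finite S"
	shows "gcontr g (a \<and>\<^sub>g b) S = (gcontr g a \<and>\<^sub>g b) S + (ginvol a \<and>\<^sub>g gcontr g b) S"
proof -
	let ?X = "%S g. \<Sum>T\<in>Pow S. isg (insert g T) (insert g S - insert g T) * a (insert g T) * b (insert g S - insert g T)"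
	define k :: "'a set => complex" where "k U = (-1) ^ card {u \<in> U. u < g}" for U
	have sub: "finite T" if "T \<subseteq> S" for T using fin that finite_subset by blast
	have kk: "k U * k U = 1" for U by (simp add: k_def power_add[symmetric] flip: mult_2)
	have ginsl: "isg (insert g T) U = k U * isg T U" if "finite T" "finite U" "g ~: T" for T U
		using isg_union_left[of "{g}" T U] that by (simp add: isg_singleton_left k_def)
	have ginsr: "isg T (insert g U) = (-1) ^ card T * k T * isg T U"
		if "finite T" "finite U" "g ~: U" "g ~: T" for T U
	proof -
		have "isg T {g} = (-1) ^ card {t \<in> T. g < t}" by (rule isg_singleton_right)
		also have "... = (-1) ^ card T * k T" unfolding k_def card_less_greater[OF that(1,4), symmetric] power_add
			by (simp add: mult_ac left_minus_one_mult_self)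
		finally show ?thesis using isg_union_right[of T "{g}" U] that by simp
	qed
	have split: "(\<Sum>T\<in>Pow (insert g S'). f T) = (\<Sum>T\<in>Pow S'. f T) + (\<Sum>T\<in>Pow S'. f (insert g T))"
		if "finite S'" "g ~: S'" for S' and f :: "'a set => complex"
	proof -
		have "inj_on (insert g) (Pow S')" using that(2) by (auto simp: inj_on_def)
		thus ?thesis unfolding Pow_insert using that by (subst sum.union_disjoint) (auto simp: sum.reindex)
	qed
	show ?thesis
	proof (cases "g \<in> S")
		case True
		define S' where "S' = S - {g}"
		have S: "S = insert g S'" "g ~: S'" "finite S'" using True fin by (auto simp: S'_def)
		have "(gcontr g a \<and>\<^sub>g b) S = (\<Sum>T\<in>Pow S'. isg T (S - T) * gcontr g a T * b (S - T))"
			unfolding gwedge_isg S(1) by (subst split[OF S(3,2)]) (simp add: gcontr_def)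
		moreover have "(ginvol a \<and>\<^sub>g gcontr g b) S =
				(\<Sum>T\<in>Pow S'. isg (insert g T) (S - insert g T) * ginvol a (insert g T) * gcontr g b (S - insert g T))"
			unfolding gwedge_isg S(1) using S(2) by (subst split[OF S(3,2)]) (auto simp: gcontr_def intro!: sum.neutral)
		moreover have "isg T (S - T) * gcontr g a T * b (S - T) +
				isg (insert g T) (S - insert g T) * ginvol a (insert g T) * gcontr g b (S - insert g T) = 0"
			if "T \<in> Pow S'" for T
		proof -
			have T: "g ~: T" "T \<subseteq> S'" "finite T" using that S by (auto intro: finite_subset)
			define U where "U = S' - T"
			have U: "S - T = insert g U" "S - insert g T = U" "g ~: U" "finite U" using S T by (auto simp: U_def)
			have "isg T (insert g U) * gcontr g a T * b (insert g U) = (-1) ^ card T * isg T U * a (insert g T) * b (insert g U) * (k T * k T)"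
				by (simp only: ginsr[OF T(3) U(4,3) T(1)]) (simp add: gcontr_def T(1) k_def)
			moreover have "isg (insert g T) U * ginvol a (insert g T) * gcontr g b U = - ((-1) ^ card T * isg T U * a (insert g T) * b (insert g U) * (k U * k U))"
				using T U by (simp only: ginsl[OF T(3) U(4) T(1)]) (simp add: gcontr_def ginvol_def k_def)
			ultimately show ?thesis unfolding U(1,2) by (simp add: kk)
		qed
		ultimately have "(gcontr g a \<and>\<^sub>g b) S + (ginvol a \<and>\<^sub>g gcontr g b) S = 0" by (simp add: sum.distrib[symmetric])
		thus ?thesis using True by (simp add: gcontr_def)
	next case False
		have "gcontr g (a \<and>\<^sub>g b) S = k S * (\<Sum>T\<in>Pow S. isg T (insert g S - T) * a T * b (insert g S - T))
			+ k S * (?X S g)" unfolding gcontr_def gwedge_isg using False by (simp add: split[OF fin False] k_def distrib_left)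
		also have "k S * (?X S g)
				= (gcontr g a \<and>\<^sub>g b) S" unfolding gwedge_isg sum_distrib_left
		proof (rule sum.cong[OF refl], goal_cases)
			case (1 T)
			hence T: "g ~: T" "T \<subseteq> S" "finite T" "finite (S - T)" using False fin by (auto intro: finite_subset)
			have eq: "insert g S - insert g T = S - T" using False by auto
			have "k S = k T * k (S - T)" using isg_union_right[of "{g}" T "S - T"] T by (simp add: isg_singleton_left k_def Un_absorb1)
			hence "k S * (k (S - T) * isg T (S - T)) = k T * isg T (S - T) * (k (S - T) * k (S - T))" by (simp add: mult_ac)
			thus ?case unfolding eq ginsl[OF T(3,4,1)] by (simp add: kk gcontr_def T(1) k_def mult_ac)
		qed
		also have "k S * (\<Sum>T\<in>Pow S. isg T (insert g S - T) * a T * b (insert g S - T)) = (ginvol a \<and>\<^sub>g gcontr g b) S"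
			unfolding gwedge_isg sum_distrib_left
		proof (rule sum.cong[OF refl], goal_cases)
			case (1 T)
			hence T: "g ~: T" "T \<subseteq> S" "finite T" "finite (S - T)" using False fin by (auto intro: finite_subset)
			have eq: "insert g S - T = insert g (S - T)" using T by auto
			have "k S = k T * k (S - T)" using isg_union_right[of "{g}" T "S - T"] T by (simp add: isg_singleton_left k_def Un_absorb1)
			hence "k S * ((-1) ^ card T * k T * isg T (S - T)) = (-1) ^ card T * k (S - T) * isg T (S - T) * (k T * k T)" by (simp add: mult_ac)
			moreover have "g ~: S - T" using False by simp
			ultimately show ?case unfolding eq ginsr[OF T(3,4) `g ~: S - T` T(1)]
				by (auto simp: kk gcontr_def k_def[symmetric] ginvol_def mult_ac False simp del: Diff_iff)
		qed
		finally show ?thesis by simp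
	qed
qed

lemma gcontr_anticomm: 
	assumes "finite S"
	shows "gcontr g (gcontr h a) S = - gcontr h (gcontr g a) S"
proof (cases "g = h | g \<in> S | h \<in> S")
	case True
	thus ?thesis by (auto simp: gcontr_def)
next case False
	have ins: "{x \<in> insert g S. x < h} = (if g < h then insert g {x \<in> S. x < h} else {x \<in> S. x < h})" for g h by auto
	have c: "card {x \<in> insert g S. x < h} = (if g < h then Suc (card {x \<in> S. x < h}) else card {x \<in> S. x < h})"
		if "g ~: S" for g h unfolding ins using that assms by simp
	have "g ~= h" "g ~: S" "h ~: S" using False by auto
	hence "g < h & ~ h < g | h < g & ~ g < h" by (auto simp: neq_iff)
	thus ?thesis
	proof
		assume "g < h & ~ h < g"
		thus ?thesis using False c[of g h] c[of h g] by (auto simp: gcontr_def insert_commute)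
	next
		assume "h < g & ~ g < h"
		thus ?thesis using False c[of g h] c[of h g] by (auto simp: gcontr_def insert_commute)
	qed
qed

section \<open>Substitution homomorphisms\<close>

definition gmon :: "('g::linorder => 'h::linorder ext) => 'g set => 'h ext" where
	"gmon \<theta> T = gprod (map \<theta> (sorted_list_of_set T))"

definition deg1 :: "('g => 'h ext) => bool" where
	"deg1 \<theta> \<longleftrightarrow> (\<forall>g S. \<theta> g S ~= 0 --> card S = 1)"

lemma gsubst_gmon: "gsubst J \<theta> a = (%S. \<Sum>T\<in>Pow J. a T * gmon \<theta> T S)"
	by (rule ext) (simp add: gsubst_def gmon_def)

lemma gmon_empty [simp]: "gmon \<theta> {} = gone" by (simp add: gmon_def gprod_def)

lemma gmon_insert_min:
	assumes "finite T" "!!t. t \<in> T ==> g < t"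
	shows "gmon \<theta> (insert g T) = \<theta> g \<and>\<^sub>g gmon \<theta> T"
proof -
	have "g ~: T" using assms(2) by blast
	hence "sorted_list_of_set (insert g T) = g # sorted_list_of_set T"
		using assms by (subst sorted_list_of_set_insert) (auto simp: insort_is_Cons less_imp_le)
	thus ?thesis by (simp add: gmon_def gprod_def)
qed

text \<open>Adding a new least element matches the recursion of \<open>gmon\<close>, whose factors
  are in increasing order.\<close>

lemma finite_Min_induct [consumes 1, case_names empty insert]:
	assumes "finite T" "P {}"
		and "!!g T. finite T ==> (!!t. t \<in> T ==> (g::'a::linorder) < t) ==> P T ==> P (insert g T)"
	shows "P T" using assms(1)
proof (induction "card T" arbitrary: T)
	case (Suc n)
	define g where "g = Min T"
	have T: "T ~= {}" "g \<in> T" using Suc by (auto simp: g_def intro: Min_in)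
	have "P (insert g (T - {g}))"
	proof (rule assms(3))
		show "g < t" if "t \<in> T - {g}" for t using that Suc by (auto simp: g_def le_less[symmetric] intro!: le_neq_trans Min_le)
		show "P (T - {g})" using Suc T by auto
	qed (use Suc in auto)
	thus ?case using T by (simp add: insert_absorb)
qed (use assms in simp)

lemma gmon_infinite: "infinite S ==> gmon \<theta> T S = 0" unfolding gmon_def gprod_def
	by (cases "map \<theta> (sorted_list_of_set T)") (auto simp: gone_def gwedge_infinite)

lemma deg1_anticomm:
	assumes "deg1 \<theta>" "deg1 \<eta>"
	shows "\<theta> g \<and>\<^sub>g \<eta> h = - (\<eta> h \<and>\<^sub>g \<theta> g)"
	by (rule ext, unfold uminus_apply fun_Compl_def, rule gwedge_swap_odd) (use assms in "auto simp: deg1_def")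

lemma deg1_square:
	assumes "deg1 \<theta>"
	shows "\<theta> g \<and>\<^sub>g \<theta> g = 0" using deg1_anticomm[OF assms assms, of g g] by (auto simp: fun_eq_iff)

lemma gwedge_uminus_left: "(- a) \<and>\<^sub>g b = - (a \<and>\<^sub>g b)" by (rule ext) (simp add: gwedge_def sum_negf)

text \<open>The new factor moves to its place past the smaller ones, at the price of one sign each.
  \<open>deg1\<close> gives the anticommutation, hence also the vanishing of a repeated
  factor.\<close>

lemma gmon_mult_gen:
	assumes \<theta>: "deg1 \<theta>" and "finite U"
	shows "\<theta> g \<and>\<^sub>g gmon \<theta> U = (%S. (if g \<in> U then 0 else isg {g} U) * gmon \<theta> (insert g U) S)"
	using assms(2)
proof (induction U rule: finite_Min_induct)
	case empty
	thus ?case using gmon_insert_min[of "{}" g \<theta>] by simp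
next case (insert h U)
	have hU: "h ~: U" using insert.hyps(2) by blast
	consider "g < h" | "g = h" | "h < g" by fastforce
	thus ?case
	proof cases
		case 1
		hence e: "{u \<in> insert h U. u < g} = {}" and min: "!!t. t \<in> insert h U ==> g < t"
			using insert.hyps(2) by (auto dest: less_trans)
		have "isg {g} (insert h U) = 1" unfolding isg_singleton_left e by simp
		moreover have "g ~: insert h U" using min by blast
		ultimately show ?thesis using insert.hyps(1) min by (subst gmon_insert_min[symmetric]) auto
	next case 2
		thus ?thesis using insert.hyps by (simp add: gmon_insert_min gwedge_assoc[symmetric] deg1_square[OF \<theta>] fun_eq_iff)
	next case 3
		have "\<theta> g \<and>\<^sub>g gmon \<theta> (insert h U) = - (\<theta> h \<and>\<^sub>g (\<theta> g \<and>\<^sub>g gmon \<theta> U))"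
			using insert.hyps
			by (simp add: gmon_insert_min gwedge_assoc[symmetric] deg1_anticomm[OF \<theta> \<theta>, of g h] gwedge_uminus_left)
		also have "... = (%S. - (if g \<in> U then 0 else isg {g} U) * (\<theta> h \<and>\<^sub>g gmon \<theta> (insert g U)) S)"
			unfolding insert.IH gwedge_cmult_right by (simp add: fun_eq_iff)
		also have "\<theta> h \<and>\<^sub>g gmon \<theta> (insert g U) = gmon \<theta> (insert g (insert h U))"
			by (subst insert_commute, rule gmon_insert_min[symmetric]) (use insert.hyps 3 in auto)
		also have "- (if g \<in> U then 0 else isg {g} U) = (if g \<in> insert h U then 0 else isg {g} (insert h U))"
		proof -
			have e: "{u \<in> {h}. u < g} = {h}" using 3 by auto
			have "isg {g} {h} = -1" unfolding isg_singleton_left e by simp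
			thus ?thesis using isg_union_right[of "{g}" "{h}" U] insert.hyps hU 3 by auto
		qed
		finally show ?thesis .
	qed
qed

lemma gmon_mult:
	assumes \<theta>: "deg1 \<theta>" and "finite T" "finite U"
	shows "gmon \<theta> T \<and>\<^sub>g gmon \<theta> U = (%S. (if T \<inter> U = {} then isg T U else 0) * gmon \<theta> (T \<union> U) S)"
	using assms(2)
proof (induction T rule: finite_Min_induct)
	case empty
	thus ?case by (subst gmon_empty, subst gone_gwedge) (auto simp: gmon_infinite)
next case (insert g T)
	have gT: "g ~: T" using insert.hyps(2) by blast
	have fin: "finite (T \<union> U)" using insert.hyps assms(3) by simp
	have "gmon \<theta> (insert g T) \<and>\<^sub>g gmon \<theta> U = \<theta> g \<and>\<^sub>g (gmon \<theta> T \<and>\<^sub>g gmon \<theta> U)"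
		using insert.hyps by (simp add: gmon_insert_min gwedge_assoc)
	also have "... = (%S. (if T \<inter> U = {} then isg T U else 0) * (if g \<in> T \<union> U then 0 else isg {g} (T \<union> U)) *
			gmon \<theta> (insert g (T \<union> U)) S)"
		unfolding insert.IH gwedge_cmult_right gmon_mult_gen[OF \<theta> fin] by (simp add: mult.assoc)
	also have "(if T \<inter> U = {} then isg T U else 0) * (if g \<in> T \<union> U then 0 else isg {g} (T \<union> U)) =
			(if insert g T \<inter> U = {} then isg (insert g T) U else 0)"
	proof (cases "insert g T \<inter> U = {}")
		case True
		have "isg {g} (T \<union> U) = isg {g} T * isg {g} U" by (rule isg_union_right) (use True insert.hyps assms in auto)
		moreover have e: "{u \<in> T. u < g} = {}" using insert.hyps by (auto dest: less_not_sym)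
		have "isg {g} T = 1" unfolding isg_singleton_left e by simp
		moreover have "isg (insert g T) U = isg {g} U * isg T U" using isg_union_left[of "{g}" T U] gT insert.hyps assms by simp
		ultimately show ?thesis using True gT by auto
	qed auto
	finally show ?case by simp
qed

text \<open>By \<open>gmon_mult\<close> the images of monomials multiply with the same signs as the
  monomials. Overlapping pairs vanish, and disjoint pairs are the splittings of their union.\<close>

lemma gsubst_wedge:
	assumes \<theta>: "deg1 \<theta>" and J: "finite J"
	shows "gsubst J \<theta> (a \<and>\<^sub>g b) = gsubst J \<theta> a \<and>\<^sub>g gsubst J \<theta> b"
proof
	let ?X = "%B A S. b B * (gmon \<theta> A \<and>\<^sub>g gmon \<theta> B) S"
	fix S
	have fin: "finite T" if "T \<subseteq> J" for T using J that finite_subset by blast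
	have "gsubst J \<theta> (a \<and>\<^sub>g b) S = (\<Sum>T\<in>Pow J. \<Sum>A\<in>Pow T. isg A (T - A) * a A * b (T - A) * gmon \<theta> T S)"
		by (simp add: gsubst_gmon gwedge_isg sum_distrib_right)
	also have "... = (\<Sum>(T, A)\<in>(SIGMA T:Pow J. Pow T). isg A (T - A) * a A * b (T - A) * gmon \<theta> T S)"
		by (subst sum.Sigma) (auto simp: J intro: fin)
	also have "... = (\<Sum>(A, B)\<in>(SIGMA A:Pow J. Pow (J - A)). isg A B * a A * b B * gmon \<theta> (A \<union> B) S)"
	proof (rule sum.reindex_bij_witness[where j = "%(T, A). (A, T - A)" and i = "%(A, B). (A \<union> B, A)"], goal_cases)
		case (5 p)
		thus ?case by (auto simp: Un_absorb1)
	qed auto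
	also have "... = (\<Sum>A\<in>Pow J. \<Sum>B\<in>Pow (J - A). isg A B * a A * b B * gmon \<theta> (A \<union> B) S)"
		by (subst sum.Sigma) (auto simp: J)
	also have "... = (\<Sum>A\<in>Pow J. \<Sum>B\<in>Pow J. a A * (?X B A S))"
	proof (rule sum.cong[OF refl], rule sum.mono_neutral_cong_left)
		fix A assume A: "A \<in> Pow J"
		show "\<forall>B\<in>Pow J - Pow (J - A). a A * (?X B A S) = 0"
		proof
			fix B assume "B \<in> Pow J - Pow (J - A)"
			hence "A \<inter> B ~= {}" "B \<subseteq> J" by auto
			thus "a A * (?X B A S) = 0" using A by (simp add: gmon_mult[OF \<theta>] fin)
		qed
		fix B assume "B \<in> Pow (J - A)"
		hence "A \<inter> B = {}" "B \<subseteq> J" by auto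
		thus "isg A B * a A * b B * gmon \<theta> (A \<union> B) S = a A * (?X B A S)" using A by (simp add: gmon_mult[OF \<theta>] fin)
	qed (use J in auto)
	also have "... = (gsubst J \<theta> a \<and>\<^sub>g gsubst J \<theta> b) S"
		unfolding gsubst_gmon gwedge_sum_left gwedge_sum_right gwedge_cmult_left gwedge_cmult_right by (simp add: sum_distrib_left)
	finally show "gsubst J \<theta> (a \<and>\<^sub>g b) S = (gsubst J \<theta> a \<and>\<^sub>g gsubst J \<theta> b) S" .
qed

lemma gsubst_gone:
	assumes "finite J"
	shows "gsubst J \<theta> gone = gone"
proof
	fix S
	have "gsubst J \<theta> gone S = (\<Sum>T\<in>Pow J. if T = {} then gone S else 0)"
		unfolding gsubst_gmon by (intro sum.cong) (auto simp: gone_def[of "_::'a set"])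
	thus "gsubst J \<theta> gone S = gone S" using assms by simp
qed

lemma gcontr_sum: "gcontr g (%S. \<Sum>i\<in>I. f i S) = (%S. \<Sum>i\<in>I. gcontr g (f i) S)"
	by (rule ext) (simp add: gcontr_def sum_distrib_left)

lemma gcontr_cmult: "gcontr g (%S. k * a S) = (%S. k * gcontr g a S)" by (rule ext) (simp add: gcontr_def)

lemma ginvol_deg1: "deg1 \<theta> ==> ginvol (\<theta> g) = - \<theta> g"
proof
	fix S assume "deg1 \<theta>"
	thus "ginvol (\<theta> g) S = (- \<theta> g) S" by (cases "\<theta> g S = 0") (auto simp: ginvol_def deg1_def)
qed

lemma gcontr_gmon:
	assumes \<theta>: "deg1 \<theta>" and "finite T" and c: "!!g. g \<in> T ==> gcontr h (\<theta> g) = (%S. c g * gone S)" and fin: "finite S"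
	shows "gcontr h (gmon \<theta> T) S = (\<Sum>g\<in>T. c g * (-1) ^ card {t \<in> T. t < g} * gmon \<theta> (T - {g}) S)"
	using assms(2) c fin
proof (induction T arbitrary: S rule: finite_Min_induct)
	case empty
	thus ?case by (simp add: gcontr_def gone_def)
next case (insert g T)
	have gT: "g ~: T" using insert.hyps(2) by blast
	have IH: "gcontr h (gmon \<theta> T) S = (\<Sum>g\<in>T. c g * (-1) ^ card {t \<in> T. t < g} * gmon \<theta> (T - {g}) S)"
		if "finite S" for S by (rule insert.IH) (use insert.prems that in auto)
	have "gcontr h (gmon \<theta> (insert g T)) S = c g * gmon \<theta> T S - (\<theta> g \<and>\<^sub>g gcontr h (gmon \<theta> T)) S"
		using insert.hyps insert.prems(2)
		by (simp add: gmon_insert_min gcontr_wedge insert.prems(1) gwedge_cmult_left gone_wedge ginvol_deg1[OF \<theta>] gwedge_uminus_left)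
	also have "(\<theta> g \<and>\<^sub>g gcontr h (gmon \<theta> T)) S =
			(\<theta> g \<and>\<^sub>g (%S. \<Sum>g\<in>T. (c g * (-1) ^ card {t \<in> T. t < g}) * gmon \<theta> (T - {g}) S)) S"
		using insert.prems(2) unfolding gwedge_def by (intro sum.cong) (auto simp: IH)
	also have "... = (\<Sum>k\<in>T. (c k * (-1) ^ card {t \<in> T. t < k}) * gmon \<theta> (insert g (T - {k})) S)"
		unfolding gwedge_sum_right gwedge_cmult_right using insert.hyps by (intro sum.cong refl, subst gmon_insert_min[symmetric]) auto
	also have "c g * gmon \<theta> T S - ... = (\<Sum>k\<in>insert g T. c k * (-1) ^ card {t \<in> insert g T. t < k} * gmon \<theta> (insert g T - {k}) S)"
	proof -
		have e: "{t \<in> insert g T. t < g} = {}" using insert.hyps by (auto dest: less_not_sym)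
		have "(-1 :: complex) ^ card {t \<in> insert g T. t < g} = 1" unfolding e by simp
		moreover have "card {t \<in> insert g T. t < k} = Suc (card {t \<in> T. t < k})" if "k \<in> T" for k
		proof -
			have "{t \<in> insert g T. t < k} = insert g {t \<in> T. t < k}" using insert.hyps that by auto
			thus ?thesis using gT insert.hyps by simp
		qed
		moreover have "insert g T - {k} = insert g (T - {k})" if "k \<in> T" for k using that gT by auto
		ultimately show ?thesis using insert.hyps(1) gT Diff_insert_absorb[OF gT] by (simp add: sum_negf del: insert_iff)
	qed
	finally show ?case .
qed

text \<open>Naturality of contraction: the scalars \<open>c g\<close> are the components of the
  image of the coordinate vector of \<open>h\<close> under the differential of the map.\<close>

lemma gcontr_gsubst:
	assumes \<theta>: "deg1 \<theta>" and J: "finite J" and c: "!!g. g \<in> J ==> gcontr h (\<theta> g) = (%S. c g * gone S)"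
		and fin: "finite S"
	shows "gcontr h (gsubst J \<theta> a) S = gsubst J \<theta> (%S. \<Sum>g\<in>J. c g * gcontr g a S) S"
proof -
	have fJ: "finite T" if "T \<subseteq> J" for T using J that finite_subset by blast
	have "gcontr h (gsubst J \<theta> a) S = (\<Sum>T\<in>Pow J. a T * gcontr h (gmon \<theta> T) S)"
		by (simp add: gsubst_gmon gcontr_sum gcontr_cmult)
	also have "... = (\<Sum>T\<in>Pow J. \<Sum>g\<in>T. a T * (c g * (-1) ^ card {t \<in> T. t < g} * gmon \<theta> (T - {g}) S))"
		by (intro sum.cong refl) (subst gcontr_gmon[OF \<theta>, where c = c], use c fJ fin in "auto simp: sum_distrib_left")
	also have "... = (\<Sum>(T, g)\<in>(SIGMA T:Pow J. T). a T * (c g * (-1) ^ card {t \<in> T. t < g} * gmon \<theta> (T - {g}) S))"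
		by (subst sum.Sigma) (auto simp: J intro: fJ)
	also have "... = (\<Sum>(U, g)\<in>(SIGMA U:Pow J. J - U). c g * ((-1) ^ card {t \<in> U. t < g} * a (insert g U)) * gmon \<theta> U S)"
	proof (rule sum.reindex_bij_witness[where j = "%(T, g). (T - {g}, g)" and i = "%(U, g). (insert g U, g)"], goal_cases)
		case (5 p)
		moreover have "{t. t \<in> T & t ~= g & t < g} = {t. t \<in> T & t < g}" for T and g :: 'a by auto
		ultimately show ?case by (auto simp: insert_absorb)
	qed auto
	also have "... = (\<Sum>U\<in>Pow J. \<Sum>g\<in>J - U. c g * ((-1) ^ card {t \<in> U. t < g} * a (insert g U)) * gmon \<theta> U S)"
		by (subst sum.Sigma) (auto simp: J)
	also have "... = (\<Sum>U\<in>Pow J. (\<Sum>g\<in>J. c g * gcontr g a U) * gmon \<theta> U S)" unfolding sum_distrib_right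
		by (intro sum.cong refl sum.mono_neutral_cong_left) (auto simp: J gcontr_def)
	finally show ?thesis by (simp add: gsubst_gmon)
qed

subsection \<open>Contraction with a covector\<close>

definition vcontr :: "('g => complex) => ('g::{finite,linorder}) ext => 'g ext" where
	"vcontr c a S = (\<Sum>g\<in>UNIV. c g * gcontr g a S)"

lemma gcontr_linear [simp]:
	"gcontr g (a + b) S = gcontr g a S + gcontr g b S" "gcontr g (%S. k * a S) S = k * gcontr g a S"
	"gcontr g (- a) S = - gcontr g a S" "gcontr g 0 S = 0"
	"gcontr g gone S = 0" by (simp_all add: gcontr_def algebra_simps gone_def)

lemma vcontr_add: "vcontr c (a + b) = vcontr c a + vcontr c b" by (rule ext) (simp add: vcontr_def algebra_simps sum.distrib)

lemma vcontr_cmult: "vcontr c (%S. k * a S) = (%S. k * vcontr c a S)"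
	by (rule ext) (simp add: vcontr_def sum_distrib_left mult_ac)

lemma vcontr_zero [simp]: "vcontr c 0 = 0" by (rule ext) (simp add: vcontr_def)

lemma vcontr_uminus: "vcontr c (- a) = - vcontr c a" by (rule ext) (simp add: vcontr_def sum_negf)

lemma vcontr_wedge: "vcontr c (a \<and>\<^sub>g b) = vcontr c a \<and>\<^sub>g b + ginvol a \<and>\<^sub>g vcontr c b"
proof
	fix S :: "'a set"
	have "(\<Sum>g\<in>UNIV. c g * (gcontr g a \<and>\<^sub>g b) S) = (vcontr c a \<and>\<^sub>g b) S"
		unfolding vcontr_def[abs_def] gwedge_sum_left gwedge_cmult_left by simp
	moreover have "(\<Sum>g\<in>UNIV. c g * (ginvol a \<and>\<^sub>g gcontr g b) S) = (ginvol a \<and>\<^sub>g vcontr c b) S"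
		unfolding vcontr_def[abs_def] gwedge_sum_right gwedge_cmult_right by simp
	ultimately show "vcontr c (a \<and>\<^sub>g b) S = (vcontr c a \<and>\<^sub>g b + ginvol a \<and>\<^sub>g vcontr c b) S"
		by (simp add: vcontr_def[of c "a \<and>\<^sub>g b"] gcontr_wedge distrib_left sum.distrib)
qed

lemma gcontr_sum': "gcontr g (%S. \<Sum>i\<in>I. k i * f i S) T = (\<Sum>i\<in>I. k i * gcontr g (f i) T)"
	by (simp add: gcontr_sum gcontr_cmult)

lemma vcontr_anticomm: "vcontr c (vcontr d a) = - vcontr d (vcontr c a)"
proof
	fix S :: "'a set"
	have "vcontr c (vcontr d a) S = (\<Sum>g\<in>UNIV. \<Sum>h\<in>UNIV. c g * (d h * gcontr g (gcontr h a) S))"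
		unfolding vcontr_def[of c] unfolding vcontr_def[abs_def] gcontr_sum' sum_distrib_left ..
	also have "... = (\<Sum>g\<in>UNIV. \<Sum>h\<in>UNIV. - (d h * (c g * gcontr h (gcontr g a) S)))"
		by (intro sum.cong refl, subst gcontr_anticomm) auto
	also have "... = - vcontr d (vcontr c a) S" unfolding vcontr_def[of d] unfolding vcontr_def[abs_def] gcontr_sum' sum_distrib_left
		by (subst sum.swap) (simp add: sum_negf)
	finally show "vcontr c (vcontr d a) S = (- vcontr d (vcontr c a)) S" by simp
qed

lemma vcontr_square: "vcontr c (vcontr c a) = 0" using vcontr_anticomm[of c c a] by (auto simp: fun_eq_iff)

lemma vcontr_gone [simp]: "vcontr c gone = 0" by (rule ext) (simp add: vcontr_def)

lemma vcontr_UNIV [simp]: "vcontr c a UNIV = 0" by (simp add: vcontr_def gcontr_def)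

lemma vcontr_lincomb: "vcontr (%g. c g + k * d g) a = (%S. vcontr c a S + k * vcontr d a S)"
	by (rule ext) (simp add: vcontr_def algebra_simps sum.distrib sum_distrib_left)

lemma ginvol_vcontr: "ginvol (vcontr c a) = - vcontr c (ginvol a)"
proof
	fix S
	have "(-1) ^ card S * gcontr g a S = - gcontr g (ginvol a) S" for g by (cases "g \<in> S") (simp_all add: gcontr_def ginvol_def mult_ac)
	thus "ginvol (vcontr c a) S = (- vcontr c (ginvol a)) S"
		by (simp add: ginvol_def[of "vcontr c a"] vcontr_def sum_distrib_left sum_negf[symmetric] mult.left_commute
				del: sum_negf)
qed

text \<open>Both contractions are antiderivations and vanish on the top degree.\<close>

lemma contr2_adjoint:
	assumes "ginvol a = a"
	shows "(a \<and>\<^sub>g vcontr c (vcontr d b)) UNIV = (vcontr c (vcontr d a) \<and>\<^sub>g b) UNIV"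
proof -
	have "(vcontr c a \<and>\<^sub>g vcontr d b) UNIV + (a \<and>\<^sub>g vcontr c (vcontr d b)) UNIV = 0"
		using vcontr_UNIV[of c "a \<and>\<^sub>g vcontr d b"] by (simp add: vcontr_wedge assms del: vcontr_UNIV)
	moreover have "(vcontr d (vcontr c a) \<and>\<^sub>g b) UNIV - (vcontr c a \<and>\<^sub>g vcontr d b) UNIV = 0"
		using vcontr_UNIV[of d "vcontr c a \<and>\<^sub>g b"]
		by (simp add: vcontr_wedge assms ginvol_vcontr gwedge_uminus_left del: vcontr_UNIV)
	moreover have "(vcontr d (vcontr c a) \<and>\<^sub>g b) UNIV = - (vcontr c (vcontr d a) \<and>\<^sub>g b) UNIV"
		by (simp add: vcontr_anticomm[of d c a] gwedge_uminus_left)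
	ultimately show ?thesis by (simp add: add_eq_0_iff) (metis minus_equation_iff)
qed

instance gen :: (finite) finite by standard (rule finite_gen_set)

definition cR :: "real^'n => 'n gen => complex" where
	"cR v g = (case g of Rad j => of_real (v $ j) | Ang j => 0)"

definition cP :: "real^'n => 'n gen => complex" where
	"cP v g = (case g of Rad j => 0 | Ang j => of_real (v $ j))"

lemma sum_gen:
	fixes f :: "('n::finite) gen => 'a::comm_monoid_add"
	shows "(\<Sum>g\<in>UNIV. f g) = (\<Sum>j\<in>UNIV. f (Rad j)) + (\<Sum>j\<in>UNIV. f (Ang j))"
proof -
	have eq: "(UNIV :: 'n gen set) = range Rad \<union> range Ang" by (auto, metis gen.exhaust rangeI)
	show ?thesis unfolding eq by (subst sum.union_disjoint) (auto simp: sum.reindex inj_on_def)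
qed

lemma vcontr_cR: "vcontr (cR v) a S = (\<Sum>j\<in>UNIV. of_real (v $ j) * gcontr (Rad j) a S)" by (simp add: vcontr_def sum_gen cR_def)

lemma vcontr_cP: "vcontr (cP v) a S = (\<Sum>j\<in>UNIV. of_real (v $ j) * gcontr (Ang j) a S)" by (simp add: vcontr_def sum_gen cP_def)

lemma contrR_eq: "contrR m \<omega> r = vcontr (cR (rvec m)) (\<omega> r)" by (rule ext) (simp add: contrR_def vcontr_cR rvec_def)

lemma contrPhi_eq: "contrPhi m \<omega> r = vcontr (cP (rvec m)) (\<omega> r)" by (rule ext) (simp add: contrPhi_def vcontr_cP rvec_def)

text \<open>The action of \<open>G\<^sub>+ G\<^sub>-\<close> at the vector \<open>v\<close>, before
  the flow. It lowers the degree by two and so preserves parity, and it is quadratic in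
  \<open>v\<close>, so the orientation of an edge does not affect it.\<close>

definition rp :: "real^'n::{finite,linorder} => 'n gen ext => 'n gen ext" where
	"rp v a = vcontr (cR v) (vcontr (cP v) a)"

lemma cR_lincomb: "cR (u + k *\<^sub>R v) = (%g. cR u g + of_real k * cR v g)" by (rule ext) (simp add: cR_def split: gen.split)

lemma cR_uminus: "cR (- v) = (%g. 0 g + (-1) * cR v g)" and cP_uminus: "cP (- v) = (%g. 0 g + (-1) * cP v g)"
	by (auto simp: cR_def cP_def fun_eq_iff split: gen.split)

lemma rp_uminus: "rp (- v) a = rp v a"
proof -
	have 0: "vcontr 0 b = (%S. 0)" for b :: "'a gen ext" by (rule ext) (simp add: vcontr_def)
	show ?thesis unfolding rp_def cR_uminus cP_uminus vcontr_lincomb 0 add_0 vcontr_cmult by simp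
qed

subsection \<open>The commutative ring of even elements\<close>

text \<open>In even degree the wedge product commutes, so the value of a tree can be a product over
  a multiset of branches. Finiteness is demanded because the generators of moduli spaces form an
  infinite type, on whose infinite sets every wedge product vanishes.\<close>

typedef 'g eext = "{a :: 'g ext. \<forall>S. a S ~= 0 --> finite S & even (card S)}"
	morphisms cf Eext by (rule exI[of _ "%S. 0"]) simp

setup_lifting type_definition_eext

lemma gwedge_nonzeroE:
	assumes "(a \<and>\<^sub>g b) S ~= 0"
	obtains T where "finite S" "T \<subseteq> S" "a T ~= 0" "b (S - T) ~= 0"
proof -
	have "finite S" using assms gwedge_infinite by metis
	moreover obtain T where "T \<in> Pow S" "isg T (S - T) * a T * b (S - T) ~= 0"
		using assms unfolding gwedge_isg by (meson sum.neutral)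
	ultimately show thesis using that by auto
qed

instantiation eext :: (linorder) comm_ring_1
begin

lift_definition zero_eext :: "'a eext" is "%S. 0" by simp
lift_definition one_eext :: "'a eext" is gone by (auto simp: gone_def split: if_splits)
lift_definition plus_eext :: "'a eext => 'a eext => 'a eext" is "%a b S. a S + b S" by (metis add.right_neutral)
lift_definition minus_eext :: "'a eext => 'a eext => 'a eext" is "%a b S. a S - b S" by (metis diff_0_right)
lift_definition uminus_eext :: "'a eext => 'a eext" is "%a S. - a S" by simp
lift_definition times_eext :: "'a eext => 'a eext => 'a eext" is gwedge
proof (elim gwedge_nonzeroE, goal_cases)
	case (1 a b S T)
	hence "card S = card T + card (S - T)" by (metis card_Diff_subset card_mono finite_subset le_add_diff_inverse)
	thus ?case using 1 by auto
qed

instance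
proof
	fix a b c :: "'a eext"
	show "a * b * c = a * (b * c)" by transfer (rule gwedge_assoc)
	show "a * b = b * a" by transfer (rule gwedge_swap, blast)
	show "1 * a = a" by transfer (rule gone_gwedge, blast)
	show "(a + b) * c = a * c + b * c" by transfer (simp add: gwedge_add_left[unfolded plus_fun_def] plus_fun_def)
	show "(0::'a eext) ~= 1" by transfer (auto simp: gone_def fun_eq_iff)
qed (transfer, simp add: fun_eq_iff)+

end

lemma cf_zero [simp]: "cf 0 = 0" and cf_one: "cf 1 = gone" and cf_add: "cf (a + b) = cf a + cf b"
	and cf_mult: "cf (a * b) = cf a \<and>\<^sub>g cf b" and cf_diff: "cf (a - b) = cf a - cf b" and cf_uminus: "cf (- a) = - cf a"
	by (transfer, simp add: fun_eq_iff)+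

lemma cf_sum: "cf (sum f I) S = (\<Sum>i\<in>I. cf (f i) S)" by (induction I rule: infinite_finite_induct) (auto simp: cf_add)

lemma eext_eqI: "(!!S. cf a S = cf b S) ==> a = b" by (metis cf_inject ext)

lift_definition sc :: "complex => 'g eext => 'g eext" is "%k a S. k * a S" by simp

lemma cf_sc: "cf (sc k a) S = k * cf a S" by transfer simp

lemma sc_sc: "sc k (sc l a) = sc (k * l) a" and sc_one [simp]: "sc 1 a = a" by (transfer, simp add: mult.assoc)+

lemma ginvol_cf: "ginvol (cf a) = cf a" by transfer (fastforce simp: ginvol_def)

lemma gprod_cf: "gprod (map cf xs) = cf (prod_list xs)" by (induction xs) (simp_all add: gprod_def cf_one cf_mult)

lemma even_Eext: "(!!S. a S ~= 0 ==> finite S & even (card S)) ==> cf (Eext a) = a"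
	by (simp add: Eext_inverse)

lemma gcontr_nonzeroD:
	assumes "gcontr g a S ~= 0"
	shows "g ~: S" "a (insert g S) ~= 0" using assms by (auto simp: gcontr_def split: if_splits)

lemma vcontr_nonzeroD:
	assumes "vcontr c a S ~= 0"
	shows "\<exists>g. g ~: S & a (insert g S) ~= 0"
proof -
	obtain g where "c g * gcontr g a S ~= 0" using assms unfolding vcontr_def by (meson sum.neutral)
	thus ?thesis using gcontr_nonzeroD[of g a S] by auto
qed

lift_definition erp :: "real^'n::{finite,linorder} => 'n gen eext => 'n gen eext" is rp
proof -
	fix v :: "real^'n::{finite,linorder}" and a :: "'n gen ext" and S
	assume a: "!!S. a S ~= 0 ==> finite S & even (card S)" and "rp v a S ~= 0"
	then obtain g h where "g ~: S" "h ~: insert g S" "a (insert h (insert g S)) ~= 0"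
		unfolding rp_def by (meson vcontr_nonzeroD)
	hence "even (card (insert h (insert g S)))" using a by blast
	thus "finite S & even (card S)" using `g ~: S` `h ~: insert g S` by simp
qed

lemma cf_erp: "cf (erp v a) = rp v (cf a)" by transfer simp

lemma rp_add: "rp v (a + b) = rp v a + rp v b" by (simp add: rp_def vcontr_add)

lemma erp_adjoint: "cf (a * erp v b) UNIV = cf (erp v a * b) UNIV" by (simp add: cf_mult cf_erp rp_def contr2_adjoint ginvol_cf)

lemma erp_one [simp]: "erp v 1 = 0" by (rule eext_eqI) (simp add: cf_erp cf_one rp_def)

lemma erp_0 [simp]: "erp 0 a = 0" by (rule eext_eqI) (simp add: cf_erp rp_def vcontr_def cR_def sum_gen)

subsection \<open>Extracting the coefficient of a set of coordinate pairs\<close>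

definition prs :: "'i set => 'i gen set" where
	"prs E = Rad ` E \<union> Ang ` E"

text \<open>Fibre integration in algebraic form: the coefficient of the volume form of the
  coordinate pairs in \<open>E\<close>, as an element of the algebra on the remaining
  generators.\<close>

definition xt :: "'i set => 'i gen ext => 'i gen ext" where
	"xt E a S = (if S \<inter> prs E = {} then a (S \<union> prs E) else 0)"

definition free :: "'i set => 'i gen ext => bool" where
	"free E a \<longleftrightarrow> (\<forall>S. a S ~= 0 --> S \<inter> prs E = {})"

lemma prs_union: "prs (E \<union> F) = prs E \<union> prs F" and prs_empty [simp]: "prs {} = {}" by (auto simp: prs_def)

lemma finite_prs [simp]: "finite E ==> finite (prs E)" by (simp add: prs_def)

text \<open>No element of \<open>U\<close> lies between \<open>Rad e\<close> and
  \<open>Ang e\<close>, so the two generators contribute equal signs.\<close>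

lemma isg_prs:
	assumes "finite E" "finite U" "U \<inter> prs E = {}"
	shows "isg (prs E) (U :: 'i::linorder gen set) = 1" using assms(1,3)
proof (induction E rule: finite_induct)
	case (insert e E)
	have eq: "prs (insert e E) = ({Rad e} \<union> {Ang e}) \<union> prs E" by (auto simp: prs_def)
	have "{u \<in> U. u < Rad e} = {u \<in> U. u < Ang e}" using insert.prems by (auto simp: prs_def less_gen_def)
	hence "isg {Rad e} U = isg {Ang e} U" by (simp add: isg_singleton_left)
	hence "isg ({Rad e} \<union> {Ang e}) U = 1" by (subst isg_union_left) (use assms in "auto simp: isg_square")
	moreover have "isg (prs E) U = 1" by (rule insert.IH) (use insert.prems in "auto simp: prs_def")
	ultimately show ?case unfolding eq by (subst isg_union_left) (use assms insert in "auto simp: prs_def")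
qed simp

text \<open>Only those summands survive in which the first factor takes all of \<open>prs E\<close>,
  since \<open>b\<close> contains none of these generators; the pairs cause no signs by
  \<open>isg_prs\<close>.\<close>

lemma xt_wedge:
	fixes a b :: "('i::linorder) gen ext"
	assumes "finite E" and b: "free E b"
	shows "xt E (a \<and>\<^sub>g b) = xt E a \<and>\<^sub>g b"
proof
	let ?X = "%S T. S \<union> prs E - T"
	fix S :: "'i gen set"
	show "xt E (a \<and>\<^sub>g b) S = (xt E a \<and>\<^sub>g b) S"
	proof (cases "finite S & S \<inter> prs E = {}")
		case True
		hence fin: "finite S" and S: "S \<inter> prs E = {}" by auto
		have "(a \<and>\<^sub>g b) (S \<union> prs E) = (\<Sum>T\<in>(%T. T \<union> prs E) ` Pow S. isg T (?X S T) * a T * b (?X S T))"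
			unfolding gwedge_isg
		proof (rule sum.mono_neutral_right)
			show "\<forall>T\<in>Pow (S \<union> prs E) - (%T. T \<union> prs E) ` Pow S.
					isg T (?X S T) * a T * b (?X S T) = 0"
			proof
				fix T assume T: "T \<in> Pow (S \<union> prs E) - (%T. T \<union> prs E) ` Pow S"
				have "~ prs E \<subseteq> T"
				proof
					assume "prs E \<subseteq> T"
					hence "T = (T \<inter> S) \<union> prs E" using T by auto
					thus False using T by blast
				qed
				hence "(?X S T) \<inter> prs E ~= {}" by blast
				hence "b (?X S T) = 0" using b unfolding free_def by blast
				thus "isg T (?X S T) * a T * b (?X S T) = 0" by simp
			qed
		qed (use fin assms in auto)
		also have "... = (\<Sum>T\<in>Pow S. isg (T \<union> prs E) (S - T) * a (T \<union> prs E) * b (S - T))"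
		proof (subst sum.reindex, goal_cases)
			case 1
			show ?case using S by (auto simp: inj_on_def)
		next case 2
			have "S \<union> prs E - (T \<union> prs E) = S - T" for T using S by auto
			thus ?case by simp
		qed
		also have "... = (\<Sum>T\<in>Pow S. isg T (S - T) * xt E a T * b (S - T))"
		proof (rule sum.cong[OF refl])
			fix T assume "T \<in> Pow S"
			hence "finite T" "T \<inter> prs E = {}" "(S - T) \<inter> prs E = {}" using fin S by (auto intro: finite_subset)
			thus "isg (T \<union> prs E) (S - T) * a (T \<union> prs E) * b (S - T) = isg T (S - T) * xt E a T * b (S - T)"
				using assms(1) fin by (simp add: isg_union_left isg_prs xt_def)
		qed
		finally show ?thesis using S by (simp add: xt_def gwedge_isg)
	next case False
		then consider "infinite S" | "S \<inter> prs E ~= {}" by blast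
		thus ?thesis
		proof cases
			case 1
			thus ?thesis by (simp add: gwedge_infinite xt_def)
		next case 2
			have "(xt E a \<and>\<^sub>g b) S = 0"
			proof (rule ccontr)
				assume "(xt E a \<and>\<^sub>g b) S ~= 0"
				then obtain T where "T \<subseteq> S" "xt E a T ~= 0" "b (S - T) ~= 0" by (elim gwedge_nonzeroE)
				hence "T \<inter> prs E = {}" "(S - T) \<inter> prs E = {}" using b by (auto simp: xt_def free_def split: if_splits)
				thus False using 2 by blast
			qed
			thus ?thesis using 2 by (simp add: xt_def)
		qed
	qed
qed

lemma xt_union: "E \<inter> F = {} ==> xt (E \<union> F) a = xt E (xt F a)"
	by (rule ext) (auto simp: xt_def prs_def image_Un Un_ac)

text \<open>The radial generator is contracted first. Both contractions then produce the same sign,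
  because \<open>Rad e\<close> and \<open>Ang e\<close> have the same predecessors in
  \<open>S\<close>.\<close>

lemma xt_single:
	assumes "finite S" "Rad e ~: S" "Ang e ~: S"
	shows "xt {e} a S = gcontr (Ang e) (gcontr (Rad e) a) S"
proof -
	have "{h \<in> insert (Ang e) S. h < Rad e} = {h \<in> S. h < Ang e}" using assms(2) by (auto simp: less_gen_def)
	moreover have "S \<union> prs {e} = insert (Rad e) (insert (Ang e) S)" by (auto simp: prs_def)
	moreover have "S \<inter> prs {e} = {}" using assms by (auto simp: prs_def)
	moreover have "Rad e ~: insert (Ang e) S" using assms by simp
	moreover have "((-1::complex) ^ k) * ((-1) ^ k * z) = z" for k z by (metis left_minus_one_mult_self mult.assoc)
	ultimately show ?thesis using assms by (simp add: xt_def gcontr_def del: insert_iff)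
qed

definition ptype :: "'n gen => 'i => 'i gen" where
	"ptype g = (case g of Rad _ => Rad | Ang _ => Ang)"

text \<open>Crossing an edge \<open>e\<close> with vector \<open>k\<close> adds \<open>k\<close>
  times its length to the radial position and \<open>k\<close> times its angle to the angular one.
  This is the effect on the pulled back differentials.\<close>

definition shift_gen :: "int^'n => 'i => ('n gen => 'i gen ext) => 'n gen => 'i gen ext" where
	"shift_gen k e \<theta> g S = \<theta> g S + of_int (k $ gidx g) * ggen (ptype g e) S"

lemma deg1_shift: "deg1 \<theta> ==> deg1 (shift_gen k e \<theta>)" by (auto simp: deg1_def shift_gen_def ggen_def)

lemma gmon_shift:
	fixes \<theta> :: "'n::{finite,linorder} gen => 'i::linorder gen ext"
	assumes "finite S" "S \<inter> prs {e} = {}"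
	shows "gmon (shift_gen k e \<theta>) T S = gmon \<theta> T S" using finite_gen_set[of T] assms
proof (induction T arbitrary: S rule: finite_Min_induct)
	case (insert g T)
	have "shift_gen k e \<theta> g U = \<theta> g U" if "U \<subseteq> S" for U
		using that insert.prems by (cases g) (auto simp: shift_gen_def ggen_def ptype_def prs_def)
	moreover have "gmon (shift_gen k e \<theta>) T U = gmon \<theta> T U" if "U \<subseteq> S" for U
		by (rule insert.IH) (use that insert.prems in "auto intro: finite_subset")
	ultimately show ?case using insert.hyps by (simp add: gmon_insert_min gwedge_def)
qed simp

text \<open>The generators of \<open>e\<close> enter only through the shift, so extracting their
  coefficient amounts to two contractions, which pull back to contractions with \<open>k\<close>.
  The sign comes from exchanging the radial and the angular one; it will cancel the orientation of
  the edge by the angle before the length.\<close>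

lemma xt_shift:
	fixes \<theta> :: "'n::{finite,linorder} gen => 'i::linorder gen ext"
	assumes \<theta>: "deg1 \<theta>" "!!g. free {e} (\<theta> g)"
	shows "xt {e} (gsubst UNIV (shift_gen k e \<theta>) a) = - gsubst UNIV \<theta> (rp (rvec k) a)"
proof
	fix S :: "'i gen set"
	let ?\<eta> = "shift_gen k e \<theta>"
	have \<eta>: "deg1 ?\<eta>" by (rule deg1_shift[OF \<theta>(1)])
	have inf: "gsubst UNIV \<theta> b S = 0" if "infinite S" for b and S :: "'i gen set" using that by (simp add: gsubst_gmon gmon_infinite)
	have gsubst_eq: "gsubst UNIV ?\<eta> b S = gsubst UNIV \<theta> b S" if "finite S" "S \<inter> prs {e} = {}" for b
		unfolding gsubst_gmon by (simp add: gmon_shift[OF that])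
	have \<theta>e: "\<theta> g (insert (Rad e) U) = 0" "\<theta> g (insert (Ang e) U) = 0" for g U
		using \<theta>(2)[of g] by (auto simp: free_def prs_def)
	have R: "gcontr (Rad e) (?\<eta> g) = (%S. cR (rvec k) g * gone S)" for g
		by (rule ext, cases g) (auto simp: gcontr_def shift_gen_def \<theta>e ggen_def ptype_def cR_def rvec_def gone_def)
	have P: "gcontr (Ang e) (?\<eta> g) = (%S. cP (rvec k) g * gone S)" for g
		by (rule ext, cases g) (auto simp: gcontr_def shift_gen_def \<theta>e ggen_def ptype_def cP_def rvec_def gone_def)
	have free: "free {e} (gmon \<theta> T)" for T using finite_gen_set[of T]
	proof (induction T rule: finite_Min_induct)
		case empty
		thus ?case by (auto simp: free_def gone_def)
	next case (insert g T)
		show ?case unfolding free_def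
		proof (intro allI impI)
			fix S assume "gmon \<theta> (insert g T) S ~= 0"
			then obtain U where "U \<subseteq> S" "\<theta> g U ~= 0" "gmon \<theta> T (S - U) ~= 0"
				using insert.hyps by (auto simp: gmon_insert_min elim: gwedge_nonzeroE)
			hence "U \<inter> prs {e} = {}" "(S - U) \<inter> prs {e} = {}" using \<theta>(2)[of g] insert.IH by (auto simp: free_def)
			thus "S \<inter> prs {e} = {}" by blast
		qed
	qed
	show "xt {e} (gsubst UNIV ?\<eta> a) S = (- gsubst UNIV \<theta> (rp (rvec k) a)) S"
	proof (cases "finite S & S \<inter> prs {e} = {}")
		case True
		hence S: "finite S" "S \<inter> prs {e} = {}" "Rad e ~: S" "Ang e ~: S" by (auto simp: prs_def)
		have "gcontr (Rad e) (gsubst UNIV ?\<eta> a) U = gsubst UNIV ?\<eta> (vcontr (cR (rvec k)) a) U" if "finite U" for U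
			unfolding vcontr_def[abs_def] by (rule gcontr_gsubst[OF \<eta>]) (use that R in auto)
		hence "gcontr (Ang e) (gcontr (Rad e) (gsubst UNIV ?\<eta> a)) S =
				gcontr (Ang e) (gsubst UNIV ?\<eta> (vcontr (cR (rvec k)) a)) S" unfolding gcontr_def[of "Ang e"] using S by simp
		also have "... = gsubst UNIV ?\<eta> (vcontr (cP (rvec k)) (vcontr (cR (rvec k)) a)) S"
			unfolding vcontr_def[of "cP _", abs_def] by (rule gcontr_gsubst[OF \<eta>]) (use S P in auto)
		also have "... = gsubst UNIV \<theta> (- rp (rvec k) a) S"
			unfolding vcontr_anticomm[of "cP _"] rp_def by (rule gsubst_eq[OF S(1,2)])
		finally show ?thesis unfolding xt_single[OF S(1,3,4)] by (simp add: gsubst_gmon sum_negf)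
	next case False
		then consider "infinite S" | "S \<inter> prs {e} ~= {}" by blast
		thus ?thesis
		proof cases
			case 1
			hence "gsubst UNIV ?\<eta> a (S \<union> prs {e}) = 0" by (simp add: gsubst_gmon gmon_infinite)
			thus ?thesis using 1 by (simp add: xt_def inf)
		next case 2
			hence "gmon \<theta> T S = 0" for T using free[of T] by (auto simp: free_def)
			thus ?thesis using 2 by (simp add: xt_def gsubst_gmon)
		qed
	qed
qed

lemma gmon_ggen:
	fixes h :: "'g::{finite,linorder} => 'h::linorder"
	assumes h: "!!x y. x < y ==> h x < h y"
	shows "gmon (%g. ggen (h g)) T S = (if S = h ` T then 1 else 0)" using finite[of T]
proof (induction T arbitrary: S rule: finite_Min_induct)
	case empty
	thus ?case by (simp add: gone_def)
next case (insert g T)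
	have nin: "h g ~: h ` T" using insert.hyps(2) h by (metis imageE less_irrefl)
	show ?case
	proof (cases "finite S")
		case True
		have eq: "gmon (%g. ggen (h g)) (insert g T) = ggen (h g) \<and>\<^sub>g gmon (%g. ggen (h g)) T"
			using insert.hyps by (rule gmon_insert_min)
		have "gmon (%g. ggen (h g)) (insert g T) S =
				(\<Sum>U\<in>Pow S. if U = {h g} then isg U (S - U) * (if S - U = h ` T then 1 else 0) else 0)" unfolding eq gwedge_isg
			by (intro sum.cong refl) (auto simp: insert.IH ggen_def)
		also have "... = (if S = h ` insert g T then isg {h g} (h ` T) else 0)" using True nin by (auto simp: Diff_eq) (metis image_eqI)
		also have "isg {h g} (h ` T) = 1"
		proof -
			have e: "{u \<in> h ` T. u < h g} = {}" using insert.hyps(2) h by (auto dest: less_not_sym)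
			show ?thesis unfolding isg_singleton_left e by simp
		qed
		finally show ?thesis .
	next case False
		hence "S ~= h ` insert g T" using finite by blast
		thus ?thesis using False by (simp add: gmon_infinite)
	qed
qed

lemma gsubst_ggen:
	fixes h :: "'g::{finite,linorder} => 'h::linorder"
	assumes h: "!!x y. x < y ==> h x < h y"
	shows "gsubst UNIV (%g. ggen (h g)) a (range h) = a UNIV"
proof -
	have "inj h" using h by (metis injI neq_iff)
	hence "range h = h ` T \<longleftrightarrow> T = UNIV" for T by (metis inj_image_eq_iff)
	thus ?thesis by (simp add: gsubst_gmon gmon_ggen[OF h] if_distrib[of "%x. _ * x"] cong: if_cong)
qed

section \<open>Forms with exponential decay transversally to their kernel\<close>

definition dec :: "(real^'n::finite) list => real^'n => real" where
	"dec A r = (\<Sum>a\<leftarrow>A. \<bar>a \<bullet> r\<bar>)"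

abbreviation "edec A r \<equiv> ennreal (exp (- dec A r))"

definition basic :: "(real^'n::{finite,linorder}) list => 'n gen ext => bool" where
	"basic A a \<longleftrightarrow> (\<forall>v. (\<forall>x\<in>set A. x \<bullet> v = 0) --> vcontr (cR v) a = 0)"

text \<open>
  A family of forms with parameters in \<open>P\<close>.  The common kernel of the covectors in \<open>A\<close> is
  annihilated by contraction, and in the complementary directions the family decays after
  integration over the parameters.  Hence a form of top degree is integrable.
\<close>

definition piece :: "'p measure => ('p => real) => (real^'n::{finite,linorder}) list => real => real =>
		('p => 'n form) => bool" where
	"piece P \<beta> A C K w \<longleftrightarrow>
		 (\<forall>S. (%(p, r). w p r S) \<in> borel_measurable (P \<Otimes>\<^sub>M borel)) &
		 (\<forall>p\<in>space P. \<forall>r. basic A (w p r)) &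
		 (\<forall>r S. (\<integral>\<^sup>+p. ennreal (norm (w p r S)) \<partial>P) \<le> ennreal C * edec A r) &
		 (\<forall>p\<in>space P. \<forall>r S. norm (w p r S) \<le> K * \<beta> p)"

text \<open>Sums are needed because a form decays along different covectors in different cones of
  the fan, while \<open>piece\<close> fixes one list. The weight \<beta> is \<open>1\<close> for
  edge lengths and \<open>exp \<bar>s\<bar>\<close> for Dyson times, where the pointwise bound may
  grow with time.\<close>

inductive pgood :: "'p measure => ('p => real) => ('p => ('n::{finite,linorder}) form) => bool"
	for P \<beta> where
	pgood_piece: "piece P \<beta> A C K w ==> pgood P \<beta> w"
| pgood_add: "pgood P \<beta> w1 ==> pgood P \<beta> w2 ==> pgood P \<beta> (%p r. w1 p r + w2 p r)"

lemma pieceD: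
	assumes "piece P \<beta> A C K w"
	shows "(%(p, r). w p r S) \<in> borel_measurable (P \<Otimes>\<^sub>M borel)"
		and "p \<in> space P ==> basic A (w p r)"
		and "(\<integral>\<^sup>+p. ennreal (norm (w p r S)) \<partial>P) \<le> ennreal C * edec A r"
		and "p \<in> space P ==> norm (w p r S) \<le> K * \<beta> p" using assms by (auto simp: piece_def)

lemma ennreal_max_zero: "ennreal (max x 0) = ennreal x" by (cases "0 \<le> x") (auto simp: max_def ennreal_neg)

lemma dec_nonneg: "0 \<le> dec A r" unfolding dec_def by (rule sum_list_nonneg) auto

lemma dec_append: "dec (A @ B) r = dec A r + dec B r" by (simp add: dec_def)

lemma basicD: "basic A a ==> (!!x. x \<in> set A ==> x \<bullet> v = 0) ==> vcontr (cR v) a = 0"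
	by (auto simp: basic_def)

lemma basic_zero: "basic A 0" by (simp add: basic_def)

lemma basic_wedge:
	assumes "basic A a" "basic B b"
	shows "basic (A @ B) (a \<and>\<^sub>g b)" unfolding basic_def vcontr_wedge using assms by (auto simp: basic_def)

lemma piece_zero: "piece P \<beta> A 0 0 (%p r. 0)" by (simp add: piece_def basic_zero)

lemma pgood_zero: "pgood P \<beta> (%p r. 0)" using pgood_piece[OF piece_zero[where A = "[]"]] .

lemma pgood_measurable:
	assumes "pgood P \<beta> w"
	shows "(%(p, r). w p r S) \<in> borel_measurable (P \<Otimes>\<^sub>M borel)"
	using assms by induction (auto simp: case_prod_beta' pieceD(1)[unfolded case_prod_beta'])

lemma measurable_section:
	assumes "(%(p, r). f p r) \<in> borel_measurable (P \<Otimes>\<^sub>M borel)"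
	shows "(%p. f p r) \<in> borel_measurable P" using measurable_compose[OF measurable_Pair2'[of r borel P] assms] by simp

lemma piece_integrable:
	assumes w: "piece P \<beta> A C K w"
	shows "integrable P (%p. w p r S)"
proof (rule integrableI_bounded)
	show "(%p. w p r S) \<in> borel_measurable P" by (rule measurable_section[OF pieceD(1)[OF w]])
	show "(\<integral>\<^sup>+p. ennreal (norm (w p r S)) \<partial>P) < \<infinity>"
		by (rule le_less_trans[OF pieceD(3)[OF w]]) (simp add: ennreal_mult_less_top)
qed

lemma pgood_integrable: "pgood P \<beta> w ==> integrable P (%p. w p r S)"
	by (induction rule: pgood.induct) (auto intro: piece_integrable)

lemma pgood_bounded:
	assumes "pgood P \<beta> w"
	shows "\<exists>K. \<forall>p\<in>space P. \<forall>r S. norm (w p r S) \<le> K * \<beta> p" using assms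
proof induction
	case (pgood_add w1 w2)
	then obtain K1 K2 where K: "!!p r S. p \<in> space P ==> norm (w1 p r S) \<le> K1 * \<beta> p"
			"!!p r S. p \<in> space P ==> norm (w2 p r S) \<le> K2 * \<beta> p" by blast
	have "norm ((w1 p r + w2 p r) S) \<le> (K1 + K2) * \<beta> p" if "p \<in> space P" for p r S
		using norm_triangle_le[OF add_mono[OF K[OF that, of r S]]] by (simp add: algebra_simps)
	thus ?case by blast
qed (auto simp: piece_def)

abbreviation point :: "unit measure" where
	"point \<equiv> count_space UNIV"

text \<open>A single form is a family over a one-point measure space, so that statements about
  families specialise to forms.\<close>

definition good :: "('n::{finite,linorder}) form => bool" where
	"good f \<longleftrightarrow> pgood point (%_. 1) (%_. f)"

lemma good_add: "good f ==> good g ==> good (%r. f r + g r)" unfolding good_def by (rule pgood_add)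

lemma sigma_finite_point: "sigma_finite_measure point" by (rule sigma_finite_measure_count_space_finite) simp

lemma integral_point: "(\<integral>p. f p \<partial>point) = f ()" for f :: "unit => complex"
	by (subst lebesgue_integral_count_space_finite) (auto simp: UNIV_unit)

lemma nn_integral_point: "(\<integral>\<^sup>+p. f p \<partial>point) = f ()"
	by (subst nn_integral_count_space_finite) (auto simp: UNIV_unit)

lemma measurable_point: "(%(p, r). f r) \<in> borel_measurable (point \<Otimes>\<^sub>M M) \<longleftrightarrow> f \<in> borel_measurable M"
	for f :: "'a => complex"
proof
	assume "(%(p, r). f r) \<in> borel_measurable (point \<Otimes>\<^sub>M M)"
	from measurable_compose[OF _ this, of "Pair ()" M] show "f \<in> borel_measurable M" by simp
qed simp

lemma good_measurable:
	assumes "good f"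
	shows "(%r. f r S) \<in> borel_measurable borel"
	using pgood_measurable[OF assms[unfolded good_def], of S] measurable_point[of "%r. f r S" borel] by simp

lemma piece_point_iff:
	"piece point (%_. 1) A C K (%_. f) \<longleftrightarrow>
		 (\<forall>S. (%r. f r S) \<in> borel_measurable borel) & (\<forall>r. basic A (f r)) &
		 (\<forall>r S. ennreal (norm (f r S)) \<le> ennreal C * edec A r) & (\<forall>r S. norm (f r S) \<le> K)"
	by (simp add: piece_def nn_integral_point measurable_point)

lemma vcontr_integral:
	assumes "!!S. integrable P (%p. f p S)"
	shows "vcontr c (%S. \<integral>p. f p S \<partial>P) = (%S. \<integral>p. vcontr c (f p) S \<partial>P)"
		and "integrable P (%p. vcontr c (f p) S)"
proof -
	have i: "integrable P (%p. gcontr g (f p) S)" for g S using assms by (cases "g \<in> S") (simp_all add: gcontr_def)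
	show "integrable P (%p. vcontr c (f p) S)"
		unfolding vcontr_def by (intro Bochner_Integration.integrable_sum integrable_mult_right i)
	have "gcontr g (%S. \<integral>p. f p S \<partial>P) S = (\<integral>p. gcontr g (f p) S \<partial>P)" for g S
		by (simp add: gcontr_def)
	thus "vcontr c (%S. \<integral>p. f p S \<partial>P) = (%S. \<integral>p. vcontr c (f p) S \<partial>P)"
		unfolding vcontr_def by (simp add: i)
qed

text \<open>The third clause of \<open>piece\<close> is the decay of the integral. As
  \<open>dec\<close> is nonnegative, it also supplies the uniform bound.\<close>

lemma good_integral:
	assumes "pgood P \<beta> w" and sf: "sigma_finite_measure P"
	shows "good (%r S. \<integral>p. w p r S \<partial>P)" using assms(1)
proof induction
	case (pgood_piece A C K w)
	interpret sigma_finite_measure P by fact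
	have meas: "(%r. \<integral>p. w p r S \<partial>P) \<in> borel_measurable borel" for S
		using measurable_compose[OF measurable_pair_swap' pieceD(1)[OF pgood_piece, of S]]
		by (intro borel_measurable_lebesgue_integral) (simp add: case_prod_beta')
	have bas: "basic A (%S. \<integral>p. w p r S \<partial>P)" for r unfolding basic_def
	proof (intro allI impI)
		fix v assume "\<forall>x\<in>set A. x \<bullet> v = 0"
		hence "vcontr (cR v) (w p r) = 0" if "p \<in> space P" for p using basicD[OF pieceD(2)[OF pgood_piece that]] by blast
		hence "(\<integral>p. vcontr (cR v) (w p r) S \<partial>P) = 0" for S
			by (subst Bochner_Integration.integral_cong[of _ _ _ "%_. 0"]) auto
		thus "vcontr (cR v) (%S. \<integral>p. w p r S \<partial>P) = 0"
			by (subst vcontr_integral[OF piece_integrable[OF pgood_piece]]) (simp add: fun_eq_iff)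
	qed
	have dec: "ennreal (norm (\<integral>p. w p r S \<partial>P)) \<le> ennreal C * edec A r" for r S
		using integral_norm_bound_ennreal[OF piece_integrable[OF pgood_piece]] pieceD(3)[OF pgood_piece] by (rule order_trans)
	have "norm (\<integral>p. w p r S \<partial>P) \<le> max C 0" for r S
	proof -
		have "ennreal (norm (\<integral>p. w p r S \<partial>P)) \<le> ennreal C * edec A r" by (rule dec)
		also have "... \<le> ennreal C * ennreal 1" by (intro mult_left_mono ennreal_leI) (auto simp: dec_nonneg)
		also have "... = ennreal (max C 0)" by (simp add: ennreal_max_zero)
		finally show ?thesis by (subst (asm) ennreal_le_iff) auto
	qed
	thus ?case unfolding good_def using meas bas dec by (intro pgood.pgood_piece[where K = "max C 0"]) (auto simp: piece_point_iff)
next case (pgood_add w1 w2)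
	have "(%r S. \<integral>p. (w1 p r + w2 p r) S \<partial>P) = (%r. (%S. \<integral>p. w1 p r S \<partial>P) + (%S. \<integral>p. w2 p r S \<partial>P))"
		using pgood_add.hyps by (simp add: fun_eq_iff pgood_integrable)
	thus ?case using good_add[OF pgood_add.IH] by simp
qed

text \<open>Measure-preserving reparametrisation. It later splits the lengths of a tree into those
  of its branches.\<close>

lemma pgood_transport:
	assumes "pgood P \<beta> w" and f: "f \<in> measurable Q P" and P: "distr Q P f = P"
	shows "pgood Q (%q. \<beta> (f q)) (%q. w (f q))" using assms(1)
proof induction
	case (pgood_piece A C K w)
	have "piece Q (%q. \<beta> (f q)) A C K (%q. w (f q))" unfolding piece_def
	proof (intro conjI allI ballI)
		fix S
		have "(%(q, r). (f q, r)) \<in> measurable (Q \<Otimes>\<^sub>M borel) (P \<Otimes>\<^sub>M borel)" using f by measurable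
		from measurable_compose[OF this pieceD(1)[OF pgood_piece, of S]]
		show "(%(q, r). w (f q) r S) \<in> borel_measurable (Q \<Otimes>\<^sub>M borel)" by (simp add: case_prod_beta')
	next
		fix r S
		have m: "(%p. w p r S) \<in> borel_measurable P" by (rule measurable_section[OF pieceD(1)[OF pgood_piece]])
		have "(\<integral>\<^sup>+q. ennreal (norm (w (f q) r S)) \<partial>Q) = (\<integral>\<^sup>+p. ennreal (norm (w p r S)) \<partial>distr Q P f)"
			by (subst nn_integral_distr[OF f]) (use m in "auto simp: P")
		also have "... \<le> ennreal C * edec A r" unfolding P by (rule pieceD(3)[OF pgood_piece])
		finally show "(\<integral>\<^sup>+q. ennreal (norm (w (f q) r S)) \<partial>Q) \<le> ennreal C * edec A r" .
	qed (use pieceD(2,4)[OF pgood_piece] measurable_space[OF f] in auto)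
	thus ?case by (rule pgood.pgood_piece)
next case (pgood_add w1 w2)
	from pgood.pgood_add[OF pgood_add.IH] show ?case .
qed

subsection \<open>Products\<close>

lemma norm_isg [simp]: "norm (isg T U) = 1" by (simp add: isg_def norm_power)

lemma norm_gwedge_le:
	fixes a b :: "'g::{finite,linorder} ext"
	shows "norm ((a \<and>\<^sub>g b) S) \<le> (\<Sum>T\<in>UNIV. norm (a T) * norm (b (S - T)))"
proof -
	have "norm ((a \<and>\<^sub>g b) S) \<le> (\<Sum>T\<in>Pow S. norm (a T) * norm (b (S - T)))"
		unfolding gwedge_isg by (rule order_trans[OF norm_sum]) (simp add: norm_mult)
	also have "... \<le> (\<Sum>T\<in>UNIV. norm (a T) * norm (b (S - T)))" by (rule sum_mono2) auto
	finally show ?thesis .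
qed

lemma pgood_cong_fun: "pgood P \<beta> w ==> w = w' ==> pgood P \<beta> w'" by simp

lemma nn_integral_product:
	assumes "sigma_finite_measure P'" "f \<in> borel_measurable P" "g \<in> borel_measurable P'"
	shows "(\<integral>\<^sup>+(p, p'). f p * g p' \<partial>(P \<Otimes>\<^sub>M P')) = (\<integral>\<^sup>+p. f p \<partial>P) * (\<integral>\<^sup>+p'. g p' \<partial>P')"
proof -
	interpret sigma_finite_measure P' by fact
	have [measurable]: "f \<in> borel_measurable P" "g \<in> borel_measurable P'" by fact+
	have "(\<integral>\<^sup>+z. (case z of (p, p') => f p * g p') \<partial>(P \<Otimes>\<^sub>M P')) = (\<integral>\<^sup>+p. \<integral>\<^sup>+p'. f p * g p' \<partial>P' \<partial>P)"
		by (subst nn_integral_fst[symmetric]) auto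
	thus ?thesis by (simp add: nn_integral_cmult nn_integral_multc)
qed

text \<open>Concatenating the covector lists adds the decay exponents and intersects the kernels. By
  Tonelli the parameter integrals of products of coefficients factor, and \<open>N\<close> counts
  the coefficients.\<close>

lemma piece_wedge:
	fixes w1 :: "'p => ('n::{finite,linorder}) form" and w2 :: "'q => 'n form"
	assumes w1: "piece P1 \<beta>1 A1 C1 K1 w1" and w2: "piece P2 \<beta>2 A2 C2 K2 w2" and sf: "sigma_finite_measure P2"
	shows "\<exists>A C K. piece (P1 \<Otimes>\<^sub>M P2) (%(p, q). \<beta>1 p * \<beta>2 q) A C K (%(p, q) r. w1 p r \<and>\<^sub>g w2 q r)"
proof -
	let ?W = "%r T. \<integral>\<^sup>+p. ennreal (norm (w1 p r T)) \<partial>P1"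
	let ?Z = "%r S T. \<integral>\<^sup>+q. ennreal (norm (w2 q r (S - T))) \<partial>P2"
	let ?Y = "P1 \<Otimes>\<^sub>M P2"
	let ?X = "%z p q. case z of (p, q) => %r. w1 p r \<and>\<^sub>g w2 q r"
	define N where "N = real (card (UNIV :: 'n gen set set))"
	have [measurable]: "(%z. w1 (fst (fst z)) (snd z) S) \<in> borel_measurable (?Y \<Otimes>\<^sub>M borel)" for S
		using measurable_compose[OF _ pieceD(1)[OF w1, of S], of "%z. (fst (fst z), snd z)" "?Y \<Otimes>\<^sub>M borel"]
		by (simp add: case_prod_beta')
	have [measurable]: "(%z. w2 (snd (fst z)) (snd z) S) \<in> borel_measurable (?Y \<Otimes>\<^sub>M borel)" for S
		using measurable_compose[OF _ pieceD(1)[OF w2, of S], of "%z. (snd (fst z), snd z)" "?Y \<Otimes>\<^sub>M borel"]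
		by (simp add: case_prod_beta')
	have m1 [measurable]: "(%p. w1 p r S) \<in> borel_measurable P1" for r S by (rule measurable_section[OF pieceD(1)[OF w1]])
	have m2 [measurable]: "(%p. w2 p r S) \<in> borel_measurable P2" for r S by (rule measurable_section[OF pieceD(1)[OF w2]])
	have "piece ?Y (%(p, q). \<beta>1 p * \<beta>2 q) (A1 @ A2) (N * (max C1 0 * max C2 0)) (N * (K1 * K2))
			(%(p, q) r. w1 p r \<and>\<^sub>g w2 q r)" unfolding piece_def
	proof (intro conjI allI ballI)
		fix S
		show "(%(z, r). (?X z p q) r S) \<in> borel_measurable (?Y \<Otimes>\<^sub>M borel)"
			unfolding gwedge_def by (simp add: case_prod_beta')
	next
		fix z r assume "z \<in> space ?Y"
		thus "basic (A1 @ A2) ((?X z p q) r)" by (auto simp: space_pair_measure intro!: basic_wedge pieceD(2)[OF w1] pieceD(2)[OF w2])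
	next
		fix r S
		let ?D = "ennreal (max C1 0 * max C2 0) * ennreal (exp (- dec (A1 @ A2) r))"
		have "(\<integral>\<^sup>+z. ennreal (norm ((?X z p q) r S)) \<partial>?Y) \<le>
				(\<integral>\<^sup>+z. (\<Sum>T\<in>UNIV. (case z of (p, q) => ennreal (norm (w1 p r T)) * ennreal (norm (w2 q r (S - T))))) \<partial>?Y)"
		proof (rule nn_integral_mono)
			fix z :: "'p \<times> 'q"
			obtain p q where z: "z = (p, q)" by force
			show "ennreal (norm ((?X z p q) r S)) \<le>
					(\<Sum>T\<in>UNIV. (case z of (p, q) => ennreal (norm (w1 p r T)) * ennreal (norm (w2 q r (S - T)))))"
				unfolding z using ennreal_leI[OF norm_gwedge_le[of "w1 p r" "w2 q r" S]] by (simp add: ennreal_mult[symmetric] sum_ennreal)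
		qed
		also have "... = (\<Sum>T\<in>UNIV. (?W r T) * (?Z r S T))"
			by (subst nn_integral_sum) (auto intro!: sum.cong nn_integral_product[OF sf])
		also have "... \<le> (\<Sum>T\<in>(UNIV :: 'n gen set set). ?D)"
		proof (rule sum_mono)
			fix T :: "'n gen set"
			have "(?W r T) * (?Z r S T) \<le>
					(ennreal C1 * edec A1 r) * (ennreal C2 * edec A2 r)" by (intro mult_mono pieceD(3)[OF w1] pieceD(3)[OF w2]) auto
			also have "... = (ennreal (max C1 0) * ennreal (max C2 0)) * (edec A1 r * edec A2 r)" by (simp add: ennreal_max_zero mult_ac)
			also have "... = ?D" by (simp add: dec_append exp_add[symmetric] ennreal_mult[symmetric] add.commute)
			finally show "(?W r T) * (?Z r S T) \<le> ?D" .
		qed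
		also have "... = ennreal (N * (max C1 0 * max C2 0)) * ennreal (exp (- dec (A1 @ A2) r))"
		proof -
			have "of_nat (card (UNIV :: 'n gen set set)) = ennreal N" "0 \<le> N"
				by (simp_all add: N_def ennreal_of_nat_eq_real_of_nat del: card_UNIV_set)
			thus ?thesis by (simp only: sum_constant) (simp add: ennreal_mult mult.assoc)
		qed
		finally show "(\<integral>\<^sup>+z. ennreal (norm ((?X z p q) r S)) \<partial>?Y) \<le>
				ennreal (N * (max C1 0 * max C2 0)) * ennreal (exp (- dec (A1 @ A2) r))" .
	next
		fix z r S assume "z \<in> space ?Y"
		then obtain p q where z: "z = (p, q)" "p \<in> space P1" "q \<in> space P2" by (auto simp: space_pair_measure)
		have "norm ((w1 p r \<and>\<^sub>g w2 q r) S) \<le> (\<Sum>T\<in>(UNIV :: 'n gen set set). (K1 * \<beta>1 p) * (K2 * \<beta>2 q))"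
			by (rule order_trans[OF norm_gwedge_le], intro sum_mono mult_mono pieceD(4)[OF w1] pieceD(4)[OF w2])
				(use z order_trans[OF norm_ge_zero pieceD(4)[OF w1, of p r "{}"]] in auto)
		thus "norm ((?X z p q) r S) \<le> N * (K1 * K2) * (case z of (p, q) => \<beta>1 p * \<beta>2 q)"
			unfolding z by (simp add: N_def mult_ac)
	qed
	thus ?thesis by blast
qed

lemma pgood_wedge:
	assumes "pgood P1 \<beta>1 w1" "pgood P2 \<beta>2 w2" and sf: "sigma_finite_measure P2"
	shows "pgood (P1 \<Otimes>\<^sub>M P2) (%(p, q). \<beta>1 p * \<beta>2 q) (%(p, q) r. w1 p r \<and>\<^sub>g w2 q r)"
	using assms(1)
proof induction
	case w1: (pgood_piece A C K w1)
	show ?case using assms(2)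
	proof induction
		case (pgood_piece A2 C2 K2 w2)
		show ?case using piece_wedge[OF w1 pgood_piece sf] by (auto intro: pgood.pgood_piece)
	next case (pgood_add v1 v2)
		from pgood.pgood_add[OF pgood_add.IH] show ?case
			by (rule pgood_cong_fun) (intro ext, simp add: gwedge_add_right gwedge_add_right[unfolded plus_fun_def] split: prod.split)
	qed
next case (pgood_add v1 v2)
	from pgood.pgood_add[OF pgood_add.IH] show ?case
		by (rule pgood_cong_fun) (intro ext, simp add: gwedge_add_left gwedge_add_left[unfolded plus_fun_def] split: prod.split)
qed

lemma integral_product:
	fixes f g :: "_ => complex"
	assumes "sigma_finite_measure P" "sigma_finite_measure P'" "integrable P f" "integrable P' g"
	shows "integrable (P \<Otimes>\<^sub>M P') (%(p, q). f p * g q)"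
		and "(\<integral>z. (case z of (p, q) => f p * g q) \<partial>(P \<Otimes>\<^sub>M P')) = (\<integral>p. f p \<partial>P) * (\<integral>q. g q \<partial>P')"
proof -
	interpret pair_sigma_finite P P' by (rule pair_sigma_finite.intro) fact+
	have [measurable]: "f \<in> borel_measurable P" "g \<in> borel_measurable P'" using assms by auto
	show int: "integrable (P \<Otimes>\<^sub>M P') (%(p, q). f p * g q)"
		by (rule Fubini_integrable) (use assms in "auto simp: norm_mult")
	show "(\<integral>z. (case z of (p, q) => f p * g q) \<partial>(P \<Otimes>\<^sub>M P')) = (\<integral>p. f p \<partial>P) * (\<integral>q. g q \<partial>P')"
		by (subst integral_fst'[symmetric, OF int]) simp
qed

lemma integral_wedge:
	assumes w1: "pgood P1 \<beta>1 w1" and w2: "pgood P2 \<beta>2 w2"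
		and sf: "sigma_finite_measure P1" "sigma_finite_measure P2"
	shows "(\<integral>z. (case z of (p, q) => w1 p r \<and>\<^sub>g w2 q r) S \<partial>(P1 \<Otimes>\<^sub>M P2)) =
		((%S. \<integral>p. w1 p r S \<partial>P1) \<and>\<^sub>g (%S. \<integral>q. w2 q r S \<partial>P2)) S"
proof -
	note i = pgood_integrable[OF w1] pgood_integrable[OF w2]
	have "(\<integral>z. (case z of (p, q) => w1 p r \<and>\<^sub>g w2 q r) S \<partial>(P1 \<Otimes>\<^sub>M P2)) =
			(\<integral>z. (\<Sum>T\<in>Pow S. isg T (S - T) * (case z of (p, q) => w1 p r T * w2 q r (S - T))) \<partial>(P1 \<Otimes>\<^sub>M P2))"
		by (intro Bochner_Integration.integral_cong) (auto simp: gwedge_isg mult_ac)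
	also have "... = (\<Sum>T\<in>Pow S. isg T (S - T) * ((\<integral>p. w1 p r T \<partial>P1) * (\<integral>q. w2 q r (S - T) \<partial>P2)))"
		by (subst Bochner_Integration.integral_sum)
			(auto intro!: integrable_mult_right integral_product i sf simp: integral_product[OF sf i])
	finally show ?thesis by (simp add: gwedge_isg mult_ac)
qed

lemma good_wedge:
	assumes "good f" "good g"
	shows "good (%r. f r \<and>\<^sub>g g r)"
proof -
	have pp: "point \<Otimes>\<^sub>M point = count_space (UNIV :: (unit \<times> unit) set)" by (simp add: pair_measure_countable)
	have d: "distr point (count_space UNIV) (%_. ((), ())) = count_space (UNIV :: (unit \<times> unit) set)"
		by (rule distr_bij_count_space) (auto simp: bij_betw_def inj_on_def)
	from pgood_transport[OF pgood_wedge[OF assms[unfolded good_def] sigma_finite_point], of "%_. ((), ())" point]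
	show ?thesis unfolding good_def pp using d by simp
qed

subsection \<open>Flowing along a lattice direction\<close>

lemma norm_vcontr_le:
	"norm (vcontr c a S) \<le> (\<Sum>g\<in>UNIV. norm (c g)) * (\<Sum>U\<in>UNIV. norm (a U))"
proof -
	have "norm (gcontr g a S) \<le> (\<Sum>U\<in>UNIV. norm (a U))" for g
		by (auto simp: gcontr_def norm_mult norm_power intro!: sum_nonneg member_le_sum)
	hence "norm (vcontr c a S) \<le> (\<Sum>g\<in>UNIV. norm (c g) * (\<Sum>U\<in>UNIV. norm (a U)))"
		unfolding vcontr_def by (intro order_trans[OF norm_sum] sum_mono) (simp add: norm_mult mult_left_mono)
	thus ?thesis by (simp add: sum_distrib_right)
qed

lemma norm_rp_le:
	obtains k where "0 \<le> k"
		"!!a S. norm (rp (m::real^'n::{finite,linorder}) a S) \<le> k * (\<Sum>U\<in>UNIV. norm (a U))"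
proof
	let ?R = "\<Sum>g\<in>UNIV. norm (cR m g)" and ?P = "\<Sum>g\<in>UNIV. norm (cP m g)"
		and ?N = "real (card (UNIV :: 'n gen set set))"
	have nn: "0 \<le> ?R" "0 \<le> ?P" by (auto intro: sum_nonneg)
	thus "0 \<le> ?R * (?N * ?P)" by simp
	fix a :: "'n gen ext" and S
	have "norm (rp m a S) \<le> ?R * (\<Sum>U\<in>UNIV. norm (vcontr (cP m) a U))" unfolding rp_def by (rule norm_vcontr_le)
	also have "... \<le> ?R * (\<Sum>U\<in>(UNIV :: 'n gen set set). ?P * (\<Sum>U\<in>UNIV. norm (a U)))"
		by (intro mult_left_mono sum_mono norm_vcontr_le nn)
	finally show "norm (rp m a S) \<le> ?R * (?N * ?P) * (\<Sum>U\<in>UNIV. norm (a U))" by (simp add: mult.assoc)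
qed

lemma nn_integral_exp_abs: "(\<integral>\<^sup>+x. ennreal (exp (- (\<bar>x\<bar> / 2))) \<partial>lborel) \<le> ennreal 4"
proof -
	let ?Y = "\<integral>\<^sup>+x. ennreal (exp (- (- x / 2))) * indicator {0..} (- x) \<partial>lborel"
	let ?X = "\<integral>\<^sup>+x. ennreal (exp (- (x / 2))) * indicator {0..} x \<partial>lborel"
	have 1: "?X = ennreal (0 - (- 2 * exp (- (0 / 2))))"
	proof (rule nn_integral_FTC_atLeast)
		show "((%x::real. - 2 * exp (- (x / 2))) \<longlongrightarrow> 0) at_top"
		proof -
			have "((%x::real. - 2 * exp (- (1/2 * x))) \<longlongrightarrow> - 2 * 0) at_top"
				by (intro tendsto_intros filterlim_compose[OF exp_at_bot] filterlim_compose[OF filterlim_uminus_at_bot_at_top]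
						filterlim_tendsto_pos_mult_at_top[OF tendsto_const] filterlim_ident) auto
			thus ?thesis by simp
		qed
	qed (auto intro!: derivative_eq_intros)
	have "(\<integral>\<^sup>+x. ennreal (exp (- (\<bar>x\<bar> / 2))) \<partial>lborel) \<le>
			(\<integral>\<^sup>+x. ennreal (exp (- (x / 2))) * indicator {0..} x + ennreal (exp (- (- x / 2))) * indicator {0..} (- x) \<partial>lborel)"
		by (intro nn_integral_mono) (auto simp: indicator_def)
	also have "... = ?X +
			?Y" by (rule nn_integral_add) auto
	also have "?Y =
			?X" by (subst nn_integral_real_affine[where c = "-1" and t = 0]) auto
	finally show ?thesis unfolding 1 by (simp flip: ennreal_plus)
qed

lemma nn_integral_exp_affine:
	assumes "y ~= 0"
	shows "(\<integral>\<^sup>+t. ennreal (exp (- (\<bar>x - t * y\<bar> / 2))) \<partial>lborel) \<le> ennreal (4 / \<bar>y\<bar>)"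
proof -
	let ?X = "%x. \<integral>\<^sup>+t. ennreal (exp (- (\<bar>x - t * y\<bar> / 2))) \<partial>lborel"
	have "ennreal \<bar>y\<bar> * (?X x) =
			(\<integral>\<^sup>+x. ennreal (exp (- (\<bar>x\<bar> / 2))) \<partial>lborel)"
		using assms by (subst (2) nn_integral_real_affine[where c = "- y" and t = x]) (auto simp: mult.commute)
	also have "... \<le> ennreal 4" by (rule nn_integral_exp_abs)
	finally have "ennreal (1 / \<bar>y\<bar>) * (ennreal \<bar>y\<bar> * (?X x)) \<le>
			ennreal (1 / \<bar>y\<bar>) * ennreal 4" by (rule mult_left_mono) simp
	thus ?thesis using assms by (simp add: mult.assoc[symmetric] ennreal_mult[symmetric] del: ennreal_numeral)
qed

text \<open>
  The covectors transversal to the flow: one covector \<open>x0\<close> with \<open>x0 \<bullet> m \<noteq> 0\<close> is used up by the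
  integration along \<open>m\<close>, the others are projected along \<open>m\<close>.
\<close>

lemma transversal:
	fixes A :: "(real^'n::{finite,linorder}) list"
	obtains A' c where "!!a. basic A a ==> basic A' (rp m a)"
		"(\<forall>a. basic A a --> rp m a = 0) |
		 (\<forall>r. (\<integral>\<^sup>+t. edec A (r - t *\<^sub>R m) \<partial>lborel) \<le> ennreal c * edec A' r)"
proof (cases "\<forall>x\<in>set A. x \<bullet> m = 0")
	\<comment> \<open>No covector sees \<open>m\<close>, so \<open>m\<close> lies in the common kernel
	  and the contraction with it vanishes. Nothing is left to integrate along the flow.\<close>
	case True
	have "rp m a = 0" if "basic A a" for a
	proof -
		have "vcontr (cR m) a = 0" using basicD[OF that] True by blast
		thus ?thesis unfolding rp_def vcontr_anticomm[of "cR m"] by simp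
	qed
	thus ?thesis using that[of "[]" 0] by (simp add: basic_zero)
next case False
	then obtain x0 where x0: "x0 \<in> set A" "x0 \<bullet> m ~= 0" by blast
	\<comment> \<open>The covector \<open>f x\<close> vanishes on \<open>m\<close>, hence is constant
	  along the flow. The scale \<open>e\<close> makes the total decay of the projected covectors at
	  most half of \<open>dec A\<close>; the other half dominates
	  \<open>\<bar>x0 \<bullet> (r - t *\<^sub>R m)\<bar> / 2\<close> and pays for the integral over
	  \<open>t\<close>.\<close>
	define B where "B = 1 + (\<Sum>x\<leftarrow>A. \<bar>x \<bullet> m\<bar> / \<bar>x0 \<bullet> m\<bar>)"
	define e where "e = 1 / (2 * (real (length A) * B))"
	define f where "f x = e *\<^sub>R (x - ((x \<bullet> m) / (x0 \<bullet> m)) *\<^sub>R x0)" for x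
	have B: "B \<ge> 1" unfolding B_def by (auto intro!: sum_list_nonneg)
	have L: "length A > 0" using x0(1) by auto
	have "e > 0" unfolding e_def using B L by (auto intro!: mult_pos_pos)
	note pos = B L this
	have fm: "f x \<bullet> (r - t *\<^sub>R m) = f x \<bullet> r" for x r t
		using x0(2) by (simp add: f_def inner_diff_left inner_diff_right algebra_simps)
	have le_dec: "\<bar>x \<bullet> r\<bar> \<le> dec A r" if "x \<in> set A" for x r
		unfolding dec_def by (rule member_le_sum_list) (use that in auto)
	have bound: "\<bar>f x \<bullet> r\<bar> \<le> e * (B * dec A r)" if "x \<in> set A" for x r
	proof -
		have q: "1 + \<bar>x \<bullet> m\<bar> / \<bar>x0 \<bullet> m\<bar> \<le> B"
			unfolding B_def by (intro add_left_mono member_le_sum_list) (use that in auto)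
		have "\<bar>f x \<bullet> r\<bar> = e * \<bar>x \<bullet> r - ((x \<bullet> m) / (x0 \<bullet> m)) * (x0 \<bullet> r)\<bar>"
			using pos by (simp add: f_def inner_diff_left abs_mult)
		also have "... \<le> e * (\<bar>x \<bullet> r\<bar> + (\<bar>x \<bullet> m\<bar> / \<bar>x0 \<bullet> m\<bar>) * \<bar>x0 \<bullet> r\<bar>)"
			using pos by (intro mult_left_mono) (auto simp: abs_mult[symmetric] abs_divide[symmetric] simp del: abs_mult abs_divide intro: order_trans[OF abs_triangle_ineq4])
		also have "... \<le> e * (dec A r + (\<bar>x \<bullet> m\<bar> / \<bar>x0 \<bullet> m\<bar>) * dec A r)"
			using pos that x0 by (intro mult_left_mono add_mono le_dec) auto
		also have "... = e * ((1 + \<bar>x \<bullet> m\<bar> / \<bar>x0 \<bullet> m\<bar>) * dec A r)" by (simp add: algebra_simps)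
		also have "... \<le> e * (B * dec A r)" using pos by (intro mult_left_mono mult_right_mono q dec_nonneg) auto
		finally show ?thesis .
	qed
	have main: "dec (map f A) r \<le> dec A r / 2" for r
	proof -
		have "dec (map f A) r \<le> (\<Sum>x\<leftarrow>A. e * (B * dec A r))"
			unfolding dec_def[of "map f A"] map_map o_def by (rule sum_list_mono) (rule bound)
		also have "... = dec A r / 2" using pos by (simp add: sum_list_triv e_def)
		finally show ?thesis .
	qed
	have drift: "dec (map f A) (r - t *\<^sub>R m) = dec (map f A) r" for r t by (simp add: dec_def o_def fm)
	show ?thesis
	proof (rule that[of "map f A" "4 / \<bar>x0 \<bullet> m\<bar>"])
		fix a assume a: "basic A a"
		show "basic (map f A) (rp m a)" unfolding basic_def
		proof (intro allI impI)
			fix v assume v: "\<forall>x\<in>set (map f A). x \<bullet> v = 0"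
			\<comment> \<open>Subtracting \<open>k\<close> times \<open>m\<close> moves \<open>v\<close> into
			  the kernel of all of \<open>A\<close>, and contraction with \<open>m\<close> annihilates
			  \<open>rp m a\<close> anyway.\<close>
			define k where "k = (x0 \<bullet> v) / (x0 \<bullet> m)"
			define u where "u = v + (- k) *\<^sub>R m"
			have "x \<bullet> u = 0" if "x \<in> set A" for x
			proof -
				have "f x \<bullet> v = 0" using v that by auto
				hence "x \<bullet> v = (x \<bullet> m) / (x0 \<bullet> m) * (x0 \<bullet> v)" using pos by (simp add: f_def inner_diff_left)
				thus ?thesis by (simp add: u_def k_def inner_diff_right algebra_simps)
			qed
			hence u: "vcontr (cR u) a = 0" using basicD[OF a] by blast
			have v: "v = u + k *\<^sub>R m" by (simp add: u_def)
			have "vcontr (cR u) (rp m a) = 0" unfolding rp_def vcontr_anticomm[of "cR u" "cR m"] vcontr_anticomm[of "cR u" "cP m"] u by simp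
			moreover have "vcontr (cR m) (rp m a) = 0" unfolding rp_def by (rule vcontr_square)
			ultimately show "vcontr (cR v) (rp m a) = 0" unfolding v cR_lincomb vcontr_lincomb by (simp add: fun_eq_iff)
		qed
	next
		have "(\<integral>\<^sup>+t. edec A (r - t *\<^sub>R m) \<partial>lborel) \<le>
				ennreal (4 / \<bar>x0 \<bullet> m\<bar>) * edec (map f A) r" for r
		proof -
			have "exp (- dec A (r - t *\<^sub>R m)) \<le> exp (- (\<bar>x0 \<bullet> r - t * (x0 \<bullet> m)\<bar> / 2)) * exp (- dec (map f A) r)" for t
				using main[of "r - t *\<^sub>R m"] le_dec[OF x0(1), of "r - t *\<^sub>R m"] by (simp add: exp_add[symmetric] drift inner_diff_right)
			hence "(\<integral>\<^sup>+t. edec A (r - t *\<^sub>R m) \<partial>lborel) \<le>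
					(\<integral>\<^sup>+t. ennreal (exp (- (\<bar>x0 \<bullet> r - t * (x0 \<bullet> m)\<bar> / 2))) * edec (map f A) r \<partial>lborel)"
				by (intro nn_integral_mono) (simp add: ennreal_mult[symmetric] ennreal_leI)
			also have "... = (\<integral>\<^sup>+t. ennreal (exp (- (\<bar>x0 \<bullet> r - t * (x0 \<bullet> m)\<bar> / 2))) \<partial>lborel) * edec (map f A) r"
				by (rule nn_integral_multc) auto
			also have "... \<le> ennreal (4 / \<bar>x0 \<bullet> m\<bar>) * edec (map f A) r"
				by (intro mult_right_mono nn_integral_exp_affine x0) auto
			finally show ?thesis .
		qed
		thus "(\<forall>a. basic A a --> rp m a = 0) | (\<forall>r. (\<integral>\<^sup>+t. edec A (r - t *\<^sub>R m) \<partial>lborel) \<le>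
				ennreal (4 / \<bar>x0 \<bullet> m\<bar>) * edec (map f A) r)" by blast
	qed
qed

lemma vcontr_measurable:
	assumes "!!S. (%x. f x S) \<in> borel_measurable M"
	shows "(%x. vcontr c (f x) S) \<in> borel_measurable M"
proof -
	have "(%x. gcontr g (f x) S) \<in> borel_measurable M" for g using assms by (cases "g \<in> S") (simp_all add: gcontr_def)
	thus ?thesis unfolding vcontr_def by simp
qed

lemma rp_measurable:
	assumes "!!S. (%x. f x S) \<in> borel_measurable M"
	shows "(%x. rp m (f x) S) \<in> borel_measurable M" unfolding rp_def by (intro vcontr_measurable assms)

lemma rp_integral:
	assumes "!!S. integrable P (%p. f p S)"
	shows "rp m (%S. \<integral>p. f p S \<partial>P) = (%S. \<integral>p. rp m (f p) S \<partial>P)"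
		and "integrable P (%p. rp m (f p) S)" unfolding rp_def by (simp_all add: vcontr_integral assms)

lemma measurable_flow:
	fixes w :: "'p => ('n::{finite,linorder}) form"
	assumes w: "!!S. (%(p, r). w p r S) \<in> borel_measurable (P \<Otimes>\<^sub>M borel)"
		and p: "f \<in> measurable M P" and t: "s \<in> borel_measurable M" and r: "g \<in> borel_measurable M"
	shows "(%x. rp m (w (f x) (g x - s x *\<^sub>R m)) S) \<in> borel_measurable M"
proof (rule rp_measurable)
	fix S
	have "(%x. (f x, g x - s x *\<^sub>R m)) \<in> measurable M (P \<Otimes>\<^sub>M borel)" using p t r by measurable
	from measurable_compose[OF this w[of S]]
	show "(%x. w (f x) (g x - s x *\<^sub>R m) S) \<in> borel_measurable M" by simp
qed

lemma piece_flow: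
	fixes w :: "'p => ('n::{finite,linorder}) form"
	assumes w: "piece P \<beta> A C K w" and sf: "sigma_finite_measure P"
	obtains A' C' where "!!p r. p \<in> space P ==> basic A' (rp m (w p r))"
		"!!r S. (\<integral>\<^sup>+t. \<integral>\<^sup>+p. ennreal (norm (rp m (w p (r - t *\<^sub>R m)) S)) \<partial>P \<partial>lborel) \<le>
			 ennreal C' * edec A' r"
proof -
	let ?Y = "%r S. \<integral>\<^sup>+t. \<integral>\<^sup>+p. ennreal (norm (rp m (w p (r - t *\<^sub>R m)) S)) \<partial>P \<partial>lborel"
	let ?X = "%r. \<integral>\<^sup>+t. edec A (r - t *\<^sub>R m) \<partial>lborel"
	obtain A' c where b: "!!a. basic A a ==> basic A' (rp m a)"
		and alt: "(\<forall>a. basic A a --> rp m a = 0) |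
		 (\<forall>r. (?X r) \<le> ennreal c * edec A' r)" using transversal[of A m] by metis
	obtain k where k: "0 \<le> k" "!!a S. norm (rp m a S) \<le> k * (\<Sum>U\<in>UNIV. norm (a U))" using norm_rp_le[of m] by metis
	have m [measurable]: "(%p. w p r S) \<in> borel_measurable P" for r S by (rule measurable_section[OF pieceD(1)[OF w]])
	let ?N = "real (card (UNIV :: 'n gen set set))"
	have "(?Y r S) \<le>
			ennreal (k * ?N * max C 0 * max c 0) * edec A' r" for r S using alt
	proof
		assume "\<forall>a. basic A a --> rp m a = 0"
		hence "(\<integral>\<^sup>+p. ennreal (norm (rp m (w p (r - t *\<^sub>R m)) S)) \<partial>P) = 0" for t
			by (subst nn_integral_cong[of _ _ "%_. 0"]) (auto simp: pieceD(2)[OF w])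
		thus ?thesis by simp
	next
		assume c: "\<forall>r. (?X r) \<le> ennreal c * edec A' r"
		have "(\<integral>\<^sup>+p. ennreal (norm (rp m (w p r) S)) \<partial>P) \<le> ennreal (k * ?N * max C 0) * edec A r" for r
		proof -
			have "(\<integral>\<^sup>+p. ennreal (norm (rp m (w p r) S)) \<partial>P) \<le> (\<integral>\<^sup>+p. ennreal k * (\<Sum>U\<in>UNIV. ennreal (norm (w p r U))) \<partial>P)"
				using k by (intro nn_integral_mono) (simp add: sum_ennreal ennreal_mult[symmetric] sum_nonneg ennreal_leI)
			also have "... = ennreal k * (\<Sum>U\<in>UNIV. (\<integral>\<^sup>+p. ennreal (norm (w p r U)) \<partial>P))"
				by (simp add: nn_integral_cmult nn_integral_sum del: sum_ennreal)
			also have "... \<le> ennreal k * (\<Sum>U\<in>(UNIV :: 'n gen set set). ennreal (max C 0) * edec A r)"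
				by (intro mult_left_mono sum_mono) (auto simp: ennreal_max_zero pieceD(3)[OF w])
			also have "... = ennreal (k * ?N * max C 0) * edec A r"
			proof -
				have "of_nat (card (UNIV :: 'n gen set set)) = ennreal ?N" by (simp add: ennreal_of_nat_eq_real_of_nat del: card_UNIV_set)
				thus ?thesis using k(1) by (simp only: sum_constant) (simp add: ennreal_mult mult.assoc)
			qed
			finally show ?thesis .
		qed
		hence "(?Y r S) \<le>
				(\<integral>\<^sup>+t. ennreal (k * ?N * max C 0) * edec A (r - t *\<^sub>R m) \<partial>lborel)" by (intro nn_integral_mono) simp
		also have "... = ennreal (k * ?N * max C 0) * (?X r)" by (rule nn_integral_cmult) (simp add: dec_def sum_list_sum_nth)
		also have "... \<le> ennreal (k * ?N * max C 0) * (ennreal (max c 0) * edec A' r)"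
			using c by (intro mult_left_mono) (auto simp: ennreal_max_zero)
		also have "... = ennreal (k * ?N * max C 0 * max c 0) * edec A' r" using k(1) by (simp add: ennreal_mult mult.assoc)
		finally show ?thesis .
	qed
	thus thesis using that b pieceD(2)[OF w] by blast
qed

text \<open>Integrand of one edge. Its length \<open>t\<close> joins the parameters, and integrating
  over it gives the propagator up to the angular factor.\<close>

definition drift :: "real^'n::{finite,linorder} => ('p => 'n form) => 'p \<times> real => 'n form" where
	"drift m w = (%(p, t) r S. of_bool (t > 0) * rp m (w p (r - t *\<^sub>R m)) S)"

lemma flow_add: "drift m (%p r. w1 p r + w2 p r) = (%z r. drift m w1 z r + drift m w2 z r)"
	by (auto simp: drift_def fun_eq_iff rp_add[unfolded plus_fun_def] plus_fun_def algebra_simps)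

lemma vcontr_of_bool: "vcontr c (%S. k * a S) = 0" if "vcontr c a = 0" using that by (simp add: vcontr_cmult fun_eq_iff)

lemma basic_cmult: "basic A a ==> basic A (%S. k * a S)" by (simp add: basic_def vcontr_of_bool)

lemma rp_bounded:
	fixes w :: "'p => ('n::{finite,linorder}) form"
	assumes "!!p r S. p \<in> X ==> norm (w p r S) \<le> K * \<beta> p"
	obtains K' where "0 \<le> K'" "!!p r S. p \<in> X ==> norm (rp m (w p r) S) \<le> (K' * K) * \<beta> p"
proof -
	obtain k where k: "0 \<le> k" "!!a S. norm (rp m a S) \<le> k * (\<Sum>U\<in>UNIV. norm (a U))" using norm_rp_le[of m] by metis
	let ?N = "real (card (UNIV :: 'n gen set set))"
	show thesis
	proof (rule that[of "k * ?N"])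
		fix p r S assume p: "p \<in> X"
		have "norm (rp m (w p r) S) \<le> k * (\<Sum>U\<in>(UNIV :: 'n gen set set). K * \<beta> p)"
			by (rule order_trans[OF k(2)], intro mult_left_mono sum_mono assms p k)
		thus "norm (rp m (w p r) S) \<le> k * ?N * K * \<beta> p" by (simp add: mult.assoc)
	qed (use k in simp)
qed

text \<open>The pointwise bound does not depend on the length \<open>t\<close>; convergence in
  \<open>t\<close> comes from the integrated bound of \<open>piece_flow\<close>.\<close>

lemma pgood_flow:
	fixes w :: "'p => ('n::{finite,linorder}) form"
	assumes "pgood P \<beta> w" and sf: "sigma_finite_measure P"
	shows "pgood (P \<Otimes>\<^sub>M lborel) (%(p, t). \<beta> p) (drift m w)" using assms(1)
proof induction
	case w: (pgood_piece A C K w)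
	interpret pair_sigma_finite P lborel by (rule pair_sigma_finite.intro[OF sf]) (rule sigma_finite_lborel)
	obtain A' C' where A': "!!p r. p \<in> space P ==> basic A' (rp m (w p r))"
		"!!r S. (\<integral>\<^sup>+t. \<integral>\<^sup>+p. ennreal (norm (rp m (w p (r - t *\<^sub>R m)) S)) \<partial>P \<partial>lborel) \<le>
			 ennreal C' * edec A' r" using piece_flow[OF w sf, of m] by metis
	obtain K' where K': "!!p r S. p \<in> space P ==> norm (rp m (w p r) S) \<le> (K' * K) * \<beta> p"
		using rp_bounded[of "space P" w K \<beta> m] pieceD(4)[OF w] by metis
	note mf = measurable_flow[OF pieceD(1)[OF w]]
	have "piece (P \<Otimes>\<^sub>M lborel) (%(p, t). \<beta> p) A' C' (K' * K) (drift m w)" unfolding piece_def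
	proof (intro conjI allI ballI)
		fix S
		have [measurable]: "(%x. rp m (w (fst (fst x)) (snd x - snd (fst x) *\<^sub>R m)) S) \<in> borel_measurable ((P \<Otimes>\<^sub>M lborel) \<Otimes>\<^sub>M borel)"
			by (rule mf) auto
		show "(%(z :: 'p \<times> real, r). drift m w z r S) \<in> borel_measurable ((P \<Otimes>\<^sub>M lborel) \<Otimes>\<^sub>M borel)"
			by (simp add: drift_def case_prod_beta')
	next
		fix z :: "'p \<times> real" and r assume "z \<in> space (P \<Otimes>\<^sub>M lborel)"
		thus "basic A' (drift m w z r)" by (auto simp: drift_def space_pair_measure intro!: basic_cmult A')
	next
		fix r S
		have [measurable]: "(%x. rp m (w (fst x) (r - snd x *\<^sub>R m)) S) \<in> borel_measurable (P \<Otimes>\<^sub>M lborel)"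
			by (rule mf) auto
		have "(\<integral>\<^sup>+z. ennreal (norm (drift m w z r S)) \<partial>(P \<Otimes>\<^sub>M lborel)) \<le>
				(\<integral>\<^sup>+z. ennreal (norm (rp m (w (fst z) (r - snd z *\<^sub>R m)) S)) \<partial>(P \<Otimes>\<^sub>M lborel))"
			by (intro nn_integral_mono) (auto simp: drift_def)
		also have "... = (\<integral>\<^sup>+t. \<integral>\<^sup>+p. ennreal (norm (rp m (w p (r - t *\<^sub>R m)) S)) \<partial>P \<partial>lborel)"
			by (subst nn_integral_snd[symmetric]) auto
		also have "... \<le> ennreal C' * edec A' r" by (rule A')
		finally show "(\<integral>\<^sup>+z. ennreal (norm (drift m w z r S)) \<partial>(P \<Otimes>\<^sub>M lborel)) \<le> ennreal C' * edec A' r" .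
	next
		fix z :: "'p \<times> real" and r S assume "z \<in> space (P \<Otimes>\<^sub>M lborel)"
		then obtain p t where z: "z = (p, t)" "p \<in> space P" by (auto simp: space_pair_measure)
		have "norm (drift m w z r S) \<le> norm (rp m (w p (r - t *\<^sub>R m)) S)" by (auto simp: drift_def z)
		also have "... \<le> (K' * K) * \<beta> p" by (rule K'[OF z(2)])
		finally show "norm (drift m w z r S) \<le> K' * K * (case z of (p, t) => \<beta> p)" by (simp add: z)
	qed
	thus ?case by (rule pgood.pgood_piece)
next case (pgood_add w1 w2)
	from pgood.pgood_add[OF pgood_add.IH] show ?case unfolding flow_add .
qed

subsection \<open>Forms of top degree\<close>

text \<open>By homogeneity it suffices to take the minimum over the compact unit sphere, which is
  positive because the common kernel is trivial.\<close>

lemma dec_ge_norm: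
	fixes A :: "(real^'n::{finite,linorder}) list"
	assumes "!!v. (\<forall>x\<in>set A. x \<bullet> v = 0) ==> v = 0"
	obtains d where "d > 0" "!!r. d * norm r \<le> dec A r"
proof -
	have cont: "continuous_on (sphere 0 1) (dec A)" unfolding dec_def by (induction A) (auto intro!: continuous_intros)
	have ne: "sphere (0::(real,'n) vec) 1 ~= {}" by simp
	obtain x where x: "x \<in> sphere 0 1" "!!y. y \<in> sphere 0 1 ==> dec A x \<le> dec A y"
		using continuous_attains_inf[OF compact_sphere ne cont] by blast
	have "dec A x ~= 0"
	proof
		assume "dec A x = 0"
		hence "\<forall>a\<in>set A. a \<bullet> x = 0" unfolding dec_def by (subst (asm) sum_list_nonneg_eq_0_iff) auto
		hence "x = 0" by (rule assms)
		thus False using x(1) by simp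
	qed
	hence "dec A x > 0" using dec_nonneg[of A x] by simp
	moreover have "dec A x * norm r \<le> dec A r" for r
	proof (cases "r = 0")
		case False
		have "dec A (r /\<^sub>R norm r) = dec A r / norm r"
			using False by (simp add: dec_def abs_mult divide_inverse_commute sum_list_const_mult)
		moreover have "dec A x \<le> dec A (r /\<^sub>R norm r)" using False by (intro x(2)) simp
		ultimately have "dec A x \<le> dec A r / norm r" by simp
		thus ?thesis using False by (simp add: pos_le_divide_eq)
	qed (simp add: dec_nonneg)
	ultimately show thesis using that by blast
qed

lemma nn_integral_exp_norm:
	fixes d :: real
	assumes "d > 0"
	shows "(\<integral>\<^sup>+r. ennreal (exp (- (d * norm (r :: real^'n)))) \<partial>lborel) < \<infinity>"
proof -
	let ?X = "%c. \<integral>\<^sup>+x. ennreal (exp (- (c * \<bar>x\<bar>))) \<partial>lborel"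
	\<comment> \<open>Each coordinate is at most the norm. After division by the dimension the
	  coordinate terms add up to at most \<open>d * norm r\<close>, and the resulting bound is a
	  product over coordinates.\<close>
	define c where "c = d / real (DIM(real^'n))"
	have c: "c > 0" using assms by (simp add: c_def)
	have "exp (- (d * norm r)) \<le> (\<Prod>b\<in>Basis. exp (- (c * \<bar>r \<bullet> b\<bar>)))" for r :: "real^'n"
	proof -
		have "(\<Sum>b\<in>Basis. c * \<bar>r \<bullet> b\<bar>) \<le> (\<Sum>b\<in>(Basis :: (real^'n) set). c * norm r)"
			using c by (intro sum_mono mult_left_mono Basis_le_norm) auto
		also have "... = d * norm r" by (simp add: c_def)
		finally show ?thesis by (simp add: exp_sum[symmetric] sum_negf)
	qed
	hence "(\<integral>\<^sup>+r. ennreal (exp (- (d * norm (r :: real^'n)))) \<partial>lborel) \<le>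
			(\<integral>\<^sup>+r. (\<Prod>b\<in>Basis. ennreal (exp (- (c * \<bar>(r :: real^'n) \<bullet> b\<bar>)))) \<partial>lborel)"
		by (intro nn_integral_mono) (simp add: prod_ennreal ennreal_leI)
	also have "... = (\<Prod>b\<in>(Basis :: (real^'n) set). (?X c))" by (rule nn_integral_lborel_prod) auto
	also have "... < \<infinity>"
	proof -
		have "(?X c) \<le> ennreal (4 / \<bar>2 * c\<bar>)" using nn_integral_exp_affine[of "2 * c" 0] c by (simp add: abs_mult mult_ac)
		hence "(?X c) < \<infinity>" using le_less_trans ennreal_less_top by (metis infinity_ennreal_def)
		thus ?thesis by (simp add: power_less_top_ennreal)
	qed
	finally show ?thesis .
qed

text \<open>For any \<open>j\<close> with \<open>v $ j\<close> nonzero, the contraction with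
  \<open>v\<close> at the complement of \<open>Rad j\<close> is a nonzero multiple of the top
  coefficient.\<close>

lemma basic_top:
	assumes "basic A a" "v ~= 0" "!!x. x \<in> set A ==> x \<bullet> v = 0"
	shows "a UNIV = 0"
proof -
	obtain j where j: "v $ j ~= 0" using assms(2) by (auto simp: vec_eq_iff)
	have "0 = vcontr (cR v) a (UNIV - {Rad j})" using basicD[OF assms(1,3)] by simp
	also have "... = (\<Sum>i\<in>UNIV. if i = j then of_real (v $ j) * gcontr (Rad j) a (UNIV - {Rad j}) else 0)"
		unfolding vcontr_cR by (intro sum.cong) (auto simp: gcontr_def)
	also have "... = of_real (v $ j) * ((-1) ^ card {h \<in> UNIV - {Rad j}. h < Rad j} * a UNIV)" by (simp add: gcontr_def insert_UNIV)
	finally show ?thesis using j by simp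
qed

text \<open>Either the covectors have a common zero direction and the top coefficient vanishes by
  \<open>basic_top\<close>, or \<open>dec\<close> dominates a multiple of the norm and the decay is
  integrable.\<close>

lemma pgood_top:
	fixes w :: "'p => ('n::{finite,linorder}) form"
	assumes "pgood P \<beta> w" and sf: "sigma_finite_measure P"
	shows "integrable (lborel \<Otimes>\<^sub>M P) (%(r, p). w p r UNIV)" using assms(1)
proof induction
	case w: (pgood_piece A C K w)
	interpret sigma_finite_measure P by fact
	have [measurable]: "(%(r, p). w p r UNIV) \<in> borel_measurable (lborel \<Otimes>\<^sub>M P)"
		using measurable_compose[OF measurable_pair_swap' pieceD(1)[OF w, of UNIV]]
		by (simp add: case_prod_beta' measurable_cong_sets[OF sets_pair_measure_cong[OF sets_lborel refl] refl])
	show ?case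
	proof (rule integrableI_bounded)
		have "(\<integral>\<^sup>+z. ennreal (norm (case z of (r, p) => w p r UNIV)) \<partial>(lborel \<Otimes>\<^sub>M P)) =
				(\<integral>\<^sup>+r. \<integral>\<^sup>+p. ennreal (norm (w p r UNIV)) \<partial>P \<partial>lborel)"
			by (subst nn_integral_fst[symmetric]) auto
		also have "... < \<infinity>"
		proof (cases "\<exists>v. v ~= 0 & (\<forall>x\<in>set A. x \<bullet> v = 0)")
			case True
			hence "w p r UNIV = 0" if "p \<in> space P" for p r using basic_top pieceD(2)[OF w that] by blast
			hence "(\<integral>\<^sup>+p. ennreal (norm (w p r UNIV)) \<partial>P) = 0" for r
				by (subst nn_integral_cong[of _ _ "%_. 0"]) auto
			thus ?thesis by simp
		next case False
			then obtain d where d: "d > 0" "!!r. d * norm r \<le> dec A r" using dec_ge_norm[of A] by blast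
			have "(\<integral>\<^sup>+r. \<integral>\<^sup>+p. ennreal (norm (w p r UNIV)) \<partial>P \<partial>lborel) \<le>
					(\<integral>\<^sup>+r. ennreal C * ennreal (exp (- (d * norm (r :: (real,'n) vec)))) \<partial>lborel)"
			proof (rule nn_integral_mono)
				fix r
				have "ennreal C * edec A r \<le> ennreal C * ennreal (exp (- (d * norm r)))"
					using d(2)[of r] by (intro mult_left_mono ennreal_leI) auto
				thus "(\<integral>\<^sup>+p. ennreal (norm (w p r UNIV)) \<partial>P) \<le> ennreal C * ennreal (exp (- (d * norm r)))"
					by (rule order_trans[OF pieceD(3)[OF w]])
			qed
			also have "... = ennreal C * (\<integral>\<^sup>+r. ennreal (exp (- (d * norm (r :: (real,'n) vec)))) \<partial>lborel)"
				by (rule nn_integral_cmult) auto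
			also have "... < \<infinity>" using nn_integral_exp_norm[OF d(1), where 'n = 'n] by (auto simp: ennreal_mult_less_top)
			finally show ?thesis .
		qed
		finally show "(\<integral>\<^sup>+z. ennreal (norm (case z of (r, p) => w p r UNIV)) \<partial>(lborel \<Otimes>\<^sub>M P)) < \<infinity>" .
	qed fact
next case (pgood_add w1 w2)
	from Bochner_Integration.integrable_add[OF pgood_add.IH] show ?case by (simp add: case_prod_beta')
qed

lemma good_top: 
	assumes "good f"
	shows "integrable lborel (%r. f r UNIV)"
proof -
	interpret pair_sigma_finite lborel point by (rule pair_sigma_finite.intro[OF sigma_finite_lborel sigma_finite_point])
	from integrable_fst'[OF pgood_top[OF assms[unfolded good_def] sigma_finite_point]] show ?thesis by (simp add: integral_point)
qed

subsection \<open>The Dyson step\<close>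

text \<open>Duhamel integral for one order of the Dyson series, with the perturbation already
  reduced to the two contractions.\<close>

definition volt :: "real^'n::{finite,linorder} => (real => 'n form) => real => 'n form" where
	"volt m w t r S = (LINT s:{0..t}|lborel. rp m (w s (r - (t - s) *\<^sub>R m)) S)"

lemma set_integrable_volt:
	assumes w: "pgood lborel (%s. exp \<bar>s\<bar>) w"
	shows "set_integrable lborel {0..t} (%s. w s (r - (t - s) *\<^sub>R m) S)"
proof -
	obtain K where K: "!!s r S. norm (w s r S) \<le> K * exp \<bar>s\<bar>" using pgood_bounded[OF w] by auto
	have "(%s. (s, r - (t - s) *\<^sub>R m)) \<in> measurable lborel (lborel \<Otimes>\<^sub>M borel)" by measurable
	from measurable_compose[OF this pgood_measurable[OF w, of S]]
	have [measurable]: "(%s. w s (r - (t - s) *\<^sub>R m) S) \<in> borel_measurable lborel" by simp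
	show ?thesis unfolding set_integrable_def
	proof (rule integrableI_bounded_set_indicator[where B = "\<bar>K\<bar> * exp \<bar>t\<bar>"])
		show "AE s\<in>{0..t} in lborel. norm (w s (r - (t - s) *\<^sub>R m) S) \<le> \<bar>K\<bar> * exp \<bar>t\<bar>"
		proof (intro AE_I2 impI)
			fix s assume "s \<in> {0..t}"
			hence "K * exp \<bar>s\<bar> \<le> \<bar>K\<bar> * exp \<bar>t\<bar>" by (intro mult_mono) auto
			thus "norm (w s (r - (t - s) *\<^sub>R m) S) \<le> \<bar>K\<bar> * exp \<bar>t\<bar>" by (rule order_trans[OF K])
		qed
	qed (auto simp: emeasure_lborel_Icc_eq)
qed

lemma rp_cmult: "rp m (%S. k * a S) = (%S. k * rp m a S)" by (simp add: rp_def vcontr_cmult)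

lemma vcontr_volt:
	assumes w: "pgood lborel (%s. exp \<bar>s\<bar>) w"
	shows "set_integrable lborel {0..t} (%s. rp m (w s (r - (t - s) *\<^sub>R m)) S)"
		and "vcontr c (volt m w t r) S = (LINT s:{0..t}|lborel. vcontr c (rp m (w s (r - (t - s) *\<^sub>R m))) S)"
proof -
	let ?X = "%s. r - (t - s) *\<^sub>R m"
	have i: "integrable lborel (%s. of_real (indicator {0..t} s) * w s (?X s) S)" for S
		using set_integrable_volt[OF w, of t r m S] by (simp add: set_integrable_def scaleR_conv_of_real)
	from rp_integral(2)[OF this, of m]
	have i2: "integrable lborel (%s. of_real (indicator {0..t} s) * rp m (w s (?X s)) S)" for S by (simp add: rp_cmult)
	thus "set_integrable lborel {0..t} (%s. rp m (w s (?X s)) S)" by (simp add: set_integrable_def scaleR_conv_of_real)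
	have "volt m w t r = (%S. \<integral>s. of_real (indicator {0..t} s) * rp m (w s (?X s)) S \<partial>lborel)"
		by (simp add: volt_def[abs_def] set_lebesgue_integral_def scaleR_conv_of_real)
	thus "vcontr c (volt m w t r) S = (LINT s:{0..t}|lborel. vcontr c (rp m (w s (?X s))) S)"
		using vcontr_integral(1)[OF i2, of c] by (simp add: set_lebesgue_integral_def scaleR_conv_of_real vcontr_cmult)
qed

lemma volt_measurable:
	fixes w :: "real => ('n::{finite,linorder}) form"
	assumes w: "!!S. (%(p, r). w p r S) \<in> borel_measurable (lborel \<Otimes>\<^sub>M borel)"
	shows "(%(t, r). volt m w t r S) \<in> borel_measurable (lborel \<Otimes>\<^sub>M borel)"
proof -
	have [measurable]: "(%x. rp m (w (snd x) (snd (fst x) - (fst (fst x) - snd x) *\<^sub>R m)) S)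
			\<in> borel_measurable ((lborel \<Otimes>\<^sub>M borel) \<Otimes>\<^sub>M lborel)" by (rule measurable_flow[OF w]) auto
	have "(%x. \<integral>s. indicator {0..fst x} s *\<^sub>R rp m (w s (snd x - (fst x - s) *\<^sub>R m)) S \<partial>lborel)
			\<in> borel_measurable (lborel \<Otimes>\<^sub>M borel)"
	proof (rule lborel.borel_measurable_lebesgue_integral)
		have [measurable]: "(%x. indicator {0..fst (fst x)} (snd x) :: real) \<in>
				borel_measurable (((lborel :: real measure) \<Otimes>\<^sub>M (borel :: 'n rvec measure)) \<Otimes>\<^sub>M (lborel :: real measure))"
		proof -
			have m: "(%x. fst (fst x)) \<in> borel_measurable (((lborel :: real measure) \<Otimes>\<^sub>M (borel :: 'n rvec measure)) \<Otimes>\<^sub>M (lborel :: real measure))"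
				"snd \<in> borel_measurable (((lborel :: real measure) \<Otimes>\<^sub>M (borel :: 'n rvec measure)) \<Otimes>\<^sub>M (lborel :: real measure))"
				by (auto simp: measurable_lborel2[symmetric] simp del: measurable_lborel2)
			have i: "(indicator {0..} :: real => real) \<in> borel_measurable borel" by simp
			have "(%x. (indicator {0..} (snd x) :: real) * indicator {0..} (fst (fst x) - snd x)) \<in>
					borel_measurable (((lborel :: real measure) \<Otimes>\<^sub>M (borel :: 'n rvec measure)) \<Otimes>\<^sub>M (lborel :: real measure))"
				by (rule borel_measurable_times[OF measurable_compose[OF m(2) i]
						measurable_compose[OF borel_measurable_diff[OF m] i]])
			moreover have "indicator {0..fst (fst x)} (snd x) = (indicator {0..} (snd x) :: real) * indicator {0..} (fst (fst x) - snd x)"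
				for x :: "(real \<times> 'n rvec) \<times> real" by (auto simp: indicator_def)
			ultimately show ?thesis by simp
		qed
		show "(%(x, s). indicator {0..fst x} s *\<^sub>R rp m (w s (snd x - (fst x - s) *\<^sub>R m)) S)
				\<in> borel_measurable ((lborel \<Otimes>\<^sub>M borel) \<Otimes>\<^sub>M lborel)" unfolding case_prod_beta' by measurable
	qed
	thus ?thesis by (simp add: volt_def set_lebesgue_integral_def case_prod_beta')
qed

lemma nn_integral_flow_shift:
	fixes f :: "real => real => ennreal"
	assumes [measurable]: "case_prod f \<in> borel_measurable (lborel \<Otimes>\<^sub>M lborel)"
	shows "(\<integral>\<^sup>+t. \<integral>\<^sup>+s. f s (t - s) \<partial>lborel \<partial>lborel) = (\<integral>\<^sup>+s. \<integral>\<^sup>+t. f s t \<partial>lborel \<partial>lborel)"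
proof -
	have m: "(%(t, s). f s (t - s)) \<in> borel_measurable (lborel \<Otimes>\<^sub>M lborel)"
		using measurable_compose[OF _ assms, of "%(t, s). (s, t - s)" "lborel \<Otimes>\<^sub>M lborel"] by (simp add: case_prod_beta')
	have ms: "f s \<in> borel_measurable borel" for s using measurable_compose[OF measurable_Pair1' assms, of s] by simp
	have "(\<integral>\<^sup>+t. \<integral>\<^sup>+s. f s (t - s) \<partial>lborel \<partial>lborel) = (\<integral>\<^sup>+s. \<integral>\<^sup>+t. f s (t - s) \<partial>lborel \<partial>lborel)"
		using lborel_pair.Fubini'[OF m] by simp
	moreover have "(\<integral>\<^sup>+t. f s (t - s) \<partial>lborel) = (\<integral>\<^sup>+t. f s t \<partial>lborel)" for s
		using nn_integral_real_affine[of "f s" 1 "- s"] ms by simp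
	ultimately show ?thesis by simp
qed

text \<open>The exponential weight reproduces itself, because the integral of \<open>exp\<close>
  over \<open>{0..t}\<close> is at most \<open>exp \<bar>t\<bar>\<close>. For the decay, integrating
  over all \<open>t\<close> decouples the two times after the shift by \<open>s\<close>, so that
  \<open>piece_flow\<close> applies.\<close>

lemma pgood_volt:
	assumes "pgood lborel (%s. exp \<bar>s\<bar>) w"
	shows "pgood lborel (%s. exp \<bar>s\<bar>) (volt m w)" using assms
proof induction
	case w: (pgood_piece A C K w)
	note pw = pgood_piece[OF w]
	obtain A' C' where A': "!!p r. basic A' (rp m (w p r))"
		"!!r S. (\<integral>\<^sup>+t. \<integral>\<^sup>+p. ennreal (norm (rp m (w p (r - t *\<^sub>R m)) S)) \<partial>lborel \<partial>lborel) \<le>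
			 ennreal C' * edec A' r" using piece_flow[OF w sigma_finite_lborel, of m] by auto
	obtain K' where K': "!!p r S. norm (rp m (w p r) S) \<le> (K' * K) * exp \<bar>p\<bar>"
		using rp_bounded[of UNIV w K "%s. exp \<bar>s\<bar>" m] pieceD(4)[OF w] by (metis UNIV_I space_lborel space_borel)
	have [measurable]: "(%x. rp m (w (fst x) (r - snd x *\<^sub>R m)) S) \<in> borel_measurable (lborel \<Otimes>\<^sub>M lborel)" for r S
		by (rule measurable_flow[OF pieceD(1)[OF w]]) auto
	have [measurable]: "(%x. rp m (w (snd x) (r - fst x *\<^sub>R m)) S) \<in> borel_measurable (lborel \<Otimes>\<^sub>M lborel)" for r S
		by (rule measurable_flow[OF pieceD(1)[OF w]]) auto
	have ms [measurable]: "(%s. rp m (w s (r - (t - s) *\<^sub>R m)) S) \<in> borel_measurable lborel" for r t S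
		by (rule measurable_flow[OF pieceD(1)[OF w]]) auto
	have "piece lborel (%s. exp \<bar>s\<bar>) A' C' \<bar>K' * K\<bar> (volt m w)" unfolding piece_def
	proof (intro conjI allI ballI)
		fix S
		show "(%(t, r). volt m w t r S) \<in> borel_measurable (lborel \<Otimes>\<^sub>M borel)"
			by (rule volt_measurable[OF pieceD(1)[OF w]])
	next
		fix t r
		show "basic A' (volt m w t r)" unfolding basic_def
		proof (intro allI impI ext)
			fix v S assume "\<forall>x\<in>set A'. x \<bullet> v = 0"
			hence "vcontr (cR v) (rp m (w s r)) = 0" for s r using basicD[OF A'(1)] by blast
			thus "vcontr (cR v) (volt m w t r) S = 0 S" unfolding vcontr_volt(2)[OF pw] by simp
		qed
	next
		fix r S
		have "ennreal (norm (volt m w t r S)) \<le> (\<integral>\<^sup>+s. ennreal (norm (rp m (w s (r - (t - s) *\<^sub>R m)) S)) \<partial>lborel)" for t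
		proof -
			have "ennreal (norm (volt m w t r S)) \<le>
					(\<integral>\<^sup>+s. ennreal (norm (indicator {0..t} s *\<^sub>R rp m (w s (r - (t - s) *\<^sub>R m)) S)) \<partial>lborel)"
				unfolding volt_def set_lebesgue_integral_def
				by (rule integral_norm_bound_ennreal) (use vcontr_volt(1)[OF pw, of t m r S] in "simp add: set_integrable_def")
			also have "... \<le> (\<integral>\<^sup>+s. ennreal (norm (rp m (w s (r - (t - s) *\<^sub>R m)) S)) \<partial>lborel)"
				by (intro nn_integral_mono) (auto simp: indicator_def)
			finally show ?thesis .
		qed
		hence "(\<integral>\<^sup>+t. ennreal (norm (volt m w t r S)) \<partial>lborel) \<le>
				(\<integral>\<^sup>+t. \<integral>\<^sup>+s. ennreal (norm (rp m (w s (r - (t - s) *\<^sub>R m)) S)) \<partial>lborel \<partial>lborel)"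
			by (intro nn_integral_mono)
		also have "... = (\<integral>\<^sup>+s. \<integral>\<^sup>+t. ennreal (norm (rp m (w s (r - t *\<^sub>R m)) S)) \<partial>lborel \<partial>lborel)"
			by (rule nn_integral_flow_shift) (simp add: case_prod_beta')
		also have "... = (\<integral>\<^sup>+t. \<integral>\<^sup>+s. ennreal (norm (rp m (w s (r - t *\<^sub>R m)) S)) \<partial>lborel \<partial>lborel)"
			by (rule lborel_pair.Fubini') (simp add: case_prod_beta')
		also have "... \<le> ennreal C' * edec A' r" by (rule A')
		finally show "(\<integral>\<^sup>+t. ennreal (norm (volt m w t r S)) \<partial>lborel) \<le> ennreal C' * edec A' r" .
	next
		fix t r S
		have "norm (volt m w t r S) \<le> (LINT s:{0..t}|lborel. \<bar>K' * K\<bar> * exp s)" unfolding volt_def set_lebesgue_integral_def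
		proof (rule Bochner_Integration.integral_norm_bound_integral)
			show "integrable lborel (%s. indicator {0..t} s *\<^sub>R rp m (w s (r - (t - s) *\<^sub>R m)) S)"
				using vcontr_volt(1)[OF pw, of t m r S] by (simp add: set_integrable_def)
			show "integrable lborel (%s. indicator {0..t} s *\<^sub>R (\<bar>K' * K\<bar> * exp s))"
				using borel_integrable_atLeastAtMost'[of 0 t "%s. \<bar>K' * K\<bar> * exp s"]
				by (simp add: set_integrable_def continuous_on_exp continuous_on_mult)
			fix s :: real
			have "(K' * K) * exp \<bar>s\<bar> \<le> \<bar>K' * K\<bar> * exp \<bar>s\<bar>" by (intro mult_right_mono) auto
			thus "norm (indicator {0..t} s *\<^sub>R rp m (w s (r - (t - s) *\<^sub>R m)) S) \<le> indicator {0..t} s *\<^sub>R (\<bar>K' * K\<bar> * exp s)"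
				using order_trans[OF K'[of s "r - (t - s) *\<^sub>R m" S]] by (auto simp: indicator_def)
		qed
		also have "... \<le> \<bar>K' * K\<bar> * exp \<bar>t\<bar>"
		proof (cases "0 \<le> t")
			case True
			have "(LINT s:{0..t}|lborel. \<bar>K' * K\<bar> * exp s) = \<bar>K' * K\<bar> * exp t - \<bar>K' * K\<bar> * exp 0"
				unfolding set_lebesgue_integral_def real_scaleR_def
				by (subst mult.commute, rule integral_FTC_Icc_real[OF True, of "%s. \<bar>K' * K\<bar> * exp s"])
					(auto intro!: derivative_eq_intros continuous_intros)
			thus ?thesis using True by simp
		qed (simp add: set_lebesgue_integral_def)
		finally show "norm (volt m w t r S) \<le> \<bar>K' * K\<bar> * exp \<bar>t\<bar>" .
	qed
	thus ?case by (rule pgood.pgood_piece)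
next case (pgood_add w1 w2)
	have "volt m (%p r. w1 p r + w2 p r) t r S = volt m w1 t r S + volt m w2 t r S" for t r S unfolding volt_def
		by (simp add: rp_add set_integral_add vcontr_volt(1) pgood_add.hyps)
	hence "(%t r. volt m w1 t r + volt m w2 t r) = volt m (%p r. w1 p r + w2 p r)" by (simp add: fun_eq_iff)
	thus ?case by (rule subst) (rule pgood.pgood_add[OF pgood_add.IH])
qed

text \<open>After integration over all times the Duhamel convolution factorises: with
  \<open>t - s\<close> as the new outer time, one flow is applied to the total time integral of
  \<open>w\<close>. By \<open>supp\<close>, negative times do not contribute, which matches the
  lower end of \<open>{0..t}\<close>.\<close>

lemma integral_volt:
	assumes w: "pgood lborel (%s. exp \<bar>s\<bar>) w" and supp: "!!s r. s < 0 ==> w s r = 0"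
	shows "(LBINT t. volt m w t r S) =
		(LBINT t. of_bool (t > 0) * rp m (%S. \<integral>s. w s (r - t *\<^sub>R m) S \<partial>lborel) S)"
proof -
	let ?X = "(lborel :: real measure) \<Otimes>\<^sub>M (lborel :: real measure)"
	define F where "F s t = drift m w (s, t) r S" for s t
	have F: "integrable ?X (case_prod F)" using pgood_integrable[OF pgood_flow[OF w sigma_finite_lborel], of m r S]
		by (simp add: F_def case_prod_beta')
	have mF [measurable]: "case_prod F \<in> borel_measurable ?X" using F by simp
	have msF: "F s \<in> borel_measurable lborel" for s using measurable_compose[OF measurable_Pair1' mF, of s] by simp
	have mG [measurable]: "(%(t, s). F s (t - s)) \<in> borel_measurable ?X"
		using measurable_compose[OF _ mF, of "%(t, s). (s, t - s)" "lborel \<Otimes>\<^sub>M lborel"] by (simp add: case_prod_beta')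
	have G: "integrable ?X (%(t, s). F s (t - s))"
	proof (rule integrableI_bounded[OF mG])
		have "(\<integral>\<^sup>+z. ennreal (norm (case z of (t, s) => F s (t - s))) \<partial>?X) =
				(\<integral>\<^sup>+t. \<integral>\<^sup>+s. ennreal (norm (F s (t - s))) \<partial>lborel \<partial>lborel)"
			by (subst lborel.nn_integral_fst[symmetric]) auto
		also have "... = (\<integral>\<^sup>+s. \<integral>\<^sup>+t. ennreal (norm (F s t)) \<partial>lborel \<partial>lborel)"
			by (rule nn_integral_flow_shift) simp
		also have "... = (\<integral>\<^sup>+z. ennreal (norm (case_prod F z)) \<partial>?X)"
			by (subst lborel.nn_integral_fst[symmetric]) auto
		also have "... < \<infinity>" using F by (simp add: integrable_iff_bounded)
		finally show "(\<integral>\<^sup>+z. ennreal (norm (case z of (t, s) => F s (t - s))) \<partial>?X) < \<infinity>" .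
	qed
	have "(LBINT t. volt m w t r S) = (LBINT t. (LBINT s. F s (t - s)))"
	proof (rule Bochner_Integration.integral_cong[OF refl])
		fix t :: real
		\<comment> \<open>At \<open>s = t\<close> the closed interval in \<open>volt\<close> and the
		  strict positivity in \<open>drift\<close> disagree, so a null set is removed.\<close>
		have "AE s in lborel. s ~= t" by (rule AE_lborel_singleton)
		hence "AE s in lborel. indicator {0..t} s *\<^sub>R rp m (w s (r - (t - s) *\<^sub>R m)) S = F s (t - s)"
		proof eventually_elim
			case (elim s)
			have "rp m 0 = 0" by (simp add: rp_def)
			thus ?case using elim by (cases "s < 0") (auto simp: F_def drift_def indicator_def supp)
		qed
		moreover have "(%s. F s (t - s)) \<in> borel_measurable lborel" using measurable_compose[OF measurable_Pair1' mG, of t] by simp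
		moreover have "(%s. indicator {0..t} s *\<^sub>R rp m (w s (r - (t - s) *\<^sub>R m)) S) \<in> borel_measurable lborel"
			using vcontr_volt(1)[OF w, of t m r S] by (auto simp: set_integrable_def dest: borel_measurable_integrable)
		ultimately show "volt m w t r S = (LBINT s. F s (t - s))" unfolding volt_def set_lebesgue_integral_def by (intro integral_cong_AE)
	qed
	also have "... = (LBINT s. (LBINT t. F s (t - s)))" by (rule lborel_pair.Fubini_integral[symmetric, OF G])
	also have "... = (LBINT s. (LBINT t. F s t))" using lborel_integral_real_affine[of 1 "F _" "- _"] by simp
	also have "... = (LBINT t. (LBINT s. F s t))" by (rule lborel_pair.Fubini_integral[symmetric, OF F])
	also have "... = (LBINT t. of_bool (t > 0) * rp m (%S. \<integral>s. w s (r - t *\<^sub>R m) S \<partial>lborel) S)"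
		by (intro Bochner_Integration.integral_cong refl)
			(simp add: F_def drift_def rp_integral[OF pgood_integrable[OF w]])
	finally show ?thesis .
qed

section \<open>The ring of good forms\<close>

lemma pgood_cmult:
	assumes "pgood P \<beta> w"
	shows "pgood P \<beta> (%p r S. k * w p r S)" using assms
proof induction
	case w: (pgood_piece A C K w)
	have "piece P \<beta> A (norm k * max C 0) (norm k * K) (%p r S. k * w p r S)" unfolding piece_def
	proof (intro conjI allI ballI)
		fix S
		show "(%(p, r). k * w p r S) \<in> borel_measurable (P \<Otimes>\<^sub>M borel)"
			using borel_measurable_times[OF borel_measurable_const pieceD(1)[OF w], of k S] by (simp add: case_prod_beta')
	next
		fix r S
		have "(%p. w p r S) \<in> borel_measurable P" by (rule measurable_section[OF pieceD(1)[OF w]])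
		hence "(\<integral>\<^sup>+p. ennreal (norm (k * w p r S)) \<partial>P) = ennreal (norm k) * (\<integral>\<^sup>+p. ennreal (norm (w p r S)) \<partial>P)"
			by (simp add: norm_mult ennreal_mult nn_integral_cmult)
		also have "... \<le> ennreal (norm k) * (ennreal C * edec A r)" by (intro mult_left_mono pieceD(3)[OF w]) simp
		also have "... = ennreal (norm k * max C 0) * edec A r" by (simp add: ennreal_mult ennreal_max_zero mult.assoc)
		finally show "(\<integral>\<^sup>+p. ennreal (norm (k * w p r S)) \<partial>P) \<le> ennreal (norm k * max C 0) * edec A r" .
	qed (auto simp: norm_mult mult.assoc intro: mult_left_mono pieceD[OF w] basic_cmult)
	thus ?case by (rule pgood.pgood_piece)
next case (pgood_add w1 w2)
	from pgood.pgood_add[OF pgood_add.IH] show ?case by (rule pgood_cong_fun) (simp add: fun_eq_iff distrib_left)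
qed

lemma good_cmult: "good f ==> good (%r S. k * f r S)" unfolding good_def by (rule pgood_cmult)

lemma good_cong_fun: "good f ==> f = g ==> good g" by simp

lemma good_zero: "good (%r S. 0)"
	using pgood_zero[of point "%_. 1"] unfolding good_def by (rule pgood_cong_fun) (simp add: fun_eq_iff)

lemma good_gone: "good (%r. gone)" unfolding good_def by (rule pgood_piece[where A = "[]" and C = 1 and K = 1])
		(auto simp: piece_point_iff basic_def dec_def gone_def)

lemma good_sum:
	assumes "!!i. i \<in> I ==> good (f i)"
	shows "good (%r S. \<Sum>i\<in>I. f i r S)" using assms
proof (induction I rule: infinite_finite_induct)
	case (insert i I)
	have "good (%r. f i r + (%S. \<Sum>i\<in>I. f i r S))" using insert by (intro good_add) auto
	thus ?case using insert by (simp add: plus_fun_def)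
qed (simp_all add: good_zero)

lemma distr_point: "distr M (point \<Otimes>\<^sub>M M) (Pair ()) = point \<Otimes>\<^sub>M M"
	if "sigma_finite_measure M"
proof (rule measure_eqI)
	let ?X = "point \<Otimes>\<^sub>M M"
	interpret sigma_finite_measure M by fact
	fix X assume "X \<in> sets (distr M ?X (Pair ()))"
	hence X: "X \<in> sets ?X" by simp
	have "emeasure ?X X = emeasure M (Pair () -` X)" by (simp add: emeasure_pair_measure_alt[OF X] nn_integral_point)
	moreover have "Pair () -` X \<subseteq> space M" using sets.sets_into_space[OF X] by (auto simp: space_pair_measure)
	ultimately show "emeasure (distr M ?X (Pair ())) X = emeasure ?X X" using X by (simp add: emeasure_distr Int_absorb2)
qed simp

lemma pgood_point:
	assumes "pgood (point \<Otimes>\<^sub>M M) \<beta> w" "sigma_finite_measure M"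
	shows "pgood M (%t. \<beta> ((), t)) (%t. w ((), t))"
	using pgood_transport[OF assms(1) _ distr_point[OF assms(2)]] by simp

lemma pgood_flow_good:
	assumes "good f"
	shows "pgood lborel (%_. 1) (%t r S. of_bool (t > 0) * rp m (f (r - t *\<^sub>R m)) S)"
	using pgood_point[OF pgood_flow[OF assms[unfolded good_def] sigma_finite_point] sigma_finite_lborel, of m] by (simp add: drift_def)

lemma good_flow_integral:
	assumes "good f"
	shows "good (%r S. \<integral>t. of_bool (t > 0) * rp m (f (r - t *\<^sub>R m)) S \<partial>lborel)"
	by (rule good_integral[OF pgood_flow_good[OF assms] sigma_finite_lborel])

lemma pgood_good_wedge:
	assumes "good f" "pgood M \<beta> w" "sigma_finite_measure M"
	shows "pgood M \<beta> (%t r. f r \<and>\<^sub>g w t r)"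
	using pgood_point[OF pgood_wedge[OF assms(1)[unfolded good_def] assms(2,3)] assms(3)] by simp

text \<open>With the decay built into the type, products, propagators and traces satisfy purely
  algebraic laws without convergence hypotheses.\<close>

typedef (overloaded) ('n::"{finite,linorder}") gf = "{f :: (real,'n) vec => 'n gen eext. good (%r. cf (f r))}"
	morphisms ev Gf by (rule exI[of _ "%r. 1"]) (simp add: cf_one good_gone)

setup_lifting type_definition_gf

instantiation gf :: ("{finite,linorder}") comm_ring_1
begin

lift_definition zero_gf :: "'a gf" is "%r. 0" using good_zero by (simp add: zero_fun_def)
lift_definition one_gf :: "'a gf" is "%r. 1" using good_gone by (simp add: cf_one)
lift_definition plus_gf :: "'a gf => 'a gf => 'a gf" is "%f g r. f r + g r" by (subst cf_add) (rule good_add)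
lift_definition uminus_gf :: "'a gf => 'a gf" is "%f r. - f r"
proof -
	fix f :: "(real,'a) vec => 'a gen eext"
	assume "good (%r. cf (f r))"
	from good_cmult[OF this, of "-1"] show "good (%r. cf (- f r))" by (rule good_cong_fun) (simp add: fun_eq_iff cf_uminus)
qed
lift_definition minus_gf :: "'a gf => 'a gf => 'a gf" is "%f g r. f r - g r"
proof -
	fix f g :: "(real,'a) vec => 'a gen eext"
	assume "good (%r. cf (f r))" "good (%r. cf (g r))"
	from good_add[OF this(1) good_cmult[OF this(2), of "-1"]] show "good (%r. cf (f r - g r))"
		by (rule good_cong_fun) (simp add: fun_eq_iff cf_diff)
qed
lift_definition times_gf :: "'a gf => 'a gf => 'a gf" is "%f g r. f r * g r"
	by (subst cf_mult) (rule good_wedge)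

instance by standard (transfer, simp add: fun_eq_iff algebra_simps)+

end

lemma good_ev: "good (%r. cf (ev f r))" using ev by blast

lemma ev_simps: "ev (a + b) r = ev a r + ev b r" "ev (a * b) r = ev a r * ev b r"
	"ev 0 r = 0" "ev 1 r = 1" "ev (- a) r = - ev a r" "ev (a - b) r = ev a r - ev b r"
	by (simp_all add: plus_gf.rep_eq times_gf.rep_eq zero_gf.rep_eq one_gf.rep_eq uminus_gf.rep_eq minus_gf.rep_eq)

lemma ev_sum: "ev (sum f I) r = (\<Sum>i\<in>I. ev (f i) r)" by (induction I rule: infinite_finite_induct) (auto simp: ev_simps)

lemma gf_eqI: "(!!r. ev a r = ev b r) ==> a = b" by (metis ev_inject ext)

subsection \<open>The propagator\<close>

definition flowint :: "real^'n::{finite,linorder} => 'n form => 'n form" where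
	"flowint m f r S = (LBINT t. of_bool (t > 0) * rp m (f (r - t *\<^sub>R m)) S)"

lemma flowint_integrable:
	"good f ==> integrable lborel (%t. of_bool (t > 0) * rp m (f (r - t *\<^sub>R m)) S)"
	by (rule pgood_integrable[OF pgood_flow_good])

lemma good_flowint: "good f ==> good (flowint m f)" using good_flow_integral[of f m] by (simp add: flowint_def[abs_def])

lemma flowint_even:
	fixes f :: "real^'n::{finite,linorder} => 'n gen eext"
	shows "cf (Eext (flowint m (%r. cf (f r)) r)) = flowint m (%r. cf (f r)) r"
proof (rule even_Eext)
	fix S assume "flowint m (%r. cf (f r)) r S ~= 0"
	moreover have "flowint m (%r. cf (f r)) r S = 0" if "\<forall>t. rp m (cf (f (r - t *\<^sub>R m))) S = 0"
		using that by (simp add: flowint_def)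
	ultimately have "~ (\<forall>t. rp m (cf (f (r - t *\<^sub>R m))) S = 0)" by blast
	then obtain t where "cf (erp m (f (r - t *\<^sub>R m))) S ~= 0" by (auto simp: cf_erp)
	thus "finite S & even (card S)" using cf by blast
qed

text \<open>This is \<open>2\<pi> K G\<^sub>-\<close> on the component with vector \<open>m\<close>;
  the factor in front is the integral over the angle of an edge.\<close>

lift_definition kap :: "int^'n::{finite,linorder} => 'n gf => 'n gf" is
	"%m f r. sc (2 * of_real pi) (Eext (flowint (rvec m) (%r. cf (f r)) r))"
proof -
	fix m :: "(int,'n) vec" and f :: "(real,'n) vec => 'n gen eext"
	assume "good (%r. cf (f r))"
	from good_cmult[OF good_flowint[OF this], of "2 * of_real pi" "rvec m"]
	show "good (%r. cf (sc (2 * of_real pi) (Eext (flowint (rvec m) (%r. cf (f r)) r))))"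
		by (rule good_cong_fun) (simp add: fun_eq_iff cf_sc flowint_even)
qed

lemma cf_kap: "cf (ev (kap m f) r) S = 2 * of_real pi * flowint (rvec m) (%r. cf (ev f r)) r S"
	by transfer (simp add: cf_sc flowint_even)

lemma flowint_add:
	assumes "good f" "good g"
	shows "flowint m (%r. f r + g r) r S = flowint m f r S + flowint m g r S"
	unfolding flowint_def using flowint_integrable[OF assms(1)] flowint_integrable[OF assms(2)] by (simp add: rp_add distrib_left)

lemma kap_add: "kap m (f + g) = kap m f + kap m g" by (intro gf_eqI eext_eqI)
		(simp add: cf_kap ev_simps cf_add flowint_add[OF good_ev good_ev] distrib_left)

lemma kap_zero [simp]: "kap m 0 = 0" using kap_add[of m 0 0] by simp

lemma kap_sum: "kap m (sum f I) = (\<Sum>i\<in>I. kap m (f i))" by (induction I rule: infinite_finite_induct) (auto simp: kap_add)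

lemma rvec_0 [simp]: "rvec 0 = 0" by (simp add: rvec_def vec_eq_iff)

lemma rvec_uminus: "rvec (- m) = - rvec m" and rvec_add: "rvec (m + n) = rvec m + rvec n" by (simp_all add: rvec_def vec_eq_iff)

text \<open>Both contractions vanish for the zero vector. This removes shapes with a vanishing
  internal edge as well as propagated products of bare states.\<close>

lemma kap_0 [simp]: "kap 0 f = 0"
proof (intro gf_eqI eext_eqI)
	fix r S
	have "rp (0::(real,'a) vec) a S = 0" for a by (simp add: rp_def vcontr_def cR_def sum_gen)
	thus "cf (ev (kap 0 f) r) S = cf (ev 0 r) S" by (simp add: cf_kap flowint_def ev_simps)
qed

text \<open>Contractions kill constants, so joining two external edges contributes nothing.\<close>

lemma kap_1 [simp]: "kap m 1 = 0" by (intro gf_eqI eext_eqI) (simp add: cf_kap flowint_def ev_simps cf_one rp_def)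

definition tr :: "('n::{finite,linorder}) gf => complex" where
	"tr f = int_X (%r. cf (ev f r))"

lemma tr_add: "tr (f + g) = tr f + tr g" unfolding tr_def int_X_def using good_top[OF good_ev[of f]] good_top[OF good_ev[of g]]
	by (simp add: ev_simps cf_add distrib_left)

lemma tr_zero [simp]: "tr 0 = 0" using tr_add[of 0 0] by simp

lemma tr_sum: "tr (sum f I) = (\<Sum>i\<in>I. tr (f i))" by (induction I rule: infinite_finite_induct) (auto simp: tr_add)

lemma wedge_integral_right:
	assumes "!!S. integrable M (%t. h t S)"
	shows "(a \<and>\<^sub>g (%S. \<integral>t. h t S \<partial>M)) S = (\<integral>t. (a \<and>\<^sub>g h t) S \<partial>M)"
	unfolding gwedge_isg using assms by simp

lemma lborel_translation:
	fixes h :: "'a::euclidean_space => complex"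
	assumes [measurable]: "h \<in> borel_measurable borel"
	shows "(LBINT r. h (c + r)) = (LBINT r. h r)"
proof -
	have "(LBINT r. h r) = (\<integral>r. h r \<partial>distr lborel borel ((+) c))" by (simp add: lborel_distr_plus)
	also have "... = (LBINT r. h (c + r))" by (rule integral_distr) auto
	finally show ?thesis ..
qed

text \<open>The coefficient integrated is of top degree, so \<open>pgood_top\<close> justifies
  exchanging the two integrals; then \<open>r\<close> is translated along the flow.\<close>

lemma integral_wedge_flowint:
	fixes f g :: "('n::{finite,linorder}) form"
	assumes f: "good f" and g: "good g"
	shows "(LBINT r. (f r \<and>\<^sub>g flowint m g r) UNIV) =
		(LBINT t. of_bool (t > 0) * (LBINT r. (f (r + t *\<^sub>R m) \<and>\<^sub>g rp m (g r)) UNIV))"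
proof -
	let ?w = "%t r. f r \<and>\<^sub>g (%S. of_bool (t > 0) * rp m (g (r - t *\<^sub>R m)) S)"
	have w: "pgood lborel (%_. 1) ?w" using pgood_good_wedge[OF f pgood_flow_good[OF g] sigma_finite_lborel] .
	have top: "integrable (lborel \<Otimes>\<^sub>M lborel) (%(r, t). ?w t r UNIV)" by (rule pgood_top[OF w sigma_finite_lborel])
	have "(LBINT r. (f r \<and>\<^sub>g flowint m g r) UNIV) = (LBINT r. (LBINT t. ?w t r UNIV))"
		unfolding flowint_def[abs_def] by (simp add: wedge_integral_right[OF flowint_integrable[OF g]])
	also have "... = (LBINT t. (LBINT r. ?w t r UNIV))" by (rule lborel_pair.Fubini_integral[OF top, symmetric])
	also have "... = (LBINT t. of_bool (t > 0) * (LBINT r. (f (r + t *\<^sub>R m) \<and>\<^sub>g rp m (g r)) UNIV))"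
	proof (rule Bochner_Integration.integral_cong[OF refl])
		fix t :: real
		have "(LBINT r. (f r \<and>\<^sub>g rp m (g (r - t *\<^sub>R m))) UNIV) = (LBINT r. (f (t *\<^sub>R m + r) \<and>\<^sub>g rp m (g (t *\<^sub>R m + r - t *\<^sub>R m))) UNIV)"
		proof (rule lborel_translation[symmetric])
			have "(%r. g (r - t *\<^sub>R m) S) \<in> borel_measurable borel" for S
				by (rule measurable_compose[OF _ good_measurable[OF g]]) simp
			hence [measurable]: "(%r. rp m (g (r - t *\<^sub>R m)) S) \<in> borel_measurable borel" for S by (rule rp_measurable)
			have [measurable]: "(%r. f r S) \<in> borel_measurable borel" for S by (rule good_measurable[OF f])
			show "(%r. (f r \<and>\<^sub>g rp m (g (r - t *\<^sub>R m))) UNIV) \<in> borel_measurable borel"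
				unfolding gwedge_def by measurable
		qed
		thus "(LBINT r. ?w t r UNIV) = of_bool (t > 0) * (LBINT r. (f (r + t *\<^sub>R m) \<and>\<^sub>g rp m (g r)) UNIV)"
			by (simp add: gwedge_cmult_right add.commute)
	qed
	finally show ?thesis .
qed

text \<open>Moving the propagator across an edge of a tree: translate by the flow, then use the adjointness of contractions.\<close>

lemma tr_kap: "tr (f * kap m g) = tr (kap (- m) f * g)"
proof -
	let ?f = "%r. cf (ev f r)" and ?g = "%r. cf (ev g r)" and ?m = "rvec m"
	have "(LBINT r. (?f r \<and>\<^sub>g flowint ?m ?g r) UNIV) =
			(LBINT t. of_bool (t > 0) * (LBINT r. (?f (r + t *\<^sub>R ?m) \<and>\<^sub>g rp ?m (?g r)) UNIV))"
		by (rule integral_wedge_flowint[OF good_ev good_ev])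
	also have "... = (LBINT t. of_bool (t > 0) * (LBINT r. (?g r \<and>\<^sub>g rp (- ?m) (?f (r - t *\<^sub>R (- ?m)))) UNIV))"
	proof -
		have "(cf a \<and>\<^sub>g rp ?m (cf b)) UNIV = (cf b \<and>\<^sub>g rp (- ?m) (cf a)) UNIV" for a b
		proof -
			have "(cf a \<and>\<^sub>g rp ?m (cf b)) UNIV = cf (erp ?m a * b) UNIV" using erp_adjoint[of a ?m b] by (simp add: cf_mult cf_erp)
			also have "... = (cf b \<and>\<^sub>g rp (- ?m) (cf a)) UNIV" by (subst mult.commute) (simp add: cf_mult cf_erp rp_uminus)
			finally show ?thesis .
		qed
		thus ?thesis by simp
	qed
	also have "... = (LBINT t. of_bool (t > 0) * (LBINT r. (?g (r + t *\<^sub>R (- ?m)) \<and>\<^sub>g rp (- ?m) (?f r)) UNIV))"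
	proof (rule Bochner_Integration.integral_cong[OF refl])
		fix t :: real
		have "(%r. (?g (r + t *\<^sub>R (- ?m)) \<and>\<^sub>g rp (- ?m) (?f r)) UNIV) \<in> borel_measurable borel"
		proof -
			have [measurable]: "(%r. ?g (r + t *\<^sub>R (- ?m)) S) \<in> borel_measurable borel" for S
				by (rule measurable_compose[OF _ good_measurable[OF good_ev]]) simp
			have [measurable]: "(%r. rp (- ?m) (?f r) S) \<in> borel_measurable borel" for S
				by (rule rp_measurable[OF good_measurable[OF good_ev]])
			show ?thesis unfolding gwedge_def by measurable
		qed
		from lborel_translation[OF this, of "- t *\<^sub>R (- ?m)"]
		have "(LBINT r. (?g r \<and>\<^sub>g rp (- ?m) (?f (r - t *\<^sub>R (- ?m)))) UNIV) =
				(LBINT r. (?g (r + t *\<^sub>R (- ?m)) \<and>\<^sub>g rp (- ?m) (?f r)) UNIV)" by (simp add: add.commute)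
		thus "of_bool (t > 0) * (LBINT r. (?g r \<and>\<^sub>g rp (- ?m) (?f (r - t *\<^sub>R (- ?m)))) UNIV) =
				of_bool (t > 0) * (LBINT r. (?g (r + t *\<^sub>R (- ?m)) \<and>\<^sub>g rp (- ?m) (?f r)) UNIV)" by (simp only:)
	qed
	also have "... = (LBINT r. (?g r \<and>\<^sub>g flowint (- ?m) ?f r) UNIV)"
		by (rule integral_wedge_flowint[OF good_ev good_ev, symmetric])
	finally have eq: "(LBINT r. (?f r \<and>\<^sub>g flowint ?m ?g r) UNIV) = (LBINT r. (?g r \<and>\<^sub>g flowint (- ?m) ?f r) UNIV)" .
	have kap: "cf (ev (kap m h) r) = (%S. 2 * of_real pi * flowint (rvec m) (%r. cf (ev h r)) r S)" for m h r
		by (rule ext) (rule cf_kap)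
	show ?thesis unfolding tr_def int_X_def mult.commute[of "kap (- m) f"] ev_simps cf_mult kap gwedge_cmult_right
		by (simp add: eq rvec_uminus)
qed

section \<open>Forms extending to the toric variety are good\<close>

lemma gmon_cmult:
	fixes \<theta> :: "'g::linorder => 'h::linorder ext"
	assumes "finite T"
	shows "gmon (%k S. e k * \<theta> k S) T = (%S. (\<Prod>k\<in>T. e k) * gmon \<theta> T S)" using assms
proof (induction T rule: finite_Min_induct)
	case (insert g T)
	have "g ~: T" using insert.hyps(2) by blast
	thus ?case using insert by (simp add: gmon_insert_min gwedge_cmult_left gwedge_cmult_right mult.assoc)
qed simp

lemma vcontr_gmon:
	fixes \<theta> :: "'g::linorder => 'h::{finite,linorder} ext"
	assumes "finite T" "!!k. k \<in> T ==> vcontr c (\<theta> k) = 0"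
	shows "vcontr c (gmon \<theta> T) = 0" using assms
proof (induction T rule: finite_Min_induct)
	case (insert g T)
	have "gmon \<theta> (insert g T) = \<theta> g \<and>\<^sub>g gmon \<theta> T" using insert.hyps by (rule gmon_insert_min)
	moreover have "vcontr c (\<theta> g) = 0" "vcontr c (gmon \<theta> T) = 0" using insert by auto
	ultimately show ?case by (simp only: vcontr_wedge gwedge_zero add_0)
qed simp

text \<open>The differential of the \<open>k\<close>-th real chart coordinate at angle zero with its
  exponential factor removed: radial for real parts, angular for imaginary parts.\<close>

definition chart_cov :: "(int,'n::{finite,linorder}) vec list => nat => 'n gen ext" where
	"chart_cov as k S = (\<Sum>j\<in>UNIV. of_int (as ! (k div 2) $ j) * ggen ((if even k then Rad else Ang) j) S)"

lemma chart_diff_0: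
	"chart_diff as r 0 k S = of_real (exp (rvec (as ! (k div 2)) \<bullet> r)) * chart_cov as k S"
proof -
	have c: "character a r 0 = of_real (exp (rvec a \<bullet> r))" for a by (simp add: character_def complex_eq_iff Re_exp Im_exp)
	show ?thesis by (simp add: chart_diff_def c Let_def chart_cov_def sum_distrib_left mult_ac)
qed

lemma vcontr_sum: "vcontr c (%S. \<Sum>i\<in>I. k i * f i S) = (%S. \<Sum>i\<in>I. k i * vcontr c (f i) S)"
proof
	fix S
	show "vcontr c (%S. \<Sum>i\<in>I. k i * f i S) S = (\<Sum>i\<in>I. k i * vcontr c (f i) S)"
		unfolding vcontr_def gcontr_sum' sum_distrib_left by (subst sum.swap) (simp add: mult.left_commute)
qed

lemma vcontr_ggen: "vcontr c (ggen g) = (%S. c g * gone S)"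
proof
	fix S
	have "gcontr h (ggen g) S = (if h = g then gone S else 0)" for h by (auto simp: gcontr_def ggen_def gone_def)
	hence "vcontr c (ggen g) S = (\<Sum>h\<in>UNIV. if h = g then c h * gone S else 0)" unfolding vcontr_def by (intro sum.cong) auto
	thus "vcontr c (ggen g) S = c g * gone S" by simp
qed

lemma vcontr_chart_cov:
	assumes "rvec (as ! (k div 2)) \<bullet> v = 0"
	shows "vcontr (cR v) (chart_cov as k) = 0"
proof
	fix S
	have "(\<Sum>j\<in>UNIV. of_int (as ! (k div 2) $ j) * cR v ((if even k then Rad else Ang) j)) =
			(if even k then of_real (rvec (as ! (k div 2)) \<bullet> v) else 0)" by (simp add: cR_def rvec_def inner_vec_def)
	thus "vcontr (cR v) (chart_cov as k) S = 0 S"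
		unfolding chart_cov_def[abs_def] vcontr_sum vcontr_ggen mult.assoc[symmetric] sum_distrib_right[symmetric] by (simp only: assms) simp
qed

lemma finite_sum_dec:
	assumes "finite T"
	shows "dec (map f (sorted_list_of_set T)) r = (\<Sum>k\<in>T. \<bar>f k \<bullet> r\<bar>)"
	using assms by (simp add: dec_def o_def sum_list_distinct_conv_sum_set)

text \<open>At angle zero every differential splits off a factor \<open>exp (a \<bullet> r)\<close>,
  and these factors are a decay along precisely the covectors that occur in the remaining constant
  form. On \<open>X\<close> the characters are at most one, so the chart coordinates stay in a
  compact cube on which the coefficient \<open>F\<close> is bounded.\<close>

lemma good_chart_piece:
	fixes as :: "(int,'n::{finite,linorder}) vec list"
	assumes F: "continuous_on UNIV (F :: (nat => real) => complex)" and T: "T \<subseteq> {..<2 * length as}"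
		and X: "X \<in> sets borel" "!!r a. r \<in> X ==> a \<in> set as ==> rvec a \<bullet> r \<le> 0"
	shows "good (%r S. indicator X r * (F (chart_point as r 0) * gmon (chart_diff as r 0) T S))"
proof -
	let ?Y = "chart_cov as"
	let ?X = "%r S. F (chart_point as r 0) * gmon (chart_diff as r 0) T S"
	have fT: "finite T" using T finite_subset by blast
	define a where "a k = rvec (as ! (k div 2))" for k
	define E where "E r = (\<Prod>k\<in>T. exp (a k \<bullet> r))" for r
	have eq: "gmon (chart_diff as r 0) T S = of_real (E r) * gmon ?Y T S" for r S
	proof -
		have "chart_diff as r 0 = (%k S. of_real (exp (a k \<bullet> r)) * chart_cov as k S)"
			by (simp add: fun_eq_iff chart_diff_0 a_def)
		thus ?thesis by (simp add: gmon_cmult[OF fT] E_def)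
	qed
	have asin: "as ! (k div 2) \<in> set as" if "k \<in> T" for k using T that by (intro nth_mem) auto
	have E: "E r = exp (- dec (map a (sorted_list_of_set T)) r)" if "r \<in> X" for r
	proof -
		have "E r = exp (\<Sum>k\<in>T. a k \<bullet> r)" using fT by (simp add: E_def exp_sum)
		also have "(\<Sum>k\<in>T. a k \<bullet> r) = - (\<Sum>k\<in>T. \<bar>a k \<bullet> r\<bar>)"
			unfolding sum_negf[symmetric] using X(2)[OF that] asin by (intro sum.cong) (auto simp: a_def)
		finally show ?thesis using fT by (simp add: finite_sum_dec)
	qed
	\<comment> \<open>Chart coordinates are functions on all of \<open>nat\<close>, zero beyond the
	  chart, so the compactness of the cube is Tychonoff's theorem.\<close>
	define Q :: "(nat => real) set" where "Q = PiE UNIV (%_. {-1..1})"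
	have "compact Q" using compactin_PiE[of "%_. euclidean" UNIV "%_. {-1..1::real}"]
		by (simp add: Q_def euclidean_product_topology)
	hence "compact (F ` Q)" using F by (intro compact_continuous_image) (auto intro: continuous_on_subset)
	then obtain B where B: "!!x. x \<in> Q ==> norm (F x) \<le> B" using compact_imp_bounded bounded_iff by (metis imageI)
	have chart0: "chart_point as r 0 k = (if k < 2 * length as & even k then exp (rvec (as ! (k div 2)) \<bullet> r) else 0)" for r k
		by (simp add: chart_point_def character_def Re_exp Im_exp)
	have inQ: "chart_point as r 0 \<in> Q" if "r \<in> X" for r
	proof -
		have "(-1 :: real) \<le> exp y" for y by (rule order_trans[OF _ exp_ge_zero]) simp
		thus ?thesis using X(2)[OF that] by (auto simp: Q_def chart0 less_mult_imp_div_less mult.commute)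
	qed
	have cont: "continuous_on UNIV (%r. F (chart_point as r 0))"
	proof (rule continuous_on_compose2[OF F])
		have "continuous_on UNIV (%r. chart_point as r 0 k)" for k
			unfolding chart0 by (cases "k < 2 * length as & even k") (auto intro!: continuous_intros)
		thus "continuous_on UNIV (%r. chart_point as r 0)" by (rule continuous_on_coordinatewise_then_product)
	qed auto
	have nG: "0 \<le> (\<Sum>U\<in>UNIV. norm (gmon ?Y T U))" by (intro sum_nonneg) simp
	let ?G = "\<Sum>U\<in>UNIV. norm (gmon ?Y T U)" and ?A = "map a (sorted_list_of_set T)"
	have bound: "norm (indicator X r * (?X r S)) \<le>
			(max B 0 * ?G) * exp (- dec ?A r)" for r S
	proof (cases "r \<in> X")
		case True
		have "norm (F (chart_point as r 0)) \<le> max B 0" using B[OF inQ[OF True]] by simp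
		moreover have "norm (gmon ?Y T S) \<le> ?G" by (rule member_le_sum) auto
		ultimately have "norm (F (chart_point as r 0)) * norm (gmon ?Y T S) \<le> max B 0 * ?G" by (intro mult_mono) auto
		thus ?thesis using True by (simp add: eq E norm_mult mult_ac mult_left_mono)
	qed (simp add: nG)
	show ?thesis unfolding good_def
	proof (rule pgood_piece[where A = ?A and C = "max B 0 * ?G" and K = "max B 0 * ?G"],
			unfold piece_point_iff, intro conjI allI)
		fix S
		have "continuous_on UNIV E" unfolding E_def by (intro continuous_intros)
		hence [measurable]: "E \<in> borel_measurable borel" "(%r. F (chart_point as r 0)) \<in> borel_measurable borel"
			using cont by (auto intro: borel_measurable_continuous_onI)
		show "(%r. indicator X r * (?X r S)) \<in> borel_measurable borel" unfolding eq using X(1) by measurable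
	next
		fix r
		have "basic ?A (gmon ?Y T)" unfolding basic_def using fT by (auto intro!: vcontr_gmon vcontr_chart_cov simp: a_def)
		hence "basic ?A (%S. (indicator X r * F (chart_point as r 0) * of_real (E r)) * gmon ?Y T S)" by (rule basic_cmult)
		thus "basic ?A (%S. indicator X r * (?X r S))" by (simp add: eq mult.assoc)
	next
		fix r S
		show "ennreal (norm (indicator X r * (?X r S))) \<le>
				ennreal (max B 0 * ?G) * ennreal (exp (- dec ?A r))"
			using bound[of r S] nG by (simp add: ennreal_mult[symmetric] ennreal_leI del: ennreal_mult_le_mult_iff)
		have "(max B 0 * ?G) * exp (- dec ?A r) \<le> (max B 0 * ?G) * 1" using nG dec_nonneg[of ?A r] by (intro mult_left_mono) auto
		thus "norm (indicator X r * (?X r S)) \<le> max B 0 * ?G" using bound[of r S] by simp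
	qed
qed

text \<open>The characters of the chart are bounded by one where
  \<open>rvec a \<bullet> r \<le> 0\<close> for all generators \<open>a\<close>, a closed set
  containing the negative of the cone. The angle may be set to zero, since the representation of the
  form holds for every angle.\<close>

lemma good_local:
	fixes \<gamma> :: "('n::{finite,linorder}) form"
	assumes "extends_to \<sigma> \<gamma>"
	obtains R where "R \<in> sets borel" "uminus ` \<sigma> \<subseteq> R"
		"!!X. X \<in> sets borel ==> X \<subseteq> R ==> good (%r S. indicator X r * \<gamma> r S)"
proof -
	obtain as F where as: "monoid_gens \<sigma> as"
		and F: "!!S. S \<subseteq> {..<2 * length as} ==> smooth_coords {..<2 * length as} (F S)"
		and \<gamma>: "!!r \<phi>. \<gamma> r = gsubst {..<2 * length as} (chart_diff as r \<phi>) (%S. F S (chart_point as r \<phi>))"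
		using assms unfolding extends_to_def by blast
	define R where "R = (\<Inter>a\<in>set as. {r. rvec a \<bullet> r \<le> 0})"
	have "closed R" unfolding R_def by (intro closed_INT ballI closed_halfspace_le)
	show thesis
	proof (rule that[of R])
		show "R \<in> sets borel" using `closed R` by (rule borel_closed)
		show "uminus ` \<sigma> \<subseteq> R" using as by (auto simp: R_def monoid_gens_def dual_monoid_def)
		fix X assume X: "X \<in> sets borel" "X \<subseteq> R"
		have "good (%r S. \<Sum>T\<in>Pow {..<2 * length as}. indicator X r * (F T (chart_point as r 0) * gmon (chart_diff as r 0) T S))"
		proof (rule good_sum, rule good_chart_piece)
			fix T assume "T \<in> Pow {..<2 * length as}"
			hence "smooth_coords {..<2 * length as} (F T)" using F by blast
			hence "\<forall>js\<in>lists {..<2 * length as}. continuous_on UNIV (foldr partial js (F T))" by (simp add: smooth_coords_def)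
			thus "continuous_on UNIV (F T)" by (metis foldr.simps(1) id_apply lists.Nil)
		qed (use X in "auto simp: R_def")
		thus "good (%r S. indicator X r * \<gamma> r S)" unfolding \<gamma>[where \<phi> = 0] gsubst_gmon sum_distrib_left .
	qed
qed

text \<open>By completeness the sets obtained from the cones cover the space. Induction over the
  cones cuts the space into disjoint Borel pieces, on each of which the form is good.\<close>

lemma good_Omega_trop:
	fixes \<gamma> :: "('n::{finite,linorder}) form"
	assumes \<Delta>: "complete_fan \<Delta>" and \<gamma>: "\<gamma> \<in> Omega_trop \<Delta>"
	shows "good \<gamma>"
proof -
	let ?X = "%R. \<forall>X. X \<in> sets borel --> X \<subseteq> R --> good (%r S. indicator X r * \<gamma> r S)"
	have "\<forall>\<sigma>\<in>\<Delta>. \<exists>R. R \<in> sets borel & uminus ` \<sigma> \<subseteq> R &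
			(?X R)"
	proof
		fix \<sigma> assume "\<sigma> \<in> \<Delta>"
		hence "extends_to \<sigma> \<gamma>" using \<gamma> by (simp add: Omega_trop_def)
		show "\<exists>R. R \<in> sets borel & uminus ` \<sigma> \<subseteq> R &
				(?X R)" by (rule good_local[OF `extends_to \<sigma> \<gamma>`]) (intro exI conjI allI impI)
	qed
	from bchoice[OF this] obtain R where "\<forall>\<sigma>\<in>\<Delta>. R \<sigma> \<in> sets borel & uminus ` \<sigma> \<subseteq> R \<sigma> &
			(\<forall>X. X \<in> sets borel --> X \<subseteq> R \<sigma> --> good (%r S. indicator X r * \<gamma> r S))" ..
	hence R: "!!\<sigma>. \<sigma> \<in> \<Delta> ==> R \<sigma> \<in> sets borel" "!!\<sigma>. \<sigma> \<in> \<Delta> ==> uminus ` \<sigma> \<subseteq> R \<sigma>"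
		"!!\<sigma> X. \<sigma> \<in> \<Delta> ==> X \<in> sets borel ==> X \<subseteq> R \<sigma> ==> good (%r S. indicator X r * \<gamma> r S)"
		by blast+
	have fin: "finite \<Delta>" and cov: "\<Union>\<Delta> = UNIV" using \<Delta> by (auto simp: complete_fan_def fan_def)
	have "D \<subseteq> \<Delta> ==> X \<in> sets borel ==> X \<subseteq> (\<Union>\<sigma>\<in>D. R \<sigma>) ==> good (%r S. indicator X r * \<gamma> r S)"
		if "finite D" for D X using that
	proof (induction D arbitrary: X rule: finite_induct)
		case empty
		thus ?case by (simp add: good_zero)
	next case (insert \<sigma> D)
		have "good (%r S. indicator (X \<inter> R \<sigma>) r * \<gamma> r S)"
			using insert.prems R(1)[of \<sigma>] by (intro R(3)[of \<sigma>]) auto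
		moreover have "good (%r S. indicator (X - R \<sigma>) r * \<gamma> r S)"
			using insert.prems R(1)[of \<sigma>] by (intro insert.IH) auto
		ultimately have "good (%r. (%S. indicator (X \<inter> R \<sigma>) r * \<gamma> r S) + (%S. indicator (X - R \<sigma>) r * \<gamma> r S))"
			by (rule good_add)
		thus ?case by (rule good_cong_fun) (auto simp: fun_eq_iff indicator_def)
	qed
	note loc = this
	have "good (%r S. indicator UNIV r * \<gamma> r S)"
	proof (rule loc[OF fin order_refl])
		have "x \<in> (\<Union>\<sigma>\<in>\<Delta>. R \<sigma>)" for x
		proof -
			obtain \<sigma> where "\<sigma> \<in> \<Delta>" "- x \<in> \<sigma>" using cov by blast
			hence "x \<in> R \<sigma>" using R(2)[of \<sigma>] by (metis imageI minus_minus subsetD)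
			thus ?thesis using `\<sigma> \<in> \<Delta>` by blast
		qed
		thus "UNIV \<subseteq> (\<Union>\<sigma>\<in>\<Delta>. R \<sigma>)" by blast
	qed simp
	thus ?thesis by simp
qed

subsection \<open>The rays\<close>

lemma convex_cone_hull_single: "convex_cone hull {x} = {c *\<^sub>R x |c. c \<ge> 0}" for x :: "'a::real_vector"
proof -
	show ?thesis
	proof (rule hull_unique)
		show "{x} \<subseteq> {c *\<^sub>R x |c. c \<ge> 0}" by (auto intro: exI[of _ 1])
		have "a *\<^sub>R (c *\<^sub>R x) + b *\<^sub>R (d *\<^sub>R x) \<in> {c *\<^sub>R x |c. c \<ge> 0}" if "a \<ge> 0" "b \<ge> 0" "c \<ge> 0" "d \<ge> 0" for a b c d
			using that by (auto intro!: exI[of _ "a * c + b * d"] simp: scaleR_add_left)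
		hence "convex {c *\<^sub>R x |c. c \<ge> 0}" unfolding convex_def by blast
		thus "convex_cone {c *\<^sub>R x |c. c \<ge> 0}" by (auto simp: convex_cone_def conic_def intro: exI[of _ 0])
		show "{c *\<^sub>R x |c. c \<ge> 0} \<subseteq> T" if "{x} \<subseteq> T" "convex_cone T" for T
			using that by (auto simp: convex_cone_def conic_def)
	qed
qed

text \<open>Proportionality gives \<open>b $ j * c $ i = c $ j * b $ i\<close>. Taking the gcd over
  \<open>i\<close> shows that the entries agree up to sign, and \<open>x \<ge> 0\<close> fixes the
  sign.\<close>

lemma primitive_multiple:
	fixes b c :: "(int,'n::finite) vec"
	assumes gb: "Gcd (range (%j. b $ j)) = 1" and gc: "Gcd (range (%j. c $ j)) = 1"
		and x: "rvec b = x *\<^sub>R rvec c" "x \<ge> 0"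
	shows "b = c"
proof -
	have bj: "of_int (b $ j) = x * of_int (c $ j)" for j using x(1) by (simp add: rvec_def vec_eq_iff)
	have cross: "b $ j * c $ i = c $ j * b $ i" for i j
	proof -
		have "real_of_int (b $ j * c $ i) = real_of_int (c $ j * b $ i)" by (simp add: bj)
		thus ?thesis by (simp only: of_int_eq_iff)
	qed
	have "b $ j = c $ j" for j
	proof -
		have "(*) (b $ j) ` range (%i. c $ i) = (*) (c $ j) ` range (%i. b $ i)" by (simp add: image_image cross)
		hence "normalize (b $ j * Gcd (range (%i. c $ i))) = normalize (c $ j * Gcd (range (%i. b $ i)))"
			by (simp only: Gcd_mult[symmetric])
		hence "\<bar>b $ j\<bar> = \<bar>c $ j\<bar>" by (simp add: gb gc)
		moreover have "real_of_int (b $ j * c $ j) \<ge> 0" using x(2) by (simp add: bj mult.assoc)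
		hence "0 \<le> b $ j * c $ j" by (simp only: of_int_0_le_iff)
		ultimately show ?thesis by (auto simp: abs_eq_iff zero_le_mult_iff)
	qed
	thus ?thesis by (simp add: vec_eq_iff)
qed

lemma finite_rays:
	assumes "fan \<Delta>"
	shows "finite (rays \<Delta>)"
proof (rule inj_on_finite)
	show "inj_on (%b. convex_cone hull {rvec b}) (rays \<Delta>)"
	proof (rule inj_onI)
		fix b c assume bc: "b \<in> rays \<Delta>" "c \<in> rays \<Delta>" "convex_cone hull {rvec b} = convex_cone hull {rvec c}"
		have "rvec b \<in> convex_cone hull {rvec c}" unfolding bc(3)[symmetric] by (simp add: hull_inc)
		then obtain x where "x \<ge> 0" "rvec b = x *\<^sub>R rvec c" by (auto simp: convex_cone_hull_single)
		thus "b = c" using bc by (intro primitive_multiple) (auto simp: rays_def)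
	qed
	show "(%b. convex_cone hull {rvec b}) ` rays \<Delta> \<subseteq> \<Delta>" by (auto simp: rays_def)
	show "finite \<Delta>" using assms by (simp add: fan_def)
qed

section \<open>Formal power series with multisets as monomials\<close>

text \<open>A type of its own, so that convolution over submultisets can be the multiplication of a
  ring instance.\<close>

typedef ('a, 'b) mser = "UNIV :: ('a multiset => 'b) set"
	morphisms co Ser by simp

setup_lifting type_definition_mser

lemma mser_eqI: "(!!M. co a M = co b M) ==> a = b" by (metis co_inject ext)

lemma sum_submsets_swap: "(\<Sum>A | A \<subseteq># M. f A (M - A)) = (\<Sum>A | A \<subseteq># M. f (M - A) A)"
	by (rule sum.reindex_bij_witness[where i = "%A. M - A" and j = "%A. M - A"])
		(auto simp: subset_mset.le_iff_add)

lemma sum_submsets_assoc: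
	fixes f :: "'a multiset => 'a multiset => 'a multiset => 'b::comm_monoid_add"
	shows "(\<Sum>A | A \<subseteq># M. \<Sum>C | C \<subseteq># A. f C (A - C) (M - A)) = (\<Sum>C | C \<subseteq># M. \<Sum>D | D \<subseteq># M - C. f C D (M - C - D))"
proof -
	have "(\<Sum>A | A \<subseteq># M. \<Sum>C | C \<subseteq># A. f C (A - C) (M - A)) =
			(\<Sum>(A, C)\<in>(SIGMA A:{A. A \<subseteq># M}. {C. C \<subseteq># A}). f C (A - C) (M - A))"
		by (rule sum.Sigma) (auto simp: finite_submultisets)
	also have "... = (\<Sum>(C, D)\<in>(SIGMA C:{C. C \<subseteq># M}. {D. D \<subseteq># M - C}). f C D (M - C - D))"
		by (rule sum.reindex_bij_witness[where j = "%(A, C). (C, A - C)" and i = "%(C, D). (C + D, C)"])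
			(auto simp: subset_mset.le_iff_add add.assoc)
	also have "... = (\<Sum>C | C \<subseteq># M. \<Sum>D | D \<subseteq># M - C. f C D (M - C - D))"
		by (rule sum.Sigma[symmetric]) (auto simp: finite_submultisets)
	finally show ?thesis .
qed

instantiation mser :: (type, comm_ring_1) comm_ring_1
begin

lift_definition zero_mser :: "('a, 'b) mser" is "%M. 0" .
lift_definition one_mser :: "('a, 'b) mser" is "%M. if M = {#} then 1 else 0" .
lift_definition plus_mser :: "('a, 'b) mser => ('a, 'b) mser => ('a, 'b) mser" is "%u v M. u M + v M" .
lift_definition minus_mser :: "('a, 'b) mser => ('a, 'b) mser => ('a, 'b) mser" is "%u v M. u M - v M" .
lift_definition uminus_mser :: "('a, 'b) mser => ('a, 'b) mser" is "%u M. - u M" .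
lift_definition times_mser :: "('a, 'b) mser => ('a, 'b) mser => ('a, 'b) mser" is
	"%u v M. \<Sum>A | A \<subseteq># M. u A * v (M - A)" .

lemma co_simps: "co (a + b) M = co a M + co b M" "co (a - b) M = co a M - co b M" "co (- a) M = - co a M"
	"co 0 M = 0" "co 1 M = (if M = {#} then 1 else 0)"
	by (simp_all add: plus_mser.rep_eq minus_mser.rep_eq uminus_mser.rep_eq zero_mser.rep_eq one_mser.rep_eq)

lemma co_mult: "co (a * b) M = (\<Sum>A | A \<subseteq># M. co a A * co b (M - A))" by (simp add: times_mser.rep_eq)

instance
proof
	fix a b c :: "('a, 'b) mser"
	show "a * b * c = a * (b * c)"
	proof (rule mser_eqI)
		fix M
		show "co (a * b * c) M = co (a * (b * c)) M" using sum_submsets_assoc[of "%C D E. co a C * co b D * co c E" M]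
			by (simp add: co_mult sum_distrib_left sum_distrib_right mult.assoc)
	qed
	show "a * b = b * a" using sum_submsets_swap[of "%A B. co a A * co b B"] by (intro mser_eqI) (simp add: co_mult mult.commute)
	show "1 * a = a"
	proof (rule mser_eqI)
		fix M
		have "co (1 * a) M = (\<Sum>A | A \<subseteq># M. if A = {#} then co a M else 0)"
			unfolding co_mult by (intro sum.cong) (auto simp: co_simps)
		thus "co (1 * a) M = co a M" by (simp add: finite_submultisets)
	qed
	show "(0 :: ('a, 'b) mser) ~= 1"
	proof
		assume "(0 :: ('a, 'b) mser) = 1"
		hence "co (0 :: ('a, 'b) mser) {#} = co 1 {#}" by simp
		thus False by (simp add: co_simps)
	qed
qed (rule mser_eqI, simp add: co_simps co_mult algebra_simps sum.distrib)+

end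

lemma co_sum: "co (sum f I) M = (\<Sum>i\<in>I. co (f i) M)" by (induction I rule: infinite_finite_induct) (auto simp: co_simps)

lemma co_Ser [simp]: "co (Ser f) = f" by (simp add: Ser_inverse)

section \<open>States and propagators as series of good forms\<close>

type_synonym 'n qs = "((int,'n) vec, 'n gf) mser"

definition Wq :: "(int,'n::{finite,linorder}) vec set => 'n qs" where
	"Wq B = Ser (%M. if \<exists>b\<in>B. M = {#b#} then 1 else 0)"

text \<open>All states that occur have the vector \<open>sum_mset M\<close> at the monomial
  \<open>M\<close>, because each \<open>q\<^sub>b\<close> enters together with the vector
  \<open>b\<close>. So the vector is not stored, and the propagator reads it off from
  \<open>M\<close>.\<close>

definition kq :: "'n::{finite,linorder} qs => 'n qs" where
	"kq v = Ser (%M. kap (sum_mset M) (co v M))"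

definition TR :: "'n::{finite,linorder} qs => 'n monom => complex" where
	"TR v M = (if sum_mset M = 0 then tr (co v M) else 0)"

lemma kq_add: "kq (u + v) = kq u + kq v" by (rule mser_eqI) (simp add: kq_def co_simps kap_add)

lemma kq_zero [simp]: "kq 0 = 0" using kq_add[of 0 0] by simp

lemma TR_add: "TR (u + v) M = TR u M + TR v M" by (simp add: TR_def co_simps tr_add)

lemma TR_zero [simp]: "TR 0 M = 0" by (simp add: TR_def co_simps)

lemma TR_sum: "TR (sum f I) M = (\<Sum>i\<in>I. TR (f i) M)" by (induction I rule: infinite_finite_induct) (auto simp: TR_add)

lemma sum_mset_diff: "A \<subseteq># M ==> sum_mset (M - A) = sum_mset M - sum_mset (A :: 'a::ab_group_add multiset)"
	by (metis add_diff_cancel_right' subset_mset.diff_add sum_mset.union)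

text \<open>\<open>TR\<close> sees only total vector zero. There the two factors carry opposite
  vectors, and \<open>tr_kap\<close> applies to each summand.\<close>

lemma TR_kq: "TR (a * kq b) M = TR (kq a * b) M"
proof (cases "sum_mset M = 0")
	case True
	have "tr (co a A * kap (sum_mset (M - A)) (co b (M - A))) = tr (kap (sum_mset A) (co a A) * co b (M - A))" if "A \<subseteq># M" for A
		using True by (simp add: sum_mset_diff[OF that] tr_kap)
	thus ?thesis using True by (simp add: TR_def co_mult kq_def tr_sum)
qed (simp add: TR_def)

lemma sum_if_submset:
	assumes "finite B"
	shows "(\<Sum>A | A \<subseteq># M. if \<exists>b\<in>B. A = {#b#} then f A else 0) = (\<Sum>b\<in>B. if b \<in># M then f {#b#} else 0)"
proof -
	have "(\<Sum>A | A \<subseteq># M. if \<exists>b\<in>B. A = {#b#} then f A else 0) = (\<Sum>A | A \<subseteq># M. \<Sum>b\<in>B. if A = {#b#} then f A else 0)"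
	proof (rule sum.cong[OF refl])
		fix A
		show "(if \<exists>b\<in>B. A = {#b#} then f A else 0) = (\<Sum>b\<in>B. if A = {#b#} then f A else 0)"
		proof (cases "\<exists>b\<in>B. A = {#b#}")
			case True
			then obtain b where b: "b \<in> B" "A = {#b#}" by blast
			have "(\<Sum>c\<in>B. if A = {#c#} then f A else 0) = (\<Sum>c\<in>B. if c = b then f A else 0)" by (intro sum.cong) (auto simp: b)
			thus ?thesis using b assms by auto
		qed (auto intro!: sum.neutral[symmetric])
	qed
	also have "... = (\<Sum>b\<in>B. \<Sum>A | A \<subseteq># M. if A = {#b#} then f A else 0)" by (rule sum.swap)
	also have "... = (\<Sum>b\<in>B. if b \<in># M then f {#b#} else 0)"
		by (intro sum.cong) (auto simp: finite_submultisets intro!: sum.neutral)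
	finally show ?thesis .
qed

lemma co_Wq:
	assumes "finite B"
	shows "co (Wq B * v) M = (\<Sum>b\<in>B. if b \<in># M then co v (M - {#b#}) else 0)"
proof -
	have "co (Wq B * v) M = (\<Sum>A | A \<subseteq># M. if \<exists>b\<in>B. A = {#b#} then co v (M - A) else 0)"
		unfolding co_mult by (intro sum.cong) (auto simp: Wq_def)
	thus ?thesis by (simp add: sum_if_submset[OF assms])
qed

text \<open>Multiplication by \<open>Wq B\<close> raises the degree by one, so each coefficient of a
  solution is determined by those of lower degree.\<close>

lemma Wq_fixpoint_unique:
	assumes B: "finite B" and y: "y = u + kq (Wq B * y)" and z: "z = u + kq (Wq B * z)"
	shows "y = z"
proof (rule mser_eqI)
	fix M
	show "co y M = co z M"
	proof (induction "size M" arbitrary: M rule: less_induct)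
		case less
		have IH: "co y (M - {#b#}) = co z (M - {#b#})" if "b \<in># M" for b by (rule less) (use that in "simp add: size_Diff1_less")
		have "co (Wq B * y) M = co (Wq B * z) M" unfolding co_Wq[OF B] using IH by (intro sum.cong) auto
		moreover have "co y M = co u M + kap (sum_mset M) (co (Wq B * y) M)" by (subst y) (simp add: co_simps kq_def)
		moreover have "co z M = co u M + kap (sum_mset M) (co (Wq B * z) M)" by (subst z) (simp add: co_simps kq_def)
		ultimately show ?case by simp
	qed
qed

definition itq :: "(int,'n::{finite,linorder}) vec set => nat => 'n qs => 'n qs" where
	"itq B d = (%v. kq (Wq B * v)) ^^ d"

text \<open>The geometric series in \<open>kq\<close> and \<open>Wq\<close>. The iterates beyond the
  degree of the monomial vanish by \<open>itq_eq_0\<close>, so truncating there loses nothing and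
  keeps the sum finite.\<close>

definition dressed :: "(int,'n::{finite,linorder}) vec set => 'n qs => 'n qs" where
	"dressed B v = Ser (%M. \<Sum>d\<le>size M. co (itq B d v) M)"

lemma itq_eq_0: "finite B ==> size M < d ==> co (itq B d v) M = 0"
proof (induction d arbitrary: M)
	case (Suc d)
	have "co (itq B d v) (M - {#b#}) = 0" if "b \<in># M" for b by (rule Suc.IH) (use Suc that size_Diff1_less[OF that] in auto)
	hence "co (Wq B * itq B d v) M = 0" unfolding co_Wq[OF Suc.prems(1)] by (intro sum.neutral) auto
	thus ?case by (simp add: itq_def kq_def)
qed simp

lemma dressed_eq:
	assumes "finite B"
	shows "dressed B v = v + kq (Wq B * dressed B v)"
proof (rule mser_eqI)
	fix M
	have le: "(\<Sum>d\<le>k. co (itq B d v) A) = co (dressed B v) A" if "size A \<le> k" for A k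
		unfolding dressed_def co_Ser by (rule sum.mono_neutral_right) (use that in "auto simp: itq_eq_0[OF assms]")
	have "co (Wq B * dressed B v) M = (\<Sum>b\<in>B. if b \<in># M then (\<Sum>d\<le>size M. co (itq B d v) (M - {#b#})) else 0)"
		unfolding co_Wq[OF assms] by (intro sum.cong refl) (auto intro!: le[symmetric] simp: size_Diff_singleton)
	also have "... = (\<Sum>d\<le>size M. co (Wq B * itq B d v) M)" unfolding co_Wq[OF assms] by (subst sum.swap) (auto intro!: sum.cong)
	finally have "co (kq (Wq B * dressed B v)) M = (\<Sum>d\<le>size M. co (itq B (Suc d) v) M)" by (simp add: kq_def kap_sum itq_def)
	moreover have "co (dressed B v) M = (\<Sum>d\<le>Suc (size M). co (itq B d v) M)" by (rule le[symmetric]) simp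
	ultimately show "co (dressed B v) M = co (v + kq (Wq B * dressed B v)) M"
		by (simp add: sum.atMost_Suc_shift co_simps itq_def del: sum.atMost_Suc)
qed

text \<open>The deformed propagator: the free one followed by the geometric series.
  \<open>kX_eq\<close> is its resolvent equation.\<close>

definition kX :: "(int,'n::{finite,linorder}) vec set => 'n qs => 'n qs" where
	"kX B v = dressed B (kq v)"

lemma kX_eq: "finite B ==> kX B v = kq (v + Wq B * kX B v)" using dressed_eq[of B "kq v"] by (simp add: kX_def kq_add)

text \<open>With \<open>y\<close> and \<open>z\<close> the resolvents of \<open>v\<close> and
  \<open>u\<close>, \<open>TR_kq\<close> is applied to the pairing of \<open>u + W z\<close> with
  \<open>kq (v + W y)\<close>. The term with \<open>W\<close>, \<open>z\<close> and \<open>y\<close>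
  appears on both sides and cancels.\<close>

lemma TR_kX:
	assumes "finite B"
	shows "TR (u * kX B v) M = TR (kX B u * v) M"
proof -
	let ?y = "kX B v" and ?z = "kX B u" and ?W = "Wq B"
	have "TR ((u + ?W * ?z) * ?y) M = TR ((u + ?W * ?z) * kq (v + ?W * ?y)) M" by (subst kX_eq[OF assms, of v]) simp
	also have "... = TR (kq (u + ?W * ?z) * (v + ?W * ?y)) M" by (rule TR_kq)
	also have "... = TR (?z * (v + ?W * ?y)) M" by (subst (2) kX_eq[OF assms, of u]) simp
	finally show ?thesis by (simp add: distrib_left distrib_right TR_add mult_ac)
qed

lemma kX_add:
	assumes "finite B"
	shows "kX B (u + v) = kX B u + kX B v"
proof (rule Wq_fixpoint_unique[OF assms])
	show "kX B (u + v) = kq (u + v) + kq (Wq B * kX B (u + v))" using kX_eq[OF assms, of "u + v"] by (simp add: kq_add)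
	show "kX B u + kX B v = kq (u + v) + kq (Wq B * (kX B u + kX B v))"
		by (subst kX_eq[OF assms, of u], subst kX_eq[OF assms, of v]) (simp add: kq_add distrib_left)
qed

lemma kX_zero: "finite B ==> kX B 0 = 0" using kX_add[of B 0 0] by simp

lemma kX_sum: "finite B ==> kX B (sum f I) = (\<Sum>i\<in>I. kX B (f i))"
	by (induction I rule: infinite_finite_induct) (auto simp: kX_add kX_zero)

section \<open>Translation of the operators on states\<close>

text \<open>Embeds the reduced series into states by restoring the vector from the monomial. All
  operators of the two models are compared through this map.\<close>

definition toq :: "'n::{finite,linorder} qs => 'n qstate" where
	"toq v M m = (if m = sum_mset M then (%r. cf (ev (co v M) r)) else 0)"

lemma toq_apply: "toq v M m r S = (if m = sum_mset M then cf (ev (co v M) r) S else 0)" by (simp add: toq_def)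

lemma fun_sum_apply: "sum f I x = (\<Sum>i\<in>I. f i x)" for f :: "'i => 'a => 'b::comm_monoid_add"
	by (induction I rule: infinite_finite_induct) auto

lemma fwedge_zero [simp]: "fwedge 0 f = 0" "fwedge f 0 = 0" by (intro ext, simp add: fwedge_def gwedge_def)+

lemma mu2_toq:
	assumes "A \<subseteq># M"
	shows "mu2 (toq u A) (toq v (M - A)) m r S = (if m = sum_mset M then cf (ev (co u A * co v (M - A)) r) S else 0)"
proof -
	let ?k = "sum_mset A"
	have "mu2 (toq u A) (toq v (M - A)) m r S = (\<Sum>k | toq u A k ~= 0. fwedge (toq u A k) (toq v (M - A) (m - k)) r S)"
		by (simp add: mu2_def fun_sum_apply)
	also have "... = (\<Sum>k\<in>{?k}. fwedge (toq u A k) (toq v (M - A) (m - k)) r S)"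
		by (rule sum.mono_neutral_left) (auto simp: toq_def[of u] split: if_splits)
	also have "... = (if m = sum_mset M then cf (ev (co u A * co v (M - A)) r) S else 0)"
	proof -
		have "m - ?k = sum_mset (M - A) \<longleftrightarrow> m = sum_mset M" by (simp add: sum_mset_diff[OF assms])
		thus ?thesis by (auto simp: toq_def) (simp add: fwedge_def ev_simps cf_mult)
	qed
	finally show ?thesis .
qed

lemma qmu2_toq: "qmu2 (toq u) (toq v) = toq (u * v)"
proof (intro ext)
	fix M m r S
	have "qmu2 (toq u) (toq v) M m r S = (\<Sum>A | A \<subseteq># M. mu2 (toq u A) (toq v (M - A)) m r S)"
		by (simp add: qmu2_def fun_sum_apply)
	thus "qmu2 (toq u) (toq v) M m r S = toq (u * v) M m r S" by (simp add: mu2_toq toq_apply co_mult ev_sum cf_sum)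
qed

lemma qpairing_toq:
	fixes u v :: "'n::{finite,linorder} qs"
	shows "qpairing (toq u) (toq v) M = TR (u * v) M"
proof -
	have "pairing (toq u A) (toq v (M - A)) = (if sum_mset M = 0 then tr (co u A * co v (M - A)) else 0)" if "A \<subseteq># M" for A
	proof -
		let ?k = "sum_mset A"
		have i0: "int_X (0 :: 'n form) = 0" "int_X (%r S. 0 :: complex) = 0" by (simp_all add: int_X_def)
		have "pairing (toq u A) (toq v (M - A)) = (\<Sum>k\<in>{?k}. int_X (fwedge (toq u A k) (toq v (M - A) (- k))))"
			unfolding pairing_def by (rule sum.mono_neutral_left) (auto simp: toq_def[of u] i0 split: if_splits)
		moreover have "- ?k = sum_mset (M - A) \<longleftrightarrow> sum_mset M = 0" by (auto simp: sum_mset_diff[OF that])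
		ultimately show ?thesis by (auto simp: toq_def i0) (simp add: tr_def ev_simps cf_mult fwedge_def[abs_def])
	qed
	thus ?thesis by (simp add: qpairing_def TR_def co_mult tr_sum)
qed

lemma PsiX_toq:
	assumes "finite B"
	shows "PsiX B = toq (Wq B)" by (intro ext) (auto simp: PsiX_apply[OF assms] toq_apply Wq_def ev_simps cf_one)

lemma OX_toq: "finite B ==> OX B (toq v) = toq (Wq B * v)" by (simp add: OX_def PsiX_toq qmu2_toq)

lemma set_integral_Ici:
	fixes f :: "real => complex"
	shows "(LINT t:{0..}|lborel. f t) = (LBINT t. of_bool (t > 0) * f t)" unfolding set_lebesgue_integral_def
	by (rule integral_discrete_difference[where X = "{0}"]) (auto simp: indicator_def)

lemma contr_rp: "contrR m (contrPhi m \<omega>) r = rp (rvec m) (\<omega> r)" by (simp add: contrR_eq contrPhi_eq rp_def)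

lemma rp_zero [simp]: "rp m 0 = 0" "rp m (%S. 0) = (%S. 0)" by (simp_all add: rp_def zero_fun_def[symmetric])

lemma propK_toq:
	fixes v :: "'n::{finite,linorder} qs"
	shows "scale (2 * of_real pi) (propK (Gminus (toq v))) = toq (kq v)"
proof (intro ext)
	fix M m r S
	have z: "rp (rvec m) ((0 :: 'n form) r') S = 0" for r' by (simp add: rp_def)
	show "scale (2 * of_real pi) (propK (Gminus (toq v))) M m r S = toq (kq v) M m r S"
	proof (cases "m = sum_mset M")
		case True
		thus ?thesis by (simp add: scale_def propK_def heat_def Gplus_def Gminus_def contr_rp toq_def kq_def cf_kap
					flowint_def set_integral_Ici)
	next case False
		hence "propK (Gminus (toq v)) M m r S = 0" unfolding propK_def heat_def Gplus_def Gminus_def contr_rp toq_def by (simp add: z)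
		thus ?thesis using False by (simp add: scale_def toq_apply)
	qed
qed

text \<open>Meaningful for good forms of even degree, for which \<open>cf_gform\<close> recovers the
  form.\<close>

definition gform :: "'n::{finite,linorder} form => 'n gf" where
	"gform \<gamma> = Gf (%r. Eext (\<gamma> r))"

definition mono0 :: "'b => ('a, 'b::comm_ring_1) mser" where
	"mono0 c = Ser (%M. if M = {#} then c else 0)"

lemma cf_gform:
	fixes \<gamma> :: "'n::{finite,linorder} form"
	assumes "good \<gamma>" "homogeneous p \<gamma>" "even p"
	shows "cf (ev (gform \<gamma>) r) = \<gamma> r"
proof -
	have e: "cf (Eext (\<gamma> r)) = \<gamma> r" for r by (rule even_Eext) (use assms in "auto simp: homogeneous_def finite_gen_set")
	hence "ev (gform \<gamma>) = (%r. Eext (\<gamma> r))" unfolding gform_def using assms(1) by (intro Gf_inverse) simp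
	thus ?thesis by (simp add: e)
qed

lemma ev_state_toq:
	fixes \<gamma> :: "'n::{finite,linorder} form"
	assumes "good \<gamma>" "homogeneous p \<gamma>" "even p"
	shows "ev_state \<gamma> = toq (mono0 (gform \<gamma>))"
	by (intro ext) (auto simp: ev_state_def qmonom_def ket_def toq_apply mono0_def cf_gform[OF assms] ev_simps)

lemma suminf_toq:
	assumes "finite B"
	shows "(\<Sum>d. toq (itq B d v) M m r S) = toq (dressed B v) M m r S"
proof -
	have "toq (itq B d v) M m r S = 0" if "d ~: {..size M}" for d
		using that itq_eq_0[OF assms, of M d v] by (simp add: toq_apply ev_simps)
	hence "(\<Sum>d. toq (itq B d v) M m r S) = (\<Sum>d\<le>size M. toq (itq B d v) M m r S)" by (intro suminf_finite) auto
	thus ?thesis by (simp add: toq_apply dressed_def ev_sum cf_sum)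
qed

lemma mirror_state_toq:
	fixes \<gamma> :: "'n::{finite,linorder} form"
	assumes \<gamma>: "good \<gamma>" "homogeneous p \<gamma>" "even p" and B: "finite B"
	shows "mirror_state B \<gamma> = toq (dressed B (mono0 (gform \<gamma>)))"
proof (intro ext)
	fix M m r S
	have "((%v. scale (2 * of_real pi) (propK (Gminus (OX B v)))) ^^ d) (toq u) = toq (itq B d u)" for d u
		by (induction d) (simp_all add: itq_def OX_toq[OF B] propK_toq)
	thus "mirror_state B \<gamma> M m r S = toq (dressed B (mono0 (gform \<gamma>))) M m r S"
		by (simp add: mirror_state_def ev_state_toq[OF \<gamma>] suminf_toq[OF B])
qed

subsection \<open>The Dyson series\<close>

text \<open>Order \<open>d\<close> of the Dyson series with initial state
  \<open>G\<^sub>+ G\<^sub>-\<close> of \<open>v\<close>, at the vector \<open>sum_mset M\<close>.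
  Each order multiplies by the superpotential, which takes one divisor \<open>b\<close> out of the
  monomial; the constant \<open>2\<pi>\<close> is that of
  \<open>Q - 2\<pi> [G\<^sub>-, O\<^sub>X]\<close>.\<close>

primrec dys :: "(int,'n::{finite,linorder}) vec set => 'n qs => nat => 'n monom => real => 'n form" where
	"dys B v 0 = (%M t r S. of_bool (t > 0) * rp (rvec (sum_mset M)) (cf (ev (co v M) (r - t *\<^sub>R rvec (sum_mset M)))) S)"
| "dys B v (Suc d) = (%M. volt (rvec (sum_mset M)) (%s r S. 2 * of_real pi *
		 (\<Sum>b\<in>B. if b \<in># M then dys B v d (M - {#b#}) s r S else 0)))"

lemma pgood_sum:
	assumes "!!i. i \<in> I ==> pgood P \<beta> (w i)"
	shows "pgood P \<beta> (%p r S. \<Sum>i\<in>I. w i p r S)" using assms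
proof (induction I rule: infinite_finite_induct)
	case (insert i I)
	have "pgood P \<beta> (%p r. w i p r + (%S. \<Sum>i\<in>I. w i p r S))" using insert by (intro pgood_add) auto
	thus ?case by (rule pgood_cong_fun) (use insert in "simp add: fun_eq_iff")
qed (use pgood_zero[of P \<beta>] in "simp_all add: zero_fun_def")

lemma pgood_weaken:
	assumes "pgood P \<beta> w" "!!p. p \<in> space P ==> 0 \<le> \<beta> p & \<beta> p \<le> \<beta>' p"
	shows "pgood P \<beta>' w" using assms(1)
proof induction
	case (pgood_piece A C K w)
	have "norm (w p r S) \<le> \<bar>K\<bar> * \<beta>' p" if "p \<in> space P" for p r S
	proof -
		have "K * \<beta> p \<le> \<bar>K\<bar> * \<beta>' p" using assms(2)[OF that] by (intro mult_mono) auto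
		thus ?thesis using pieceD(4)[OF pgood_piece that, of r S] by simp
	qed
	hence "piece P \<beta>' A C \<bar>K\<bar> w" using pgood_piece by (simp add: piece_def)
	thus ?case by (rule pgood.pgood_piece)
next case (pgood_add w1 w2)
	from pgood.pgood_add[OF pgood_add.IH] show ?case .
qed

lemma pgood_if: "pgood P \<beta> w ==> pgood P \<beta> (%p r S. if c then w p r S else 0)"
	using pgood_zero[of P \<beta>] by (cases c) (simp_all add: zero_fun_def)

lemma pgood_dys:
	assumes "finite B"
	shows "pgood lborel (%s. exp \<bar>s\<bar>) (dys B v d M)"
proof (induction d arbitrary: M)
	case 0
	show ?case using pgood_weaken[OF pgood_flow_good[OF good_ev], of "%s. exp \<bar>s\<bar>"] by simp
next case (Suc d)
	from Suc show ?case by (auto intro!: pgood_volt pgood_cmult pgood_sum pgood_if)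
qed

lemma dys_neg: "s < 0 ==> dys B v d M s r = (%S. 0)"
	by (cases d) (auto simp: volt_def fun_eq_iff set_lebesgue_integral_def)

lemma rp_annihilated: "vcontr (cR m) (rp m a) = 0" "vcontr (cP m) (rp m a) = 0"
	by (simp_all add: rp_def vcontr_square vcontr_anticomm[of "cP m" "cR m"] vcontr_uminus)

lemma pgood_dys_sum:
	assumes "finite B"
	shows "pgood lborel (%s. exp \<bar>s\<bar>) (%s r S. 2 * of_real pi * (\<Sum>b\<in>B. if b \<in># M then dys B v d (M - {#b#}) s r S else 0))"
	by (intro pgood_cmult pgood_sum pgood_if pgood_dys assms)

text \<open>Every order ends with the two contractions by its own vector, and each of them squares
  to zero. This is the hypothesis of \<open>hamiltonian_diff\<close>.\<close>

lemma dys_annihilated: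
	assumes "finite B"
	shows "vcontr (cR (rvec (sum_mset M))) (dys B v d M s r) = 0" "vcontr (cP (rvec (sum_mset M))) (dys B v d M s r) = 0"
proof -
	have "vcontr (cR (rvec (sum_mset M))) (dys B v d M s r) = 0 & vcontr (cP (rvec (sum_mset M))) (dys B v d M s r) = 0"
	proof (cases d)
		case 0
		thus ?thesis by (simp add: vcontr_of_bool rp_annihilated)
	next case (Suc d')
		show ?thesis unfolding Suc dys.simps
			by (auto simp: fun_eq_iff vcontr_volt(2)[OF pgood_dys_sum[OF assms]] rp_annihilated set_lebesgue_integral_def)
	qed
	thus "vcontr (cR (rvec (sum_mset M))) (dys B v d M s r) = 0" "vcontr (cP (rvec (sum_mset M))) (dys B v d M s r) = 0" by auto
qed

lemma Gplus_diff: "Gplus (u - v) = Gplus u - Gplus v"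
	by (intro ext) (simp add: Gplus_def contrR_eq diff_conv_add_uminus vcontr_add vcontr_uminus del: add_uminus_conv_diff)

lemma scale_fun: "scale c v M m r = (%S. c * v M m r S)" by (rule ext) (simp add: scale_def)

lemma Gplus_scale: "Gplus (scale c v) = scale c (Gplus v)" by (intro ext) (simp add: Gplus_def contrR_eq scale_fun vcontr_cmult)

lemma G_zero: "Gplus 0 = 0" "Gminus 0 = 0" "finite B ==> OX B 0 = 0"
	by (intro ext, force simp: Gplus_def Gminus_def contrR_eq contrPhi_eq OX_apply intro!: sum.neutral)+

text \<open>
  Only the part \<open>2\<pi> G\<^sub>+ G\<^sub>- O\<^sub>X\<close> of the perturbation acts on states annihilated by \<open>G\<^sub>+\<close> and \<open>G\<^sub>-\<close>;
  no derivative is left.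
\<close>

lemma hamiltonian_diff:
	assumes B: "finite B" and w: "Gplus w = 0" "Gminus w = 0"
	shows "hamiltonian (QX B) w - hamiltonian opQ w = - scale (2 * of_real pi) (Gplus (Gminus (OX B w)))"
proof -
	have s0: "scale c 0 = 0" for c by (intro ext) (simp add: scale_def)
	have 1: "QX B (Gplus w) = opQ (Gplus w)" unfolding QX_eq_commutator[OF B] w by (simp add: G_zero B s0)
	have 2: "QX B w = opQ w - scale (2 * of_real pi) (Gminus (OX B w))" unfolding QX_eq_commutator[OF B] w by (simp add: G_zero B)
	show ?thesis unfolding hamiltonian_def 1 2 Gplus_diff Gplus_scale by simp
qed

text \<open>By induction the states stay annihilated by both contractions, so each perturbation
  reduces to \<open>2\<pi> G\<^sub>+ G\<^sub>- O\<^sub>X\<close> up to a sign, which cancels the one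
  in \<open>dyson\<close>.\<close>

lemma dyson_dys:
	fixes v :: "'n::{finite,linorder} qs"
	assumes B: "finite B" and "t > 0"
	shows "dyson (QX B) d t (Gplus (Gminus (toq v))) M m r S = (if m = sum_mset M then dys B v d M t r S else 0)" using assms(2)
proof (induction d arbitrary: t M m r S)
	case 0
	have z: "rp (rvec m) ((0 :: 'n form) r') S = 0" for r' by (simp add: rp_def)
	show ?case using 0 by (auto simp: heat_def Gplus_def Gminus_def contr_rp toq_def z)
next case (Suc d)
	let ?w = "%s. dyson (QX B) d s (Gplus (Gminus (toq v)))"
	have w: "?w s M m r = (if m = sum_mset M then dys B v d M s r else 0)" if "s > 0" for s M m r
		using Suc.IH[OF that] by (simp add: fun_eq_iff)
	have G: "Gplus (?w s) = 0" "Gminus (?w s) = 0" if "s > 0" for s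
		by (intro ext, simp add: Gplus_def Gminus_def contrR_eq contrPhi_eq w[OF that] dys_annihilated[OF B])+
	have X: "heat (t - s) (hamiltonian (QX B) (?w s) - hamiltonian opQ (?w s)) M m r S =
			(if m = sum_mset M then - rp (rvec m) (%S. 2 * of_real pi * (\<Sum>b\<in>B. if b \<in># M then dys B v d (M - {#b#}) s (r - (t - s) *\<^sub>R rvec m) S else 0)) S else 0)"
		if s: "s > 0" for s
	proof -
		have O: "OX B (?w s) M m r' = (%S. if m = sum_mset M then (\<Sum>b\<in>B. if b \<in># M then dys B v d (M - {#b#}) s r' S else 0) else 0)" for r'
		proof
			fix S
			have "m - b = sum_mset (M - {#b#}) \<longleftrightarrow> m = sum_mset M" if "b \<in># M" for b using that by (simp add: sum_mset_diff)
			thus "OX B (?w s) M m r' S = (if m = sum_mset M then (\<Sum>b\<in>B. if b \<in># M then dys B v d (M - {#b#}) s r' S else 0) else 0)"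
				unfolding OX_apply[OF B] w[OF s] by (auto intro!: sum.cong sum.neutral)
		qed
		have z: "rp (rvec m) (%S. 0) S = 0" by (simp add: rp_def zero_fun_def[symmetric])
		show ?thesis unfolding hamiltonian_diff[OF B G[OF s]] heat_def by (simp add: scale_def Gplus_def Gminus_def contr_rp O rp_cmult z)
	qed
	\<comment> \<open>The induction hypothesis holds for positive times only: at time zero
	  \<open>dys\<close> vanishes, whereas \<open>heat 0\<close> is the identity. So the point
	  \<open>s = 0\<close> is left out of the integral.\<close>
	have "dyson (QX B) (Suc d) t (Gplus (Gminus (toq v))) M m r S =
			- (LBINT s. indicator {0..t} s *\<^sub>R (if m = sum_mset M then - rp (rvec m) (%S. 2 * of_real pi * (\<Sum>b\<in>B. if b \<in># M then dys B v d (M - {#b#}) s (r - (t - s) *\<^sub>R rvec m) S else 0)) S else 0))"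
		unfolding dyson.simps set_lebesgue_integral_def minus_equation_iff[of "- _"] neg_equal_iff_equal
		by (rule integral_discrete_difference[where X = "{0}"]) (auto simp: indicator_def X)
	thus ?case by (auto simp: volt_def set_lebesgue_integral_def)
qed

text \<open>\<open>integral_volt\<close> turns each order of the series into one more application of
  \<open>Wq\<close> and \<open>kq\<close>.\<close>

lemma integral_dys:
	assumes B: "finite B"
	shows "2 * of_real pi * (LBINT t. dys B v d M t r S) = cf (ev (co (itq B d (kq v)) M) r) S"
proof (induction d arbitrary: M r S)
	case 0
	show ?case by (simp add: itq_def kq_def cf_kap flowint_def)
next case (Suc d)
	let ?m = "rvec (sum_mset M)"
	have int: "integrable lborel (%s. dys B v d M s r S)" for M r S by (rule pgood_integrable[OF pgood_dys[OF B]])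
	have "(LBINT s. 2 * of_real pi * (\<Sum>b\<in>B. if b \<in># M then dys B v d (M - {#b#}) s r S else 0)) =
			cf (ev (co (Wq B * itq B d (kq v)) M) r) S" for r S
	proof -
		have i: "integrable lborel (%s. if b \<in># M then dys B v d (M - {#b#}) s r S else 0)" for b
			using int by (cases "b \<in># M") auto
		have "(LBINT s. 2 * of_real pi * (\<Sum>b\<in>B. if b \<in># M then dys B v d (M - {#b#}) s r S else 0)) =
				(\<Sum>b\<in>B. if b \<in># M then 2 * of_real pi * (LBINT s. dys B v d (M - {#b#}) s r S) else 0)"
			using i by (simp add: sum_distrib_left) (auto intro!: sum.cong)
		thus ?thesis unfolding Suc.IH co_Wq[OF B] by (auto simp: ev_sum cf_sum ev_simps intro!: sum.cong)
	qed
	hence "(LBINT t. dys B v (Suc d) M t r S) =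
			(LBINT t. of_bool (t > 0) * rp ?m (cf (ev (co (Wq B * itq B d (kq v)) M) (r - t *\<^sub>R ?m))) S)" unfolding dys.simps
		by (subst integral_volt[OF pgood_dys_sum[OF B]]) (auto simp: dys_neg zero_fun_def cong: if_cong)
	thus ?case by (simp add: itq_def kq_def cf_kap flowint_def)
qed

lemma propagator_toq:
	assumes B: "finite B"
	shows "scale (2 * of_real pi) (propagator (QX B) (Gminus (toq v))) = toq (kX B v)"
proof (intro ext)
	let ?X = "%d M m r S. LINT t:{0..}|lborel. dyson (QX B) d t (Gplus (Gminus (toq v))) M m r S"
	fix M m r S
	have int: "2 * of_real pi * (?X d M m r S) = toq (itq B d (kq v)) M m r S" for d
	proof -
		have "(?X d M m r S) =
				(LBINT t. (if m = sum_mset M then dys B v d M t r S else 0))" unfolding set_lebesgue_integral_def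
			by (rule integral_discrete_difference[where X = "{0}"]) (auto simp: indicator_def dyson_dys[OF B] dys_neg)
		thus ?thesis by (simp add: integral_dys[OF B] toq_apply)
	qed
	have "(?X d M m r S) = 0" if "d ~: {..size M}" for d
	proof -
		have "toq (itq B d (kq v)) M m r S = 0" using that itq_eq_0[OF B, of M d "kq v"] by (simp add: toq_apply ev_simps)
		thus ?thesis using int[of d] by simp
	qed
	hence "2 * of_real pi * propagator (QX B) (Gminus (toq v)) M m r S = (\<Sum>d\<le>size M. toq (itq B d (kq v)) M m r S)"
		unfolding propagator_def by (subst suminf_finite[of "{..size M}"]) (auto simp: sum_distrib_left int)
	thus "scale (2 * of_real pi) (propagator (QX B) (Gminus (toq v))) M m r S = toq (kX B v) M m r S"
		by (simp add: scale_def toq_apply kX_def dressed_def ev_sum cf_sum)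
qed

section \<open>Rooted trees\<close>

text \<open>Children form a multiset, so equality of trees is isomorphism of rooted labelled trees,
  and isomorphism classes become elements of a set.\<close>

datatype 'l rt = Nd (lab: 'l) (kids: "'l rt multiset")

primrec labs :: "'l rt => 'l multiset" where
	"labs (Nd l ts) = add_mset l (\<Sum>\<^sub># (image_mset labs ts))"

lemma rt_add_induct [case_names single add]:
	assumes "!!l. P (Nd l {#})" "!!l c ts. P c ==> P (Nd l ts) ==> P (Nd l (add_mset c ts))"
	shows "P t"
proof (induction t)
	case (Nd l ts)
	thus ?case by (induction ts) (auto intro: assms)
qed

lemma labs_add: "labs (Nd l (add_mset c ts)) = labs c + labs (Nd l ts)" by simp

lemma set_labs: "set_mset (labs t) = set_rt t" by (induction t) auto

lemma labs_map: "labs (map_rt f t) = image_mset f (labs t)" by (induction t rule: rt_add_induct) auto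

lemma finite_set_rt [simp]: "finite (set_rt t)" using finite_set_mset[of "labs t"] by (simp add: set_labs)

lemma lab_in_set_rt [simp]: "lab t \<in> set_rt t" by (cases t) simp

lemma set_rt_add: "set_rt (Nd l (add_mset c ts)) = set_rt c \<union> set_rt (Nd l ts)" by auto

definition dstl :: "'l rt => bool" where
	"dstl t \<longleftrightarrow> (\<forall>a. count (labs t) a \<le> 1)"

lemma count_labs: "count (labs t) a = 0 \<longleftrightarrow> a ~: set_rt t" by (simp add: count_eq_zero_iff set_labs)

lemma dstl_add: "dstl (Nd l (add_mset c ts)) \<longleftrightarrow> dstl c & dstl (Nd l ts) & set_rt c \<inter> set_rt (Nd l ts) = {}"
proof -
	have le1: "a + b \<le> 1 \<longleftrightarrow> a \<le> 1 & b \<le> 1 & (a = 0 | b = 0)" for a b :: nat by auto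
	show ?thesis unfolding dstl_def labs_add count_union le1 count_labs by blast
qed

lemma dstl_single [simp]: "dstl (Nd l {#})" by (simp add: dstl_def)

lemma dstl_child:
	assumes "dstl (Nd l ts)" "c \<in># ts"
	shows "dstl c" "l ~: set_rt c" using assms by (auto dest!: multi_member_split simp: dstl_add)

primrec ped :: "'l rt => ('l \<times> 'l) set" where
	"ped (Nd l ts) = \<Union>(set_mset (image_mset (%c. insert (l, lab c) (ped c)) ts))"

lemma ped_add: "ped (Nd l (add_mset c ts)) = insert (l, lab c) (ped c \<union> ped (Nd l ts))" by auto

lemma ped_single [simp]: "ped (Nd l {#}) = {}" by simp

lemma lab_map [simp]: "lab (map_rt f c) = f (lab c)" by (cases c) simp

lemma ped_subset: "ped t \<subseteq> set_rt t \<times> set_rt t"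
proof (induction t rule: rt_add_induct)
	case (add l c ts)
	thus ?case unfolding ped_add set_rt_add by auto
qed simp

lemma ped_map: "ped (map_rt f t) = map_prod f f ` ped t"
proof (induction t rule: rt_add_induct)
	case (add l c ts)
	have "map_rt f (Nd l (add_mset c ts)) = Nd (f l) (add_mset (map_rt f c) (kids (map_rt f (Nd l ts))))" by simp
	moreover have "Nd (f l) (kids (map_rt f (Nd l ts))) = map_rt f (Nd l ts)" by simp
	ultimately show ?case by (simp only: ped_add add lab_map) auto
qed simp

definition gr :: "nat rt => graph" where
	"gr t = \<lparr>verts = set_rt t, adj = ped t \<union> (ped t)\<inverse>\<rparr>"

lemma verts_gr [simp]: "verts (gr t) = set_rt t" and adj_gr: "adj (gr t) = ped t \<union> (ped t)\<inverse>" by (simp_all add: gr_def)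

subsection \<open>Trees with a leaf removed\<close>

lemma successively_cong_on:
	assumes "!!x y. x \<in> set p ==> y \<in> set p ==> P x y = Q x y"
	shows "successively P p = successively Q p" by (rule successively_cong) (use assms in auto)

lemma is_pathD:
	assumes "is_path G u p v"
	shows "p ~= []" "hd p = u" "last p = v" "distinct p" "set p \<subseteq> verts G" "successively (%x y. (x, y) \<in> adj G) p"
	using assms by (auto simp: is_path_def)

lemma is_treeD:
	assumes "is_tree G"
	shows "finite (verts G)" "verts G ~= {}" "adj G \<subseteq> verts G \<times> verts G" "sym (adj G)" "irrefl (adj G)"
		"!!u v. u \<in> verts G ==> v \<in> verts G ==> \<exists>!p. is_path G u p v"
	using assms by (auto simp: is_tree_def)

lemma is_tree_single: "is_tree \<lparr>verts = {v}, adj = {}\<rparr>"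
proof -
	have "is_path \<lparr>verts = {v}, adj = {}\<rparr> v p v \<longleftrightarrow> p = [v]" for p
	proof (cases p)
		case (Cons a q)
		thus ?thesis by (cases q) (auto simp: is_path_def)
	qed (simp add: is_path_def)
	thus ?thesis by (auto simp: is_tree_def sym_def irrefl_def)
qed

definition delv :: "nat => graph => graph" where
	"delv w G = \<lparr>verts = verts G - {w}, adj = {(x, y) \<in> adj G. x ~= w & y ~= w}\<rparr>"

text \<open>An interior visit to \<open>w\<close> would enter and leave through its only neighbour
  \<open>u\<close>, which a path without repetitions cannot visit twice.\<close>

lemma path_avoids_leaf:
	assumes p: "is_path G x p y" and w: "nbrs G w = {u}" and s: "sym (adj G)" and xy: "x ~= w" "y ~= w"
	shows "w ~: set p"
proof
	assume "w \<in> set p"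
	then obtain p1 p2 where pp: "p = p1 @ w # p2" by (meson split_list)
	note pD = is_pathD[OF p]
	have "p1 ~= []" "p2 ~= []" using pD(2,3) xy by (auto simp: pp)
	hence "(last p1, w) \<in> adj G" "(w, hd p2) \<in> adj G" using pD(6) by (auto simp: pp successively_append_iff successively_Cons)
	hence "last p1 = u" "hd p2 = u" using w s by (auto simp: nbrs_def sym_def)
	moreover have "last p1 \<in> set p1" "hd p2 \<in> set p2" using `p1 ~= []` `p2 ~= []` by auto
	ultimately show False using pD(4) by (auto simp: pp)
qed

lemma path_delv:
	assumes w: "nbrs G w = {u}" and s: "sym (adj G)" and xy: "x ~= w" "y ~= w"
	shows "is_path (delv w G) x p y \<longleftrightarrow> is_path G x p y"
proof
	assume p: "is_path G x p y"
	have "w ~: set p" by (rule path_avoids_leaf[OF p w s xy])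
	moreover from this have "successively (%x y. (x, y) \<in> adj (delv w G)) p = successively (%x y. (x, y) \<in> adj G) p"
		by (intro successively_cong_on) (auto simp: delv_def)
	ultimately show "is_path (delv w G) x p y" using p by (auto simp: is_path_def delv_def)
qed (auto simp: is_path_def delv_def elim!: successively_mono)

lemma is_tree_delv:
	assumes G: "is_tree G" and w: "nbrs G w = {u}" "u \<in> verts G" "u ~= w"
	shows "is_tree (delv w G)" unfolding is_tree_def
proof (intro conjI ballI)
	show "\<exists>!p. is_path (delv w G) x p y" if "x \<in> verts (delv w G)" "y \<in> verts (delv w G)" for x y
		using is_treeD(6)[OF G, of x y] path_delv[OF w(1) is_treeD(4)[OF G]] that by (simp add: delv_def)
qed (use is_treeD[OF G] w in "auto simp: delv_def sym_def irrefl_def")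

lemma is_path_rev: "sym (adj G) ==> is_path G y (rev p) x \<longleftrightarrow> is_path G x p y"
proof -
	assume "sym (adj G)"
	hence "(%x y. (y, x) \<in> adj G) = (%x y. (x, y) \<in> adj G)" by (auto simp: sym_def)
	hence "successively (%x y. (x, y) \<in> adj G) (rev p) = successively (%x y. (x, y) \<in> adj G) p"
		unfolding successively_rev by (simp only:)
	thus ?thesis by (auto simp: is_path_def hd_rev last_rev)
qed

text \<open>Paths from the new leaf are the paths from its neighbour with the leaf put in front;
  paths between other vertices avoid it.\<close>

lemma is_tree_leaf:
	assumes H: "is_tree (delv w G)" and G: "adj G \<subseteq> verts G \<times> verts G" "sym (adj G)" "irrefl (adj G)"
		and w: "nbrs G w = {u}" "w \<in> verts G"
	shows "is_tree G"
proof -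
	have u: "(u, w) \<in> adj G" "(w, x) \<in> adj G \<longleftrightarrow> x = u" for x using w(1) G(2) by (auto simp: nbrs_def sym_def)
	hence uV: "u \<in> verts (delv w G)" using G by (auto simp: irrefl_def delv_def)
	have from_w: "\<exists>!p. is_path G w p y" if y: "y \<in> verts G" "y ~= w" for y
	proof -
		have "is_path G w p y \<longleftrightarrow> (\<exists>q. p = w # q & is_path (delv w G) u q y)" for p
		proof
			assume p: "is_path G w p y"
			then obtain q where q: "p = w # q" by (cases p) (auto simp: is_path_def)
			hence "q ~= []" "hd q = u" using is_pathD[OF p] y(2) u(2) by (auto simp: successively_Cons)
			thus "\<exists>q. p = w # q & is_path (delv w G) u q y"
				using p q path_delv[OF w(1) G(2), of u y q] y(2) uV by (auto simp: is_path_def successively_Cons delv_def)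
		next
			assume "\<exists>q. p = w # q & is_path (delv w G) u q y"
			then obtain q where q: "p = w # q" "is_path (delv w G) u q y" by blast
			hence "w ~: set q" "is_path G u q y" using path_delv[OF w(1) G(2), of u y q] y(2) uV by (auto simp: is_path_def delv_def)
			thus "is_path G w p y" using q(1) u(2) w(2) by (auto simp: is_path_def successively_Cons)
		qed
		moreover have "\<exists>!q. is_path (delv w G) u q y" using is_treeD(6)[OF H uV, of y] y by (simp add: delv_def)
		ultimately show ?thesis by auto
	qed
	have "\<exists>!p. is_path G x p y" if x: "x \<in> verts G" and y: "y \<in> verts G" for x y
	proof (cases "x = w"; cases "y = w")
		assume "x = w" "y = w"
		hence "is_path G x p y \<longleftrightarrow> p = [w]" for p using w(2) by (cases p) (auto simp: is_path_def)
		thus ?thesis by simp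
	next
		assume xw: "x ~= w" "y = w"
		obtain p where "is_path G w p x" "!!q. is_path G w q x ==> q = p" using from_w[OF x xw(1)] by blast
		thus ?thesis using is_path_rev[OF G(2)] xw(2) by (intro ex1I[of _ "rev p"]) (metis rev_rev_ident)+
	next
		assume "x ~= w" "y ~= w"
		thus ?thesis using is_treeD(6)[OF H, of x y] path_delv[OF w(1) G(2)] x y by (simp add: delv_def)
	qed (use from_w y in auto)
	moreover have "finite (verts G)" using is_treeD(1)[OF H] by (simp add: delv_def)
	ultimately show ?thesis using G w(2) by (auto simp: is_tree_def)
qed

text \<open>Attaches the leaf at every node labelled \<open>u\<close>; under \<open>dstl\<close>
  there is at most one such node.\<close>

primrec addleaf :: "'l => 'l => 'l rt => 'l rt" where
	"addleaf u w (Nd l ts) = Nd l (image_mset (addleaf u w) ts + (if l = u then {#Nd w {#}#} else {#}))"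

lemma lab_addleaf [simp]: "lab (addleaf u w t) = lab t" by (cases t) simp

lemma addleaf_add: "addleaf u w (Nd l (add_mset c ts)) = Nd l (add_mset (addleaf u w c) (kids (addleaf u w (Nd l ts))))" by simp

lemma labs_addleaf: "labs (addleaf u w t) = labs t + replicate_mset (count (labs t) u) w"
proof (induction t rule: rt_add_induct)
	case (add l c ts)
	have "labs (Nd l (kids (addleaf u w (Nd l ts)))) = labs (addleaf u w (Nd l ts))" by simp
	hence "labs (addleaf u w (Nd l (add_mset c ts))) = labs (addleaf u w c) + labs (addleaf u w (Nd l ts))"
		unfolding addleaf_add labs_add by simp
	thus ?case unfolding add labs_add by (simp only: count_union) (auto simp: multiset_eq_iff)
qed simp

lemma ped_addleaf: "ped (addleaf u w t) = ped t \<union> (if u \<in> set_rt t then {(u, w)} else {})"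
proof (induction t rule: rt_add_induct)
	case (add l c ts)
	have "ped (Nd l (kids (addleaf u w (Nd l ts)))) = ped (addleaf u w (Nd l ts))" by simp
	hence "ped (addleaf u w (Nd l (add_mset c ts))) = insert (l, lab c) (ped (addleaf u w c) \<union> ped (addleaf u w (Nd l ts)))"
		unfolding addleaf_add ped_add by simp
	thus ?case unfolding add ped_add set_rt_add by auto
qed auto

lemma dstl_addleaf: "dstl t ==> w ~: set_rt t ==> dstl (addleaf u w t)"
	using count_labs[of t w] by (auto simp: dstl_def labs_addleaf)

lemma set_addleaf: "u \<in> set_rt t ==> set_rt (addleaf u w t) = insert w (set_rt t)"
	unfolding set_labs[symmetric] labs_addleaf by (auto simp: count_eq_zero_iff)

lemma addleaf_id: "u ~: set_rt t ==> addleaf u w t = t"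
proof (induction t rule: rt_add_induct)
	case (add l c ts)
	thus ?case unfolding addleaf_add set_rt_add by (simp del: addleaf.simps)
qed simp

lemma addleaf_cases:
	assumes "dstl t" "kids t ~= {#}"
	shows "\<exists>u w s. t = addleaf u w s & dstl s & u \<in> set_rt s & w ~: set_rt s" using assms
proof (induction t rule: rt_add_induct)
	case (add l c ts)
	have d: "dstl c" "dstl (Nd l ts)" "set_rt c \<inter> set_rt (Nd l ts) = {}" using add.prems(1) by (auto simp: dstl_add)
	show ?case
	proof (cases "kids c = {#}")
		case True
		hence c: "c = Nd (lab c) {#}" by (cases c) simp
		have "image_mset (addleaf l (lab c)) ts = ts" by (rule multiset.map_ident_strong) (rule addleaf_id[OF dstl_child(2)[OF d(2)]])
		hence "Nd l (add_mset c ts) = addleaf l (lab c) (Nd l ts)" using c[symmetric] by simp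
		moreover have "l \<in> set_rt (Nd l ts)" "lab c ~: set_rt (Nd l ts)" using d(3) lab_in_set_rt[of c] by (simp, blast)
		ultimately show ?thesis using d(2) by (intro exI[of _ l] exI[of _ "lab c"] exI[of _ "Nd l ts"] conjI)
	next case False
		then obtain u w s where s: "c = addleaf u w s" "dstl s" "u \<in> set_rt s" "w ~: set_rt s"
			using add.IH(1)[OF d(1) False] by (elim exE conjE)
		have sub: "set_rt c = insert w (set_rt s)" unfolding s(1) by (rule set_addleaf[OF s(3)])
		hence "addleaf u w (Nd l ts) = Nd l ts" using d(3) s(3) by (intro addleaf_id) blast
		hence "Nd l (add_mset c ts) = addleaf u w (Nd l (add_mset s ts))" unfolding addleaf_add by (simp only: s(1) rt.sel)
		moreover have "dstl (Nd l (add_mset s ts))" "u \<in> set_rt (Nd l (add_mset s ts))" "w ~: set_rt (Nd l (add_mset s ts))"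
			using d s(2-4) sub unfolding dstl_add set_rt_add by auto
		ultimately show ?thesis by (intro exI[of _ u] exI[of _ w] exI[of _ "Nd l (add_mset s ts)"] conjI)
	qed
qed simp

lemma gr_addleaf:
	"u \<in> set_rt t ==> gr (addleaf u w t) = \<lparr>verts = insert w (verts (gr t)), adj = adj (gr t) \<union> {(u, w), (w, u)}\<rparr>"
	by (auto simp: gr_def ped_addleaf set_addleaf)

lemma is_tree_gr: "dstl t ==> is_tree (gr t)"
proof (induction "size (labs t)" arbitrary: t rule: less_induct)
	case less
	show ?case
	proof (cases "kids t = {#}")
		case True
		thus ?thesis using is_tree_single[of "lab t"] by (cases t) (simp add: gr_def)
	next case False
		then obtain u w s where s: "t = addleaf u w s" "dstl s" "u \<in> set_rt s" "w ~: set_rt s"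
			using addleaf_cases[OF less.prems] by blast
		have "0 < count (labs s) u" using s(3) by (simp add: set_labs)
		hence S: "is_tree (gr s)" by (intro less.hyps s(2)) (simp add: s(1) labs_addleaf)
		have g: "gr t = \<lparr>verts = insert w (set_rt s), adj = adj (gr s) \<union> {(u, w), (w, u)}\<rparr>"
			unfolding s(1) gr_addleaf[OF s(3)] by simp
		note SD = is_treeD(3-5)[OF S]
		have "delv w (gr t) = gr s" using s(4) SD(1) unfolding g by (cases "gr s") (auto simp: delv_def gr_def)
		hence "is_tree (delv w (gr t))" using S by simp
		thus ?thesis
		proof (rule is_tree_leaf)
			have "(x, w) ~: adj (gr s)" for x using SD(1) s(4) by auto
			thus "nbrs (gr t) w = {u}" using s(3,4) by (auto simp: g nbrs_def)
			show "adj (gr t) \<subseteq> verts (gr t) \<times> verts (gr t)" "irrefl (adj (gr t))"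
				using SD(1,3) s(3,4) by (auto simp: g irrefl_def)
			show "sym (adj (gr t))" unfolding g using SD(2) by (simp add: sym_def)
		qed (simp add: g)
	qed
qed

subsection \<open>Every tree is the graph of a rooted tree\<close>

text \<open>The end of a longest path from \<open>R\<close> works: another neighbour off the path
  would extend it, and one on the path would give a second path to the same end.\<close>

lemma exists_leaf:
	assumes G: "is_tree G" and R: "R \<in> verts G" and ne: "verts G ~= {R}"
	obtains u w where "u \<in> verts G" "w \<in> verts G" "u ~= w" "w ~= R" "nbrs G w = {u}"
proof -
	obtain v where v: "v \<in> verts G" "v ~= R" using R ne by blast
	define L where "L = {length p | p w. is_path G R p w}"
	have "finite L"
	proof (rule finite_subset)
		show "L \<subseteq> {..card (verts G)}"
			unfolding L_def by (auto simp: distinct_card[symmetric] is_path_def intro!: card_mono is_treeD(1)[OF G])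
	qed simp
	obtain q where q: "is_path G R q v" using is_treeD(6)[OF G R v(1)] by blast
	hence "L ~= {}" by (auto simp: L_def)
	hence "Max L \<in> L" using `finite L` by simp
	then obtain p w where p: "is_path G R p w" "length p = Max L" by (auto simp: L_def)
	have max: "length p' \<le> length p" if "is_path G R p' w'" for p' w'
		using that `finite L` unfolding p(2) by (intro Max_ge) (auto simp: L_def)
	note pD = is_pathD[OF p(1)]
	have "length q \<ge> 2" using is_pathD[OF q] v by (cases q; cases "tl q") auto
	hence "length p \<ge> 2" using max[OF q] by simp
	then obtain p0 u where p0: "p = p0 @ [u, w]"
		using pD(3) by (metis append_butlast_last_id append_assoc append_Cons append_Nil length_0_conv length_append_singleton
				not_less_eq_eq numeral_2_eq_2 One_nat_def le_zero_eq)
	have uw: "(u, w) \<in> adj G" "u \<in> verts G" "w \<in> verts G" "u ~= w" using pD by (auto simp: p0 successively_append_iff)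
	have "w ~= R" using pD by (cases p0) (auto simp: p0)
	have pu: "is_path G R (p0 @ [u]) u"
	proof -
		have "successively (%x y. (x, y) \<in> adj G) ((p0 @ [u]) @ [w])" using pD(6) by (simp add: p0)
		hence "successively (%x y. (x, y) \<in> adj G) (p0 @ [u])" by (subst (asm) successively_append_iff) auto
		thus ?thesis using pD by (cases p0) (auto simp: p0 is_path_def)
	qed
	have "x = u" if x: "(x, w) \<in> adj G" for x
	proof (rule ccontr)
		assume "x ~= u"
		have "(w, x) \<in> adj G" "x \<in> verts G" "x ~= w" using x is_treeD[OF G] by (auto simp: sym_def irrefl_def)
		show False
		proof (cases "x \<in> set p")
			case False
			hence "is_path G R (p @ [x]) x" using pD `(w, x) \<in> adj G` `x \<in> verts G` by (auto simp: is_path_def successively_append_iff)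
			thus False using max by fastforce
		next case True
			hence "x \<in> set p0" using `x ~= u` `x ~= w` by (auto simp: p0)
			then obtain p1 p2 where p1: "p0 = p1 @ x # p2" by (meson split_list)
			have "is_path G R (p1 @ [x, w]) w"
			proof -
				have "successively (%x y. (x, y) \<in> adj G) ((p1 @ [x]) @ (p2 @ [u, w]))" using pD(6) by (simp add: p0 p1)
				hence "successively (%x y. (x, y) \<in> adj G) (p1 @ [x])" by (subst (asm) successively_append_iff) auto
				hence "successively (%x y. (x, y) \<in> adj G) ((p1 @ [x]) @ [w])" using x by (simp only: successively_append_iff) simp
				thus ?thesis using pD(1-5) `w \<in> verts G` by (cases p1) (auto simp: is_path_def p0 p1)
			qed
			hence "p1 @ [x, w] = p" using is_treeD(6)[OF G R `w \<in> verts G`] p(1) by blast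
			thus False by (simp add: p0 p1)
		qed
	qed
	with uw(1) have "nbrs G w = {u}" unfolding nbrs_def by blast
	thus thesis by (rule that[OF uw(2,3,4) `w ~= R`])
qed

lemma tree_rooted:
	assumes "is_tree G" "R \<in> verts G"
	shows "\<exists>t. dstl t & gr t = G & lab t = R" using assms
proof (induction "card (verts G)" arbitrary: G rule: less_induct)
	case less
	note G = less.prems
	show ?case
	proof (cases "verts G = {R}")
		case True
		have "adj G = {}" using is_treeD(3,5)[OF G(1)] True by (auto simp: irrefl_def)
		thus ?thesis using True by (intro exI[of _ "Nd R {#}"]) (auto simp: gr_def)
	next case False
		then obtain u w where uw: "u \<in> verts G" "w \<in> verts G" "u ~= w" "w ~= R" "nbrs G w = {u}"
			using exists_leaf[OF G] by blast
		have "card (verts (delv w G)) < card (verts G)" using card_Diff1_less[OF is_treeD(1)[OF G(1)] uw(2)] by (simp add: delv_def)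
		moreover have "is_tree (delv w G)" by (rule is_tree_delv[OF G(1) uw(5,1,3)])
		ultimately obtain t where t: "dstl t" "gr t = delv w G" "lab t = R" using less.hyps[of "delv w G"] G(2) uw(4) by (auto simp: delv_def)
		have V: "set_rt t = verts G - {w}" and E: "adj (gr t) = {(x, y) \<in> adj G. x ~= w & y ~= w}"
			using arg_cong[OF t(2), of verts] arg_cong[OF t(2), of adj] by (simp_all add: delv_def)
		have nw: "(x, w) \<in> adj G \<longleftrightarrow> x = u" "(w, x) \<in> adj G \<longleftrightarrow> x = u" for x
			using uw(5) is_treeD(4)[OF G(1)] by (auto simp: nbrs_def sym_def)
		have "u \<in> set_rt t" using uw V by blast
		hence "gr (addleaf u w t) = G" unfolding gr_addleaf[OF `u \<in> set_rt t`] E using uw(2) nw V by (cases G) auto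
		moreover have "dstl (addleaf u w t)" by (rule dstl_addleaf[OF t(1)]) (simp add: V)
		ultimately show ?thesis using t(3) by (intro exI[of _ "addleaf u w t"]) simp
	qed
qed

subsection \<open>Neighbours and branches\<close>

lemma set_rt_child: "c \<in># ts ==> set_rt c \<subseteq> set_rt (Nd l ts)" by auto

lemma dstl_kids_lab:
	assumes "dstl (Nd l ts)"
	shows "mset_set (lab ` set_mset ts) = image_mset lab ts" "inj_on lab (set_mset ts)" "l ~: lab ` set_mset ts"
proof -
	have "mset_set (lab ` set_mset ts) = image_mset lab ts & inj_on lab (set_mset ts) & l ~: lab ` set_mset ts" using assms
	proof (induction ts)
		case (add c ts)
		hence *: "dstl (Nd l ts)" "set_rt c \<inter> set_rt (Nd l ts) = {}" by (simp_all add: dstl_add)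
		have "lab c ~: lab ` set_mset ts"
		proof
			assume "lab c \<in> lab ` set_mset ts"
			then obtain d where d: "d \<in># ts" "lab c = lab d" by blast
			have "lab d \<in> set_rt (Nd l ts)" by (rule subsetD[OF set_rt_child[OF d(1)] lab_in_set_rt])
			hence "lab c \<in> set_rt c \<inter> set_rt (Nd l ts)" unfolding d(2)[symmetric] by (rule IntI[OF lab_in_set_rt])
			thus False unfolding *(2) by simp
		qed
		moreover have "lab c ~= l" using *(2) lab_in_set_rt[of c] by auto
		ultimately show ?case using add.IH[OF *(1)] by auto
	qed simp
	thus "mset_set (lab ` set_mset ts) = image_mset lab ts" "inj_on lab (set_mset ts)" "l ~: lab ` set_mset ts" by auto
qed

text \<open>\<open>att G P t\<close>: the tree \<open>t\<close> is a branch of \<open>G\<close> that meets the rest only through edges from its root to \<open>P\<close>.\<close>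

definition att :: "graph => nat set => nat rt => bool" where
	"att G P t \<longleftrightarrow> dstl t & P \<inter> set_rt t = {} &
		 (\<forall>u\<in>set_rt t. nbrs G u = nbrs (gr t) u \<union> (if u = lab t then P else {}))"

lemma att_gr: "dstl t ==> att (gr t) {} t" by (simp add: att_def)

lemma nbrs_gr: "nbrs (gr t) u = {a. (a, u) \<in> ped t | (u, a) \<in> ped t}" by (auto simp: nbrs_def adj_gr)

lemma nbrs_gr_root: "dstl (Nd l ts) ==> nbrs (gr (Nd l ts)) l = lab ` set_mset ts"
proof -
	assume d: "dstl (Nd l ts)"
	have "(a, l) ~: ped (Nd l ts)" for a
	proof
		assume "(a, l) \<in> ped (Nd l ts)"
		then obtain c where c: "c \<in># ts" "(a, l) = (l, lab c) | (a, l) \<in> ped c" by auto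
		hence "l \<in> set_rt c" using ped_subset[of c] by auto
		thus False using dstl_child[OF d c(1)] by blast
	qed
	moreover have "(l, a) \<in> ped (Nd l ts) \<longleftrightarrow> a \<in> lab ` set_mset ts" for a
	proof -
		have "(l, a) ~: ped c" if "c \<in># ts" for c using ped_subset[of c] dstl_child[OF d that] by auto
		thus ?thesis by auto
	qed
	ultimately show "nbrs (gr (Nd l ts)) l = lab ` set_mset ts" by (auto simp: nbrs_gr)
qed

lemma att_root:
	assumes "att G P t"
	shows "nbrs G (lab t) = lab ` set_mset (kids t) \<union> P" using assms nbrs_gr_root[of "lab t" "kids t"] by (auto simp: att_def)

lemma att_child:
	assumes t: "att G P (Nd l ts)" and c: "c \<in># ts"
	shows "att G {l} c"
proof -
	obtain us where ts: "ts = add_mset c us" using c by (metis multi_member_split)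
	have d: "dstl c" "dstl (Nd l us)" "set_rt c \<inter> set_rt (Nd l us) = {}" "l ~: set_rt c"
		using t unfolding att_def ts dstl_add by auto
	have "nbrs G u = nbrs (gr c) u \<union> (if u = lab c then {l} else {})" if u: "u \<in> set_rt c" for u
	proof -
		have "u ~= l" "u \<in> set_rt (Nd l ts)" using u d(4) c by auto
		moreover have "\<forall>u\<in>set_rt (Nd l ts). nbrs G u = nbrs (gr (Nd l ts)) u \<union> (if u = l then P else {})"
			using t unfolding att_def rt.sel by blast
		ultimately have "nbrs G u = nbrs (gr (Nd l ts)) u" by (metis Un_empty_right)
		also have "... = nbrs (gr c) u \<union> (if u = lab c then {l} else {})"
		proof -
			have "(a, u) ~: ped (Nd l us) & (u, a) ~: ped (Nd l us)" for a using ped_subset[of "Nd l us"] u d(3) by blast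
			thus ?thesis unfolding nbrs_gr ts ped_add using `u ~= l` by auto
		qed
		finally show ?thesis .
	qed
	thus ?thesis using d by (simp add: att_def)
qed

lemma att_valence:
	assumes "att G P t" "finite P"
	shows "valence G (lab t) = size (kids t) + card P"
proof -
	obtain l ts where t: "t = Nd l ts" by (cases t)
	have d: "dstl (Nd l ts)" using assms by (simp add: att_def t)
	have disj: "lab ` set_mset ts \<inter> P = {}" using assms(1) by (fastforce simp: att_def t)
	have "nbrs G (lab t) = lab ` set_mset ts \<union> P" using att_root[OF assms(1)] by (simp only: t rt.sel)
	hence "valence G (lab t) = card (lab ` set_mset ts) + card P"
		unfolding valence_def using assms(2) disj by (simp only:) (rule card_Un_disjoint, auto)
	also have "card (lab ` set_mset ts) = size ts" using arg_cong[OF dstl_kids_lab(1)[OF d], of size] by simp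
	finally show ?thesis by (simp add: t)
qed

lemma size_labs_child: "c \<in># ts ==> size (labs c) < size (labs (Nd l ts))" by (auto dest!: multi_member_split)

text \<open>Reads off from the graph the branch at \<open>v\<close> as seen from \<open>p\<close>.
  The number \<open>k\<close> bounds the depth and is chosen at least as large as the tree.\<close>

primrec nm :: "graph => nat => nat => nat => nat rt" where
	"nm G 0 p v = Nd v {#}"
| "nm G (Suc k) p v = Nd v (image_mset (nm G k v) (mset_set (nbrs G v - {p})))"

lemma nm_att:
	assumes "att G P t" "P - {p} = {}" "p ~: set_rt t" "size (labs t) \<le> k"
	shows "nm G k p (lab t) = t" using assms
proof (induction k arbitrary: P p t)
	case 0
	thus ?case by (cases t) simp
next case (Suc k)
	obtain l ts where t: "t = Nd l ts" by (cases t)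
	have d: "dstl (Nd l ts)" using Suc.prems by (simp add: att_def t)
	have "nbrs G l = lab ` set_mset ts \<union> P" using att_root[OF Suc.prems(1)] by (simp add: t)
	moreover have "p ~: lab ` set_mset ts" using Suc.prems(3) lab_in_set_rt by (fastforce simp: t)
	ultimately have "nbrs G l - {p} = lab ` set_mset ts" using Suc.prems(2) by blast
	moreover have "nm G k l (lab c) = c" if c: "c \<in># ts" for c
	proof (rule Suc.IH)
		show "att G {l} c" using att_child[OF Suc.prems(1)[unfolded t] c] .
		show "l ~: set_rt c" by (rule dstl_child[OF d c])
		show "size (labs c) \<le> k" using size_labs_child[OF c, of l] Suc.prems(4) by (simp add: t)
	qed simp
	hence "image_mset (nm G k l) (image_mset lab ts) = ts"
		unfolding multiset.map_comp by (intro trans[OF image_mset_cong image_mset_id]) (auto simp: id_def)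
	ultimately show ?case by (simp only: t rt.sel nm.simps dstl_kids_lab(1)[OF d])
qed

lemma gr_unique:
	assumes "dstl s" "dstl t" "gr s = gr t" "lab s = lab t"
	shows "s = t"
proof -
	define k where "k = size (labs s) + size (labs t)"
	\<comment> \<open>A vertex outside both trees plays the part of the missing predecessor of the
	  root.\<close>
	obtain p where p: "p ~: set_rt s \<union> set_rt t"
		using ex_new_if_finite[OF infinite_UNIV_nat, of "set_rt s \<union> set_rt t"] finite_set_rt by blast
	have "nm (gr s) k p (lab s) = s" by (rule nm_att[OF att_gr[OF assms(1)]]) (use p in "auto simp: k_def")
	moreover have "nm (gr t) k p (lab t) = t" by (rule nm_att[OF att_gr[OF assms(2)]]) (use p in "auto simp: k_def")
	ultimately show ?thesis unfolding assms(3,4) by (rule trans[OF sym])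
qed

lemma is_path_gr_child:
	assumes d: "dstl (Nd l ts)" and c: "c \<in># ts" and q: "is_path (gr c) (lab c) q v"
	shows "is_path (gr (Nd l ts)) l (l # q) v"
proof -
	note qD = is_pathD[OF q]
	have "l ~: set q" using qD(5) dstl_child[OF d c] by auto
	moreover have "successively (%x y. (x, y) \<in> adj (gr (Nd l ts))) q"
		by (rule successively_mono[OF qD(6)]) (use c in "auto simp: adj_gr")
	moreover have "(l, hd q) \<in> adj (gr (Nd l ts))" using qD(2) c by (auto simp: adj_gr)
	moreover have "set q \<subseteq> set_rt (Nd l ts)" using qD(5) c by auto
	ultimately show ?thesis using qD by (auto simp: is_path_def successively_Cons)
qed

lemma the_path_eq:
	assumes "is_tree G" "is_path G u p v"
	shows "the_path G u v = p"
proof -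
	have "u \<in> verts G" "v \<in> verts G"
	proof -
		have "hd p \<in> set p" "last p \<in> set p" using is_pathD(1)[OF assms(2)] by simp_all
		thus "u \<in> verts G" "v \<in> verts G" using is_pathD(2,3,5)[OF assms(2)] by blast+
	qed
	thus ?thesis unfolding the_path_def using is_treeD(6)[OF assms(1)] assms(2) by (metis the1_equality)
qed

lemma the_path_is_path:
	assumes "is_tree G" "u \<in> verts G" "v \<in> verts G"
	shows "is_path G u (the_path G u v) v" unfolding the_path_def using is_treeD(6)[OF assms] by (rule theI')

lemma the_path_child:
	assumes d: "dstl (Nd l ts)" and c: "c \<in># ts" and v: "v \<in> set_rt c"
	shows "the_path (gr (Nd l ts)) l v = l # the_path (gr c) (lab c) v"
proof (rule the_path_eq[OF is_tree_gr[OF d] is_path_gr_child[OF d c]])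
	show "is_path (gr c) (lab c) (the_path (gr c) (lab c) v) v"
		by (rule the_path_is_path[OF is_tree_gr[OF dstl_child(1)[OF d c]]]) (simp_all add: v)
qed

lemma the_path_self: "is_tree G ==> u \<in> verts G ==> the_path G u u = [u]"
	by (rule the_path_eq) (auto simp: is_path_def)

subsection \<open>Relabelling\<close>

lemma dstl_iff: "dstl t \<longleftrightarrow> labs t = mset_set (set_rt t)"
proof
	assume d: "dstl t"
	show "labs t = mset_set (set_rt t)"
	proof (rule multiset_eqI)
		fix a
		have "count (labs t) a \<le> 1" using d by (simp add: dstl_def)
		thus "count (labs t) a = count (mset_set (set_rt t)) a" using count_labs[of t a] by (simp add: count_mset_set') linarith
	qed
next
	assume "labs t = mset_set (set_rt t)"
	thus "dstl t" by (simp add: dstl_def count_mset_set')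
qed

lemma dstl_map:
	assumes "dstl t" "inj_on f (set_rt t)"
	shows "dstl (map_rt f t)" using image_mset_mset_set[OF assms(2)] assms(1) unfolding dstl_iff labs_map rt.set_map by (simp only:)

lemma dstl_map_inj:
	assumes "dstl (map_rt f t)"
	shows "inj_on f (set_rt t)" "dstl t"
proof -
	let ?F = "%a. {x. x \<in># labs t & f a = f x}"
	have fin: "finite (?F a)" for a by (rule finite_subset[of _ "set_rt t"]) (auto simp: set_labs)
	have le: "(\<Sum>x\<in>?F a. count (labs t) x) \<le> 1" for a using assms unfolding dstl_def labs_map count_image_mset' by simp
	have "count (labs t) a \<le> 1" for a
	proof (cases "a \<in># labs t")
		case True
		hence "count (labs t) a \<le> (\<Sum>x\<in>?F a. count (labs t) x)" by (intro member_le_sum) (use fin in auto)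
		thus ?thesis using le[of a] by linarith
	qed (simp add: not_in_iff)
	thus "dstl t" by (simp add: dstl_def)
	show "inj_on f (set_rt t)"
	proof (rule inj_onI, rule ccontr)
		fix a b assume ab: "a \<in> set_rt t" "b \<in> set_rt t" "f a = f b" "a ~= b"
		hence "count (labs t) a ~= 0" "count (labs t) b ~= 0" by (simp_all only: count_labs not_not)
		hence 1: "1 \<le> count (labs t) a" "1 \<le> count (labs t) b" by linarith+
		have "(\<Sum>x\<in>{a, b}. count (labs t) x) \<le> (\<Sum>x\<in>?F a. count (labs t) x)"
			by (rule sum_mono2) (use ab fin in "auto simp: set_labs")
		hence "count (labs t) a + count (labs t) b \<le> 1" using le[of a] ab(4) by simp
		thus False using 1 by linarith
	qed
qed

lemma gr_map_iso:
	assumes f: "graph_iso f (gr t) H" and H: "adj H \<subseteq> verts H \<times> verts H"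
	shows "gr (map_rt f t) = H" "inj_on f (set_rt t)"
proof -
	have V: "f ` set_rt t = verts H" and inj: "inj_on f (set_rt t)" using f by (auto simp: graph_iso_def bij_betw_def)
	have adj: "(u, v) \<in> adj (gr t) \<longleftrightarrow> (f u, f v) \<in> adj H" if "u \<in> set_rt t" "v \<in> set_rt t" for u v
		using f that by (auto simp: graph_iso_def)
	have sub: "(a, b) \<in> adj (gr t) ==> a \<in> set_rt t & b \<in> set_rt t" for a b
		using ped_subset[of t] unfolding adj_gr by blast
	have "map_prod f f ` adj (gr t) = adj H"
	proof (intro equalityI subsetI)
		fix e assume "e \<in> map_prod f f ` adj (gr t)"
		then obtain a b where "(a, b) \<in> adj (gr t)" "e = (f a, f b)" by force
		thus "e \<in> adj H" using adj sub by blast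
	next
		fix e assume e: "e \<in> adj H"
		hence "e \<in> f ` set_rt t \<times> f ` set_rt t" using H V by blast
		then obtain a b where ab: "e = (f a, f b)" "a \<in> set_rt t" "b \<in> set_rt t" by blast
		hence "(a, b) \<in> adj (gr t)" using adj e by blast
		thus "e \<in> map_prod f f ` adj (gr t)" unfolding ab(1) by (metis imageI map_prod_simp)
	qed
	moreover have "adj (gr (map_rt f t)) = map_prod f f ` adj (gr t)" unfolding adj_gr ped_map by (auto simp: image_Un intro: rev_image_eqI)
	ultimately have "adj (gr (map_rt f t)) = adj H" by simp
	thus "gr (map_rt f t) = H" using V by (cases H) (simp add: gr_def rt.set_map)
	show "inj_on f (set_rt t)" by (rule inj)
qed

lemma graph_iso_map:
	assumes "inj_on f (set_rt t)"
	shows "graph_iso f (gr t) (gr (map_rt f t))"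
proof -
	have "(f u, f v) \<in> adj (gr (map_rt f t)) \<longleftrightarrow> (u, v) \<in> adj (gr t)" if "u \<in> set_rt t" "v \<in> set_rt t" for u v
	proof
		assume "(f u, f v) \<in> adj (gr (map_rt f t))"
		then obtain a b where "(a, b) \<in> adj (gr t)" "f u = f a" "f v = f b" by (auto simp: adj_gr ped_map)
		moreover from this have "a \<in> set_rt t" "b \<in> set_rt t" using ped_subset[of t] unfolding adj_gr by blast+
		ultimately show "(u, v) \<in> adj (gr t)" using inj_onD[OF assms, of u a] inj_onD[OF assms, of v b] that by simp
	qed (auto simp: adj_gr ped_map intro: rev_image_eqI)
	thus ?thesis using assms by (auto simp: graph_iso_def bij_betw_def rt.set_map)
qed

text \<open>Equality under relabelling yields a tree of pairs that projects onto \<open>s\<close>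
  and \<open>t\<close>. As their labels are distinct, both projections are injective on the pairs,
  which thus form the graph of \<open>f\<close>.\<close>

lemma shape_eqD:
	assumes eq: "map_rt h s = map_rt k t" and s: "dstl s" and t: "dstl t"
	obtains f where "map_rt f s = t" "inj_on f (set_rt s)" "!!a. a \<in> set_rt s ==> k (f a) = h a"
proof -
	have "rel_rt (=) (map_rt h s) (map_rt k t)" unfolding rt.rel_eq by (rule eq)
	hence "rel_rt (%a b. h a = k b) s t" unfolding rt.rel_map .
	then obtain z where z: "set_rt z \<subseteq> {(a, b). h a = k b}" "map_rt fst z = s" "map_rt snd z = t" unfolding rt.in_rel by blast
	have inj: "inj_on fst (set_rt z)" "inj_on snd (set_rt z)" using dstl_map_inj(1) s t z by blast+
	define f where "f a = snd (the_inv_into (set_rt z) fst a)" for a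
	have ff: "f (fst p) = snd p" if "p \<in> set_rt z" for p using the_inv_into_f_f[OF inj(1) that] by (simp add: f_def)
	have "map_rt f s = map_rt (f \<circ> fst) z" unfolding z(2)[symmetric] rt.map_comp ..
	also have "... = map_rt snd z" by (rule rt.map_cong) (simp_all add: ff)
	finally have f: "map_rt f s = t" using z by simp
	have k: "k (f a) = h a" if a: "a \<in> set_rt s" for a
	proof -
		obtain b where ab: "(a, b) \<in> set_rt z" using a unfolding z(2)[symmetric] rt.set_map by force
		hence "h a = k b" using z(1) by blast
		thus ?thesis using ff[OF ab] by simp
	qed
	show thesis by (rule that[OF f dstl_map_inj(1) k]) (simp_all add: f t)
qed

text \<open>Each node is paired with a fresh number. The lower bound \<open>n\<close> lets the
  numbers of further branches start above those already used.\<close>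

lemma shape_exists_aux:
	fixes t :: "'l rt"
	shows "\<exists>z :: (nat \<times> 'l) rt. map_rt snd z = t & dstl (map_rt fst z) & (\<forall>p\<in>set_rt z. n \<le> fst p)"
proof (induction t arbitrary: n rule: rt_add_induct)
	case (single l)
	show ?case by (intro exI[of _ "Nd (n, l) {#}"]) simp
next case (add l c ts)
	obtain z where z: "map_rt snd z = c" "dstl (map_rt fst z)" "\<forall>p\<in>set_rt z. n \<le> fst p" using add.IH(1) by blast
	define N where "N = Suc (Max (insert n (fst ` set_rt z)))"
	have N: "fst p < N" if "p \<in> set_rt z" for p unfolding N_def less_Suc_eq_le by (rule Max_ge) (use that in auto)
	have "n \<le> N" unfolding N_def by (rule le_SucI, rule Max_ge) auto
	obtain y where y: "map_rt snd y = Nd l ts" "dstl (map_rt fst y)" "\<forall>p\<in>set_rt y. N \<le> fst p" using add.IH(2) by blast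
	obtain a ys where ya: "y = Nd (a, l) ys" using y(1) by (cases y) auto
	have "dstl (map_rt fst (Nd (a, l) (add_mset z ys)))"
		using z(2) y(2,3) N unfolding ya by (fastforce simp: dstl_add rt.set_map simp flip: not_less)
	thus ?case using z y ya `n \<le> N` by (intro exI[of _ "Nd (a, l) (add_mset z ys)"]) (auto intro: order_trans)
qed

lemma shape_exists:
	fixes t :: "'l rt"
	obtains x :: "nat rt" and h where "dstl x" "map_rt h x = t"
proof -
	obtain z :: "(nat \<times> 'l) rt" where z: "map_rt snd z = t" "dstl (map_rt fst z)" using shape_exists_aux[of t 0] by blast
	have inj: "inj_on fst (set_rt z)" by (rule dstl_map_inj(1)[OF z(2)])
	have "map_rt (%a. snd (the_inv_into (set_rt z) fst a)) (map_rt fst z) = map_rt snd z"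
		unfolding rt.map_comp by (rule rt.map_cong) (simp_all add: the_inv_into_f_f[OF inj])
	thus thesis by (intro that[OF z(2)]) (simp add: z(1))
qed

text \<open>When the relation is the kernel of \<open>h\<close>, classes correspond to values of
  \<open>h\<close>, and the chosen representative disappears because \<open>F\<close> factors
  through \<open>h\<close>.\<close>

lemma sum_quotient_kernel:
	assumes r: "r = {(x, y) \<in> S \<times> S. h x = h y}" and F: "!!x. x \<in> S ==> F x = H (h x)"
	shows "(\<Sum>C\<in>S // r. F (SOME x. x \<in> C)) = (\<Sum>k\<in>h ` S. H k)"
proof -
	define K where "K k = {x \<in> S. h x = k}" for k
	define pick where "pick C = (SOME x. x \<in> C)" for C :: "'a set"
	have quot: "S // r = K ` h ` S"
	proof -
		have "r `` {x} = K (h x)" if "x \<in> S" for x using that by (auto simp: r K_def)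
		thus ?thesis unfolding quotient_def image_image by auto
	qed
	have pick: "pick (K k) \<in> S" "h (pick (K k)) = k" if k: "k \<in> h ` S" for k
	proof -
		obtain x where "x \<in> K k" using k by (auto simp: K_def)
		hence "pick (K k) \<in> K k" unfolding pick_def by (rule someI)
		thus "pick (K k) \<in> S" "h (pick (K k)) = k" by (simp_all add: K_def)
	qed
	have "inj_on K (h ` S)" by (rule inj_on_inverseI[where g = "%C. h (pick C)"]) (rule pick)
	hence "(\<Sum>C\<in>S // r. F (pick C)) = (\<Sum>k\<in>h ` S. F (pick (K k)))" unfolding quot by (simp add: sum.reindex)
	also have "... = (\<Sum>k\<in>h ` S. H k)" by (rule sum.cong[OF refl]) (metis F pick)
	finally show ?thesis by (simp add: pick_def)
qed

subsection \<open>Moving the root\<close>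

text \<open>Moving the root across an edge only exchanges which of its two ends is the parent; the
  same pairs of labels stay joined.\<close>

lemma reroot:
	assumes "dstl (Nd v (add_mset (Nd w us) ts))"
	shows "dstl (Nd w (add_mset (Nd v ts) us))" "gr (Nd w (add_mset (Nd v ts) us)) = gr (Nd v (add_mset (Nd w us) ts))"
proof -
	have "labs (Nd w (add_mset (Nd v ts) us)) = labs (Nd v (add_mset (Nd w us) ts))" by simp
	thus "dstl (Nd w (add_mset (Nd v ts) us))" using assms unfolding dstl_def by (rule ssubst)
	show "gr (Nd w (add_mset (Nd v ts) us)) = gr (Nd v (add_mset (Nd w us) ts))" unfolding gr_def by auto
qed

lemma tree_neighbour:
	assumes "dstl x" "(lab x, w) \<in> adj (gr x)"
	obtains us ts where "x = Nd (lab x) (add_mset (Nd w us) ts)"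
proof -
	obtain v ss where x: "x = Nd v ss" by (cases x)
	have "w \<in> nbrs (gr x) v" using assms(2) by (auto simp: nbrs_def adj_gr x)
	then obtain c where c: "c \<in># ss" "w = lab c" using nbrs_gr_root assms(1) unfolding x by blast
	obtain us where "c = Nd w us" using c(2) by (cases c) auto
	moreover obtain ts where "ss = add_mset c ts" using c(1) by (metis multi_member_split)
	ultimately show thesis using that x by simp
qed

lemma path_interior_nonleaf:
	assumes G: "is_tree G" and p: "is_path G u p v" and u: "u ~: leaves G" and v: "v ~: leaves G" and x: "x \<in> set p"
	shows "x ~: leaves G"
proof
	assume l: "x \<in> leaves G"
	then obtain w where w: "nbrs G x = {w}" by (auto simp: leaves_def valence_def card_1_singleton_iff)
	have "u ~= x" "v ~= x" using u v l by auto
	thus False using path_avoids_leaf[OF p w is_treeD(4)[OF G]] x by blast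
qed

text \<open>Paths between internal vertices stay internal, so invariance across internal edges gives
  independence of the sink.\<close>

lemma nonleaf_constant:
	assumes G: "is_tree G" and u: "u \<in> verts G" "u ~: leaves G" and v: "v \<in> verts G" "v ~: leaves G"
		and f: "!!x y. (x, y) \<in> adj G ==> x ~: leaves G ==> y ~: leaves G ==> f x = f y"
	shows "f u = f v"
proof -
	obtain p where p: "is_path G u p v" using is_treeD(6)[OF G u(1) v(1)] by blast
	have "successively (%x y. (x, y) \<in> adj G) q ==> q ~= [] ==> set q \<inter> leaves G = {} ==> f (hd q) = f (last q)" for q
	proof (induction q)
		case (Cons a q)
		show ?case
		proof (cases q)
			case (Cons b q')
			hence "f a = f b" using Cons.prems by (intro f) auto
			thus ?thesis using Cons.IH Cons.prems `q = b # q'` by auto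
		qed simp
	qed simp
	from this[of p] show ?thesis using is_pathD[OF p] path_interior_nonleaf[OF G p u(2) v(2)] by auto
qed

section \<open>Values of trees\<close>

text \<open>An external edge with its vector, a mark, or an unmarked vertex. One type of labels
  serves both sides: below the root, marks have one child in tropical shapes and none in B-model
  trees.\<close>

datatype 'n tl = Dv "(int,'n) vec" | Mk nat | In

text \<open>The propagator is included, so this is the state carried by the edge above the
  branch.\<close>

primrec bv :: "(int,'n::{finite,linorder}) vec set => (nat => 'n qs) => 'n tl rt => 'n qs" where
	"bv B \<Psi> (Nd l ts) = (case l of Mk i => \<Psi> i | _ => kX B (\<Prod>\<^sub># (image_mset (bv B \<Psi>) ts)))"

definition leaf_labels :: "(nat => nat) => graph => nat => 'n tl" where
	"leaf_labels \<sigma> G v = (if v \<in> leaves G then Mk (\<sigma> v) else In)"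

lemma choose_kid_fun:
	assumes "dstl (Nd l ts)"
	obtains g where "!!c. c \<in># ts ==> g (lab c) = h c"
proof (rule that[of "%a. h (the_inv_into (set_mset ts) lab a)"])
	fix c assume "c \<in># ts"
	thus "h (the_inv_into (set_mset ts) lab (lab c)) = h c" by (simp add: the_inv_into_f_f[OF dstl_kids_lab(2)[OF assms]])
qed

lemma prod_kids:
	fixes g :: "nat => 'a::comm_monoid_mult"
	assumes "dstl (Nd l ts)" "!!c. c \<in># ts ==> g (lab c) = h c"
	shows "prod g (lab ` set_mset ts) = \<Prod>\<^sub># (image_mset h ts)"
proof -
	have "prod g (lab ` set_mset ts) = \<Prod>\<^sub># (image_mset g (image_mset lab ts))"
		unfolding dstl_kids_lab(1)[OF assms(1), symmetric] by (simp add: prod_unfold_prod_mset)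
	also have "image_mset g (image_mset lab ts) = image_mset h ts" unfolding multiset.map_comp by (rule image_mset_cong) (simp add: assms(2))
	finally show ?thesis .
qed

lemma sorted_list_two:
	assumes "finite A" "card A = 2"
	obtains a b where "sorted_list_of_set A = [a, b]" "A = {a, b}" "a ~= (b::'a::linorder)"
proof -
	have "length (sorted_list_of_set A) = 2" using assms by simp
	then obtain a b where ab: "sorted_list_of_set A = [a, b]" by (metis length_0_conv length_Suc_conv numeral_2_eq_2)
	hence "A = {a, b}" "a ~= b" using set_sorted_list_of_set[OF assms(1)] distinct_sorted_list_of_set[of A] by auto
	thus thesis using that ab by blast
qed

lemma sorted_list_three:
	assumes "finite A" "card A = 3"
	obtains a b c where "sorted_list_of_set A = [a, b, c]" "A = {a, b, c}" "a ~= (b::'a::linorder)" "a ~= c" "b ~= c"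
proof -
	have "length (sorted_list_of_set A) = 3" using assms by simp
	then obtain a b c where abc: "sorted_list_of_set A = [a, b, c]" by (metis length_0_conv length_Suc_conv numeral_3_eq_3)
	hence "A = {a, b, c}" "a ~= b" "a ~= c" "b ~= c"
		using set_sorted_list_of_set[OF assms(1)] distinct_sorted_list_of_set[of A] by auto
	thus thesis using that abc by blast
qed

text \<open>The sorted list of neighbours in \<open>branch\<close> merely orders two commuting
  factors, so the product over the multiset of children is the same.\<close>

lemma branch_bv:
	fixes \<Psi> :: "nat => 'n::{finite,linorder} qs"
	assumes B: "finite B" and tri: "!!v. v \<in> verts G ==> v ~: leaves G ==> valence G v = 3"
	shows "att G {p} t ==> set_rt t \<subseteq> verts G ==> size (labs t) \<le> k ==>
		branch (QX B) G (%v. toq (\<Psi> (\<sigma> v))) k p (lab t) = toq (bv B \<Psi> (map_rt (leaf_labels \<sigma> G) t))"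
proof (induction k arbitrary: p t)
	case 0
	thus ?case by (cases t) simp
next case (Suc k)
	obtain v ts where t: "t = Nd v ts" by (cases t)
	have v: "v \<in> verts G" using Suc.prems(2) by (simp add: t)
	have d: "dstl (Nd v ts)" using Suc.prems(1) by (simp add: att_def t)
	show ?case
	proof (cases "v \<in> leaves G")
		case True
		thus ?thesis by (simp add: t leaf_labels_def)
	next case False
		let ?h = "%c. bv B \<Psi> (map_rt (leaf_labels \<sigma> G) c)"
		have "size ts = 2" using att_valence[OF Suc.prems(1)] tri[OF v False] by (simp add: t)
		obtain g where g: "!!c. c \<in># ts ==> g (lab c) = ?h c" using choose_kid_fun[OF d, of ?h] by blast
		have br: "branch (QX B) G (%v. toq (\<Psi> (\<sigma> v))) k v a = toq (g a)" if a: "a \<in> lab ` set_mset ts" for a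
		proof -
			obtain c where c: "c \<in># ts" "a = lab c" using a by blast
			have "branch (QX B) G (%v. toq (\<Psi> (\<sigma> v))) k v (lab c) = toq (?h c)"
			proof (rule Suc.IH)
				show "att G {v} c" using att_child[OF Suc.prems(1)[unfolded t] c(1)] .
				show "set_rt c \<subseteq> verts G" using Suc.prems(2) set_rt_child[OF c(1), of v] unfolding t by (rule order_trans[rotated])
				show "size (labs c) \<le> k" using size_labs_child[OF c(1), of v] Suc.prems(3) unfolding t by linarith
			qed
			thus ?thesis using g[OF c(1)] c(2) by simp
		qed
		have nb: "nbrs G v - {p} = lab ` set_mset ts"
		proof -
			have "p ~: lab ` set_mset ts" using Suc.prems(1) set_rt_child[of _ ts v] lab_in_set_rt unfolding att_def t by blast
			thus ?thesis using att_root[OF Suc.prems(1)] unfolding t by auto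
		qed
		have "card (lab ` set_mset ts) = 2" using `size ts = 2` arg_cong[OF dstl_kids_lab(1)[OF d], of size] by simp
		then obtain a b where ab: "sorted_list_of_set (lab ` set_mset ts) = [a, b]" "lab ` set_mset ts = {a, b}" "a ~= b"
			using sorted_list_two[of "lab ` set_mset ts"] by blast
		have "g a * g b = \<Prod>\<^sub># (image_mset ?h ts)" using prod_kids[OF d, of g ?h] g ab by simp
		hence "branch (QX B) G (%v. toq (\<Psi> (\<sigma> v))) (Suc k) p v =
				scale (2 * of_real pi) (propagator (QX B) (Gminus (toq (\<Prod>\<^sub># (image_mset ?h ts)))))"
			using False br ab by (simp add: nb qmu2_toq)
		thus ?thesis using False by (simp add: propagator_toq[OF B] t leaf_labels_def[of \<sigma> G v] multiset.map_comp o_def)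
	qed
qed

lemma amplitude_bv:
	fixes \<Psi> :: "nat => 'n::{finite,linorder} qs"
	assumes B: "finite B" and tri: "!!v. v \<in> verts G ==> v ~: leaves G ==> valence G v = 3"
		and x: "dstl x" "gr x = G" and R: "lab x ~: leaves G"
	shows "amplitude (QX B) G (lab x) (%v. toq (\<Psi> (\<sigma> v))) M =
		TR (\<Prod>\<^sub># (image_mset (bv B \<Psi>) (kids (map_rt (leaf_labels \<sigma> G) x)))) M"
proof -
	obtain v ts where t: "x = Nd v ts" by (cases x)
	have att: "att G {} (Nd v ts)" using att_gr[OF x(1)] x(2) t by simp
	have d: "dstl (Nd v ts)" using x t by simp
	let ?h = "%c. bv B \<Psi> (map_rt (leaf_labels \<sigma> G) c)" and ?n = "card (verts G)"
	have V: "verts G = set_rt x" using x(2) by auto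
	have "size ts = 3" using att_valence[OF att] tri[of v] R V by (simp add: t)
	obtain g where g: "!!c. c \<in># ts ==> g (lab c) = ?h c" using choose_kid_fun[OF d, of ?h] by blast
	have sz: "size (labs x) = ?n" using x(1) unfolding dstl_iff V by simp
	have br: "branch (QX B) G (%v. toq (\<Psi> (\<sigma> v))) ?n v a = toq (g a)" if a: "a \<in> lab ` set_mset ts" for a
	proof -
		obtain c where c: "c \<in># ts" "a = lab c" using a by blast
		have "branch (QX B) G (%v. toq (\<Psi> (\<sigma> v))) ?n v (lab c) = toq (?h c)"
		proof (rule branch_bv[OF B tri])
			show "att G {v} c" using att_child[OF att c(1)] .
			show "set_rt c \<subseteq> verts G" using set_rt_child[OF c(1), of v] unfolding V t .
			show "size (labs c) \<le> ?n" using size_labs_child[OF c(1), of v] sz unfolding t by linarith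
		qed
		thus ?thesis using g[OF c(1)] c(2) by simp
	qed
	have nb: "nbrs G v = lab ` set_mset ts" using att_root[OF att] by simp
	have "card (lab ` set_mset ts) = 3" using `size ts = 3` arg_cong[OF dstl_kids_lab(1)[OF d], of size] by simp
	then obtain a b c where abc: "sorted_list_of_set (lab ` set_mset ts) = [a, b, c]" "lab ` set_mset ts = {a, b, c}" "a ~= b" "a ~= c" "b ~= c"
		using sorted_list_three[of "lab ` set_mset ts"] by blast
	have "g a * (g b * g c) = \<Prod>\<^sub># (image_mset ?h ts)" using prod_kids[OF d, of g ?h] g abc by simp
	thus ?thesis using br abc by (simp add: amplitude_def nb qmu2_toq qpairing_toq t multiset.map_comp o_def)
qed

lemma TR_reroot:
	assumes "finite B"
	shows "TR (\<Prod>\<^sub># (image_mset (bv B \<Psi>) (add_mset (Nd In us) ts))) M =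
		TR (\<Prod>\<^sub># (image_mset (bv B \<Psi>) (add_mset (Nd In ts) us))) M"
	using TR_kX[OF assms, of "\<Prod>\<^sub># (image_mset (bv B \<Psi>) ts)" "\<Prod>\<^sub># (image_mset (bv B \<Psi>) us)"]
	by (simp add: mult.commute)

text \<open>The amplitude with the sink moved next to the leaf \<open>r\<close>.\<close>

lemma amplitude_leaf:
	fixes \<Psi> :: "nat => 'n::{finite,linorder} qs"
	assumes B: "finite B" and G: "is_tree G" and tri: "!!v. v \<in> verts G ==> v ~: leaves G ==> valence G v = 3"
		and x: "dstl (Nd r {#y#})" "gr (Nd r {#y#}) = G" and y: "lab y ~: leaves G"
		and R: "R \<in> verts G" "R ~: leaves G"
	shows "amplitude (QX B) G R (%v. toq (\<Psi> (\<sigma> v))) M =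
		TR (\<Psi> (\<sigma> r) * \<Prod>\<^sub># (image_mset (bv B \<Psi>) (kids (map_rt (leaf_labels \<sigma> G) y)))) M"
proof -
	let ?L = "leaf_labels \<sigma> G" and ?amp = "%R. amplitude (QX B) G R (%v. toq (\<Psi> (\<sigma> v))) M"
	have V: "verts G = insert r (set_rt y)" using x(2) by auto
	\<comment> \<open>Moving the sink across one internal edge changes which end carries the propagator
	  of that edge, and \<open>TR_reroot\<close> says that the trace is unchanged.\<close>
	have "?amp R = ?amp (lab y)"
	proof (rule nonleaf_constant[OF G R _ y])
		show "lab y \<in> verts G" by (simp add: V)
		fix a b assume ab: "(a, b) \<in> adj G" "a ~: leaves G" "b ~: leaves G"
		hence "a \<in> verts G" using is_treeD(3)[OF G] by blast
		then obtain z where z: "dstl z" "gr z = G" "lab z = a" using tree_rooted[OF G] by blast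
		have "(lab z, b) \<in> adj (gr z)" using z ab(1) by simp
		then obtain us ts where "z = Nd (lab z) (add_mset (Nd b us) ts)" using tree_neighbour[OF z(1)] by blast
		hence zz: "z = Nd a (add_mset (Nd b us) ts)" by (simp only: z(3))
		define z' where "z' = Nd b (add_mset (Nd a ts) us)"
		have z': "dstl z'" "gr z' = G" "lab z' = b" using reroot z(1,2) unfolding zz z'_def by auto
		have "?amp a = TR (\<Prod>\<^sub># (image_mset (bv B \<Psi>) (kids (map_rt ?L z)))) M"
			using amplitude_bv[OF B tri z(1,2), of \<Psi> \<sigma> M] ab z(3) by simp
		also have "... = TR (\<Prod>\<^sub># (image_mset (bv B \<Psi>) (add_mset (Nd In (image_mset (map_rt ?L) us)) (image_mset (map_rt ?L) ts)))) M"
			using ab by (simp add: zz leaf_labels_def[of _ _ b] del: bv.simps)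
		also have "... = TR (\<Prod>\<^sub># (image_mset (bv B \<Psi>) (add_mset (Nd In (image_mset (map_rt ?L) ts)) (image_mset (map_rt ?L) us)))) M"
			by (rule TR_reroot[OF B])
		also have "... = TR (\<Prod>\<^sub># (image_mset (bv B \<Psi>) (kids (map_rt ?L z')))) M"
			using ab by (simp add: z'_def leaf_labels_def[of _ _ a] del: bv.simps)
		also have "... = ?amp b" using amplitude_bv[OF B tri z'(1,2), of \<Psi> \<sigma> M] ab z'(3) by simp
		finally show "?amp a = ?amp b" .
	qed
	also obtain w us where yw: "y = Nd w us" by (cases y)
	\<comment> \<open>With the sink next to \<open>r\<close>, this leaf is one of the three branches
	  and contributes its bare value.\<close>
	define z where "z = Nd w (add_mset (Nd r {#}) us)"
	have z: "dstl z" "gr z = G" "lab z = w" using reroot[of r w us "{#}"] x unfolding z_def yw by auto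
	have "r \<in> leaves G"
	proof -
		have "att G {} (Nd r {#y#})" using att_gr[OF x(1)] x(2) by simp
		hence "valence G r = 1" using att_valence by fastforce
		thus ?thesis by (simp add: leaves_def V)
	qed
	hence "?amp (lab y) = TR (\<Psi> (\<sigma> r) * \<Prod>\<^sub># (image_mset (bv B \<Psi>) (kids (map_rt ?L y)))) M"
		using amplitude_bv[OF B tri z(1,2), of \<Psi> \<sigma> M] y z(3) yw by (simp add: z_def leaf_labels_def[of _ _ r])
	finally show ?thesis .
qed

section \<open>Leaf-labelled trivalent trees\<close>

fun mkl :: "'n tl => nat multiset" where
	"mkl (Mk i) = {#i#}" | "mkl _ = {#}"

fun dvl :: "'n tl => (int,'n::finite) vec multiset" where
	"dvl (Dv b) = {#b#}" | "dvl _ = {#}"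

definition mk :: "'n tl rt => nat multiset" where
	"mk t = \<Sum>\<^sub># (image_mset mkl (labs t))"

definition dvs :: "'n::finite tl rt => (int,'n) vec multiset" where
	"dvs t = \<Sum>\<^sub># (image_mset dvl (labs t))"

lemma sum_mset_sum_mset: "\<Sum>\<^sub># (image_mset f (\<Sum>\<^sub># N)) = \<Sum>\<^sub># (image_mset (%M. \<Sum>\<^sub># (image_mset f M)) N)"
	by (induction N) auto

lemma mk_Nd: "mk (Nd l ts) = mkl l + \<Sum>\<^sub># (image_mset mk ts)"
	by (simp add: mk_def[abs_def] sum_mset_sum_mset multiset.map_comp o_def)

lemma dvs_Nd: "dvs (Nd l ts) = dvl l + \<Sum>\<^sub># (image_mset dvs ts)"
	by (simp add: dvs_def[abs_def] sum_mset_sum_mset multiset.map_comp o_def)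

primrec wfB :: "'n tl rt => bool" where
	"wfB (Nd l ts) \<longleftrightarrow> (case l of Mk i => ts = {#} | In => size ts = 2 | Dv b => False) & (\<forall>w\<in>#image_mset wfB ts. w)"

definition btrees :: "nat set => 'n tl rt set" where
	"btrees A = {t. wfB t & mk t = mset_set A}"

lemma size_two: "size ts = 2 ==> \<exists>a b. ts = {#a, b#}"
proof -
	assume "size ts = 2"
	then obtain a N where "ts = add_mset a N" "size N = 1" by (cases ts) auto
	thus ?thesis using size_1_singleton_mset by blast
qed

text \<open>A binary tree has one inner node less than leaves, and its leaves are the marks.\<close>

lemma size_labs_wfB: "wfB t ==> size (labs t) + 1 = 2 * size (mk t)"
proof (induction t)
	case (Nd l ts)
	show ?case
	proof (cases l)
		case In
		then obtain a b where ab: "ts = {#a, b#}" using Nd.prems size_two[of ts] by auto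
		have "size (labs a) + 1 = 2 * size (mk a)" "size (labs b) + 1 = 2 * size (mk b)" using Nd ab by auto
		thus ?thesis by (simp add: mk_Nd In ab)
	qed (use Nd.prems in "auto simp: mk_Nd")
qed

section \<open>Isomorphisms of trees and their effect on rooted trees\<close>

lemma iso_nbrs:
	assumes f: "graph_iso f G H" and G: "adj G \<subseteq> verts G \<times> verts G" and H: "adj H \<subseteq> verts H \<times> verts H" and v: "v \<in> verts G"
	shows "nbrs H (f v) = f ` nbrs G v"
proof (intro equalityI subsetI)
	fix u assume "u \<in> nbrs H (f v)"
	hence "(u, f v) \<in> adj H" by (simp add: nbrs_def)
	moreover from this obtain w where w: "w \<in> verts G" "u = f w" using H f unfolding graph_iso_def bij_betw_def by blast
	ultimately have "(w, v) \<in> adj G" using f v by (auto simp: graph_iso_def)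
	thus "u \<in> f ` nbrs G v" using w by (auto simp: nbrs_def)
next
	fix u assume "u \<in> f ` nbrs G v"
	then obtain w where w: "(w, v) \<in> adj G" "u = f w" by (auto simp: nbrs_def)
	hence "w \<in> verts G" using G by blast
	thus "u \<in> nbrs H (f v)" using f v w by (auto simp: graph_iso_def nbrs_def)
qed

lemma iso_valence:
	assumes f: "graph_iso f G H" and G: "is_tree G" and H: "is_tree H" and v: "v \<in> verts G"
	shows "valence H (f v) = valence G v"
proof -
	have "nbrs G v \<subseteq> verts G" using is_treeD(3)[OF G] by (auto simp: nbrs_def)
	hence "inj_on f (nbrs G v)" using f by (auto simp: graph_iso_def bij_betw_def intro: inj_on_subset)
	thus ?thesis unfolding valence_def iso_nbrs[OF f is_treeD(3)[OF G] is_treeD(3)[OF H] v] by (rule card_image)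
qed

lemma iso_verts: "graph_iso f G H ==> v \<in> verts G ==> f v \<in> verts H"
	by (auto simp: graph_iso_def bij_betw_def)

lemma iso_leaves:
	assumes f: "graph_iso f G H" and G: "is_tree G" and H: "is_tree H" and v: "v \<in> verts G"
	shows "f v \<in> leaves H \<longleftrightarrow> v \<in> leaves G"
	using iso_valence[OF assms] iso_verts[OF f v] v by (simp add: leaves_def)

text \<open>The choice is unique by \<open>gr_unique\<close>, so trees with a chosen vertex and
  rooted trees are interchangeable.\<close>

definition rooted :: "graph => nat => nat rt" where
	"rooted G r = (SOME x. dstl x & gr x = G & lab x = r)"

lemma rooted:
	assumes "is_tree G" "r \<in> verts G"
	shows "dstl (rooted G r)" "gr (rooted G r) = G" "lab (rooted G r) = r"
proof -
	have "dstl (rooted G r) & gr (rooted G r) = G & lab (rooted G r) = r"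
		unfolding rooted_def by (rule someI_ex) (rule tree_rooted[OF assms])
	thus "dstl (rooted G r)" "gr (rooted G r) = G" "lab (rooted G r) = r" by auto
qed

lemma rooted_eqI:
	assumes "dstl x" "gr x = G" "lab x = r"
	shows "rooted G r = x"
proof -
	have "is_tree G" "r \<in> verts G" using is_tree_gr[OF assms(1)] assms(2,3) lab_in_set_rt[of x] by auto
	from rooted[OF this] show ?thesis using assms by (intro gr_unique) auto
qed

lemma map_rooted:
	assumes f: "graph_iso f G H" and G: "is_tree G" and H: "is_tree H" and r: "r \<in> verts G"
	shows "map_rt f (rooted G r) = rooted H (f r)"
proof -
	note x = rooted[OF G r]
	have g: "gr (map_rt f (rooted G r)) = H" "inj_on f (set_rt (rooted G r))"
		using gr_map_iso[of f "rooted G r" H] f is_treeD(3)[OF H] unfolding x(2) by auto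
	show ?thesis by (rule rooted_eqI[symmetric]) (use g x in "auto intro: dstl_map")
qed

lemma map_rt_cong_on: "(!!v. v \<in> set_rt x ==> f v = g v) ==> map_rt f x = map_rt g x"
	by (rule rt.map_cong) auto

lemma verts_rooted: "is_tree G ==> r \<in> verts G ==> set_rt (rooted G r) = verts G"
	using rooted(2)[of G r] by (metis verts_gr)

text \<open>\<open>shape_eqD\<close> provides the vertex map from an equality of relabelled trees,
  and \<open>graph_iso_map\<close> its compatibility with edges. The criterion classifies both
  tropical types and leaf-labelled trivalent trees.\<close>

lemma shape_eq_iff:
	assumes G: "is_tree G" and H: "is_tree H" and r: "r \<in> verts G" and s: "s \<in> verts H"
	shows "map_rt h (rooted G r) = map_rt k (rooted H s) \<longleftrightarrow>
		(\<exists>f. graph_iso f G H & f r = s & (\<forall>v\<in>verts G. k (f v) = h v))"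
proof
	assume eq: "map_rt h (rooted G r) = map_rt k (rooted H s)"
	note x = rooted[OF G r] and y = rooted[OF H s]
	obtain f where f: "map_rt f (rooted G r) = rooted H s" "inj_on f (set_rt (rooted G r))"
			"!!a. a \<in> set_rt (rooted G r) ==> k (f a) = h a" using shape_eqD[OF eq x(1) y(1)] by blast
	have "graph_iso f G H" using graph_iso_map[OF f(2)] unfolding f(1) x(2) y(2) .
	moreover have "f r = s" using arg_cong[OF f(1), of lab] x(3) y(3) by simp
	ultimately show "\<exists>f. graph_iso f G H & f r = s & (\<forall>v\<in>verts G. k (f v) = h v)"
		using f(3) verts_rooted[OF G r] by blast
next
	assume "\<exists>f. graph_iso f G H & f r = s & (\<forall>v\<in>verts G. k (f v) = h v)"
	then obtain f where f: "graph_iso f G H" "f r = s" "!!v. v \<in> verts G ==> k (f v) = h v" by blast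
	have "map_rt k (rooted H s) = map_rt (k \<circ> f) (rooted G r)" using map_rooted[OF f(1) G H r] f(2) by (simp flip: rt.map_comp)
	also have "... = map_rt h (rooted G r)" by (rule map_rt_cong_on) (simp add: verts_rooted[OF G r] f(3))
	finally show "map_rt h (rooted G r) = map_rt k (rooted H s)" ..
qed

text \<open>A branch that contains a point of \<open>L\<close> is recognised among its siblings by
  the image of that point, since siblings have disjoint labels. Descending from the root forces
  \<open>f\<close> and \<open>g\<close> to agree. The predicate \<open>P\<close> passes to children
  and marks the branches that must meet \<open>L\<close>.\<close>

lemma map_rt_faithful:
	assumes "dstl x" "map_rt f x = map_rt g x" "inj_on g (set_rt x)"
		and "!!v. v \<in> L ==> f v = g v" "!!c. set_rt c \<subseteq> set_rt x ==> P c ==> set_rt c \<inter> L ~= {}"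
		and "P x" "!!l ts c. P (Nd l ts) ==> c \<in># ts ==> P c"
	shows "\<forall>v\<in>set_rt x. f v = g v" using assms(1-3,5,6)
proof (induction x)
	case (Nd v ts)
	note d = Nd.prems(1) and eq = Nd.prems(2) and inj = Nd.prems(3)
	have fv: "f v = g v" and im: "image_mset (map_rt f) ts = image_mset (map_rt g) ts" using eq by simp_all
	have "\<forall>u\<in>set_rt c. f u = g u" if c: "c \<in># ts" for c
	proof (rule Nd.IH[OF c])
		have sub: "set_rt c \<subseteq> set_rt (Nd v ts)" by (rule set_rt_child[OF c])
		have Pc: "P c" by (rule assms(7)[OF Nd.prems(5) c])
		obtain w where w: "w \<in> set_rt c" "w \<in> L" using Nd.prems(4)[OF sub Pc] by blast
		have "map_rt f c \<in># image_mset (map_rt g) ts" unfolding im[symmetric] using c by simp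
		then obtain e where e: "e \<in># ts" "map_rt f c = map_rt g e" by auto
		have "f w \<in> set_rt (map_rt g e)" unfolding e(2)[symmetric] rt.set_map using w(1) by blast
		then obtain w' where w': "w' \<in> set_rt e" "g w = g w'" using assms(4)[OF w(2)] by (auto simp: rt.set_map)
		have "w = w'" by (rule inj_onD[OF inj w'(2)]) (use w(1) w'(1) sub set_rt_child[OF e(1), of v] in blast)+
		have "c = e"
		proof (rule ccontr)
			assume "c ~= e"
			then obtain us where us: "ts = add_mset c us" "e \<in># us" using c e(1) by (metis insert_noteq_member multi_member_split)
			have "set_rt c \<inter> set_rt (Nd v us) = {}" using d unfolding us(1) dstl_add by blast
			thus False using w(1) w'(1) `w = w'` set_rt_child[OF us(2), of v] by blast
		qed
		thus "map_rt f c = map_rt g c" using e(2) by simp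
		show "inj_on g (set_rt c)" by (rule inj_on_subset[OF inj sub])
		show "dstl c" by (rule dstl_child(1)[OF d c])
		show "P c" by (rule Pc)
		show "set_rt b \<inter> L ~= {}" if "set_rt b \<subseteq> set_rt c" "P b" for b by (rule Nd.prems(4)) (use that sub in auto)
	qed
	thus ?case using fv by auto
qed

lemma leaf_exists: "att G {p} t ==> set_rt t \<subseteq> verts G ==> set_rt t \<inter> leaves G ~= {}"
proof (induction t arbitrary: p)
	case (Nd v ts)
	show ?case
	proof (cases "ts = {#}")
		case True
		hence "valence G v = 1" using att_valence[OF Nd.prems(1)] by simp
		thus ?thesis using Nd.prems(2) by (auto simp: leaves_def)
	next case False
		then obtain c where c: "c \<in># ts" by (meson multiset_nonemptyE)
		have "set_rt c \<inter> leaves G ~= {}"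
			by (rule Nd.IH[OF c att_child[OF Nd.prems(1) c]]) (use set_rt_child[OF c, of v] Nd.prems(2) in blast)
		thus ?thesis using set_rt_child[OF c, of v] by blast
	qed
qed

text \<open>Every branch contains a leaf, so \<open>map_rt_faithful\<close> applies with the leaves
  as the known values.\<close>

lemma iso_faithful:
	assumes G: "is_tree G" and f: "graph_iso f G G" and g: "graph_iso g G G" and r: "r \<in> leaves G"
		and eq: "!!v. v \<in> leaves G ==> f v = g v" and v: "v \<in> verts G"
	shows "f v = g v"
proof -
	let ?x = "rooted G r"
	have rG: "r \<in> verts G" using r by (simp add: leaves_def)
	note x = rooted[OF G rG] and V = verts_rooted[OF G rG]
	have m: "map_rt f ?x = map_rt g ?x" using map_rooted[OF f G G rG] map_rooted[OF g G G rG] eq[OF r] by simp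
	have inj: "inj_on g (set_rt ?x)" using g unfolding V by (simp add: graph_iso_def bij_betw_def)
	\<comment> \<open>Either the whole tree or a branch hanging from a single vertex.\<close>
	define P where "P c \<longleftrightarrow> (\<exists>p. att G p c & (p = {} --> c = ?x) & finite p & card p \<le> 1)" for c
	have "\<forall>v\<in>set_rt ?x. f v = g v"
	proof (rule map_rt_faithful[where P = P and L = "leaves G", OF x(1) m inj eq])
		show "P ?x" unfolding P_def using att_gr[OF x(1)] unfolding x(2) by (intro exI[of _ "{}"]) simp
		show "P c" if "P (Nd l ts)" "c \<in># ts" for l ts c
		proof -
			obtain p where "att G p (Nd l ts)" using `P (Nd l ts)` unfolding P_def by blast
			thus ?thesis unfolding P_def using att_child[OF _ `c \<in># ts`] by (intro exI[of _ "{l}"]) simp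
		qed
		show "set_rt c \<inter> leaves G ~= {}" if c: "set_rt c \<subseteq> set_rt ?x" "P c" for c
		proof (cases "c = ?x")
			case True
			thus ?thesis using r V by (auto simp: leaves_def)
		next case False
			then obtain p where "att G p c" "p ~= {}" "finite p" "card p \<le> 1" using c(2) unfolding P_def by blast
			moreover from this have "card p = 1" by (simp add: le_Suc_eq)
			then obtain q where "p = {q}" by (meson card_1_singletonE)
			ultimately show ?thesis using leaf_exists c(1) unfolding V by blast
		qed
	qed
	thus ?thesis using v unfolding V by blast
qed

lemma trivalentD:
	assumes "G \<in> trivalent_trees n"
	shows "is_tree G" "verts G = {1..2 * n - 2}" "leaves G = {1..n}" "!!v. v \<in> verts G ==> v ~: leaves G ==> valence G v = 3"
	using assms by (auto simp: trivalent_trees_def)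

lemma iso_inj: "graph_iso f G H ==> A \<subseteq> verts G ==> inj_on f A"
	unfolding graph_iso_def bij_betw_def by (blast intro: inj_on_subset)

text \<open>Marks occur with multiplicity one, so reading off the mark is injective: the number of
  marked nodes equals the number of marks.\<close>

lemma marks_bij:
	fixes x :: "nat rt"
	assumes x: "dstl x" and mk: "mk (map_rt h x) = mset_set A" and A: "finite A"
	obtains g where "bij_betw g {v \<in> set_rt x. \<exists>i. h v = Mk i} A" "!!v i. h v = Mk i ==> g v = i"
proof -
	define L where "L = {v \<in> set_rt x. \<exists>i. h v = Mk i}"
	define g where "g v = (THE i. h v = Mk i)" for v
	have g: "g v = i" if "h v = Mk i" for v i using that by (simp add: g_def)
	have "mk (map_rt h x) = \<Sum>\<^sub># (image_mset (%v. mkl (h v)) (mset_set (set_rt x)))"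
		using x unfolding dstl_iff by (simp add: mk_def labs_map multiset.map_comp o_def)
	also have "... = (\<Sum>v\<in>set_rt x. mkl (h v))" by (simp add: sum_unfold_sum_mset)
	also have "... = (\<Sum>v\<in>L. {#g v#})"
	proof (rule sum.mono_neutral_cong_right)
		show "\<forall>v\<in>set_rt x - L. mkl (h v) = {#}"
		proof
			fix v assume "v \<in> set_rt x - L"
			thus "mkl (h v) = {#}" by (cases "h v") (auto simp: L_def)
		qed
		show "mkl (h v) = {#g v#}" if v: "v \<in> L" for v
		proof -
			obtain i where "h v = Mk i" using v by (auto simp: L_def)
			thus ?thesis by (simp add: g)
		qed
	qed (auto simp: L_def)
	also have "... = image_mset g (mset_set L)" by (simp add: sum_unfold_sum_mset)
	finally have mm: "image_mset g (mset_set L) = mset_set A" using mk by simp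
	have fL: "finite L" by (simp add: L_def)
	have gL: "g ` L = A" using arg_cong[OF mm, of set_mset] fL A by simp
	moreover have "inj_on g L" using arg_cong[OF mm, of size] gL by (intro eq_card_imp_inj_on[OF fL]) simp
	ultimately show thesis using g by (intro that[of g]) (simp_all add: bij_betw_def L_def)
qed

lemma permutes_extend: "bij_betw f A A ==> (%i. if i \<in> A then f i else i) permutes A"
	by (rule bij_imp_permutes) (auto elim: bij_betw_cong[THEN iffD1, rotated])

section \<open>Labelled trivalent trees modulo isomorphism\<close>

lemma wfB_branch:
	assumes tri: "!!v. v \<in> verts G ==> v ~: leaves G ==> valence G v = 3"
	shows "att G {p} t ==> set_rt t \<subseteq> verts G ==> wfB (map_rt (leaf_labels \<sigma> G) t :: 'n tl rt)"
proof (induction t arbitrary: p)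
	case (Nd v ts)
	have v: "v \<in> verts G" using Nd.prems(2) by auto
	have val: "valence G v = size ts + 1" using att_valence[OF Nd.prems(1)] by simp
	have "wfB (map_rt (leaf_labels \<sigma> G) c :: 'n tl rt)" if c: "c \<in># ts" for c
		by (rule Nd.IH[OF c att_child[OF Nd.prems(1) c]]) (use set_rt_child[OF c, of v] Nd.prems(2) in blast)
	moreover have "v \<in> leaves G \<longleftrightarrow> size ts = 0" "v ~: leaves G --> size ts = 2"
		using val tri[OF v] v by (auto simp: leaves_def)
	ultimately show ?case by (auto simp: leaf_labels_def[of \<sigma> G v])
qed

lemma mk_rooted:
	assumes G: "is_tree G" and r: "r \<in> verts G" and \<sigma>: "inj_on \<sigma> (leaves G)"
	shows "mk (map_rt (leaf_labels \<sigma> G) (rooted G r) :: 'a tl rt) = mset_set (\<sigma> ` leaves G)"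
proof -
	have "labs (rooted G r) = mset_set (verts G)" using rooted(1)[OF G r] verts_rooted[OF G r] unfolding dstl_iff by simp
	hence "mk (map_rt (leaf_labels \<sigma> G) (rooted G r) :: 'a tl rt) = \<Sum>\<^sub># (image_mset (%v. mkl (leaf_labels \<sigma> G v :: 'a tl)) (mset_set (verts G)))"
		by (simp add: mk_def labs_map multiset.map_comp o_def)
	also have "... = (\<Sum>v\<in>verts G. mkl (leaf_labels \<sigma> G v :: 'a tl))" by (simp add: sum_unfold_sum_mset)
	also have "... = (\<Sum>v\<in>leaves G. {#\<sigma> v#})"
		by (rule sum.mono_neutral_cong_right) (auto simp: is_treeD(1)[OF G] leaf_labels_def leaves_def)
	also have "... = image_mset \<sigma> (mset_set (leaves G))" by (simp add: sum_unfold_sum_mset)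
	also have "... = mset_set (\<sigma> ` leaves G)" by (rule image_mset_mset_set[OF \<sigma>])
	finally show ?thesis .
qed

abbreviation perms :: "nat => (nat => nat) set" where
	"perms n \<equiv> {\<sigma>. \<sigma> permutes {1..n}}"

text \<open>The labelled tree rooted at the leaf that carries mark 1. This canonical root makes
  isomorphism of labelled trees an equality.\<close>

definition full :: "graph => (nat => nat) => 'n tl rt" where
	"full G \<sigma> = map_rt (leaf_labels \<sigma> G) (rooted G (inv \<sigma> 1))"

text \<open>The sink sits next to the root leaf: it is the only child of the root, and its own
  children are the other two branches.\<close>

definition bval :: "(int,'n::{finite,linorder}) vec set => (nat => 'n qs) => 'n tl rt => 'n qs" where
	"bval B \<Psi> t = \<Psi> 1 * \<Prod>\<^sub># (image_mset (%y. \<Prod>\<^sub># (image_mset (bv B \<Psi>) (kids y))) (kids t))"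

context
	fixes n :: nat
	assumes n: "3 \<le> n"
begin

lemma full_shape:
	assumes G: "G \<in> trivalent_trees n" and \<sigma>: "\<sigma> permutes {1..n}"
	obtains x where "rooted G (inv \<sigma> 1) = Nd (inv \<sigma> 1) {#x#}" "lab x \<in> verts G" "lab x ~: leaves G"
		"(full G \<sigma> :: 'n tl rt) = Nd (Mk 1) {#map_rt (leaf_labels \<sigma> G) x#}" "(map_rt (leaf_labels \<sigma> G) x :: 'n tl rt) \<in> btrees {2..n}"
proof -
	let ?X = "leaf_labels \<sigma> G"
	note GD = trivalentD[OF G]
	let ?r = "inv \<sigma> 1"
	have r: "?r \<in> {1..n}" "\<sigma> ?r = 1"
		using permutes_in_image[OF permutes_inv[OF \<sigma>], of 1] permutes_inverses(1)[OF \<sigma>] n by auto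
	hence rl: "?r \<in> leaves G" "?r \<in> verts G" unfolding GD(2,3) using n by auto
	note x = rooted[OF GD(1) rl(2)]
	have a: "att G {} (rooted G ?r)" using att_gr[OF x(1)] unfolding x(2) .
	have "size (kids (rooted G ?r)) = 1" using att_valence[OF a] rl(1) unfolding x(3) by (simp add: leaves_def)
	then obtain y where "kids (rooted G ?r) = {#y#}" using size_1_singleton_mset by blast
	hence y: "rooted G ?r = Nd ?r {#y#}" using x(3) by (cases "rooted G ?r") auto
	have ay: "att G {?r} y" using att_child[of G "{}" ?r "{#y#}" y] a unfolding y by simp
	have V: "verts G = insert ?r (set_rt y)" "?r ~: set_rt y"
		using verts_rooted[OF GD(1) rl(2)] dstl_child(2)[OF x(1)[unfolded y], of y] unfolding y by simp_all
	have "lab y ~: leaves G"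
	proof
		assume "lab y \<in> leaves G"
		hence "size (kids y) = 0" using att_valence[OF ay] by (simp add: leaves_def)
		hence "set_rt y = {lab y}" by (cases y) simp
		hence "card (verts G) \<le> 2" unfolding V(1) by (simp add: card_insert_if)
		thus False using n by (simp add: GD(2))
	qed
	moreover have lr: "leaf_labels \<sigma> G ?r = (Mk 1 :: 'n tl)" using rl(1) r(2) by (simp add: leaf_labels_def)
	have "(full G \<sigma> :: 'n tl rt) = Nd (Mk 1) {#map_rt ?X y#}" unfolding full_def y using lr by simp
	moreover have "wfB (map_rt ?X y :: 'n tl rt)" using wfB_branch[OF GD(4) ay] V by blast
	moreover have "mk (map_rt ?X (rooted G ?r) :: 'n tl rt) = mset_set {1..n}"
		using mk_rooted[OF GD(1) rl(2) inj_on_subset[OF permutes_inj[OF \<sigma>] subset_UNIV]] permutes_image[OF \<sigma>] unfolding GD(3) by simp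
	hence "mk (map_rt ?X y :: 'n tl rt) = mset_set {2..n}"
	proof -
		assume m: "mk (map_rt ?X (rooted G ?r) :: 'n tl rt) = mset_set {1..n}"
		have "{1..n} = insert 1 {2..n}" using n by auto
		with m show ?thesis unfolding y rt.map lr by (simp add: mk_Nd)
	qed
	moreover have "lab y \<in> verts G" unfolding V by simp
	ultimately show thesis using y by (intro that) (auto simp: btrees_def)
qed

text \<open>An isomorphism preserves leaves, so compatibility of labels is a condition on the marked
  leaves alone, and it matches the roots as well.\<close>

lemma full_eq_iff:
	assumes G: "G \<in> trivalent_trees n" and \<sigma>: "\<sigma> permutes {1..n}" and H: "H \<in> trivalent_trees n" and \<rho>: "\<rho> permutes {1..n}"
	shows "full G \<sigma> = (full H \<rho> :: 'n tl rt) \<longleftrightarrow> (\<exists>f. graph_iso f G H & (\<forall>i\<in>{1..n}. \<rho> (f i) = \<sigma> i))"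
proof -
	let ?X = "%f. \<forall>i\<in>{1..n}. \<rho> (f i) = \<sigma> i"
	note GD = trivalentD[OF G] and HD = trivalentD[OF H]
	have r: "inv \<sigma> 1 \<in> {1..n}" "\<sigma> (inv \<sigma> 1) = 1" and s: "inv \<rho> 1 \<in> {1..n}"
		using permutes_in_image[OF permutes_inv[OF \<sigma>], of 1] permutes_in_image[OF permutes_inv[OF \<rho>], of 1]
			permutes_inverses(1)[OF \<sigma>] n by auto
	have rl: "inv \<sigma> 1 \<in> verts G" "inv \<rho> 1 \<in> verts H" using r s n unfolding GD(2) HD(2) by auto
	have sub: "{1..n} \<subseteq> verts G" using GD(3) by (auto simp: leaves_def)
	have "full G \<sigma> = (full H \<rho> :: 'n tl rt) \<longleftrightarrow>
			(\<exists>f. graph_iso f G H & f (inv \<sigma> 1) = inv \<rho> 1 & (\<forall>v\<in>verts G. (leaf_labels \<rho> H (f v) :: 'n tl) = leaf_labels \<sigma> G v))"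
		unfolding full_def by (rule shape_eq_iff[OF GD(1) HD(1) rl])
	also have "... \<longleftrightarrow> (\<exists>f. graph_iso f G H & (?X f))"
	proof (intro arg_cong[of _ _ Ex] ext conj_cong refl)
		fix f assume f: "graph_iso f G H"
		have L: "f v \<in> leaves H \<longleftrightarrow> v \<in> leaves G" if "v \<in> verts G" for v
			by (rule iso_leaves[OF f GD(1) HD(1) that])
		have "(\<forall>v\<in>verts G. (leaf_labels \<rho> H (f v) :: 'n tl) = leaf_labels \<sigma> G v) \<longleftrightarrow> (?X f)"
			using L sub unfolding leaf_labels_def GD(3) by auto
		moreover have "f (inv \<sigma> 1) = inv \<rho> 1" if "\<forall>i\<in>{1..n}. \<rho> (f i) = \<sigma> i"
			using that r permutes_inv_eq[OF \<rho>] by metis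
		ultimately show "(f (inv \<sigma> 1) = inv \<rho> 1 & (\<forall>v\<in>verts G. (leaf_labels \<rho> H (f v) :: 'n tl) = leaf_labels \<sigma> G v)) =
				(?X f)" by blast
	qed
	finally show ?thesis .
qed

lemma wfB_valences:
	"wfB (map_rt h t) ==> att G {p} t ==>
		\<forall>v\<in>set_rt t. (\<exists>i. h v = Mk i & valence G v = 1) | h v = In & valence G v = 3"
proof (induction t arbitrary: p)
	case (Nd v ts)
	have "\<forall>v\<in>set_rt c. (\<exists>i. h v = Mk i & valence G v = 1) | h v = In & valence G v = 3" if c: "c \<in># ts" for c
		by (rule Nd.IH[OF c _ att_child[OF Nd.prems(2) c]]) (use Nd.prems(1) c in auto)
	moreover have "(\<exists>i. h v = Mk i & valence G v = 1) | h v = In & valence G v = 3"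
		using att_valence[OF Nd.prems(2)] Nd.prems(1) by (auto split: tl.splits)
	ultimately show ?case by auto
qed

text \<open>The tree is realised on \<open>{1..2 * n - 2}\<close> by naming each marked leaf after
  its mark and distributing the remaining numbers over the inner vertices.\<close>

lemma full_surj:
	fixes y :: "'n tl rt"
	assumes y: "y \<in> btrees {2..n}"
	obtains G where "G \<in> trivalent_trees n" "full G id = Nd (Mk 1) {#y#}"
proof -
	define t where "t = Nd (Mk 1) {#y#}"
	have ins: "{1..n} = insert 1 {2..n}" using n by auto
	have mkt: "mk t = mset_set {1..n}" unfolding ins using y by (simp add: t_def mk_Nd btrees_def)
	have "size (labs y) + 1 = 2 * (n - 1)" using size_labs_wfB[of y] y by (simp add: btrees_def)
	hence size: "size (labs t) = 2 * n - 2" using n by (simp add: t_def)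
	obtain x :: "nat rt" and h where x: "dstl x" "map_rt h x = t" by (rule shape_exists[of t])
	have cV: "card (set_rt x) = 2 * n - 2"
		using x(1) size unfolding x(2)[symmetric] dstl_iff labs_map by (metis size_image_mset size_mset_set)
	define L where "L = {v \<in> set_rt x. \<exists>i. h v = Mk i}"
	obtain m where m: "bij_betw m L {1..n}" "!!v i. h v = Mk i ==> m v = i"
		unfolding L_def by (rule marks_bij[OF x(1), of h "{1..n}"]) (simp_all add: x(2) mkt)
	have fL: "finite L" by (simp add: L_def)
	have cL: "card L = n" using bij_betw_same_card[OF m(1)] by simp
	have "card (set_rt x - L) = card {n + 1..2 * n - 2}" using cV cL card_Diff_subset[OF fL, of "set_rt x"] n by (simp add: L_def)
	then obtain e where e: "bij_betw e (set_rt x - L) {n + 1..2 * n - 2}"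
		by (metis finite_same_card_bij finite_Diff finite_set_rt finite_atLeastAtMost)
	define g where "g v = (if v \<in> L then m v else e v)" for v
	have g1: "bij_betw g L {1..n}" using m(1) by (rule bij_betw_cong[THEN iffD1, rotated]) (simp add: g_def)
	have g2: "bij_betw g (set_rt x - L) {n + 1..2 * n - 2}" using e by (rule bij_betw_cong[THEN iffD1, rotated]) (simp add: g_def)
	have "bij_betw g (L \<union> (set_rt x - L)) ({1..n} \<union> {n + 1..2 * n - 2})" by (rule bij_betw_combine[OF g1 g2]) auto
	moreover have "L \<union> (set_rt x - L) = set_rt x" "{1..n} \<union> {n + 1..2 * n - 2} = {1..2 * n - 2}" using n by (auto simp: L_def)
	ultimately have g: "inj_on g (set_rt x)" "g ` set_rt x = {1..2 * n - 2}" by (simp_all add: bij_betw_def)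
	define x' where "x' = map_rt g x"
	define G where "G = gr x'"
	have d: "dstl x'" unfolding x'_def by (rule dstl_map[OF x(1) g(1)])
	have V: "verts G = {1..2 * n - 2}" by (simp add: G_def x'_def rt.set_map g(2))
	define k :: "nat => 'n tl" where "k = (%v. if v \<le> n then Mk v else In)"
	obtain v us where xu: "x = Nd v us" by (cases x)
	have wft: "wfB y" using y by (simp add: btrees_def)
	have hIn: "h u = In" if "u \<in> set_rt x" "u ~: L" for u
	proof -
		have "\<forall>l\<in>set_rt t. l = In | (\<exists>i. l = Mk i)"
		proof -
			have "wfB s ==> \<forall>l\<in>set_rt s. l = In | (\<exists>i. l = Mk i)" for s :: "'n tl rt"
				by (induction s) (auto split: tl.splits)
			thus ?thesis using wft by (auto simp: t_def)
		qed
		thus ?thesis using that unfolding x(2)[symmetric] rt.set_map L_def by blast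
	qed
	have kg: "k (g u) = h u" if u: "u \<in> set_rt x" for u
	proof (cases "u \<in> L")
		case True
		then obtain i where i: "h u = Mk i" by (auto simp: L_def)
		have "m u \<le> n" using m(1) True by (auto simp: bij_betw_def)
		thus ?thesis using m(2)[OF i] i True by (simp add: k_def g_def)
	next case False
		hence "e u \<ge> n + 1" using e u by (auto simp: bij_betw_def)
		thus ?thesis using hIn[OF u False] False by (simp add: k_def g_def)
	qed
	have kx: "map_rt k x' = t" unfolding x'_def rt.map_comp x(2)[symmetric] by (rule map_rt_cong_on) (simp add: kg)
	obtain l zs where lz: "x' = Nd l zs" by (cases x')
	have kl: "k l = Mk 1" "image_mset (map_rt k) zs = {#y#}" using kx unfolding lz t_def by simp_all
	have "size zs = 1" using arg_cong[OF kl(2), of size] by simp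
	then obtain z where zs: "zs = {#z#}" using size_1_singleton_mset by blast
	have z: "x' = Nd (lab x') {#z#}" "k (lab x') = Mk 1" "map_rt k z = y" using kl unfolding lz zs by simp_all
	have r1: "lab x' = 1" using z(2) by (auto simp: k_def split: if_splits)
	note z' = z(1)[unfolded r1]
	have aG: "att G {} x'" unfolding G_def by (rule att_gr[OF d])
	have az: "att G {1} z" using att_child[of G "{}" 1 "{#z#}" z] aG z' by simp
	have val1: "valence G 1 = 1" using att_valence[OF aG] unfolding z' by simp
	have val: "\<forall>v\<in>set_rt z. (\<exists>i. k v = Mk i & valence G v = 1) | k v = In & valence G v = 3"
		by (rule wfB_valences[OF _ az]) (simp add: z(3) wft)
	have Vz: "verts G = insert 1 (set_rt z)" unfolding G_def by (subst z') simp
	have val': "valence G v = (if v \<le> n then 1 else 3)" if "v \<in> verts G" for v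
		using that val val1 n unfolding Vz k_def by (auto split: if_splits)
	have lv: "leaves G = {1..n}"
	proof -
		have "v \<in> verts G & valence G v = 1 \<longleftrightarrow> v \<in> verts G & v \<le> n" for v
			using val'[of v] by (cases "v \<le> n") auto
		thus ?thesis unfolding leaves_def using V n by auto
	qed
	have tr: "is_tree G" unfolding G_def by (rule is_tree_gr[OF d])
	have "G \<in> trivalent_trees n" unfolding trivalent_trees_def using V lv tr val' by auto
	moreover have "full G id = t"
	proof -
		have "rooted G 1 = x'" by (rule rooted_eqI[OF d G_def[symmetric] r1])
		moreover have "map_rt (leaf_labels id G) x' = map_rt k x'"
		proof (rule map_rt_cong_on)
			fix v assume "v \<in> set_rt x'"
			hence "v \<in> verts G" by (simp add: G_def)
			thus "leaf_labels id G v = k v" unfolding leaf_labels_def lv k_def using V by auto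
		qed
		ultimately show ?thesis using kx by (simp add: full_def inv_id)
	qed
	ultimately show thesis using that by (simp add: t_def)
qed

lemma iso_marks:
	assumes f: "graph_iso f G H" and G: "G \<in> trivalent_trees n" and H: "H \<in> trivalent_trees n"
	shows "bij_betw f {1..n} {1..n}"
proof -
	note GD = trivalentD[OF G] and HD = trivalentD[OF H]
	have sub: "{1..n} \<subseteq> verts G" using GD(3) by (auto simp: leaves_def)
	have inj: "inj_on f {1..n}" by (rule iso_inj[OF f sub])
	moreover have "f ` {1..n} \<subseteq> {1..n}" using iso_leaves[OF f GD(1) HD(1)] sub GD(3) HD(3) by auto
	hence "f ` {1..n} = {1..n}" using card_subset_eq[of "{1..n}" "f ` {1..n}"] card_image[OF inj] by simp
	ultimately show ?thesis by (rule bij_betw_imageI)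
qed

text \<open>An automorphism \<open>f\<close> produces the labelling that takes the value
  \<open>\<sigma> i\<close> at \<open>f i\<close>, and all labellings in the fibre arise so. The
  automorphism is recovered from its effect on leaves by \<open>iso_faithful\<close>.\<close>

lemma card_full_fibre:
	assumes G: "G \<in> trivalent_trees n" and \<sigma>: "\<sigma> permutes {1..n}"
	shows "card {\<rho>. \<rho> permutes {1..n} & full G \<rho> = (full G \<sigma> :: 'n tl rt)} = card (automorphisms G)"
proof -
	note GD = trivalentD[OF G]
	have sub: "{1..n} \<subseteq> verts G" using GD(3) by (auto simp: leaves_def)
	define Rel where "Rel f \<rho> \<longleftrightarrow> (\<forall>i\<in>{1..n}. \<rho> (f i) = \<sigma> i)" for f \<rho> :: "nat => nat"
	define \<Phi> where "\<Phi> f = (THE \<rho>. \<rho> permutes {1..n} & Rel f \<rho>)" for f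
	have un: "\<rho> = \<rho>'" if *: "graph_iso f G G" "\<rho> permutes {1..n}" "\<rho>' permutes {1..n}" "Rel f \<rho>" "Rel f \<rho>'" for f \<rho> \<rho>'
	proof
		fix j show "\<rho> j = \<rho>' j"
		proof (cases "j \<in> {1..n}")
			case True
			then obtain i where "i \<in> {1..n}" "j = f i" using iso_marks[OF *(1) G G] unfolding bij_betw_def by blast
			thus ?thesis using *(4,5) by (simp add: Rel_def)
		next case False
			thus ?thesis using *(2,3) by (simp add: permutes_not_in)
		qed
	qed
	have ex: "\<exists>\<rho>. \<rho> permutes {1..n} & Rel f \<rho>" if f: "graph_iso f G G" for f
	proof -
		define f' where "f' i = (if i \<in> {1..n} then f i else i)" for i
		have "f' permutes {1..n}" unfolding f'_def[abs_def] by (rule permutes_extend[OF iso_marks[OF f G G]])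
		hence "\<sigma> \<circ> inv f' permutes {1..n} & Rel f (\<sigma> \<circ> inv f')"
		proof (intro conjI)
			assume p: "f' permutes {1..n}"
			show "\<sigma> \<circ> inv f' permutes {1..n}" by (rule permutes_compose[OF permutes_inv[OF p] \<sigma>])
			show "Rel f (\<sigma> \<circ> inv f')" unfolding Rel_def
			proof
				fix i assume "i \<in> {1..n}"
				hence "f i = f' i" by (simp add: f'_def)
				thus "(\<sigma> \<circ> inv f') (f i) = \<sigma> i" using permutes_inverses(2)[OF p] by simp
			qed
		qed
		thus ?thesis by blast
	qed
	have \<Phi>: "\<Phi> f permutes {1..n}" "Rel f (\<Phi> f)" if f: "graph_iso f G G" for f
	proof -
		have "\<exists>!\<rho>. \<rho> permutes {1..n} & Rel f \<rho>" using ex[OF f] un[OF f] by (intro ex_ex1I) auto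
		from theI'[OF this] show "\<Phi> f permutes {1..n}" "Rel f (\<Phi> f)" unfolding \<Phi>_def by auto
	qed
	have eq: "full G \<rho> = (full G \<sigma> :: 'n tl rt) \<longleftrightarrow> (\<exists>f. graph_iso f G G & Rel f \<rho>)" if "\<rho> permutes {1..n}" for \<rho>
		using full_eq_iff[OF G \<sigma> G that, where ?'n = 'n] unfolding Rel_def by auto
	have "bij_betw \<Phi> (automorphisms G) {\<rho>. \<rho> permutes {1..n} & full G \<rho> = (full G \<sigma> :: 'n tl rt)}"
	proof (rule bij_betwI')
		fix f g assume "f \<in> automorphisms G" "g \<in> automorphisms G"
		hence f: "f permutes verts G" "graph_iso f G G" and g: "g permutes verts G" "graph_iso g G G" by (auto simp: automorphisms_def)
		show "(\<Phi> f = \<Phi> g) = (f = g)"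
		proof
			assume e: "\<Phi> f = \<Phi> g"
			have fg: "f i = g i" if "i \<in> leaves G" for i
			proof -
				have "\<Phi> f (f i) = \<Phi> f (g i)" using \<Phi>(2)[OF f(2)] \<Phi>(2)[OF g(2)] that unfolding GD(3) e Rel_def by simp
				thus ?thesis using permutes_inj[OF \<Phi>(1)[OF f(2)]] by (simp add: inj_eq)
			qed
			have "1 \<in> leaves G" unfolding GD(3) using n by simp
			from iso_faithful[OF GD(1) f(2) g(2) this fg] show "f = g" using f(1) g(1) by (metis ext permutes_not_in)
		qed simp
	next
		fix f assume "f \<in> automorphisms G"
		hence f: "graph_iso f G G" by (auto simp: automorphisms_def)
		show "\<Phi> f \<in> {\<rho>. \<rho> permutes {1..n} & full G \<rho> = (full G \<sigma> :: 'n tl rt)}"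
			using \<Phi>[OF f] f eq[OF \<Phi>(1)[OF f]] by blast
	next
		fix \<rho> assume "\<rho> \<in> {\<rho>. \<rho> permutes {1..n} & full G \<rho> = (full G \<sigma> :: 'n tl rt)}"
		then obtain f where \<rho>: "\<rho> permutes {1..n}" and f: "graph_iso f G G" "Rel f \<rho>" using eq by blast
		define f' where "f' v = (if v \<in> verts G then f v else v)" for v
		have b: "bij_betw f (verts G) (verts G)" using f(1) by (simp add: graph_iso_def)
		hence p: "f' permutes verts G" unfolding f'_def[abs_def] by (rule permutes_extend)
		moreover have iso: "graph_iso f' G G" using f(1) permutes_imp_bij[OF p] by (simp add: graph_iso_def f'_def)
		ultimately have "f' \<in> automorphisms G" by (simp add: automorphisms_def)
		moreover have "Rel f' \<rho>" using f(2) sub by (auto simp: Rel_def f'_def)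
		hence "\<rho> = \<Phi> f'" using un[OF iso \<rho> \<Phi>(1)[OF iso] _ \<Phi>(2)[OF iso]] by blast
		ultimately show "\<exists>f\<in>automorphisms G. \<rho> = \<Phi> f" by blast
	qed
	thus ?thesis by (rule bij_betw_same_card[symmetric])
qed

lemma full_trees: "(\<Union>G\<in>trivalent_trees n. full G ` perms n) = (%y. Nd (Mk 1) {#y#} :: 'n tl rt) ` btrees {2..n}"
proof (intro equalityI subsetI)
	fix t :: "'n tl rt" assume "t \<in> (\<Union>G\<in>trivalent_trees n. full G ` perms n)"
	then obtain G \<sigma> where G: "G \<in> trivalent_trees n" "\<sigma> permutes {1..n}" "t = full G \<sigma>" by blast
	show "t \<in> (%y. Nd (Mk 1) {#y#}) ` btrees {2..n}" by (rule full_shape[OF G(1,2), where ?'n = 'n]) (use G(3) in auto)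
next
	fix t :: "'n tl rt" assume "t \<in> (%y. Nd (Mk 1) {#y#}) ` btrees {2..n}"
	then obtain y where y: "y \<in> btrees {2..n}" "t = Nd (Mk 1) {#y#}" by blast
	obtain G where "G \<in> trivalent_trees n" "full G id = t" using full_surj[OF y(1)] y(2) by blast
	thus "t \<in> (\<Union>G\<in>trivalent_trees n. full G ` perms n)" using permutes_id by blast
qed

text \<open>An isomorphism that transports one labelling also transports all relabelled ones. Hence
  the sets of labelled trees of two graphs are equal or disjoint.\<close>

lemma full_overlap:
	assumes G: "G \<in> trivalent_trees n" and H: "H \<in> trivalent_trees n" and \<sigma>: "\<sigma> permutes {1..n}" and \<rho>: "\<rho> permutes {1..n}"
		and eq: "full G \<sigma> = (full H \<rho> :: 'n tl rt)"
	shows "full G ` perms n \<subseteq> (full H ` perms n :: 'n tl rt set)"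
proof
	obtain f where f: "graph_iso f G H" "\<forall>i\<in>{1..n}. \<rho> (f i) = \<sigma> i"
		using full_eq_iff[OF G \<sigma> H \<rho>, where ?'n = 'n] eq by blast
	fix t :: "'n tl rt" assume "t \<in> full G ` perms n"
	then obtain \<sigma>' where s: "\<sigma>' permutes {1..n}" "t = full G \<sigma>'" by blast
	define \<rho>' where "\<rho>' = (\<sigma>' \<circ> inv \<sigma>) \<circ> \<rho>"
	have p: "\<rho>' permutes {1..n}"
		unfolding \<rho>'_def by (intro permutes_compose[OF \<rho>] permutes_compose[OF permutes_inv[OF \<sigma>]] s(1))
	have "\<forall>i\<in>{1..n}. \<rho>' (f i) = \<sigma>' i" using f(2) permutes_inverses(2)[OF \<sigma>] by (simp add: \<rho>'_def)
	hence "t = full H \<rho>'" unfolding s(2) full_eq_iff[OF G s(1) H p] using f(1) by blast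
	thus "t \<in> full H ` perms n" using p by blast
qed

lemma tree_iso_kernel:
	"tree_iso n = {(G, H) \<in> trivalent_trees n \<times> trivalent_trees n.
		full G ` perms n = (full H ` perms n :: 'n tl rt set)}"
proof -
	have "(\<exists>f. graph_iso f G H) \<longleftrightarrow> full G ` perms n = (full H ` perms n :: 'n tl rt set)"
		if G: "G \<in> trivalent_trees n" and H: "H \<in> trivalent_trees n" for G H
	proof
		assume "\<exists>f. graph_iso f G H"
		then obtain f where f: "graph_iso f G H" by blast
		define f' where "f' i = (if i \<in> {1..n} then f i else i)" for i
		have p: "f' permutes {1..n}" unfolding f'_def[abs_def] by (rule permutes_extend[OF iso_marks[OF f G H]])
		have "\<forall>i\<in>{1..n}. id (f i) = f' i" by (simp add: f'_def)
		hence "full G f' = (full H id :: 'n tl rt)" unfolding full_eq_iff[OF G p H permutes_id] using f by blast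
		thus "full G ` perms n = (full H ` perms n :: 'n tl rt set)"
			using full_overlap[OF G H p permutes_id] full_overlap[OF H G permutes_id p] by (intro equalityI) auto
	next
		assume "full G ` perms n = (full H ` perms n :: 'n tl rt set)"
		hence "(full G id :: 'n tl rt) \<in> full H ` perms n" using permutes_id by blast
		then obtain \<rho> where \<rho>: "\<rho> permutes {1..n}" "full G id = (full H \<rho> :: 'n tl rt)" by blast
		thus "\<exists>f. graph_iso f G H" using full_eq_iff[OF G permutes_id H \<rho>(1), where ?'n = 'n] by blast
	qed
	thus ?thesis unfolding tree_iso_def by blast
qed

lemma amplitude_full:
	fixes \<Psi> :: "nat => 'n::{finite,linorder} qs"
	assumes B: "finite B" and G: "G \<in> trivalent_trees n" and \<sigma>: "\<sigma> permutes {1..n}"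
	shows "amplitude (QX B) G (tree_sink G) (%i. toq (\<Psi> (\<sigma> i))) M = TR (bval B \<Psi> (full G \<sigma>)) M"
proof -
	note GD = trivalentD[OF G]
	obtain x where x: "rooted G (inv \<sigma> 1) = Nd (inv \<sigma> 1) {#x#}" "lab x \<in> verts G" "lab x ~: leaves G"
		"(full G \<sigma> :: 'n tl rt) = Nd (Mk 1) {#map_rt (leaf_labels \<sigma> G) x#}" by (rule full_shape[OF G \<sigma>, where ?'n = 'n])
	have "1 \<in> {1..n}" using n by simp
	hence "inv \<sigma> 1 \<in> {1..n}" using permutes_in_image[OF permutes_inv[OF \<sigma>]] by blast
	hence r: "inv \<sigma> 1 \<in> verts G" using GD(3) by (auto simp: leaves_def)
	have "tree_sink G \<in> verts G & valence G (tree_sink G) = 3"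
		unfolding tree_sink_def by (rule someI[of _ "lab x"]) (use x(2,3) GD(4) in auto)
	hence R: "tree_sink G \<in> verts G" "tree_sink G ~: leaves G" by (auto simp: leaves_def)
	have "amplitude (QX B) G (tree_sink G) (%v. toq (\<Psi> (\<sigma> v))) M =
			TR (\<Psi> (\<sigma> (inv \<sigma> 1)) * \<Prod>\<^sub># (image_mset (bv B \<Psi>) (kids (map_rt (leaf_labels \<sigma> G) x)))) M"
		by (rule amplitude_leaf[OF B GD(1,4) _ _ x(3) R])
			 (use rooted(1,2)[OF GD(1) r] x(1) in auto)
	thus ?thesis using permutes_inverses(1)[OF \<sigma>] by (simp add: x(4) bval_def)
qed

text \<open>Each labelled tree of \<open>G\<close> comes from \<open>card (automorphisms G)\<close>
  permutations, which cancels the denominator. The isomorphism classes of graphs partition the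
  labelled trees, and removing the root leaf identifies these with
  \<open>btrees {2..n}\<close>.\<close>

lemma total_amplitude_btrees:
	assumes B: "finite B"
	shows "total_amplitude (QX B) n (%\<alpha>. toq (\<Psi> \<alpha>)) M =
		(\<Sum>y\<in>btrees {2..n}. TR (\<Psi> 1 * \<Prod>\<^sub># (image_mset (bv B \<Psi>) (kids y))) M)"
proof -
	let ?P = "{\<sigma>. \<sigma> permutes {1..n}}"
	let ?K = "%G. full G ` ?P :: 'a tl rt set"
	let ?H = "%K. \<Sum>t\<in>K. TR (bval B \<Psi> t) M"
	have finP: "finite ?P" by (simp add: finite_permutations)
	have F: "(\<Sum>\<sigma> | \<sigma> permutes {1..n}. amplitude (QX B) G (tree_sink G) (%i. toq (\<Psi> (\<sigma> i))) M / of_nat (card (automorphisms G))) = ?H (?K G)"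
		if G: "G \<in> trivalent_trees n" for G
	proof -
		have pos: "card (automorphisms G) ~= 0"
		proof -
			have "id \<in> automorphisms G" by (simp add: automorphisms_def graph_iso_def permutes_id)
			moreover have "finite (automorphisms G)"
				by (rule finite_subset[OF _ finite_permutations[of "verts G"]]) (auto simp: automorphisms_def is_treeD(1)[OF trivalentD(1)[OF G]])
			ultimately show ?thesis by auto
		qed
		have "(\<Sum>\<sigma>\<in>?P. TR (bval B \<Psi> (full G \<sigma>)) M / of_nat (card (automorphisms G))) =
				(\<Sum>t\<in>?K G. \<Sum>\<sigma>\<in>{\<rho>\<in>?P. full G \<rho> = t}. TR (bval B \<Psi> (full G \<sigma>)) M / of_nat (card (automorphisms G)))"
			by (rule sum.image_gen[OF finP])
		also have "... = ?H (?K G)"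
		proof (rule sum.cong[OF refl])
			fix t assume "t \<in> ?K G"
			then obtain \<sigma> where s: "\<sigma> permutes {1..n}" "t = full G \<sigma>" by blast
			have "card {\<rho>\<in>?P. full G \<rho> = t} = card (automorphisms G)"
				using card_full_fibre[OF G s(1), where ?'n = 'a] unfolding s(2) by simp
			moreover have "(\<Sum>\<sigma>\<in>{\<rho>\<in>?P. full G \<rho> = t}. TR (bval B \<Psi> (full G \<sigma>)) M / of_nat (card (automorphisms G))) =
					(\<Sum>\<sigma>\<in>{\<rho>\<in>?P. full G \<rho> = t}. TR (bval B \<Psi> t) M / of_nat (card (automorphisms G)))"
				by (rule sum.cong) auto
			ultimately show "(\<Sum>\<sigma>\<in>{\<rho>\<in>?P. full G \<rho> = t}. TR (bval B \<Psi> (full G \<sigma>)) M / of_nat (card (automorphisms G))) =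
					TR (bval B \<Psi> t) M" using pos by simp
		qed
		finally show ?thesis using amplitude_full[OF B G, of _ \<Psi> M] by simp
	qed
	have "total_amplitude (QX B) n (%\<alpha>. toq (\<Psi> \<alpha>)) M = (\<Sum>K\<in>?K ` trivalent_trees n. ?H K)"
		unfolding total_amplitude_def Let_def by (rule sum_quotient_kernel[where h = ?K and H = ?H, OF tree_iso_kernel F])
	also have "... = ?H (\<Union>(?K ` trivalent_trees n))"
	proof (rule sum.Union_disjoint[symmetric, unfolded comp_def])
		show "\<forall>A\<in>?K ` trivalent_trees n. finite A" using finP by auto
		show "\<forall>A\<in>?K ` trivalent_trees n. \<forall>C\<in>?K ` trivalent_trees n. A ~= C --> A \<inter> C = {}"
		proof (intro ballI impI, rule ccontr)
			fix A C assume "A \<in> ?K ` trivalent_trees n" "C \<in> ?K ` trivalent_trees n" and ne: "A ~= C" "A \<inter> C ~= {}"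
			then obtain G H where G: "G \<in> trivalent_trees n" "A = ?K G" and H: "H \<in> trivalent_trees n" "C = ?K H" by blast
			then obtain \<sigma> \<rho> where "\<sigma> permutes {1..n}" "\<rho> permutes {1..n}" "full G \<sigma> = (full H \<rho> :: 'a tl rt)"
				using ne(2) by blast
			hence "A \<subseteq> C" "C \<subseteq> A" unfolding G(2) H(2) using full_overlap[OF G(1) H(1)] full_overlap[OF H(1) G(1)] by metis+
			thus False using ne(1) by blast
		qed
	qed
	also have "\<Union>(?K ` trivalent_trees n) = (%y. Nd (Mk 1) {#y#}) ` btrees {2..n}" by (rule full_trees)
	also have "?H ... = (\<Sum>y\<in>btrees {2..n}. TR (\<Psi> 1 * \<Prod>\<^sub># (image_mset (bv B \<Psi>) (kids y))) M)"
		by (subst sum.reindex) (auto simp: inj_on_def bval_def)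
	finally show ?thesis .
qed

end

section \<open>Integrals over the lengths of the internal edges\<close>

primrec iE :: "nat rt => (nat \<times> nat) set" where
	"iE (Nd l ts) = \<Union>(set_mset (image_mset (%c. if kids c = {#} then {} else insert (edge l (lab c)) (iE c)) ts))"

text \<open>\<open>k l c\<close> is the vector of the edge from \<open>l\<close> to its child \<open>c\<close>; external edges carry no parameter.\<close>

primrec tV :: "(nat => 'n gf) => (nat => nat => (int,'n::{finite,linorder}) vec) => nat rt => 'n gf" where
	"tV \<nu> k (Nd l ts) = \<nu> l * \<Prod>\<^sub># (image_mset (%c. if kids c = {#} then 1 else kap (- k l (lab c)) (tV \<nu> k c)) ts)"

text \<open>The integrand of \<open>tV\<close> at fixed lengths. The minus sign in \<open>tV\<close>
  compensates that the propagator evaluates at \<open>r - t m\<close>, while evaluation along an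
  edge moves to \<open>r\<close> plus a multiple of \<open>k\<close>.\<close>

primrec tA :: "(nat => 'n gf) => (nat => nat => (int,'n::{finite,linorder}) vec) => nat rt =>
		(nat \<times> nat => real) => (real,'n) vec => 'n gen eext" where
	"tA \<nu> k (Nd l ts) = (%\<tau> r. ev (\<nu> l) r * \<Prod>\<^sub># (image_mset (%c. if kids c = {#} then 1 else
		 erp (rvec (k l (lab c))) (tA \<nu> k c \<tau> (r + \<tau> (edge l (lab c)) *\<^sub>R rvec (k l (lab c))))) ts))"

lemma iE_add: "iE (Nd l (add_mset c ts)) = (if kids c = {#} then {} else insert (edge l (lab c)) (iE c)) \<union> iE (Nd l ts)" by simp

lemma tV_add: "tV \<nu> k (Nd l (add_mset c ts)) = (if kids c = {#} then 1 else kap (- k l (lab c)) (tV \<nu> k c)) * tV \<nu> k (Nd l ts)"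
	by (simp add: mult_ac)

lemma tA_add: "tA \<nu> k (Nd l (add_mset c ts)) \<tau> r = (if kids c = {#} then 1 else
		erp (rvec (k l (lab c))) (tA \<nu> k c \<tau> (r + \<tau> (edge l (lab c)) *\<^sub>R rvec (k l (lab c))))) * tA \<nu> k (Nd l ts) \<tau> r"
	by (simp add: mult_ac)

lemma iE_subset: "iE t \<subseteq> set_rt t \<times> set_rt t"
proof (induction t rule: rt_add_induct)
	case (add l c ts)
	have "edge l (lab c) \<in> (insert l (set_rt c)) \<times> (insert l (set_rt c))" by (auto simp: edge_def min_def max_def)
	thus ?case unfolding iE_add set_rt_add using add by auto
qed simp

lemma finite_iE [simp]: "finite (iE t)" by (rule finite_subset[OF iE_subset]) simp

lemma iE_disjoint:
	assumes "dstl (Nd l (add_mset c ts))"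
	shows "edge l (lab c) ~: iE c" "insert (edge l (lab c)) (iE c) \<inter> iE (Nd l ts) = {}"
proof -
	have d: "l ~: set_rt c" "set_rt c \<inter> set_rt (Nd l ts) = {}" using assms by (auto simp: dstl_add)
	hence "lab c ~: set_rt (Nd l ts)" using lab_in_set_rt[of c] by blast
	hence "edge l (lab c) ~: set_rt (Nd l ts) \<times> set_rt (Nd l ts)" "edge l (lab c) ~: set_rt c \<times> set_rt c"
		using d(1) by (auto simp: edge_def min_def max_def)
	thus "edge l (lab c) ~: iE c" "insert (edge l (lab c)) (iE c) \<inter> iE (Nd l ts) = {}"
		using iE_subset[of c] iE_subset[of "Nd l ts"] d(2) by blast+
qed

lemma tA_cong: "(!!e. e \<in> iE t ==> \<tau> e = \<tau>' e) ==> tA \<nu> k t \<tau> = tA \<nu> k t \<tau>'"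
proof (induction t rule: rt_add_induct)
	case (add l c ts)
	have "tA \<nu> k (Nd l ts) \<tau> = tA \<nu> k (Nd l ts) \<tau>'" by (rule add.IH(2), rule add.prems) (simp only: iE_add, blast)
	moreover have "tA \<nu> k c \<tau> = tA \<nu> k c \<tau>'" "\<tau> (edge l (lab c)) = \<tau>' (edge l (lab c))" if "kids c ~= {#}"
		using that by (auto intro!: add.IH(1) add.prems)
	ultimately show ?case unfolding tA_add fun_eq_iff by simp
qed simp

abbreviation lbm :: "(nat \<times> nat) set => (nat \<times> nat => real) measure" where
	"lbm I \<equiv> \<Pi>\<^sub>M e\<in>I. lborel"

interpretation lb: product_sigma_finite "%_::nat \<times> nat. lborel :: real measure" by standard

text \<open>Restriction to two disjoint sets of edges preserves the measure, so lengths of different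
  branches are independent parameters as in \<open>pgood_wedge\<close>.\<close>

lemma distr_split:
	fixes I J :: "(nat \<times> nat) set"
	assumes IJ: "I \<inter> J = {}" "finite I" "finite J"
	shows "distr (lbm (I \<union> J)) (lbm I \<Otimes>\<^sub>M lbm J) (%\<tau>. (restrict \<tau> I, restrict \<tau> J)) = lbm I \<Otimes>\<^sub>M lbm J"
proof -
	let ?Y = "(%\<tau>. (restrict \<tau> I, restrict \<tau> J)) \<circ> merge I J"
	let ?X = "lbm I \<Otimes>\<^sub>M lbm J"
	have m: "(%\<tau>. (restrict \<tau> I, restrict \<tau> J)) \<in> measurable (lbm (I \<union> J)) ?X"
		by (intro measurable_Pair measurable_restrict_subset) auto
	have "distr (lbm (I \<union> J)) ?X (%\<tau>. (restrict \<tau> I, restrict \<tau> J)) =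
			distr ?X ?X ?Y" by (subst lb.distr_merge[OF IJ, symmetric], rule distr_distr[OF m measurable_merge])
	also have "... = distr ?X ?X (%x. x)"
	proof (rule distr_cong[OF refl refl])
		fix x assume "x \<in> space ?X"
		thus "?Y x = x" using IJ(1) by (auto simp: space_pair_measure space_PiM PiE_def extensional_restrict)
	qed
	also have "... = lbm I \<Otimes>\<^sub>M lbm J" by (rule distr_id)
	finally show ?thesis .
qed

lemma distr_insert:
	fixes e :: "nat \<times> nat"
	assumes I: "finite I" "e ~: I"
	shows "distr (lbm (insert e I)) (lbm I \<Otimes>\<^sub>M lborel) (%\<tau>. (restrict \<tau> I, \<tau> e)) = lbm I \<Otimes>\<^sub>M lborel"
proof (rule measure_eqI)
	let ?Y = "lbm (insert e I)"
	let ?X = "lbm I \<Otimes>\<^sub>M (lborel :: real measure)"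
	let ?f = "%\<tau> :: nat \<times> nat => real. (restrict \<tau> I, \<tau> e)"
	have m [measurable]: "?f \<in> measurable ?Y ?X" by (intro measurable_Pair measurable_restrict_subset measurable_component_singleton) auto
	fix A assume "A \<in> sets (distr ?Y ?X ?f)"
	hence A [measurable]: "A \<in> sets ?X" by simp
	have "emeasure (distr ?Y ?X ?f) A = (\<integral>\<^sup>+x. indicator A x \<partial>distr ?Y ?X ?f)"
		by (rule nn_integral_indicator[symmetric]) (simp only: sets_distr A)
	also have "... = (\<integral>\<^sup>+\<tau>. indicator A (?f \<tau>) \<partial>lbm (insert e I))"
		by (rule nn_integral_distr) measurable
	also have "... = (\<integral>\<^sup>+x. \<integral>\<^sup>+y. indicator A (?f (x(e := y))) \<partial>lborel \<partial>lbm I)"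
		by (rule lb.product_nn_integral_insert[OF I]) measurable
	also have "... = (\<integral>\<^sup>+x. \<integral>\<^sup>+y. indicator A (x, y) \<partial>lborel \<partial>lbm I)"
	proof (rule nn_integral_cong)
		fix x assume "x \<in> space (lbm I)"
		hence "restrict (x(e := y)) I = x" for y using I(2) by (auto simp: space_PiM PiE_def extensional_def fun_eq_iff)
		thus "(\<integral>\<^sup>+y. indicator A (?f (x(e := y))) \<partial>lborel) = (\<integral>\<^sup>+y. indicator A (x, y) \<partial>lborel)"
			by simp
	qed
	also have "... = (\<integral>\<^sup>+z. indicator A z \<partial>?X)" by (rule lborel.nn_integral_fst) measurable
	also have "... = emeasure ?X A" by (rule nn_integral_indicator[OF A])
	finally show "emeasure (distr ?Y ?X ?f) A = emeasure ?X A" .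
qed simp

lemma integral_flow:
	fixes w :: "'p => ('n::{finite,linorder}) form"
	assumes w: "pgood P \<beta> w" and sf: "sigma_finite_measure P"
	shows "(\<integral>z. drift m w z r S \<partial>(P \<Otimes>\<^sub>M lborel)) = flowint m (%r S. \<integral>p. w p r S \<partial>P) r S"
proof -
	interpret pair_sigma_finite P lborel using sf by (simp add: pair_sigma_finite_def sigma_finite_lborel)
	have i: "integrable (P \<Otimes>\<^sub>M lborel) (%(p, t). drift m w (p, t) r S)"
		using pgood_integrable[OF pgood_flow[OF w sf], of m r S] by (simp only: case_prod_unfold prod.collapse)
	have "(\<integral>z. drift m w z r S \<partial>(P \<Otimes>\<^sub>M lborel)) = (LBINT t. \<integral>p. drift m w (p, t) r S \<partial>P)"
		using integral_snd[OF i] by (simp only: case_prod_unfold prod.collapse)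
	also have "... = flowint m (%r S. \<integral>p. w p r S \<partial>P) r S" unfolding flowint_def drift_def
		by (intro Bochner_Integration.integral_cong refl) (simp add: rp_integral(1)[OF pgood_integrable[OF w]])
	finally show ?thesis .
qed

lemma flowint_cmult: "flowint m (%r S. c * f r S) r S = c * flowint m f r S"
	unfolding flowint_def rp_cmult by (simp only: mult.left_commute[of _ c] integral_mult_right_zero)

definition wA :: "(nat => 'n gf) => (nat => nat => (int,'n::{finite,linorder}) vec) => nat rt => (nat \<times> nat => real) => 'n form" where
	"wA \<nu> k t \<tau> r S = of_bool (\<forall>e\<in>iE t. \<tau> e > 0) * cf (tA \<nu> k t \<tau> r) S"

lemma wA_restrict: "iE t \<subseteq> I ==> wA \<nu> k t (restrict \<tau> I) = wA \<nu> k t \<tau>"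
proof -
	assume I: "iE t \<subseteq> I"
	have "tA \<nu> k t (restrict \<tau> I) = tA \<nu> k t \<tau>" by (rule tA_cong) (use I in auto)
	moreover have "(\<forall>e\<in>iE t. restrict \<tau> I e > 0) \<longleftrightarrow> (\<forall>e\<in>iE t. \<tau> e > 0)" using I by auto
	ultimately show ?thesis unfolding wA_def[abs_def] by simp
qed

text \<open>Attaching a branch multiplies by its propagated value: the length of the new edge gives
  \<open>drift\<close>, whose integral is \<open>flowint\<close>, and the rest of the tree depends
  on other lengths, so the integral of the wedge product factors. Each edge adds one angular factor.
  The decay of the joint integrand is carried along because it justifies every exchange of
  integrals.\<close>

lemma wA_integral:
	fixes \<nu> :: "nat => 'n::{finite,linorder} gf"
	shows "dstl t ==> pgood (lbm (iE t)) (%_. 1) (wA \<nu> k t) &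
		(\<forall>r S. (2 * of_real pi) ^ card (iE t) * (\<integral>\<tau>. wA \<nu> k t \<tau> r S \<partial>lbm (iE t)) = cf (ev (tV \<nu> k t) r) S)"
proof (induction t rule: rt_add_induct)
	case (single l)
	have w: "wA \<nu> k (Nd l {#}) = (%_ r. cf (ev (\<nu> l) r))" by (simp add: wA_def[abs_def])
	have d: "distr (lbm {}) point (%_. ()) = point"
	proof (rule measure_eqI)
		fix A assume "A \<in> sets (distr (lbm {}) point (%_. ()))"
		have "A = {} | A = {()}" by auto
		thus "emeasure (distr (lbm {}) point (%_. ())) A = emeasure point A"
			by (auto simp: emeasure_distr PiM_empty vimage_def emeasure_count_space)
	qed simp
	have "pgood (lbm {}) (%_. 1) (%_ r. cf (ev (\<nu> l) r))"
		using pgood_transport[OF good_ev[of "\<nu> l", unfolded good_def] _ d] by simp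
	thus ?case unfolding w by (simp add: PiM_empty lebesgue_integral_count_space_finite)
next case (add l c ts)
	have dc: "dstl c" "dstl (Nd l ts)" using add.prems by (auto simp: dstl_add)
	show ?case
	proof (cases "kids c = {#}")
		case True
		have "iE (Nd l (add_mset c ts)) = iE (Nd l ts)" "tV \<nu> k (Nd l (add_mset c ts)) = tV \<nu> k (Nd l ts)"
			"wA \<nu> k (Nd l (add_mset c ts)) = wA \<nu> k (Nd l ts)" unfolding wA_def[abs_def] tA_add iE_add tV_add using True by simp_all
		thus ?thesis using add.IH(2)[OF dc(2)] by metis
	next case False
		let ?e = "edge l (lab c)" and ?I = "iE c" and ?J = "iE (Nd l ts)" and ?t = "Nd l (add_mset c ts)"
		let ?m = "k l (lab c)" and ?u = "Nd l ts" and ?K = "insert ?e ?I"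
		note disj = iE_disjoint[OF add.prems]
		have U: "iE ?t = ?K \<union> ?J" unfolding iE_add using False by simp
		note pc = add.IH(1)[OF dc(1), THEN conjunct1] and ic = add.IH(1)[OF dc(1), THEN conjunct2]
		note pu = add.IH(2)[OF dc(2), THEN conjunct1] and iu = add.IH(2)[OF dc(2), THEN conjunct2]
		let ?g = "%\<tau>. (restrict \<tau> ?I, \<tau> ?e)" and ?h = "%\<tau>. (restrict \<tau> ?K, restrict \<tau> ?J)"
		have sI: "sigma_finite_measure (lbm ?I)" and sJ: "sigma_finite_measure (lbm ?J)" and sK: "sigma_finite_measure (lbm ?K)"
			by (auto intro: lb.sigma_finite)
		have mg: "?g \<in> measurable (lbm ?K) (lbm ?I \<Otimes>\<^sub>M lborel)"
			by (intro measurable_Pair measurable_restrict_subset measurable_component_singleton) auto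
		have mh: "?h \<in> measurable (lbm (?K \<union> ?J)) (lbm ?K \<Otimes>\<^sub>M lbm ?J)"
			by (intro measurable_Pair measurable_restrict_subset) auto
		have dg: "distr (lbm ?K) (lbm ?I \<Otimes>\<^sub>M lborel) ?g = lbm ?I \<Otimes>\<^sub>M lborel"
			by (rule distr_insert) (use disj(1) in auto)
		have dh: "distr (lbm (?K \<union> ?J)) (lbm ?K \<Otimes>\<^sub>M lbm ?J) ?h = lbm ?K \<Otimes>\<^sub>M lbm ?J"
			by (rule distr_split) (use disj(2) in auto)
		\<comment> \<open>The branch \<open>c\<close> together with its edge. The direction is reversed
		  because \<open>drift\<close> evaluates at \<open>r - t *\<^sub>R m\<close>.\<close>
		define f where "f \<tau> = drift (- rvec ?m) (wA \<nu> k c) (?g \<tau>)" for \<tau>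
		let ?F = "%(p, q) r. f p r \<and>\<^sub>g wA \<nu> k ?u q r"
		have pf: "pgood (lbm ?K) (%_. 1) f"
			using pgood_transport[OF pgood_flow[OF pc sI] mg dg, of "- rvec ?m"] unfolding f_def[abs_def] by simp
		have pw: "pgood (lbm ?K \<Otimes>\<^sub>M lbm ?J) (%_. 1) ?F"
			using pgood_wedge[OF pf pu sJ] by (simp only: case_prod_unfold mult_1_left)
		have weq: "wA \<nu> k ?t \<tau> = ?F (?h \<tau>)" for \<tau>
		proof (intro ext)
			fix r S
			let ?b = "of_bool (\<tau> ?e > 0) :: complex" and ?c = "of_bool (\<forall>e\<in>?I. \<tau> e > 0) :: complex" and ?d = "of_bool (\<forall>e\<in>?J. \<tau> e > 0) :: complex" and ?X = "cf (erp (rvec ?m) (tA \<nu> k c \<tau> (r + \<tau> ?e *\<^sub>R rvec ?m)))"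
			have "f (restrict \<tau> ?K) r = (%S. ?b * rp (rvec ?m) (wA \<nu> k c \<tau> (r + \<tau> ?e *\<^sub>R rvec ?m)) S)"
				by (simp add: f_def drift_def rp_uminus Int_absorb1[OF subset_insertI] wA_restrict[OF order_refl])
			also have "... = (%S. (?b * ?c) * ?X S)" unfolding wA_def[abs_def] rp_cmult cf_erp by (simp add: mult_ac)
			finally have 1: "f (restrict \<tau> ?K) r = (%S. (?b * ?c) * ?X S)" .
			have 2: "wA \<nu> k ?u (restrict \<tau> ?J) r = (%S. ?d * cf (tA \<nu> k ?u \<tau> r) S)"
				unfolding wA_restrict[OF order_refl] by (simp add: wA_def[abs_def])
			have "wA \<nu> k ?t \<tau> r S = (?b * ?c * ?d) * (?X \<and>\<^sub>g cf (tA \<nu> k ?u \<tau> r)) S"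
				unfolding wA_def U tA_add using False by (simp only: if_False cf_mult ball_Un ball_simps of_bool_conj mult.assoc)
			also have "... = (f (restrict \<tau> ?K) r \<and>\<^sub>g wA \<nu> k ?u (restrict \<tau> ?J) r) S"
				unfolding 1 2 gwedge_cmult_left gwedge_cmult_right by (simp add: mult_ac)
			finally show "wA \<nu> k ?t \<tau> r S = (?F (?h \<tau>)) r S" by simp
		qed
		have p: "pgood (lbm (iE ?t)) (%_. 1) (wA \<nu> k ?t)"
			unfolding U using pgood_transport[OF pw mh dh] by (rule pgood_cong_fun) (simp add: weq[abs_def])
		have int: "(2 * of_real pi) ^ card (iE ?t) * (\<integral>\<tau>. wA \<nu> k ?t \<tau> r S \<partial>lbm (iE ?t)) = cf (ev (tV \<nu> k ?t) r) S" for r S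
		proof -
			have mw: "(%z. (case z of (p, q) => f p r \<and>\<^sub>g wA \<nu> k ?u q r) S) \<in> borel_measurable (lbm ?K \<Otimes>\<^sub>M lbm ?J)"
				using borel_measurable_integrable[OF pgood_integrable[OF pw, of r S]] by (simp add: case_prod_unfold)
			have mf: "(%z. drift (- rvec ?m) (wA \<nu> k c) z r U) \<in> borel_measurable (lbm ?I \<Otimes>\<^sub>M lborel)" for U
				using borel_measurable_integrable[OF pgood_integrable[OF pgood_flow[OF pc sI]]] .
			have F: "(\<integral>p. f p r U \<partial>lbm ?K) = flowint (- rvec ?m) (%r S. \<integral>p. wA \<nu> k c p r S \<partial>lbm ?I) r U" for U
				unfolding f_def integral_flow[OF pc sI, symmetric] by (rule integral_distr[OF mg mf, unfolded dg, symmetric])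
			have K: "cf (ev (kap (- ?m) (tV \<nu> k c)) r) U =
					(2 * of_real pi) ^ (card ?I + 1) * (\<integral>p. f p r U \<partial>lbm ?K)" for U
			proof -
				have "(%r. cf (ev (tV \<nu> k c) r)) = (%r S. (2 * of_real pi) ^ card ?I * (\<integral>\<tau>. wA \<nu> k c \<tau> r S \<partial>lbm ?I))"
					using ic by (simp add: fun_eq_iff)
				thus ?thesis unfolding cf_kap rvec_uminus F by (simp add: flowint_cmult)
			qed
			have "(\<integral>\<tau>. wA \<nu> k ?t \<tau> r S \<partial>lbm (iE ?t)) = (\<integral>z. (case z of (p, q) => f p r \<and>\<^sub>g wA \<nu> k ?u q r) S \<partial>(lbm ?K \<Otimes>\<^sub>M lbm ?J))"
				unfolding U weq integral_distr[OF mh mw, unfolded dh] by (simp only: case_prod_unfold)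
			also have "... = ((%S. \<integral>p. f p r S \<partial>lbm ?K) \<and>\<^sub>g (%S. \<integral>q. wA \<nu> k ?u q r S \<partial>lbm ?J)) S"
				by (rule integral_wedge[OF pf pu sK sJ])
			finally have W: "(\<integral>\<tau>. wA \<nu> k ?t \<tau> r S \<partial>lbm (iE ?t)) =
					((%S. \<integral>p. f p r S \<partial>lbm ?K) \<and>\<^sub>g (%S. \<integral>q. wA \<nu> k ?u q r S \<partial>lbm ?J)) S" .
			have cU: "card (iE ?t) = (card ?I + 1) + card ?J" unfolding U by (subst card_Un_disjoint) (use disj in auto)
			have Ju: "cf (ev (tV \<nu> k ?u) r) = (%S. (2 * of_real pi) ^ card ?J * (\<integral>q. wA \<nu> k ?u q r S \<partial>lbm ?J))"
				using iu by (simp add: fun_eq_iff)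
			have Kf: "cf (ev (kap (- ?m) (tV \<nu> k c)) r) = (%S. (2 * of_real pi) ^ (card ?I + 1) * (\<integral>p. f p r S \<partial>lbm ?K))"
				using K by (simp add: fun_eq_iff)
			show ?thesis unfolding tV_add W cU using False
				by (simp only: if_False ev_simps cf_mult Kf Ju gwedge_cmult_left gwedge_cmult_right, simp only: power_add mult_ac)
		qed
		show ?thesis using p int by blast
	qed
qed

lemma tr_tV:
	fixes \<nu> :: "nat => 'n::{finite,linorder} gf"
	assumes t: "dstl t"
	shows "(2 * of_real pi) ^ (CARD('n) + card (iE t)) *
			(\<integral>(r, \<tau>). of_bool (\<forall>e\<in>iE t. \<tau> e > 0) * cf (tA \<nu> k t \<tau> r) UNIV \<partial>(lborel \<Otimes>\<^sub>M lbm (iE t))) = tr (tV \<nu> k t)"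
proof -
	let ?X = "\<integral>(r, \<tau>). of_bool (\<forall>e\<in>iE t. \<tau> e > 0) * cf (tA \<nu> k t \<tau> r) UNIV \<partial>(lborel \<Otimes>\<^sub>M lbm (iE t))"
	note p = wA_integral[OF t, THEN conjunct1, of \<nu> k] and i = wA_integral[OF t, THEN conjunct2, rule_format, of \<nu> k]
	have s: "sigma_finite_measure (lbm (iE t))" by (auto intro: lb.sigma_finite)
	interpret pair_sigma_finite "lborel :: (real,'n) vec measure" "lbm (iE t)"
		using s by (simp add: pair_sigma_finite_def sigma_finite_lborel)
	have "?X =
			(\<integral>(r, \<tau>). wA \<nu> k t \<tau> r UNIV \<partial>(lborel \<Otimes>\<^sub>M lbm (iE t)))" by (simp add: wA_def)
	also have "... = (LBINT r. \<integral>\<tau>. wA \<nu> k t \<tau> r UNIV \<partial>lbm (iE t))"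
		using integral_fst'[OF pgood_top[OF p s]] by simp
	finally have "(2 * of_real pi) ^ (CARD('n) + card (iE t)) *
			?X =
			(2 * of_real pi) ^ CARD('n) * (LBINT r. (2 * of_real pi) ^ card (iE t) * (\<integral>\<tau>. wA \<nu> k t \<tau> r UNIV \<partial>lbm (iE t)))"
		by (simp only: power_add integral_mult_right_zero mult.assoc)
	thus ?thesis unfolding i by (simp only: tr_def int_X_def)
qed

section \<open>Pulled back forms on the moduli space\<close>

lemma gmon_degree:
	assumes \<theta>: "deg1 \<theta>" and "finite T"
	shows "gmon \<theta> T S ~= 0 ==> finite S & card S = card T" using assms(2)
proof (induction T arbitrary: S rule: finite_Min_induct)
	case empty
	thus ?case by (auto simp: gone_def split: if_splits)
next case (insert g T)
	have "g ~: T" using insert.hyps(2) by blast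
	have eq: "gmon \<theta> (insert g T) = \<theta> g \<and>\<^sub>g gmon \<theta> T" by (rule gmon_insert_min) (use insert.hyps in auto)
	from insert.prems obtain U where U: "finite S" "U \<subseteq> S" "\<theta> g U ~= 0" "gmon \<theta> T (S - U) ~= 0"
		unfolding eq by (rule gwedge_nonzeroE)
	have "card U = 1" "finite (S - U)" "card (S - U) = card T" using \<theta> U(3) insert.IH[OF U(4)] by (auto simp: deg1_def)
	moreover have "card S = card U + card (S - U)" using U(1,2) by (metis card_Diff_subset card_mono finite_subset le_add_diff_inverse)
	ultimately show ?case using U(1) `g ~: T` insert.hyps(1) by simp
qed

definition gse :: "('g::{finite,linorder} => 'h::linorder ext) => 'g eext => 'h eext" where
	"gse \<theta> a = Eext (gsubst UNIV \<theta> (cf a))"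

lemma cf_gse:
	assumes "deg1 \<theta>"
	shows "cf (gse \<theta> a) = gsubst UNIV \<theta> (cf a)" unfolding gse_def
proof (rule even_Eext)
	fix S assume "gsubst UNIV \<theta> (cf a) S ~= 0"
	then obtain T where T: "cf a T * gmon \<theta> T S ~= 0" unfolding gsubst_gmon by (meson sum.neutral)
	hence "finite S & card S = card T" using gmon_degree[OF assms, of T S] by auto
	moreover have "even (card T)" using cf[of a] T by auto
	ultimately show "finite S & even (card S)" by simp
qed

lemma gse_mult: "deg1 \<theta> ==> gse \<theta> (a * b) = gse \<theta> a * gse \<theta> b"
	by (rule eext_eqI) (simp add: cf_gse cf_mult gsubst_wedge)

lemma gse_one: "deg1 \<theta> ==> gse \<theta> 1 = 1" by (rule eext_eqI) (simp add: cf_gse cf_one gsubst_gone)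

lemma free_wedge: "free E a ==> free E b ==> free E (a \<and>\<^sub>g b)" unfolding free_def
proof (intro allI impI)
	fix S assume f: "\<forall>S. a S ~= 0 --> S \<inter> prs E = {}" "\<forall>S. b S ~= 0 --> S \<inter> prs E = {}" and "(a \<and>\<^sub>g b) S ~= 0"
	from this(3) obtain U where "a U ~= 0" "b (S - U) ~= 0" by (rule gwedge_nonzeroE)
	hence "U \<inter> prs E = {}" "(S - U) \<inter> prs E = {}" using f by auto
	thus "S \<inter> prs E = {}" by blast
qed

lemma free_mono: "free E a ==> F \<subseteq> E ==> free F a" unfolding free_def prs_def by blast

lemma free_gone: "free E gone" by (simp add: free_def gone_def)

lemma free_gsubst:
	assumes "!!g. free E (\<theta> g)"
	shows "free E (gsubst UNIV \<theta> (a :: 'g::{finite,linorder} ext))"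
proof -
	have "free E (gmon \<theta> T)" if "finite T" for T :: "'g set" using that
	proof (induction T rule: finite_Min_induct)
		case (insert g T)
		thus ?case by (simp add: gmon_insert_min free_wedge assms)
	qed (simp add: free_gone)
	hence m: "free E (gmon \<theta> T)" for T :: "'g set" by simp
	show ?thesis unfolding free_def
	proof (intro allI impI)
		fix S assume "gsubst UNIV \<theta> a S ~= 0"
		then obtain T where "a T * gmon \<theta> T S ~= 0" unfolding gsubst_gmon by (meson sum.neutral)
		thus "S \<inter> prs E = {}" using m[of T] unfolding free_def by auto
	qed
qed

lemma free_shift: "free E (\<theta> g) ==> e ~: E ==> free E (shift_gen k e \<theta> g)"
	by (auto simp: free_def shift_gen_def ggen_def prs_def ptype_def split: gen.splits if_splits)

definition edgc :: "nat => nat => 'n mcoord" where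
	"edgc u v = Edg (min u v) (max u v)"

definition iC :: "nat rt => 'n mcoord set" where
	"iC t = (%(u, v). Edg u v) ` iE t"

text \<open>The wedge product of the pulled back forms, arranged by recursion: \<open>r\<close> and
  \<theta> accumulate the position and the differentials of the evaluation map on the way down from
  the root.\<close>

primrec tP :: "(nat => 'n gf) => (nat => nat => (int,'n::{finite,linorder}) vec) => nat rt =>
		(nat \<times> nat => real) => (real,'n) vec => ('n gen => 'n mcoord gen ext) => 'n mcoord gen eext" where
	"tP \<nu> k (Nd l ts) = (%\<tau> r \<theta>. gse \<theta> (ev (\<nu> l) r) * \<Prod>\<^sub># (image_mset (%c. if kids c = {#} then 1 else
		 tP \<nu> k c \<tau> (r + \<tau> (edge l (lab c)) *\<^sub>R rvec (k l (lab c))) (shift_gen (k l (lab c)) (edgc l (lab c)) \<theta>)) ts))"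

lemma tP_add: "tP \<nu> k (Nd l (add_mset c ts)) \<tau> r \<theta> = (if kids c = {#} then 1 else
		tP \<nu> k c \<tau> (r + \<tau> (edge l (lab c)) *\<^sub>R rvec (k l (lab c))) (shift_gen (k l (lab c)) (edgc l (lab c)) \<theta>)) *
		tP \<nu> k (Nd l ts) \<tau> r \<theta>" by (simp add: mult_ac)

lemma iC_add: "iC (Nd l (add_mset c ts)) = (if kids c = {#} then {} else insert (edgc l (lab c)) (iC c)) \<union> iC (Nd l ts)"
	unfolding iC_def iE_add by (auto simp: edge_def edgc_def)

lemma iC_disjoint:
	assumes "dstl (Nd l (add_mset c ts))"
	shows "edgc l (lab c) ~: (iC c :: 'n mcoord set)" "insert (edgc l (lab c)) (iC c) \<inter> (iC (Nd l ts) :: 'n mcoord set) = {}"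
	using iE_disjoint[OF assms] by (auto simp: iC_def edgc_def edge_def)

lemma finite_iC [simp]: "finite (iC t)" by (simp add: iC_def)

lemma tP_free:
	fixes \<nu> :: "nat => 'n::{finite,linorder} gf"
	shows "deg1 \<theta> ==> (!!g. free E (\<theta> g)) ==> E \<inter> iC t = {} ==> free E (cf (tP \<nu> k t \<tau> r \<theta>))"
proof (induction t arbitrary: r \<theta> rule: rt_add_induct)
	case (single l)
	thus ?case by (simp add: cf_gse free_gsubst)
next case (add l c ts)
	have u: "free E (cf (tP \<nu> k (Nd l ts) \<tau> r \<theta>))"
		by (rule add.IH(2)[OF add.prems(1,2)]) (use add.prems(3) in "simp only: iC_add, blast")
	have "free E (cf (tP \<nu> k c \<tau> r' (shift_gen (k l (lab c)) (edgc l (lab c)) \<theta>)))" if "kids c ~= {#}" for r'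
	proof (rule add.IH(1))
		have "E \<inter> insert (edgc l (lab c)) (iC c) = {}" using add.prems(3) that unfolding iC_add by auto
		thus "E \<inter> iC c = {}" "free E (shift_gen (k l (lab c)) (edgc l (lab c)) \<theta> g)" for g
			by (auto intro: free_shift add.prems(2))
	qed (rule deg1_shift[OF add.prems(1)])
	thus ?case unfolding tP_add using u by (simp add: cf_mult free_wedge cf_one free_gone del: tP.simps)
qed

lemma xt_cmult: "xt E (%S. k * a S) = (%S. k * xt E a S)" by (auto simp: xt_def)

lemma xt_empty: "xt {} a = a" by (auto simp: xt_def)

text \<open>The coordinates of an edge enter only beyond that edge, so \<open>xt_wedge\<close> and
  \<open>xt_shift\<close> extract them branch by branch. Every internal edge contributes the pair of
  contractions and one sign.\<close>

lemma tP_xt: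
	fixes \<nu> :: "nat => 'n::{finite,linorder} gf"
	shows "dstl t ==> deg1 \<theta> ==> (!!g. free (iC t) (\<theta> g)) ==>
		xt (iC t) (cf (tP \<nu> k t \<tau> r \<theta>)) = (%S. (-1) ^ card (iE t) * cf (gse \<theta> (tA \<nu> k t \<tau> r)) S)"
proof (induction t arbitrary: r \<theta> rule: rt_add_induct)
	case (single l)
	thus ?case by (simp add: iC_def xt_empty)
next case (add l c ts)
	have d: "dstl c" "dstl (Nd l ts)" using add.prems(1) by (auto simp: dstl_add)
	show ?case
	proof (cases "kids c = {#}")
		case True
		have "!!g. free (iC (Nd l ts)) (\<theta> g)" using add.prems(3) unfolding iC_add using True by simp
		from add.IH(2)[OF d(2) add.prems(2) this] show ?thesis unfolding iC_add iE_add tP_add tA_add using True by simp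
	next case False
		let ?e = "edgc l (lab c) :: 'n mcoord" and ?I = "iC c :: 'n mcoord set" and ?J = "iC (Nd l ts) :: 'n mcoord set" and ?m = "k l (lab c)"
		let ?r = "r + \<tau> (edge l (lab c)) *\<^sub>R rvec ?m" and ?\<theta> = "shift_gen ?m ?e \<theta>"
		let ?P1 = "tP \<nu> k c \<tau> ?r ?\<theta>" and ?P2 = "tP \<nu> k (Nd l ts) \<tau> r \<theta>" and ?A1 = "tA \<nu> k c \<tau> ?r" and ?A2 = "tA \<nu> k (Nd l ts) \<tau> r"
		note disj = iC_disjoint[OF add.prems(1), where ?'n = 'n] and disjE = iE_disjoint[OF add.prems(1)]
		have U: "iC (Nd l (add_mset c ts)) = insert ?e ?I \<union> ?J" unfolding iC_add using False by simp
		have cU: "card (iE (Nd l (add_mset c ts))) = Suc (card (iE c)) + card (iE (Nd l ts))"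
		proof -
			have "iE (Nd l (add_mset c ts)) = insert (edge l (lab c)) (iE c) \<union> iE (Nd l ts)" unfolding iE_add using False by simp
			moreover have "card (insert (edge l (lab c)) (iE c) \<union> iE (Nd l ts)) = card (insert (edge l (lab c)) (iE c)) + card (iE (Nd l ts))"
				by (rule card_Un_disjoint) (use disjE(2) in simp_all)
			ultimately show ?thesis using disjE(1) by simp
		qed
		have free: "free ?I (\<theta> g)" "free {?e} (\<theta> g)" "free ?J (\<theta> g)" "free (insert ?e ?I) (\<theta> g)" for g
			by (rule free_mono[OF add.prems(3)[of g, unfolded U]], blast)+
		have free': "free ?I (?\<theta> g)" "free ?J (?\<theta> g)" for g
			by (rule free_shift[OF free(1) disj(1)], rule free_shift[OF free(3)]) (use disj(2) in blast)
		note \<theta> = add.prems(2) and \<theta>' = deg1_shift[OF add.prems(2)]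
		have x2: "xt ?J (cf ?P2) = (%S. (-1) ^ card (iE (Nd l ts)) * cf (gse \<theta> ?A2) S)"
			by (rule add.IH(2)[OF d(2) \<theta> free(3)])
		have x1: "xt ?I (cf ?P1) = (%S. (-1) ^ card (iE c) * cf (gse ?\<theta> ?A1) S)" by (rule add.IH(1)[OF d(1) \<theta>' free'(1)])
		have f1: "free ?J (cf ?P1)" by (rule tP_free[OF \<theta>' free'(2)]) (use disj(2) in blast)
		have "xt ({?e} \<union> ?I) (cf ?P1) = xt {?e} (xt ?I (cf ?P1))" by (rule xt_union) (use disj(1) in simp)
		also have "... = (%S. - ((-1) ^ card (iE c) * cf (gse \<theta> (erp (rvec ?m) ?A1)) S))"
			unfolding x1 xt_cmult cf_gse[OF \<theta>'] xt_shift[OF \<theta> free(2)] cf_gse[OF \<theta>] cf_erp by simp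
		finally have x1': "xt (insert ?e ?I) (cf ?P1) = (%S. (-1) ^ Suc (card (iE c)) * cf (gse \<theta> (erp (rvec ?m) ?A1)) S)"
			by simp
		have "xt ?J (cf (?P1 * ?P2)) = (%S. (-1) ^ card (iE (Nd l ts)) * cf (?P1 * gse \<theta> ?A2) S)"
			unfolding mult.commute[of ?P1] cf_mult xt_wedge[OF finite_iC f1] x2 gwedge_cmult_left ..
		hence "xt (insert ?e ?I \<union> ?J) (cf (?P1 * ?P2)) =
				(%S. (-1) ^ card (iE (Nd l ts)) * xt (insert ?e ?I) (cf ?P1 \<and>\<^sub>g cf (gse \<theta> ?A2)) S)"
			unfolding xt_union[OF disj(2)] by (simp only: xt_cmult cf_mult)
		also have "xt (insert ?e ?I) (cf ?P1 \<and>\<^sub>g cf (gse \<theta> ?A2)) = xt (insert ?e ?I) (cf ?P1) \<and>\<^sub>g cf (gse \<theta> ?A2)"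
			by (rule xt_wedge) (simp_all add: cf_gse[OF \<theta>] free_gsubst free)
		also have "(%S. (-1) ^ card (iE (Nd l ts)) * ... S) =
				(%S. (-1) ^ (Suc (card (iE c)) + card (iE (Nd l ts))) * cf (gse \<theta> (erp (rvec ?m) ?A1 * ?A2)) S)"
			unfolding x1' gwedge_cmult_left gse_mult[OF \<theta>] cf_mult power_add by (simp only: mult_ac)
		finally show ?thesis unfolding U cU tP_add tA_add using False by (simp only: if_False)
	qed
qed

definition ctr_gen :: "'n gen => 'n mcoord gen ext" where
	"ctr_gen g = ggen (ptype g (Ctr (gidx g)))"

lemma deg1_ctr: "deg1 ctr_gen" by (auto simp: deg1_def ctr_gen_def ggen_def split: if_splits)

text \<open>The coordinates of the centre are disjoint from those of the edges, and embedding the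
  generators of \<open>X\<close> as centre generators preserves their order. So only the edge signs
  remain.\<close>

lemma tP_top:
	fixes \<nu> :: "nat => 'n::{finite,linorder} gf"
	assumes "dstl t"
	shows "cf (tP \<nu> k t \<tau> r ctr_gen) (prs (range Ctr \<union> iC t)) = (-1) ^ card (iE t) * cf (tA \<nu> k t \<tau> r) UNIV"
proof -
	let ?h = "%g. ptype g (Ctr (gidx g)) :: 'n mcoord gen"
	have fr: "free (iC t) (ctr_gen g)" for g :: "'n gen"
		by (auto simp: free_def ctr_gen_def ggen_def prs_def iC_def ptype_def split: gen.splits if_splits)
	have dis: "prs (range Ctr) \<inter> prs (iC t :: 'n mcoord set) = {}" by (auto simp: prs_def iC_def)
	have "prs (range Ctr) = range ?h"
	proof -
		have "range ?h = ?h ` (range Rad \<union> range Ang)" by (rule arg_cong[of _ _ "image ?h"]) (auto, metis gen.exhaust rangeI)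
		thus ?thesis by (auto simp: prs_def image_Un image_image ptype_def)
	qed
	moreover have "gsubst UNIV ctr_gen (cf (tA \<nu> k t \<tau> r)) (range ?h) = cf (tA \<nu> k t \<tau> r) UNIV"
		unfolding ctr_gen_def[abs_def] by (rule gsubst_ggen) (auto simp: less_gen_def less_mcoord_def ptype_def split: gen.splits)
	moreover have "cf (tP \<nu> k t \<tau> r ctr_gen) (prs (range Ctr \<union> iC t)) = xt (iC t) (cf (tP \<nu> k t \<tau> r ctr_gen)) (prs (range Ctr))"
		using dis by (simp add: xt_def prs_union)
	ultimately show ?thesis unfolding tP_xt[OF assms deg1_ctr fr] cf_gse[OF deg1_ctr] by simp
qed

definition rad_along :: "(nat => nat => (int,'n::finite) vec) => (nat \<times> nat => real) => nat list => (real,'n) vec => (real,'n) vec" where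
	"rad_along k \<tau> p r = r + (\<Sum>(u, v)\<leftarrow>steps p. \<tau> (edge u v) *\<^sub>R rvec (k u v))"

definition gen_along :: "(nat => nat => (int,'n::{finite,linorder}) vec) => nat list =>
		('n gen => 'n mcoord gen ext) => 'n gen => 'n mcoord gen ext" where
	"gen_along k p \<theta> g S = \<theta> g S + (\<Sum>(u, v)\<leftarrow>steps p. of_int (k u v $ gidx g) * ggen (ptype g (edgc u v)) S)"

lemma steps_Cons: "q ~= [] ==> steps (l # q) = (l, hd q) # steps q" by (cases q) (simp_all add: steps_def)

lemma rad_along_Cons:
	"q ~= [] ==> rad_along k \<tau> (l # q) r = rad_along k \<tau> q (r + \<tau> (edge l (hd q)) *\<^sub>R rvec (k l (hd q)))"
	by (simp add: rad_along_def steps_Cons add.assoc)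

lemma gen_along_Cons:
	"q ~= [] ==> gen_along k (l # q) \<theta> = gen_along k q (shift_gen (k l (hd q)) (edgc l (hd q)) \<theta>)"
	by (intro ext) (simp add: gen_along_def steps_Cons shift_gen_def)

lemma along_single: "rad_along k \<tau> [l] r = r" "gen_along k [l] \<theta> = \<theta>"
	by (simp_all add: rad_along_def gen_along_def[abs_def] steps_def)

lemma prod_mset_sum_mset: "\<Prod>\<^sub># (image_mset f (\<Sum>\<^sub># N)) = \<Prod>\<^sub># (image_mset (%M. \<Prod>\<^sub># (image_mset f M)) N)"
	by (induction N) auto

text \<open>Links the recursion to evaluation maps defined by paths: a path into a child branch is
  the root followed by a path from the child, which is one step of accumulation.\<close>

lemma tP_vertices:
	fixes \<nu> :: "nat => 'n::{finite,linorder} gf"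
	assumes \<nu>: "!!v. v \<in> leaves G ==> \<nu> v = 1"
	shows "att G P t ==> set_rt t \<subseteq> verts G ==> deg1 \<theta> ==>
		tP \<nu> k t \<tau> r \<theta> = \<Prod>\<^sub># (image_mset (%v. gse (gen_along k (the_path (gr t) (lab t) v) \<theta>)
			(ev (\<nu> v) (rad_along k \<tau> (the_path (gr t) (lab t) v) r))) (labs t))"
proof (induction t arbitrary: P r \<theta>)
	case (Nd l ts)
	note a = Nd.prems(1) and \<theta> = Nd.prems(3)
	have d: "dstl (Nd l ts)" using a by (simp add: att_def)
	let ?F = "%t r \<theta> v. gse (gen_along k (the_path (gr t) (lab t) v) \<theta>) (ev (\<nu> v) (rad_along k \<tau> (the_path (gr t) (lab t) v) r))"
	let ?r = "%c. r + \<tau> (edge l (lab c)) *\<^sub>R rvec (k l (lab c))"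
	let ?\<theta> = "%c. shift_gen (k l (lab c)) (edgc l (lab c)) \<theta>"
	have kid: "(if kids c = {#} then 1 else tP \<nu> k c \<tau> (?r c) (?\<theta> c)) = \<Prod>\<^sub># (image_mset (?F (Nd l ts) r \<theta>) (labs c))" if c: "c \<in># ts" for c
	proof -
		have ac: "att G {l} c" by (rule att_child[OF a c])
		have Vc: "set_rt c \<subseteq> verts G" using set_rt_child[OF c, of l] Nd.prems(2) by blast
		\<comment> \<open>The form at an external vertex is \<open>1\<close>, so skipping external edges
		  in the recursion does not change the product.\<close>
		have "(if kids c = {#} then 1 else tP \<nu> k c \<tau> (?r c) (?\<theta> c)) = tP \<nu> k c \<tau> (?r c) (?\<theta> c)"
		proof (cases "kids c = {#}")
			case True
			have "valence G (lab c) = 1" using att_valence[OF ac] True by simp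
			hence "\<nu> (lab c) = 1" using \<nu> Vc lab_in_set_rt[of c] unfolding leaves_def by blast
			thus ?thesis using True by (cases c) (simp add: ev_simps gse_one deg1_shift[OF \<theta>])
		qed simp
		also have "... = \<Prod>\<^sub># (image_mset (?F c (?r c) (?\<theta> c)) (labs c))"
			by (rule Nd.IH[OF c ac Vc deg1_shift[OF \<theta>]])
		also have "image_mset (?F c (?r c) (?\<theta> c)) (labs c) = image_mset (?F (Nd l ts) r \<theta>) (labs c)"
		proof (rule image_mset_cong)
			fix v assume "v \<in># labs c"
			hence v: "v \<in> set_rt c" by (simp add: set_labs)
			have "is_path (gr c) (lab c) (the_path (gr c) (lab c) v) v"
				by (rule the_path_is_path) (use v dstl_child(1)[OF d c] in "auto intro: is_tree_gr")
			hence "the_path (gr c) (lab c) v ~= []" "hd (the_path (gr c) (lab c) v) = lab c" by (auto simp: is_path_def)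
			thus "?F c (?r c) (?\<theta> c) v = ?F (Nd l ts) r \<theta> v"
				using the_path_child[OF d c v] by (simp add: rad_along_Cons gen_along_Cons)
		qed
		finally show ?thesis .
	qed
	have "the_path (gr (Nd l ts)) l l = [l]" by (rule the_path_self) (use is_tree_gr[OF d] in auto)
	hence root: "?F (Nd l ts) r \<theta> l = gse \<theta> (ev (\<nu> l) r)" by (simp add: along_single)
	have "tP \<nu> k (Nd l ts) \<tau> r \<theta> = gse \<theta> (ev (\<nu> l) r) *
			\<Prod>\<^sub># (image_mset (%c. \<Prod>\<^sub># (image_mset (?F (Nd l ts) r \<theta>) (labs c))) ts)"
		unfolding tP.simps by (simp only: kid cong: image_mset_cong)
	also have "... = \<Prod>\<^sub># (image_mset (?F (Nd l ts) r \<theta>) (labs (Nd l ts)))"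
		unfolding labs.simps image_mset_add_mset prod_mset.add_mset root prod_mset_sum_mset multiset.map_comp o_def ..
	finally show ?case .
qed

lemma deg1_gen_along:
	assumes "deg1 \<theta>"
	shows "deg1 (gen_along k p \<theta>)" unfolding deg1_def
proof (intro allI impI)
	fix g S assume nz: "gen_along k p \<theta> g S ~= 0"
	show "card S = 1"
	proof (cases "\<theta> g S = 0")
		case True
		have "(\<Sum>(u, v)\<leftarrow>xs. of_int (k u v $ gidx g) * ggen (ptype g (edgc u v)) S) = (0::complex)" if "card S ~= 1" for xs
			using that by (induction xs) (auto simp: ggen_def)
		thus ?thesis using nz True unfolding gen_along_def by auto
	next case False
		thus ?thesis using assms by (simp add: deg1_def)
	qed
qed

subsection \<open>Internal edges\<close>

lemma iE_eq:
	"att G P t ==> set_rt t \<subseteq> verts G ==> iE t = {edge u v |u v. (u, v) \<in> ped t & v ~: leaves G}"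
proof (induction t arbitrary: P)
	case (Nd l ts)
	have leaf: "kids c = {#} \<longleftrightarrow> lab c \<in> leaves G" and IH: "iE c = {edge u v |u v. (u, v) \<in> ped c & v ~: leaves G}" if c: "c \<in># ts" for c
	proof -
		have ac: "att G {l} c" and Vc: "set_rt c \<subseteq> verts G"
			using att_child[OF Nd.prems(1) c] set_rt_child[OF c, of l] Nd.prems(2) by auto
		show "iE c = {edge u v |u v. (u, v) \<in> ped c & v ~: leaves G}" by (rule Nd.IH[OF c ac Vc])
		have "valence G (lab c) = size (kids c) + 1" using att_valence[OF ac] by simp
		thus "kids c = {#} \<longleftrightarrow> lab c \<in> leaves G" using Vc lab_in_set_rt[of c] by (auto simp: leaves_def)
	qed
	have empty: "iE c = {}" if "kids c = {#}" for c using that by (cases c) simp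
	have "iE (Nd l ts) = (\<Union>c\<in>set_mset ts. if lab c \<in> leaves G then iE c else insert (edge l (lab c)) (iE c))"
		by (simp only: iE.simps set_image_mset, rule SUP_cong) (use leaf empty in auto)
	also have "... = (\<Union>c\<in>set_mset ts. {edge u v |u v. (u, v) \<in> insert (l, lab c) (ped c) & v ~: leaves G})"
		by (rule SUP_cong) (use IH in auto)
	also have "... = {edge u v |u v. (u, v) \<in> ped (Nd l ts) & v ~: leaves G}" by auto
	finally show ?case .
qed

lemma parent_nonleaf:
	"att G P t ==> finite P ==> P ~= {} | lab t ~: leaves G ==> (u, v) \<in> ped t ==> u ~: leaves G"
proof (induction t arbitrary: P)
	case (Nd l ts)
	from Nd.prems(4) obtain c where c: "c \<in># ts" and uv: "(u, v) = (l, lab c) | (u, v) \<in> ped c" by auto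
	from uv show ?case
	proof
		assume "(u, v) \<in> ped c"
		thus ?thesis by (intro Nd.IH[OF c att_child[OF Nd.prems(1) c]]) auto
	next
		assume "(u, v) = (l, lab c)"
		moreover have "size ts ~= 0" using c by auto
		hence "l ~: leaves G" if "P ~= {}"
		proof -
			assume "size ts ~= 0"
			have "card P ~= 0" using that Nd.prems(2) by simp
			have "valence G l = size ts + card P" using att_valence[OF Nd.prems(1,2)] by simp
			hence "valence G l ~= 1" using `size ts ~= 0` `card P ~= 0` by linarith
			thus ?thesis unfolding leaves_def by blast
		qed
		ultimately show ?thesis using Nd.prems(3) by auto
	qed
qed

text \<open>As the root is internal, every parent is internal, so an edge is internal exactly when
  its child end is.\<close>

lemma internal_edges_rooted:
	assumes G: "is_tree G" and R: "R \<in> verts G" "R ~: leaves G"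
	shows "iE (rooted G R) = internal_edges G"
proof -
	let ?x = "rooted G R"
	note x = rooted[OF G R(1)]
	have a: "att G {} ?x" using att_gr[OF x(1)] unfolding x(2) .
	have V: "set_rt ?x = verts G" by (rule verts_rooted[OF G R(1)])
	have adj: "adj G = ped ?x \<union> (ped ?x)\<inverse>" using adj_gr[of ?x] unfolding x(2) .
	have pn: "u ~: leaves G" if "(u, v) \<in> ped ?x" for u v by (rule parent_nonleaf[OF a _ _ that]) (use x(3) R in auto)
	have irr: "u ~= v" if "(u, v) \<in> adj G" for u v using is_treeD(5)[OF G] that by (auto simp: irrefl_def)
	have "iE ?x = {edge u v |u v. (u, v) \<in> ped ?x & v ~: leaves G}" by (rule iE_eq[OF a]) (simp add: V)
	also have "... = internal_edges G"
	proof (intro equalityI subsetI)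
		fix e assume "e \<in> {edge u v |u v. (u, v) \<in> ped ?x & v ~: leaves G}"
		then obtain u v where uv: "e = edge u v" "(u, v) \<in> ped ?x" "v ~: leaves G" by blast
		have "u ~= v" using irr[of u v] uv(2) adj by auto
		thus "e \<in> internal_edges G" using uv pn[OF uv(2)] unfolding adj internal_edges_def by (auto simp: edge_def min_def)
	next
		fix e assume "e \<in> internal_edges G"
		then obtain u v where uv: "e = (u, v)" "(u, v) \<in> ped ?x \<union> (ped ?x)\<inverse>" "u < v" "u ~: leaves G" "v ~: leaves G"
			unfolding internal_edges_def adj by auto
		hence "e = edge u v" "e = edge v u" by (auto simp: edge_def)
		thus "e \<in> {edge u v |u v. (u, v) \<in> ped ?x & v ~: leaves G}" using uv by blast
	qed
	finally show ?thesis .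
qed

subsection \<open>Tropical integrals as traces\<close>

definition marked :: "'n::{finite,linorder} trop => nat => (nat => 'n form) => nat => 'n gf" where
	"marked T n \<gamma> v = (\<Prod>\<alpha>\<in>{\<alpha>\<in>{1..n}. mark T \<alpha> = v}. gform (\<gamma> \<alpha>))"

text \<open>Grouping the forms by the vertices of their marks gives the vertex product of
  \<open>tP_vertices\<close>. The orientation sign of the moduli space cancels the edge signs of
  \<open>tP_top\<close>.\<close>

lemma trop_integral_tr:
	fixes T :: "'n::{finite,linorder} trop"
	assumes G: "is_tree (tree T)" and R: "R \<in> verts (tree T)" "R ~: leaves (tree T)"
		and M: "!!\<alpha>. \<alpha> \<in> {1..n} ==> mark T \<alpha> \<in> verts (tree T) - leaves (tree T)"
		and \<gamma>: "!!\<alpha>. \<alpha> \<in> {1..n} ==> good (\<gamma> \<alpha>) & (\<exists>p. homogeneous p (\<gamma> \<alpha>) & even p)"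
	shows "trop_integral T R n \<gamma> = tr (tV (marked T n \<gamma>) (trop.flow T) (rooted (tree T) R))"
proof -
	let ?X = "%F r \<tau>. map (%\<alpha>. F r \<tau> (mark T \<alpha>) (gform (\<gamma> \<alpha>))) [1..<Suc n]"
	let ?x = "rooted (tree T) R" and ?\<nu> = "marked T n \<gamma>" and ?k = "trop.flow T"
	note x = rooted[OF G R(1)]
	have a: "att (tree T) {} ?x" using att_gr[OF x(1)] unfolding x(2) .
	have V: "set_rt ?x = verts (tree T)" by (rule verts_rooted[OF G R(1)])
	have I: "internal_edges (tree T) = iE ?x" by (rule internal_edges_rooted[OF G R, symmetric])
	have \<nu>1: "?\<nu> v = 1" if "v \<in> leaves (tree T)" for v
	proof -
		have "{\<alpha>\<in>{1..n}. mark T \<alpha> = v} = {}" using M that by blast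
		thus ?thesis by (simp only: marked_def prod.empty)
	qed
	define path where "path = the_path (tree T) R"
	have gens: "ev_gen T R \<alpha> = gen_along ?k (path (mark T \<alpha>)) ctr_gen" for \<alpha>
		by (intro ext) (simp add: ev_gen_def gen_along_def ctr_gen_def ptype_def edgc_def path_def Let_def split: gen.splits)
	have rad: "ev_rad T R \<alpha> r \<tau> = rad_along ?k \<tau> (path (mark T \<alpha>)) r" for \<alpha> r \<tau>
		by (simp add: ev_rad_def rad_along_def path_def)
	define F where "F r \<tau> v a = gse (gen_along ?k (path v) ctr_gen) (ev a (rad_along ?k \<tau> (path v) r))" for r \<tau> v a
	have Fprod: "F r \<tau> v (prod f A) = (\<Prod>a\<in>A. F r \<tau> v (f a))" for r \<tau> v and f :: "nat => 'n gf" and A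
		by (induction A rule: infinite_finite_induct)
			 (simp_all add: F_def ev_simps gse_mult gse_one deg1_gen_along deg1_ctr)
	have integrand: "gprod (map (%\<alpha>. ev_pullback T R \<alpha> (\<gamma> \<alpha>) r \<tau>) [1..<Suc n]) = cf (tP ?\<nu> ?k ?x \<tau> r ctr_gen)" for r \<tau>
	proof -
		have pb: "ev_pullback T R \<alpha> (\<gamma> \<alpha>) r \<tau> = cf (F r \<tau> (mark T \<alpha>) (gform (\<gamma> \<alpha>)))" if \<alpha>: "\<alpha> \<in> {1..n}" for \<alpha>
		proof -
			obtain p where "good (\<gamma> \<alpha>)" "homogeneous p (\<gamma> \<alpha>)" "even p" using \<gamma>[OF \<alpha>] by blast
			from cf_gform[OF this] show ?thesis unfolding F_def cf_gse[OF deg1_gen_along[OF deg1_ctr]] by (simp add: ev_pullback_def gens rad)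
		qed
		have "map (%\<alpha>. ev_pullback T R \<alpha> (\<gamma> \<alpha>) r \<tau>) [1..<Suc n] = map cf (?X F r \<tau>)"
			unfolding map_map comp_def by (rule map_cong) (auto intro: pb)
		hence "gprod (map (%\<alpha>. ev_pullback T R \<alpha> (\<gamma> \<alpha>) r \<tau>) [1..<Suc n]) =
				cf (prod_list (?X F r \<tau>))" by (simp only: gprod_cf)
		also have "prod_list (?X F r \<tau>) = (\<Prod>\<alpha>\<in>{1..n}. F r \<tau> (mark T \<alpha>) (gform (\<gamma> \<alpha>)))"
			by (simp add: prod.distinct_set_conv_list[symmetric] atLeastLessThanSuc_atLeastAtMost del: upt_Suc)
		also have "... = (\<Prod>v\<in>verts (tree T). \<Prod>\<alpha>\<in>{\<alpha>\<in>{1..n}. mark T \<alpha> = v}. F r \<tau> (mark T \<alpha>) (gform (\<gamma> \<alpha>)))"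
			by (rule prod.group[symmetric]) (use M is_treeD(1)[OF G] in auto)
		also have "... = (\<Prod>v\<in>verts (tree T). F r \<tau> v (?\<nu> v))" unfolding marked_def Fprod by (intro prod.cong refl) auto
		also have "... = \<Prod>\<^sub># (image_mset (%v. F r \<tau> v (?\<nu> v)) (labs ?x))"
			using x(1) unfolding dstl_iff V by (simp add: prod_unfold_prod_mset)
		also have "... = tP ?\<nu> ?k ?x \<tau> r ctr_gen"
			using tP_vertices[OF \<nu>1 a _ deg1_ctr, where k = ?k and \<tau> = \<tau> and r = r] unfolding V x(2,3) F_def path_def by simp
		finally show ?thesis .
	qed
	have gens_eq: "moduli_gens T = prs (range Ctr \<union> iC ?x)" unfolding moduli_gens_def Let_def prs_def iC_def I ..
	have "trop_integral T R n \<gamma> = (-1) ^ card (iE ?x) * (2 * of_real pi) ^ (CARD('n) + card (iE ?x)) *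
			(\<integral>(r, \<tau>). (-1) ^ card (iE ?x) * (of_bool (\<forall>e\<in>iE ?x. \<tau> e > 0) * cf (tA ?\<nu> ?k ?x \<tau> r) UNIV) \<partial>(lborel \<Otimes>\<^sub>M lbm (iE ?x)))"
		unfolding trop_integral_def Let_def I integrand gens_eq tP_top[OF x(1)] by (simp only: mult_ac)
	also have "... = ((-1) ^ card (iE ?x) * (-1) ^ card (iE ?x)) * ((2 * of_real pi) ^ (CARD('n) + card (iE ?x)) *
			(\<integral>(r, \<tau>). of_bool (\<forall>e\<in>iE ?x. \<tau> e > 0) * cf (tA ?\<nu> ?k ?x \<tau> r) UNIV \<partial>(lborel \<Otimes>\<^sub>M lbm (iE ?x))))"
		unfolding case_prod_unfold integral_mult_right_zero by (simp only: mult_ac)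
	also have "... = tr (tV ?\<nu> ?k ?x)" unfolding tr_tV[OF x(1)] by (simp flip: power_mult_distrib)
	finally show ?thesis .
qed

section \<open>Shapes of tropical types\<close>

primrec wfT :: "(int,'n::finite) vec set => 'n tl rt => bool" where
	"wfT B (Nd l ts) \<longleftrightarrow> (case l of Dv b => b \<in> B & ts = {#} | Mk i => size ts = 1 | In => size ts = 2) &
		 (\<forall>w\<in>#image_mset (wfT B) ts. w)"

text \<open>By balancing, the vector of the edge above a branch is the sum of its external vectors;
  so this is the condition that internal edges have nonzero vectors.\<close>

primrec nzT :: "'n::finite tl rt => bool" where
	"nzT (Nd l ts) \<longleftrightarrow> (\<forall>w\<in>#image_mset (%c. nzT c & (kids c = {#} | sum_mset (dvs c) ~= 0)) ts. w)"

text \<open>Value of a branch including the edge above it: \<open>1\<close> for an external edge,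
  otherwise a propagator along the sum of the external vectors.\<close>

primrec tv :: "(nat => 'n::{finite,linorder} gf) => 'n tl rt => 'n gf" where
	"tv g (Nd l ts) = (case l of Dv b => 1 |
		 _ => kap (sum_mset (\<Sum>\<^sub># (image_mset dvs ts))) ((case l of Mk i => g i | _ => 1) * \<Prod>\<^sub># (image_mset (tv g) ts)))"

text \<open>A leaf has exactly one neighbour, so the choice in the first case is forced.\<close>

definition tlab :: "nat => 'n::finite trop => nat => 'n tl" where
	"tlab n T v = (if v \<in> leaves (tree T) then Dv (trop.flow T v (SOME u. (v, u) \<in> adj (tree T)))
		 else if valence (tree T) v = 2 then Mk (the_inv_into {1..n} (mark T) v) else In)"

abbreviation "tmap n T \<equiv> map_rt (tlab n T)"

definition shape :: "nat => 'n::finite trop => 'n tl rt" where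
	"shape n T = tmap n T (rooted (tree T) (mark T 1))"

text \<open>Shapes of types with \<open>n\<close> marked points and external edge vectors \<open>M\<close>, rooted at the first mark.\<close>

definition shapes :: "(int,'n::finite) vec set => nat => (int,'n) vec multiset => 'n tl rt set" where
	"shapes B n M = {Nd (Mk 1) ts |ts. size ts = 2 & (\<forall>c\<in>#ts. wfT B c) &
		 \<Sum>\<^sub># (image_mset mk ts) = mset_set {2..n} & \<Sum>\<^sub># (image_mset dvs ts) = M}"

lemma sum_mset_Union: "sum_mset (\<Sum>\<^sub># N) = \<Sum>\<^sub># (image_mset sum_mset N)" by (induction N) auto

lemma sum_kids:
	fixes g :: "nat => 'a::comm_monoid_add"
	assumes "dstl (Nd l ts)"
	shows "(\<Sum>u\<in>lab ` set_mset ts. g u) = \<Sum>\<^sub># (image_mset (%c. g (lab c)) ts)"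
proof -
	have "(\<Sum>u\<in>lab ` set_mset ts. g u) = \<Sum>\<^sub># (image_mset g (image_mset lab ts))"
		unfolding dstl_kids_lab(1)[OF assms, symmetric] by (simp add: sum_unfold_sum_mset)
	thus ?thesis by (simp add: multiset.map_comp o_def)
qed

locale trop_tree =
	fixes B :: "(int,'n::{finite,linorder}) vec set" and n :: nat and T :: "'n trop"
	assumes T: "trop_type B n T" and n1: "1 \<le> n"
begin

abbreviation "G \<equiv> tree T"

lemma G: "is_tree G" using T by (simp add: trop_type_def)

lemma val: "v \<in> verts G ==> valence G v \<in> {1, 2, 3}" using T by (simp add: trop_type_def)

lemma marks: "bij_betw (mark T) {1..n} {v \<in> verts G. valence G v = 2}" using T by (simp add: trop_type_def)

lemma antisym: "(u, v) \<in> adj G ==> trop.flow T v u = - trop.flow T u v" using T by (auto simp: trop_type_def)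

lemma leaf_flow: "(u, v) \<in> adj G ==> u \<in> leaves G ==> trop.flow T u v \<in> B"
	using T by (auto simp: trop_type_def)

lemma internal_flow: "(u, v) \<in> adj G ==> u ~: leaves G ==> v ~: leaves G ==> trop.flow T u v ~= 0"
proof -
	assume a: "(u, v) \<in> adj G" "u ~: leaves G" "v ~: leaves G"
	have i: "trop.flow T u v ~= 0" if "(u, v) \<in> internal_edges G" for u v using T that by (auto simp: trop_type_def)
	have "u ~= v" using is_treeD(5)[OF G] a(1) by (auto simp: irrefl_def)
	moreover have "(v, u) \<in> adj G" using is_treeD(4)[OF G] a(1) by (auto simp: sym_def)
	ultimately show ?thesis using i[of u v] i[of v u] a antisym[OF a(1)] by (cases "u < v") (auto simp: internal_edges_def)
qed

lemma balance: "v \<in> verts G ==> v ~: leaves G ==> (\<Sum>u\<in>nbrs G v. trop.flow T u v) = 0"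
	using T by (simp add: trop_type_def)

lemma mark_in: "\<alpha> \<in> {1..n} ==> mark T \<alpha> \<in> verts G & valence G (mark T \<alpha>) = 2"
	using bij_betwE[OF marks] by blast

lemma mark_nonleaf: "\<alpha> \<in> {1..n} ==> mark T \<alpha> \<in> verts G - leaves G"
	using mark_in by (auto simp: leaves_def)

lemma tlab_mark: "\<alpha> \<in> {1..n} ==> tlab n T (mark T \<alpha>) = Mk \<alpha>"
	using mark_in[of \<alpha>] mark_nonleaf[of \<alpha>] the_inv_into_f_f[OF bij_betw_imp_inj_on[OF marks], of \<alpha>] by (simp add: tlab_def)

lemma tlab_Mk:
	assumes "v \<in> verts G" "tlab n T v = Mk i"
	shows "i \<in> {1..n} & mark T i = v"
proof -
	have v: "valence G v = 2" "i = the_inv_into {1..n} (mark T) v" using assms(2) by (auto simp: tlab_def split: if_splits)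
	have "v \<in> mark T ` {1..n}" using marks v(1) assms(1) by (auto simp: bij_betw_def)
	thus ?thesis
		unfolding v(2) using the_inv_into_into[OF bij_betw_imp_inj_on[OF marks] _ order_refl] f_the_inv_into_f[OF bij_betw_imp_inj_on[OF marks]]
		by blast
qed

lemma tlab_leaf: "v \<in> leaves G ==> nbrs G v = {p} ==> tlab n T v = Dv (trop.flow T v p)"
proof -
	assume v: "v \<in> leaves G" "nbrs G v = {p}"
	have "(v, u) \<in> adj G \<longleftrightarrow> u = p" for u using v(2) is_treeD(4)[OF G] by (auto simp: nbrs_def sym_def)
	thus ?thesis using v(1) by (simp add: tlab_def)
qed

lemma dvl_tlab: "v ~: leaves G ==> dvl (tlab n T v) = {#}" by (simp add: tlab_def)

text \<open>Balancing is applied from the leaves towards \<open>p\<close>: what flows out of a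
  branch is what enters through its external edges.\<close>

lemma branch_shape:
	"att G {p} t ==> set_rt t \<subseteq> verts G ==>
		wfT B (tmap n T t) & trop.flow T (lab t) p = sum_mset (dvs (tmap n T t))"
proof (induction t arbitrary: p)
	case (Nd v ts)
	have v: "v \<in> verts G" using Nd.prems(2) by auto
	have d: "dstl (Nd v ts)" using Nd.prems(1) by (simp add: att_def)
	have vv: "valence G v = size ts + 1" using att_valence[OF Nd.prems(1)] by simp
	have nb: "nbrs G v = lab ` set_mset ts \<union> {p}" using att_root[OF Nd.prems(1)] by simp
	have IH: "wfT B (tmap n T c)" "trop.flow T (lab c) v = sum_mset (dvs (tmap n T c))" if c: "c \<in># ts" for c
		using Nd.IH[OF c att_child[OF Nd.prems(1) c]] set_rt_child[OF c, of v] Nd.prems(2) by auto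
	have adj: "(u, v) \<in> adj G" "(v, u) \<in> adj G" if "u \<in> nbrs G v" for u
		using that is_treeD(4)[OF G] by (auto simp: nbrs_def sym_def)
	show ?case
	proof (cases "v \<in> leaves G")
		case True
		hence "ts = {#}" using vv by (simp add: leaves_def)
		moreover from this have "tlab n T v = Dv (trop.flow T v p)" by (intro tlab_leaf[OF True]) (simp add: nb)
		moreover have "trop.flow T v p \<in> B" by (rule leaf_flow[OF _ True]) (simp add: adj nb)
		ultimately show ?thesis by (simp add: dvs_Nd)
	next case False
		have "valence G v \<in> {2, 3}" using val[OF v] False v by (auto simp: leaves_def)
		hence sz: "size ts = 1 & valence G v = 2 | size ts = 2 & valence G v = 3" using vv by auto
		have "wfT B (tmap n T (Nd v ts))" using sz IH(1) False by (auto simp: tlab_def[of n T v])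
		moreover have "trop.flow T v p = sum_mset (dvs (tmap n T (Nd v ts)))"
		proof -
			have "p ~: lab ` set_mset ts" using Nd.prems(1) set_rt_child[of _ ts v] lab_in_set_rt unfolding att_def by fastforce
			hence "trop.flow T p v = - (\<Sum>u\<in>lab ` set_mset ts. trop.flow T u v)"
				using balance[OF v False] unfolding nb by (simp add: add_eq_0_iff)
			moreover have "trop.flow T v p = - trop.flow T p v" by (rule antisym[OF adj(1)]) (simp add: nb)
			ultimately have "trop.flow T v p = (\<Sum>u\<in>lab ` set_mset ts. trop.flow T u v)" by simp
			also have "... = \<Sum>\<^sub># (image_mset (%c. sum_mset (dvs (tmap n T c))) ts)"
				unfolding sum_kids[OF d] by (intro arg_cong[of _ _ sum_mset] image_mset_cong IH(2))
			also have "... = sum_mset (dvs (tmap n T (Nd v ts)))"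
				by (simp add: dvs_Nd dvl_tlab[OF False] sum_mset_Union multiset.map_comp o_def)
			finally show ?thesis .
		qed
		ultimately show ?thesis by simp
	qed
qed

lemma kid_nz:
	assumes a: "att G P (Nd v ts)" "set_rt (Nd v ts) \<subseteq> verts G" "v ~: leaves G" and c: "c \<in># ts"
	shows "kids (tmap n T c) = {#} | sum_mset (dvs (tmap n T c)) ~= 0"
proof (cases "lab c \<in> leaves G")
	case True
	hence "size (kids c) = 0" using att_valence[OF att_child[OF a(1) c]] by (simp add: leaves_def)
	thus ?thesis by (cases c) simp
next case False
	have Vc: "set_rt c \<subseteq> verts G" using set_rt_child[OF c, of v] a(2) by blast
	have "lab c \<in> nbrs G v" using att_root[OF a(1)] c by auto
	hence "trop.flow T (lab c) v ~= 0" using internal_flow[OF _ False a(3)] by (simp add: nbrs_def)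
	thus ?thesis using branch_shape[OF att_child[OF a(1) c] Vc] by simp
qed

lemma branch_nz: "att G {p} t ==> set_rt t \<subseteq> verts G ==> nzT (tmap n T t)"
proof (induction t arbitrary: p)
	case (Nd v ts)
	have "nzT (tmap n T c) & (kids (tmap n T c) = {#} | sum_mset (dvs (tmap n T c)) ~= 0)" if c: "c \<in># ts" for c
	proof
		have "valence G v = size ts + 1" "size ts ~= 0" using att_valence[OF Nd.prems(1)] c by auto
		hence "v ~: leaves G" by (auto simp: leaves_def)
		thus "kids (tmap n T c) = {#} | sum_mset (dvs (tmap n T c)) ~= 0" by (rule kid_nz[OF Nd.prems _ c])
		show "nzT (tmap n T c)" by (rule Nd.IH[OF c att_child[OF Nd.prems(1) c]]) (use set_rt_child[OF c, of v] Nd.prems(2) in blast)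
	qed
	thus ?case by auto
qed

end

context trop_tree
begin

abbreviation "x \<equiv> rooted G (mark T 1)"

lemma root_in: "mark T 1 \<in> verts G" "mark T 1 ~: leaves G" "valence G (mark T 1) = 2"
	using mark_in[of 1] mark_nonleaf[of 1] n1 by auto

lemmas x = rooted[OF G root_in(1)]

lemma att_x: "att G {} x" using att_gr[OF x(1)] unfolding x(2) .

lemma verts_x: "set_rt x = verts G" by (rule verts_rooted[OF G root_in(1)])

lemma labs_x: "labs x = mset_set (verts G)" using x(1) unfolding dstl_iff verts_x .

lemma mk_shape: "mk (shape n T) = mset_set {1..n}"
proof -
	let ?V = "{v \<in> verts G. valence G v = 2}" and ?i = "the_inv_into {1..n} (mark T)"
	have b: "bij_betw ?i ?V {1..n}" by (rule bij_betw_the_inv_into[OF marks])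
	have "mk (shape n T) = (\<Sum>v\<in>verts G. mkl (tlab n T v))"
		unfolding shape_def mk_def labs_map labs_x by (simp add: multiset.map_comp o_def sum_unfold_sum_mset)
	also have "... = (\<Sum>v\<in>?V. {#?i v#})" by (rule sum.mono_neutral_cong_right) (auto simp: is_treeD(1)[OF G] tlab_def leaves_def)
	also have "... = image_mset ?i (mset_set ?V)" by (simp add: sum_unfold_sum_mset)
	also have "... = mset_set (?i ` ?V)" by (rule image_mset_mset_set[OF bij_betw_imp_inj_on[OF b]])
	finally show ?thesis using b by (simp add: bij_betw_def)
qed

lemma dvs_shape: "dvs (shape n T) = image_mset (%v. trop.flow T v (SOME u. (v, u) \<in> adj G)) (mset_set (leaves G))"
proof -
	have "dvs (shape n T) = (\<Sum>v\<in>verts G. dvl (tlab n T v))"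
		unfolding shape_def dvs_def labs_map labs_x by (simp add: multiset.map_comp o_def sum_unfold_sum_mset)
	also have "... = (\<Sum>v\<in>leaves G. {#trop.flow T v (SOME u. (v, u) \<in> adj G)#})"
		by (rule sum.mono_neutral_cong_right) (auto simp: is_treeD(1)[OF G] tlab_def leaves_def)
	finally show ?thesis by (simp add: sum_unfold_sum_mset)
qed

lemma degree_count: "card {(u, v) \<in> adj G. u \<in> leaves G & trop.flow T u v = b} = count (dvs (shape n T)) b"
proof -
	let ?nb = "%v. SOME u. (v, u) \<in> adj G" and ?L = "{v \<in> leaves G. trop.flow T v (SOME u. (v, u) \<in> adj G) = b}"
	have nb: "(v, u) \<in> adj G \<longleftrightarrow> u = ?nb v" if v: "v \<in> leaves G" for u v
	proof -
		obtain p where p: "nbrs G v = {p}" using v by (auto simp: leaves_def valence_def card_1_singleton_iff)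
		have "(v, u) \<in> adj G \<longleftrightarrow> u = p" for u using p is_treeD(4)[OF G] by (auto simp: nbrs_def sym_def)
		thus ?thesis by simp
	qed
	have eq: "{(u, v) \<in> adj G. u \<in> leaves G & trop.flow T u v = b} = (%v. (v, ?nb v)) ` ?L"
	proof (intro equalityI subsetI)
		fix e assume "e \<in> {(u, v) \<in> adj G. u \<in> leaves G & trop.flow T u v = b}"
		then obtain u v where e: "e = (u, v)" "(u, v) \<in> adj G" "u \<in> leaves G" "trop.flow T u v = b" by blast
		have "v = ?nb u" using nb[OF e(3)] e(2) by blast
		thus "e \<in> (%v. (v, ?nb v)) ` ?L" using e by blast
	next
		fix e assume "e \<in> (%v. (v, ?nb v)) ` ?L"
		then obtain v where "v \<in> leaves G" "trop.flow T v (?nb v) = b" "e = (v, ?nb v)" by blast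
		moreover from this have "(v, ?nb v) \<in> adj G" using nb by blast
		ultimately show "e \<in> {(u, v) \<in> adj G. u \<in> leaves G & trop.flow T u v = b}" by blast
	qed
	have fin: "finite (leaves G)" using is_treeD(1)[OF G] by (simp add: leaves_def)
	have "{x. x \<in># mset_set (leaves G) & b = trop.flow T x (?nb x)} = ?L" using fin by auto
	hence "count (dvs (shape n T)) b = (\<Sum>x\<in>?L. count (mset_set (leaves G)) x)"
		unfolding dvs_shape count_image_mset' by (rule sum.cong) simp
	also have "... = card ?L" using fin by simp
	also have "... = card ((%v. (v, ?nb v)) ` ?L)" by (rule card_image[symmetric]) (rule inj_onI, blast)
	finally show ?thesis unfolding eq ..
qed

lemma shape_root:
	obtains ts where "x = Nd (mark T 1) ts" "size ts = 2" "shape n T = Nd (Mk 1) (image_mset (tmap n T) ts)"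
		"\<forall>c\<in>#ts. att G {mark T 1} c & set_rt c \<subseteq> verts G"
proof -
	obtain ts where ts: "x = Nd (mark T 1) ts" using x(3) by (cases x) auto
	have "size ts = 2" using att_valence[OF att_x] root_in(3) unfolding ts by simp
	moreover have "shape n T = Nd (Mk 1) (image_mset (tmap n T) ts)" unfolding shape_def ts rt.map using tlab_mark[of 1] n1 by simp
	moreover have "att G {mark T 1} c & set_rt c \<subseteq> verts G" if "c \<in># ts" for c
		using att_child[OF att_x[unfolded ts] that] set_rt_child[OF that, of "mark T 1"] verts_x unfolding ts by blast
	ultimately show thesis using ts by (intro that) auto
qed

lemma shape_in: "shape n T \<in> shapes B n (dvs (shape n T))" "nzT (shape n T)" "sum_mset (dvs (shape n T)) = 0"
proof -
	obtain ts where ts: "x = Nd (mark T 1) ts" "size ts = 2" "shape n T = Nd (Mk 1) (image_mset (tmap n T) ts)"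
		"\<forall>c\<in>#ts. att G {mark T 1} c & set_rt c \<subseteq> verts G" by (rule shape_root)
	have d: "dstl (Nd (mark T 1) ts)" using x(1) unfolding ts(1) .
	have b: "wfT B (tmap n T c)" "trop.flow T (lab c) (mark T 1) = sum_mset (dvs (tmap n T c))" if "c \<in># ts" for c
		using branch_shape[of "mark T 1" c] ts(4) that by auto
	have "{1..n} = insert 1 {2..n}" using n1 by auto
	hence "\<Sum>\<^sub># (image_mset mk (image_mset (tmap n T) ts)) = mset_set {2..n}" using mk_shape unfolding ts(3) mk_Nd by simp
	thus "shape n T \<in> shapes B n (dvs (shape n T))" unfolding shapes_def ts(3) using b(1) ts(2) by (auto simp: dvs_Nd)
	have "nzT (tmap n T c) & (kids (tmap n T c) = {#} | sum_mset (dvs (tmap n T c)) ~= 0)" if c: "c \<in># ts" for c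
		using branch_nz[of "mark T 1" c] ts(4) c kid_nz[OF att_x[unfolded ts(1)] eq_refl[OF verts_x[unfolded ts(1)]] root_in(2) c] by simp
	thus "nzT (shape n T)" unfolding ts(3) by auto
	have "nbrs G (mark T 1) = lab ` set_mset ts" using att_root[OF att_x] unfolding ts(1) by simp
	hence "0 = (\<Sum>u\<in>lab ` set_mset ts. trop.flow T u (mark T 1))" using balance[OF root_in(1,2)] by simp
	also have "... = \<Sum>\<^sub># (image_mset (%c. sum_mset (dvs (tmap n T c))) ts)"
		unfolding sum_kids[OF d] by (intro arg_cong[of _ _ sum_mset] image_mset_cong b(2))
	also have "... = sum_mset (dvs (shape n T))" by (simp add: ts(3) dvs_Nd sum_mset_Union multiset.map_comp o_def)
	finally show "sum_mset (dvs (shape n T)) = 0" ..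
qed

lemma marked_tlab:
	assumes "v \<in> verts G" "v ~: leaves G"
	shows "marked T n \<gamma> v = (case tlab n T v of Mk i => gform (\<gamma> i) | _ => 1)"
proof (cases "tlab n T v")
	case (Mk i)
	hence i: "i \<in> {1..n}" "mark T i = v" using tlab_Mk[OF assms(1)] by auto
	hence "{\<alpha>\<in>{1..n}. mark T \<alpha> = v} = {i}" using inj_on_eq_iff[OF bij_betw_imp_inj_on[OF marks]] by blast
	thus ?thesis by (simp only: marked_def Mk) simp
next case (Dv b)
	thus ?thesis using assms(2) by (auto simp: tlab_def split: if_splits)
next case In
	hence "{\<alpha>\<in>{1..n}. mark T \<alpha> = v} = {}" using tlab_mark by fastforce
	thus ?thesis by (simp only: marked_def In) simp
qed

lemma branch_value:
	"att G {p} t ==> set_rt t \<subseteq> verts G ==>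
		(if kids t = {#} then 1 else kap (trop.flow T (lab t) p) (tV (marked T n \<gamma>) (trop.flow T) t)) =
		tv (%i. gform (\<gamma> i)) (tmap n T t)"
proof (induction t arbitrary: p)
	case (Nd v ts)
	have v: "v \<in> verts G" using Nd.prems(2) by auto
	have vv: "valence G v = size ts + 1" using att_valence[OF Nd.prems(1)] by simp
	let ?g = "%i. gform (\<gamma> i)"
	show ?case
	proof (cases "ts = {#}")
		case True
		hence "v \<in> leaves G" using vv v by (simp add: leaves_def)
		thus ?thesis using True by (simp add: tlab_def)
	next case False
		hence vl: "v ~: leaves G" using vv by (auto simp: leaves_def)
		have kid: "(if kids c = {#} then 1 else kap (- trop.flow T v (lab c)) (tV (marked T n \<gamma>) (trop.flow T) c)) = tv ?g (tmap n T c)"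
			if c: "c \<in># ts" for c
		proof -
			have "lab c \<in> nbrs G v" using att_root[OF Nd.prems(1)] c by auto
			hence "trop.flow T v (lab c) = - trop.flow T (lab c) v" by (intro antisym) (simp add: nbrs_def)
			moreover have "set_rt c \<subseteq> verts G" using set_rt_child[OF c, of v] Nd.prems(2) by blast
			ultimately show ?thesis using Nd.IH[OF c att_child[OF Nd.prems(1) c]] by (simp split: if_splits)
		qed
		have "tV (marked T n \<gamma>) (trop.flow T) (Nd v ts) = marked T n \<gamma> v * \<Prod>\<^sub># (image_mset (%c. tv ?g (tmap n T c)) ts)"
			unfolding tV.simps by (simp only: kid cong: image_mset_cong)
		moreover have "trop.flow T v p = sum_mset (\<Sum>\<^sub># (image_mset dvs (image_mset (tmap n T) ts)))"
			using branch_shape[OF Nd.prems] by (simp add: dvs_Nd dvl_tlab[OF vl] multiset.map_comp o_def)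
		moreover have "tlab n T v ~= Dv b" for b using vl by (simp add: tlab_def)
		ultimately show ?thesis using False marked_tlab[OF v vl, of \<gamma>] by (cases "tlab n T v") (auto simp: multiset.map_comp o_def)
	qed
qed

text \<open>When the root crosses an internal edge, \<open>tr_kap\<close> moves the propagator to
  the other factor and reverses its vector. So every sink gives the value rooted at the first
  mark.\<close>

lemma integral_mark:
	assumes \<gamma>: "!!\<alpha>. \<alpha> \<in> {1..n} ==> good (\<gamma> \<alpha>) & (\<exists>p. homogeneous p (\<gamma> \<alpha>) & even p)" and R: "R \<in> verts G" "R ~: leaves G"
	shows "trop_integral T R n \<gamma> = tr (tV (marked T n \<gamma>) (trop.flow T) x)"
proof -
	let ?V = "tV (marked T n \<gamma>) (trop.flow T)"
	have "tr (?V (rooted G R)) = tr (?V x)"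
	proof (rule nonleaf_constant[OF G R root_in(1,2)])
		fix u v assume uv: "(u, v) \<in> adj G" "u ~: leaves G" "v ~: leaves G"
		have V: "u \<in> verts G" "v \<in> verts G" using uv(1) is_treeD(3)[OF G] by auto
		note ru = rooted[OF G V(1)]
		have "(lab (rooted G u), v) \<in> adj (gr (rooted G u))" unfolding ru by (rule uv(1))
		then obtain us ts where "rooted G u = Nd (lab (rooted G u)) (add_mset (Nd v us) ts)" by (rule tree_neighbour[OF ru(1)])
		note u = this[unfolded ru(3)]
		note rr = reroot[OF ru(1)[unfolded u]]
		have v: "rooted G v = Nd v (add_mset (Nd u ts) us)" by (rule rooted_eqI[OF rr(1)]) (simp_all only: rr(2) u[symmetric] ru(2) rt.sel)
		have au: "att G {} (rooted G u)" and av: "att G {} (rooted G v)"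
			using att_gr[OF ru(1)] att_gr[OF rooted(1)[OF G V(2)]] unfolding ru(2) rooted(2)[OF G V(2)] by auto
		have "size us + 1 = valence G v" "size ts + 1 = valence G u" using att_valence[OF av] att_valence[OF au] unfolding u v by simp_all
		hence ne: "us ~= {#}" "ts ~= {#}" using uv(2,3) V by (auto simp: leaves_def)
		have "tr (?V (rooted G u)) = tr (?V (Nd u ts) * kap (- trop.flow T u v) (?V (Nd v us)))"
			unfolding u tV_add using ne by (simp add: mult.commute)
		also have "... = tr (kap (trop.flow T u v) (?V (Nd u ts)) * ?V (Nd v us))"
			using tr_kap[of "?V (Nd u ts)" "- trop.flow T u v" "?V (Nd v us)"] by simp
		also have "... = tr (?V (rooted G v))" unfolding v tV_add using ne antisym[OF uv(1)] by simp
		finally show "tr (?V (rooted G u)) = tr (?V (rooted G v))" .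
	qed
	moreover have "trop_integral T R n \<gamma> = tr (?V (rooted G R))" by (rule trop_integral_tr[OF G R mark_nonleaf \<gamma>])
	ultimately show ?thesis by simp
qed

lemma integral_shape:
	assumes \<gamma>: "!!\<alpha>. \<alpha> \<in> {1..n} ==> good (\<gamma> \<alpha>) & (\<exists>p. homogeneous p (\<gamma> \<alpha>) & even p)"
	shows "trop_integral T (trop_sink T) n \<gamma> =
		tr (gform (\<gamma> 1) * \<Prod>\<^sub># (image_mset (tv (%i. gform (\<gamma> i))) (kids (shape n T))))"
proof -
	have "trop_sink T \<in> verts G & trop_sink T ~: leaves G"
		unfolding trop_sink_def by (rule someI[of _ "mark T 1"]) (use root_in in auto)
	hence sink: "trop_integral T (trop_sink T) n \<gamma> = tr (tV (marked T n \<gamma>) (trop.flow T) x)"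
		by (intro integral_mark[OF \<gamma>]) auto
	obtain ts where ts: "x = Nd (mark T 1) ts" "shape n T = Nd (Mk 1) (image_mset (tmap n T) ts)"
		"\<forall>c\<in>#ts. att G {mark T 1} c & set_rt c \<subseteq> verts G" by (rule shape_root)
	let ?r = "mark T 1" and ?g = "%i. gform (\<gamma> i)"
	have kid: "(if kids c = {#} then 1 else kap (- trop.flow T ?r (lab c)) (tV (marked T n \<gamma>) (trop.flow T) c)) = tv ?g (tmap n T c)"
		if c: "c \<in># ts" for c
	proof -
		have "lab c \<in> nbrs G ?r" using att_root[OF att_x] c unfolding ts(1) by auto
		hence "trop.flow T ?r (lab c) = - trop.flow T (lab c) ?r" by (intro antisym) (simp add: nbrs_def)
		thus ?thesis using branch_value[of ?r c \<gamma>] ts(3) c by (simp del: One_nat_def split: if_splits)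
	qed
	have "tV (marked T n \<gamma>) (trop.flow T) x = marked T n \<gamma> ?r * \<Prod>\<^sub># (image_mset (%c. tv ?g (tmap n T c)) ts)"
		unfolding ts(1) tV.simps by (simp only: kid cong: image_mset_cong)
	also have "marked T n \<gamma> ?r = gform (\<gamma> 1)" using marked_tlab[OF root_in(1,2), of \<gamma>] tlab_mark[of 1] n1 by simp
	finally show ?thesis unfolding sink ts(2) by (simp add: multiset.map_comp o_def)
qed

end

text \<open>Labels determine the flow, since each edge vector is the sum of the external vectors
  beyond the edge; so an isomorphism that preserves labels preserves the flow. Conversely, flow and
  marks determine the labels.\<close>

lemma shape_iso_iff:
	assumes S: "trop_tree B n S" and T: "trop_tree B n T"
	shows "shape n S = shape n T \<longleftrightarrow> (\<exists>f. graph_iso f (tree S) (tree T) & (\<forall>\<alpha>\<in>{1..n}. f (mark S \<alpha>) = mark T \<alpha>) &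
		(\<forall>(u, v)\<in>adj (tree S). trop.flow T (f u) (f v) = trop.flow S u v))"
proof -
	interpret S: trop_tree B n S by (rule S)
	interpret T: trop_tree B n T by (rule T)
	have eq: "shape n S = shape n T \<longleftrightarrow> (\<exists>f. graph_iso f (tree S) (tree T) & f (mark S 1) = mark T 1 &
			(\<forall>v\<in>verts (tree S). tlab n T (f v) = tlab n S v))"
		unfolding shape_def by (rule shape_eq_iff[OF S.G T.G S.root_in(1) T.root_in(1)])
	show ?thesis
	proof
		assume "shape n S = shape n T"
		then obtain f where f: "graph_iso f (tree S) (tree T)" "f (mark S 1) = mark T 1"
				"!!v. v \<in> verts (tree S) ==> tlab n T (f v) = tlab n S v" unfolding eq by blast
		have fV: "f v \<in> verts (tree T)" if "v \<in> verts (tree S)" for v by (rule iso_verts[OF f(1) that])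
		have marks: "f (mark S \<alpha>) = mark T \<alpha>" if "\<alpha> \<in> {1..n}" for \<alpha>
		proof -
			have v: "mark S \<alpha> \<in> verts (tree S)" using S.mark_in[OF that] by blast
			show ?thesis using T.tlab_Mk[OF fV[OF v], of \<alpha>] f(3)[OF v] S.tlab_mark[OF that] by simp
		qed
		have fl: "att (tree S) P t ==> set_rt t \<subseteq> verts (tree S) ==> att (tree T) P' (map_rt f t) ==>
				(u, v) \<in> ped t ==> trop.flow T (f v) (f u) = trop.flow S v u" for P P' t u v
		proof (induction t arbitrary: P P')
			case (Nd l ts)
			from Nd.prems(4) obtain c where c: "c \<in># ts" and uv: "(u, v) = (l, lab c) | (u, v) \<in> ped c" by auto
			have Vc: "set_rt c \<subseteq> verts (tree S)" using set_rt_child[OF c, of l] Nd.prems(2) by blast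
			have aS: "att (tree S) {l} c" by (rule att_child[OF Nd.prems(1) c])
			have aT: "att (tree T) {f l} (map_rt f c)" by (rule att_child[OF Nd.prems(3)[unfolded rt.map]]) (use c in simp)
			from uv show ?case
			proof
				assume "(u, v) \<in> ped c"
				thus ?thesis by (rule Nd.IH[OF c aS Vc aT])
			next
				assume uv: "(u, v) = (l, lab c)"
				have "set_rt (map_rt f c) \<subseteq> verts (tree T)" using Vc fV by (auto simp: rt.set_map)
				hence "trop.flow T (f (lab c)) (f l) = sum_mset (dvs (tmap n T (map_rt f c)))" using T.branch_shape[OF aT] by simp
				also have "tmap n T (map_rt f c) = map_rt (tlab n S) c" unfolding rt.map_comp by (rule map_rt_cong_on) (use f(3) Vc in auto)
				also have "sum_mset (dvs (map_rt (tlab n S) c)) = trop.flow S (lab c) l" using S.branch_shape[OF aS Vc] by simp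
				finally show ?thesis using uv by simp
			qed
		qed
		have "att (tree T) {} (map_rt f S.x)" unfolding map_rooted[OF f(1) S.G T.G S.root_in(1)] f(2) by (rule T.att_x)
		note fl' = fl[OF S.att_x eq_refl[OF S.verts_x] this]
		have "trop.flow T (f u) (f v) = trop.flow S u v" if uv: "(u, v) \<in> adj (tree S)" for u v
		proof -
			have "(u, v) \<in> ped S.x | (v, u) \<in> ped S.x" using uv adj_gr[of S.x] unfolding S.x(2) by auto
			thus ?thesis
			proof
				assume p: "(u, v) \<in> ped S.x"
				have "(f u, f v) \<in> adj (tree T)" using f(1) uv is_treeD(3)[OF S.G] unfolding graph_iso_def by blast
				thus ?thesis using fl'[OF p] S.antisym[OF uv] T.antisym[of "f u" "f v"] by simp
			qed (rule fl')
		qed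
		thus "\<exists>f. graph_iso f (tree S) (tree T) & (\<forall>\<alpha>\<in>{1..n}. f (mark S \<alpha>) = mark T \<alpha>) &
				(\<forall>(u, v)\<in>adj (tree S). trop.flow T (f u) (f v) = trop.flow S u v)" using f(1) marks by blast
	next
		assume "\<exists>f. graph_iso f (tree S) (tree T) & (\<forall>\<alpha>\<in>{1..n}. f (mark S \<alpha>) = mark T \<alpha>) &
				(\<forall>(u, v)\<in>adj (tree S). trop.flow T (f u) (f v) = trop.flow S u v)"
		then obtain f where f: "graph_iso f (tree S) (tree T)" "\<forall>\<alpha>\<in>{1..n}. f (mark S \<alpha>) = mark T \<alpha>"
				"\<forall>(u, v)\<in>adj (tree S). trop.flow T (f u) (f v) = trop.flow S u v" by blast
		have "tlab n T (f v) = tlab n S v" if v: "v \<in> verts (tree S)" for v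
		proof (cases "v \<in> leaves (tree S)")
			case True
			then obtain p where p: "nbrs (tree S) v = {p}" by (auto simp: leaves_def valence_def card_1_singleton_iff)
			have "nbrs (tree T) (f v) = {f p}" using iso_nbrs[OF f(1) is_treeD(3)[OF S.G] is_treeD(3)[OF T.G] v] p by simp
			moreover have "f v \<in> leaves (tree T)" using iso_leaves[OF f(1) S.G T.G v] True by simp
			moreover have "(v, p) \<in> adj (tree S)" using p is_treeD(4)[OF S.G] by (auto simp: nbrs_def sym_def)
			ultimately show ?thesis using S.tlab_leaf[OF True p] T.tlab_leaf[of "f v" "f p"] f(3) by auto
		next case False
			have fl: "f v ~: leaves (tree T)" and fv: "valence (tree T) (f v) = valence (tree S) v"
				using iso_leaves[OF f(1) S.G T.G v] iso_valence[OF f(1) S.G T.G v] False by auto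
			show ?thesis
			proof (cases "valence (tree S) v = 2")
				case True
				then obtain \<alpha> where "\<alpha> \<in> {1..n}" "v = mark S \<alpha>" using S.marks v unfolding bij_betw_def by blast
				thus ?thesis using bspec[OF f(2), of \<alpha>] S.tlab_mark[of \<alpha>] T.tlab_mark[of \<alpha>] by simp
			next case F: False
				thus ?thesis using False fl fv by (simp add: tlab_def)
			qed
		qed
		thus "shape n S = shape n T" unfolding eq using f(1) bspec[OF f(2), of 1] S.n1 by auto
	qed
qed

subsection \<open>Every shape occurs\<close>

text \<open>Pairs of a parent and the whole branch attached to it, of which \<open>ped\<close> keeps
  only the root label.\<close>

primrec sb :: "nat rt => (nat \<times> nat rt) set" where
	"sb (Nd l ts) = \<Union>(set_mset (image_mset (%c. insert (l, c) (sb c)) ts))"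

lemma sb_att: "att G P t ==> (l, c) \<in> sb t ==> att G {l} c & set_rt c \<subseteq> set_rt t"
proof (induction t arbitrary: P)
	case (Nd v ts)
	then obtain d where d: "d \<in># ts" and lc: "(l, c) = (v, d) | (l, c) \<in> sb d" by auto
	thus ?case using Nd.IH[OF d att_child[OF Nd.prems(1) d]] att_child[OF Nd.prems(1) d] set_rt_child[OF d, of v] by auto
qed

lemma ped_sb: "(u, v) \<in> ped t \<longleftrightarrow> (\<exists>c. (u, c) \<in> sb t & lab c = v)" by (induction t) auto

lemma sb_exists: "v \<in> set_rt t ==> v ~= lab t ==> \<exists>p c. (p, c) \<in> sb t & lab c = v"
proof (induction t)
	case (Nd l ts)
	then obtain d where d: "d \<in># ts" "v \<in> set_rt d" by auto
	show ?case
	proof (cases "v = lab d")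
		case True
		thus ?thesis using d by auto
	next case False
		then obtain p c where "(p, c) \<in> sb d" "lab c = v" using Nd.IH[OF d] by blast
		thus ?thesis using d(1) by auto
	qed
qed

lemma sb_subset: "dstl t ==> (l, c) \<in> sb t ==> l \<in> set_rt t & lab c \<in> set_rt t & lab c ~= lab t & l ~= lab c"
proof (induction t)
	case (Nd v ts)
	then obtain d where d: "d \<in># ts" and lc: "(l, c) = (v, d) | (l, c) \<in> sb d" by auto
	have "dstl d" "v ~: set_rt d" using dstl_child[OF Nd.prems(1) d] by auto
	from lc show ?case
	proof
		assume "(l, c) = (v, d)"
		moreover have "lab d ~= v" "lab d \<in> set_rt (Nd v ts)"
			using `v ~: set_rt d` lab_in_set_rt[of d] set_rt_child[OF d, of v] by blast+
		ultimately show ?thesis by auto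
	next
		assume "(l, c) \<in> sb d"
		hence "l \<in> set_rt d & lab c \<in> set_rt d & l ~= lab c" using Nd.IH[OF d `dstl d`] by blast
		thus ?thesis using `v ~: set_rt d` set_rt_child[OF d, of v] by auto
	qed
qed

lemma sb_functional:
	"dstl t ==> \<exists>S P. \<forall>(l, c)\<in>sb t. S (lab c) = c & P (lab c) = l"
proof (induction t rule: rt_add_induct)
	case (add l c ts)
	have d: "dstl c" "dstl (Nd l ts)" "set_rt c \<inter> set_rt (Nd l ts) = {}" using add.prems by (auto simp: dstl_add)
	obtain S1 P1 where 1: "\<forall>(l, d)\<in>sb c. S1 (lab d) = d & P1 (lab d) = l" using add.IH(1)[OF d(1)] by blast
	obtain S2 P2 where 2: "\<forall>(l, d)\<in>sb (Nd l ts). S2 (lab d) = d & P2 (lab d) = l" using add.IH(2)[OF d(2)] by blast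
	let ?S = "%v. if v = lab c then c else if v \<in> set_rt c then S1 v else S2 v"
	let ?P = "%v. if v = lab c then l else if v \<in> set_rt c then P1 v else P2 v"
	have "?S (lab d) = d & ?P (lab d) = m" if md: "(m, d) \<in> sb (Nd l (add_mset c ts))" for m d
	proof -
		have "(m, d) = (l, c) | (m, d) \<in> sb c | (m, d) \<in> sb (Nd l ts)" using md by auto
		thus ?thesis
		proof (elim disjE)
			assume "(m, d) \<in> sb c"
			thus ?thesis using 1 sb_subset[OF d(1), of m d] by auto
		next
			assume m: "(m, d) \<in> sb (Nd l ts)"
			hence "lab d ~: set_rt c" using sb_subset[OF d(2), of m d] d(3) by blast
			moreover from this have "lab d ~= lab c" using lab_in_set_rt by metis
			ultimately show ?thesis using 2 m by auto
		qed simp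
	qed
	thus ?case by (intro exI[of _ ?S] exI[of _ ?P]) blast
qed simp

lemma ped_asym: "dstl t ==> (u, v) \<in> ped t ==> (v, u) ~: ped t"
proof (induction t rule: rt_add_induct)
	case (add l c ts)
	have d: "dstl c" "dstl (Nd l ts)" "set_rt c \<inter> set_rt (Nd l ts) = {}" "l ~: set_rt c"
		using add.prems(1) by (auto simp: dstl_add)
	have l: "lab c ~: set_rt (Nd l ts)" using d(3) lab_in_set_rt[of c] by blast
	note sub = ped_subset[of c] ped_subset[of "Nd l ts"]
	have "(u, v) = (l, lab c) | (u, v) \<in> ped c | (u, v) \<in> ped (Nd l ts)" using add.prems(2) unfolding ped_add by blast
	hence "(v, u) ~= (l, lab c) & (v, u) ~: ped c & (v, u) ~: ped (Nd l ts)"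
	proof (elim disjE)
		assume uv: "(u, v) = (l, lab c)"
		have "(lab c, l) ~: ped c" "(lab c, l) ~: ped (Nd l ts)" "lab c ~= l" using sub d(4) l lab_in_set_rt[of c] by blast+
		thus ?thesis using uv by simp
	next
		assume uv: "(u, v) \<in> ped c"
		hence "u \<in> set_rt c" "v \<in> set_rt c" using sub by auto
		hence "v ~= l" "(v, u) ~: ped (Nd l ts)" using d(3,4) sub(2) by blast+
		thus ?thesis using add.IH(1)[OF d(1) uv] by simp
	next
		assume uv: "(u, v) \<in> ped (Nd l ts)"
		hence "u \<in> set_rt (Nd l ts)" "v \<in> set_rt (Nd l ts)" using sub by blast+
		hence "u ~= lab c" "(v, u) ~: ped c" using d(3) l sub(1) by blast+
		thus ?thesis using add.IH(2)[OF d(2) uv] by simp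
	qed
	thus ?case unfolding ped_add by blast
qed simp

lemma sb_wf:
	assumes "(l, c) \<in> sb t"
	shows "wfT B (map_rt h t) ==> wfT B (map_rt h c)"
		and "nzT (map_rt h t) ==> kids c = {#} | sum_mset (dvs (map_rt h c)) ~= 0"
proof -
	have "(wfT B (map_rt h t) --> wfT B (map_rt h c)) & (nzT (map_rt h t) --> kids c = {#} | sum_mset (dvs (map_rt h c)) ~= 0)"
		using assms
	proof (induction t)
		case (Nd v ts)
		then obtain d where d: "d \<in># ts" and lc: "(l, c) = (v, d) | (l, c) \<in> sb d" by auto
		have kd: "kids (map_rt h d) = {#} \<longleftrightarrow> kids d = {#}" by (cases d) simp
		from lc show ?case
		proof
			assume "(l, c) = (v, d)"
			thus ?thesis using d kd by auto
		next
			assume "(l, c) \<in> sb d"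
			thus ?thesis using Nd.IH[OF d] d by auto
		qed
	qed
	thus "wfT B (map_rt h t) ==> wfT B (map_rt h c)"
		and "nzT (map_rt h t) ==> kids c = {#} | sum_mset (dvs (map_rt h c)) ~= 0" by auto
qed

lemma sb_trans: "(p, c) \<in> sb x ==> e \<in># kids c ==> (lab c, e) \<in> sb x"
proof (induction x)
	case (Nd l ts)
	then obtain d where d: "d \<in># ts" and pc: "(p, c) = (l, d) | (p, c) \<in> sb d" by auto
	from pc have "(lab c, e) \<in> sb d"
	proof
		assume "(p, c) = (l, d)"
		thus ?thesis using Nd.prems(2) by (cases d) auto
	qed (use Nd.IH[OF d] Nd.prems(2) in auto)
	thus ?case using d by auto
qed

text \<open>The edge vectors are forced to be sums over branches. With this definition balance below
  the root is automatic, and balance at the root is \<open>sum_mset M = 0\<close>.\<close>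

lemma shape_surj:
	fixes t :: "'n::{finite,linorder} tl rt"
	assumes n: "1 \<le> n" and t: "t \<in> shapes B n M" and nz: "nzT t" and M: "sum_mset M = 0"
	obtains T where "trop_type B n T" "shape n T = t"
proof -
	obtain us where us: "t = Nd (Mk 1) us" "size us = 2" "\<forall>c\<in>#us. wfT B c"
			"\<Sum>\<^sub># (image_mset mk us) = mset_set {2..n}" "\<Sum>\<^sub># (image_mset dvs us) = M" using t unfolding shapes_def by blast
	obtain x :: "nat rt" and h where x: "dstl x" "map_rt h x = t" by (rule shape_exists[of t])
	obtain r xs where xr: "x = Nd r xs" by (cases x)
	let ?d = "%c. sum_mset (dvs (map_rt h c))"
	have hr: "h r = Mk 1" and xs: "image_mset (map_rt h) xs = us" using x(2) unfolding xr us(1) by simp_all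
	have sz: "size xs = 2" using us(2) unfolding xs[symmetric] by simp
	define G where "G = gr x"
	have V: "verts G = set_rt x" by (simp add: G_def)
	have adj: "adj G = ped x \<union> (ped x)\<inverse>" by (simp add: G_def adj_gr)
	have tree: "is_tree G" unfolding G_def by (rule is_tree_gr[OF x(1)])
	have a: "att G {} x" unfolding G_def by (rule att_gr[OF x(1)])
	have sba: "att G {l} c" "set_rt c \<subseteq> set_rt x" "valence G (lab c) = size (kids c) + 1" if "(l, c) \<in> sb x" for l c
		using sb_att[OF a that] att_valence[of G "{l}" c] by auto
	have wf: "wfT B (map_rt h c)" if lc: "(l, c) \<in> sb x" for l c
	proof -
		obtain d where d: "d \<in># xs" "c = d | (l, c) \<in> sb d" using lc unfolding xr by auto
		have "wfT B (map_rt h d)" using us(3) d(1) unfolding xs[symmetric] by simp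
		thus ?thesis using d(2) sb_wf(1) by blast
	qed
	have lab: "(\<exists>b. h (lab c) = Dv b & b \<in> B & kids c = {#}) | (\<exists>i. h (lab c) = Mk i) & size (kids c) = 1 | h (lab c) = In & size (kids c) = 2"
		if "(l, c) \<in> sb x" for l c using wf[OF that] by (cases c) (auto split: tl.splits)
	have valr: "valence G r = 2" using att_valence[OF a] sz unfolding xr by simp
	have vals: "(\<exists>b. h v = Dv b) & valence G v = 1 | (\<exists>i. h v = Mk i) & valence G v = 2 | h v = In & valence G v = 3" if v: "v \<in> set_rt x" for v
	proof (cases "v = r")
		case True
		thus ?thesis using hr valr by auto
	next case False
		then obtain p c where c: "(p, c) \<in> sb x" "lab c = v" using sb_exists[OF v] unfolding xr by auto
		thus ?thesis using lab[OF c(1)] sba(3)[OF c(1)] by auto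
	qed
	obtain S P where SP: "\<forall>(l, c)\<in>sb x. S (lab c) = c & P (lab c) = l" using sb_functional[OF x(1)] by blast
	\<comment> \<open>The sum of the external vectors in the branch at \<open>u\<close>, which flows
	  from \<open>u\<close> towards the root. At most one of the two terms in the flow \<open>k\<close>
	  below is present, by \<open>ped_asym\<close>.\<close>
	define m where "m u = sum_mset (dvs (map_rt h (S u)))" for u
	have m: "m (lab c) = ?d c" if "(l, c) \<in> sb x" for l c using SP that by (auto simp: m_def)
	define k where "k u v = (if (v, u) \<in> ped x then m u else 0) - (if (u, v) \<in> ped x then m v else 0)" for u v
	have kup: "k (lab c) l = ?d c" "k l (lab c) = - ?d c" if lc: "(l, c) \<in> sb x" for l c
	proof -
		have "(l, lab c) \<in> ped x" using lc ped_sb by blast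
		thus "k (lab c) l = ?d c" "k l (lab c) = - ?d c" using ped_asym[OF x(1), of l "lab c"] m[OF lc] by (simp_all add: k_def)
	qed
	obtain g where g: "bij_betw g {v \<in> set_rt x. \<exists>i. h v = Mk i} {1..n}" "!!v i. h v = Mk i ==> g v = i"
	proof (rule marks_bij[OF x(1)])
		have "{1..n} = insert 1 {2..n}" using n by auto
		thus "mk (map_rt h x) = mset_set {1..n}" unfolding x(2) us(1) mk_Nd us(4) by simp
	qed auto
	have L: "{v \<in> set_rt x. \<exists>i. h v = Mk i} = {v \<in> verts G. valence G v = 2}" unfolding V
	proof (rule Collect_cong, rule conj_cong[OF refl])
		fix v assume "v \<in> set_rt x"
		thus "(\<exists>i. h v = Mk i) \<longleftrightarrow> valence G v = 2" using vals by fastforce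
	qed
	let ?V2 = "{v \<in> verts G. valence G v = 2}"
	define mark where "mark = the_inv_into ?V2 g"
	have bm: "bij_betw mark {1..n} ?V2" unfolding mark_def by (rule bij_betw_the_inv_into) (use g(1) L in simp)
	have mark: "mark i = v" if "v \<in> set_rt x" "h v = Mk i" for v i
	proof -
		have "v \<in> ?V2" unfolding L[symmetric] using that by blast
		hence "mark (g v) = v" unfolding mark_def using g(1) L by (intro the_inv_into_f_f) (simp_all add: bij_betw_def)
		thus ?thesis using g(2)[OF that(2)] by simp
	qed
	define T where "T = Trop G mark k"
	have T: "tree T = G" "trop.mark T = mark" "trop.flow T = k" by (simp_all add: T_def)
	have leaf: "\<exists>c. (p, c) \<in> sb x & lab c = u & (\<exists>b\<in>B. h u = Dv b & dvs (map_rt h c) = {#b#})" if up: "(u, p) \<in> adj G" "u \<in> leaves G" for u p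
	proof -
		have "u \<in> set_rt x" "valence G u = 1" using up(2) by (auto simp: leaves_def V)
		then obtain b where b: "h u = Dv b" using vals[of u] by auto
		have "(u, p) ~: ped x" using parent_nonleaf[OF a, of u p] up(2) valr unfolding xr by (auto simp: leaves_def)
		hence "(p, u) \<in> ped x" using up(1) unfolding adj by auto
		then obtain c where c: "(p, c) \<in> sb x" "lab c = u" unfolding ped_sb by blast
		have "b \<in> B" "kids c = {#}" using lab[OF c(1)] b unfolding c(2) by auto
		hence "dvs (map_rt h c) = {#b#}" using b c(2) by (cases c) (simp add: dvs_Nd)
		thus ?thesis using b c `b \<in> B` by blast
	qed
	have internal: "k u v ~= 0" if uv: "(u, v) \<in> adj G" "u ~: leaves G" "v ~: leaves G" for u v
	proof -
		have nz: "?d c ~= 0" if lc: "(l, c) \<in> sb x" "lab c ~: leaves G" for l c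
		proof -
			have "lab c \<in> verts G" using sba(2)[OF lc(1)] lab_in_set_rt[of c] unfolding V by blast
			hence "kids c ~= {#}" using sba(3)[OF lc(1)] lc(2) by (auto simp: leaves_def)
			thus ?thesis using sb_wf(2)[OF lc(1), of h] nz unfolding x(2) by blast
		qed
		have "(u, v) \<in> ped x | (v, u) \<in> ped x" using uv(1) unfolding adj by auto
		then obtain l c where lc: "(l, c) \<in> sb x" and uvc: "u = l & v = lab c | u = lab c & v = l" unfolding ped_sb by blast
		from uvc show ?thesis using nz[OF lc] kup[OF lc] uv(2,3) by auto
	qed
	have dvl0: "dvl (h v) = {#}" if "v \<in> set_rt x" "v ~: leaves G" for v using vals[OF that(1)] that unfolding leaves_def V by auto
	have balance: "(\<Sum>u\<in>nbrs G v. k u v) = 0" if v: "v \<in> verts G" "v ~: leaves G" for v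
	proof (cases "v = r")
		case True
		have d: "dstl (Nd r xs)" using x(1) unfolding xr .
		have nb: "nbrs G r = lab ` set_mset xs" using att_root[OF a] unfolding xr by simp
		have "(\<Sum>u\<in>nbrs G r. k u r) = \<Sum>\<^sub># (image_mset (%c. ?d c) xs)" unfolding nb sum_kids[OF d]
			by (intro arg_cong[of _ _ sum_mset] image_mset_cong kup(1)) (auto simp: xr)
		also have "... = sum_mset (\<Sum>\<^sub># (image_mset dvs us))"
			unfolding xs[symmetric] by (simp add: sum_mset_Union multiset.map_comp o_def)
		finally show ?thesis using True M us(5) by simp
	next case False
		then obtain p c where c: "(p, c) \<in> sb x" "lab c = v" using sb_exists[of v x] v unfolding V xr by auto
		obtain ts where ts: "c = Nd v ts" using c(2) by (cases c) auto
		note ac = sba(1)[OF c(1), unfolded ts]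
		have d: "dstl (Nd v ts)" using ac by (simp add: att_def)
		have nb: "nbrs G v = insert p (lab ` set_mset ts)" using att_root[OF ac] by simp
		have p: "p ~: lab ` set_mset ts" using ac set_rt_child[of _ ts v] lab_in_set_rt unfolding att_def by fastforce
		have sub: "(v, e) \<in> sb x" if "e \<in># ts" for e using c(1) that sb_trans[of p c x e] by (simp add: ts)
		have "(\<Sum>u\<in>lab ` set_mset ts. k u v) = \<Sum>\<^sub># (image_mset (%c. ?d c) ts)"
			unfolding sum_kids[OF d] by (intro arg_cong[of _ _ sum_mset] image_mset_cong kup(1) sub)
		also have "... = ?d c" using dvl0[OF v(1)[unfolded V] v(2)] by (simp add: ts dvs_Nd sum_mset_Union multiset.map_comp o_def)
		moreover have "k p v = - ?d c" using kup(2)[OF c(1)] c(2) by simp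
		ultimately show ?thesis unfolding nb using p by simp
	qed
	have "trop_type B n T" unfolding trop_type_def T
	proof (intro conjI)
		show "\<forall>v\<in>verts G. valence G v \<in> {1, 2, 3}" using vals unfolding V by auto
		show "\<forall>(u, v)\<in>adj G. k v u = - k u v" by (simp add: k_def)
		show "\<forall>(u, v)\<in>adj G. u \<in> leaves G --> k u v \<in> B" using leaf kup(1) by fastforce
		show "\<forall>(u, v)\<in>internal_edges G. k u v ~= 0" using internal by (auto simp: internal_edges_def)
		show "\<forall>v\<in>verts G. v ~: leaves G --> (\<Sum>u\<in>nbrs G v. k u v) = 0" using balance by blast
	qed (rule tree, rule bm)
	moreover have "shape n T = t"
	proof -
		interpret tt: trop_tree B n T by standard (use `trop_type B n T` n in auto)
		have m1: "mark 1 = r" by (rule mark) (use hr in "simp_all add: xr")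
		have root: "rooted G (mark 1) = x" unfolding m1 by (rule rooted_eqI[OF x(1)]) (simp_all add: G_def xr)
		have "tlab n T v = h v" if v: "v \<in> set_rt x" for v
		proof (cases "h v")
			case (Dv b)
			hence vl: "v \<in> leaves G" using vals[OF v] v by (auto simp: leaves_def V)
			then obtain p where p: "nbrs G v = {p}" by (auto simp: leaves_def valence_def card_1_singleton_iff)
			hence "(v, p) \<in> adj G" using is_treeD(4)[OF tree] by (auto simp: nbrs_def sym_def)
			then obtain c where c: "(p, c) \<in> sb x" "lab c = v" "dvs (map_rt h c) = {#b#}" using leaf[OF _ vl] Dv by fastforce
			hence "k v p = b" using kup(1)[OF c(1)] by simp
			thus ?thesis using tt.tlab_leaf[of v p] vl p Dv unfolding T by simp
		next case (Mk i)
			have "i \<in> {1..n}" using g v Mk unfolding bij_betw_def by blast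
			thus ?thesis using tt.tlab_mark[of i] mark[OF v Mk] Mk unfolding T by simp
		next case In
			hence "valence G v = 3" using vals[OF v] by auto
			thus ?thesis using In by (simp add: tlab_def T leaves_def)
		qed
		hence "tmap n T x = map_rt h x" by (rule map_rt_cong_on)
		thus ?thesis by (simp only: shape_def T root x(2))
	qed
	ultimately show thesis by (rule that)
qed

section \<open>Sums over trees\<close>

definition fam :: "('n::finite tl rt => bool) => nat set => (int,'n) vec multiset => 'n tl rt set" where
	"fam W A M = {t. W t & mk t = mset_set A & dvs t = M}"

definition inpairs :: "('n::finite tl rt => bool) => nat set => (int,'n) vec multiset => 'n tl rt multiset set" where
	"inpairs W A M = {ts. size ts = 2 & (\<forall>c\<in>#ts. W c) & \<Sum>\<^sub># (image_mset mk ts) = mset_set A & \<Sum>\<^sub># (image_mset dvs ts) = M}"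

lemma mset_set_split:
	assumes "finite A" "X + Y = mset_set A"
	shows "set_mset X \<subseteq> A" "X = mset_set (set_mset X)" "Y = mset_set (A - set_mset X)"
proof -
	have c: "count X i + count Y i = (if i \<in> A then 1 else 0)" for i
		using arg_cong[OF assms(2), of "%N. count N i"] assms(1) by (simp add: count_mset_set')
	show sub: "set_mset X \<subseteq> A"
	proof
		fix i assume "i \<in># X"
		hence "0 < count X i" by (simp only: count_greater_zero_iff)
		hence "count X i + count Y i ~= 0" by linarith
		thus "i \<in> A" using c[of i] by (metis (full_types))
	qed
	show X: "X = mset_set (set_mset X)"
	proof (rule multiset_eqI)
		fix i
		have "count X i \<le> 1" using c[of i] by (auto split: if_splits)
		thus "count X i = count (mset_set (set_mset X)) i"
		proof (cases "i \<in># X")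
			case True
			hence "count X i = 1" using `count X i \<le> 1` count_greater_zero_iff[of X i] by linarith
			thus ?thesis using True by (simp add: count_mset_set')
		qed (simp add: count_mset_set' not_in_iff)
	qed
	have "mset_set A = mset_set (set_mset X) + mset_set (A - set_mset X)"
		using sub assms(1) by (metis Diff_disjoint Un_Diff_cancel Un_absorb1 finite_Diff finite_set_mset mset_set_Union)
	thus "Y = mset_set (A - set_mset X)" using assms(2) X by (metis add_left_cancel)
qed

text \<open>Ordered version of \<open>inpairs\<close>. With \<open>D = {a}\<close> the mark
  \<open>a\<close> decides which branch comes first, while \<open>D = {}\<close> admits both
  orders.\<close>

definition opairs :: "('n::finite tl rt => bool) => nat set => nat set => (int,'n) vec multiset => ('n tl rt \<times> 'n tl rt) set" where
	"opairs W A D M = (\<Union>A1\<in>{A1. D \<subseteq> A1 & A1 \<subseteq> A}. \<Union>M1\<in>{M1. M1 \<subseteq># M}. fam W A1 M1 \<times> fam W (A - A1) (M - M1))"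

lemma opairs_iff:
	assumes A: "finite A"
	shows "(s, t) \<in> opairs W A D M \<longleftrightarrow> W s & W t & D \<subseteq> set_mset (mk s) & mk s + mk t = mset_set A & dvs s + dvs t = M"
proof
	assume "(s, t) \<in> opairs W A D M"
	then obtain A1 M1 where *: "D \<subseteq> A1" "A1 \<subseteq> A" "M1 \<subseteq># M" "s \<in> fam W A1 M1" "t \<in> fam W (A - A1) (M - M1)"
		by (auto simp: opairs_def)
	have "finite A1" using *(2) A finite_subset by blast
	moreover have "mset_set A1 + mset_set (A - A1) = mset_set A"
		using *(2) A `finite A1` by (subst mset_set_Union[symmetric]) (auto simp: Un_absorb1)
	ultimately show "W s & W t & D \<subseteq> set_mset (mk s) & mk s + mk t = mset_set A & dvs s + dvs t = M"
		using * by (auto simp: fam_def)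
next
	assume st: "W s & W t & D \<subseteq> set_mset (mk s) & mk s + mk t = mset_set A & dvs s + dvs t = M"
	note sp = mset_set_split[OF A, of "mk s" "mk t"]
	have "s \<in> fam W (set_mset (mk s)) (dvs s)" "t \<in> fam W (A - set_mset (mk s)) (M - dvs s)" "dvs s \<subseteq># M"
		using st sp by (auto simp: fam_def)
	thus "(s, t) \<in> opairs W A D M" using st sp(1) unfolding opairs_def by blast
qed

lemma pair_inpairs:
	assumes "finite A"
	shows "{#s, t#} \<in> inpairs W A M \<longleftrightarrow> (s, t) \<in> opairs W A {} M" by (auto simp: opairs_iff[OF assms] inpairs_def)

lemma inpairs_opairs:
	assumes A: "finite A" and D: "D \<subseteq> {a}" "D \<subseteq> A"
	shows "inpairs W A M = (%(s, t). {#s, t#}) ` opairs W A D M"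
proof (intro equalityI subsetI)
	fix ts assume ts: "ts \<in> inpairs W A M"
	then obtain s t where st: "ts = {#s, t#}" using size_two[of ts] unfolding inpairs_def by blast
	have o: "(s, t) \<in> opairs W A {} M" "(t, s) \<in> opairs W A {} M"
		using ts pair_inpairs[OF A] unfolding st by (blast, metis add_mset_commute)
	have "D \<subseteq> set_mset (mk s + mk t)" using o(1) D(2) A unfolding opairs_iff[OF A] by simp
	hence "D \<subseteq> set_mset (mk s) | D \<subseteq> set_mset (mk t)" using D(1) by auto
	hence "(s, t) \<in> opairs W A D M | (t, s) \<in> opairs W A D M" using o unfolding opairs_iff[OF A] by blast
	thus "ts \<in> (%(s, t). {#s, t#}) ` opairs W A D M" unfolding st by (auto simp: add_mset_commute intro: rev_image_eqI)
next
	fix ts assume "ts \<in> (%(s, t). {#s, t#}) ` opairs W A D M"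
	then obtain s t where st: "ts = {#s, t#}" "(s, t) \<in> opairs W A D M" by auto
	hence "(s, t) \<in> opairs W A {} M" unfolding opairs_iff[OF A] by blast
	thus "ts \<in> inpairs W A M" unfolding st(1) pair_inpairs[OF A] .
qed

text \<open>The two branches have disjoint marks, so exactly one of them carries \<open>a\<close>.
  Unordered pairs thus correspond bijectively to ordered ones without a symmetry factor, and the
  marks and divisors of the first branch determine those of the second.\<close>

lemma sum_inpairs:
	fixes f :: "'n::finite tl rt => 'r::comm_ring_1"
	assumes A: "finite A" "a \<in> A" and fin: "!!A1 M1. A1 \<subseteq> A ==> M1 \<subseteq># M ==> finite (fam W A1 M1)"
	shows "(\<Sum>ts\<in>inpairs W A M. \<Prod>\<^sub># (image_mset f ts)) =
		(\<Sum>A1\<in>{A1. a \<in> A1 & A1 \<subseteq> A}. \<Sum>M1\<in>{M1. M1 \<subseteq># M}. (\<Sum>s\<in>fam W A1 M1. f s) * (\<Sum>t\<in>fam W (A - A1) (M - M1). f t))"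
proof -
	let ?X = "%M A1. \<Union>M1\<in>{M1. M1 \<subseteq># M}. fam W A1 M1 \<times> fam W (A - A1) (M - M1)"
	let ?O = "opairs W A {a} M"
	have inj: "inj_on (%(s, t). {#s, t#}) ?O"
	proof (rule inj_onI, clarify)
		fix s t s' t' assume st: "(s, t) \<in> ?O" "(s', t') \<in> ?O" and eq: "{#s, t#} = {#s', t'#}"
		have no: "~ (s = t' & t = s')"
		proof
			assume "s = t' & t = s'"
			hence "a \<in># mk s" "a \<in># mk t" using st unfolding opairs_iff[OF A(1)] by blast+
			hence "count (mk s + mk t) a \<ge> 2" unfolding count_greater_zero_iff[symmetric] count_union by linarith
			moreover have "mk s + mk t = mset_set A" using st(1) unfolding opairs_iff[OF A(1)] by blast
			ultimately show False by (simp only: count_mset_set') (simp split: if_splits)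
		qed
		have "s \<in># {#s', t'#}" unfolding eq[symmetric] by simp
		then consider "s = s'" | "s = t'" by auto
		thus "s = s' & t = t'"
		proof cases
			case 1
			thus ?thesis using eq by simp
		next case 2
			hence "t = s'" using eq add_mset_commute[of s' t' "{#}"] by simp
			thus ?thesis using no 2 by blast
		qed
	qed
	have "(\<Sum>ts\<in>inpairs W A M. \<Prod>\<^sub># (image_mset f ts)) = (\<Sum>(s, t)\<in>?O. f s * f t)"
		unfolding inpairs_opairs[OF A(1), of "{a}" a W M, OF order_refl, unfolded insert_subset, OF conjI[OF A(2) empty_subsetI]]
		by (subst sum.reindex[OF inj]) (simp add: case_prod_unfold)
	also have "... = (\<Sum>A1\<in>{A1. {a} \<subseteq> A1 & A1 \<subseteq> A}. \<Sum>(s, t)\<in>(?X M A1). f s * f t)"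
		unfolding opairs_def
	proof (rule sum.UNION_disjoint)
		show "finite {A1. {a} \<subseteq> A1 & A1 \<subseteq> A}" by (rule finite_subset[of _ "Pow A"]) (use A in auto)
		show "\<forall>A1\<in>{A1. {a} \<subseteq> A1 & A1 \<subseteq> A}. finite (?X M A1)"
			using fin finite_submultisets[of M] by (auto intro!: finite_UN_I finite_cartesian_product)
		show "\<forall>A1\<in>{A1. {a} \<subseteq> A1 & A1 \<subseteq> A}. \<forall>A2\<in>{A1. {a} \<subseteq> A1 & A1 \<subseteq> A}. A1 ~= A2 -->
				(?X M A1) \<inter> (\<Union>M1\<in>{M1. M1 \<subseteq># M}. fam W A2 M1 \<times> fam W (A - A2) (M - M1)) = {}"
		proof (intro ballI impI)
			fix A1 A2 assume "A1 \<in> {A1. {a} \<subseteq> A1 & A1 \<subseteq> A}" "A2 \<in> {A1. {a} \<subseteq> A1 & A1 \<subseteq> A}" "A1 ~= A2"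
			hence "mset_set A1 ~= mset_set A2"
				using A(1) by (metis (no_types, lifting) finite_set_mset_mset_set finite_subset mem_Collect_eq)
			thus "(?X M A1) \<inter> (\<Union>M1\<in>{M1. M1 \<subseteq># M}. fam W A2 M1 \<times> fam W (A - A2) (M - M1)) = {}"
				by (auto simp: fam_def)
		qed
	qed
	also have "... = (\<Sum>A1\<in>{A1. {a} \<subseteq> A1 & A1 \<subseteq> A}. \<Sum>M1\<in>{M1. M1 \<subseteq># M}. \<Sum>(s, t)\<in>fam W A1 M1 \<times> fam W (A - A1) (M - M1). f s * f t)"
	proof (rule sum.cong[OF refl], rule sum.UNION_disjoint)
		fix A1 assume A1: "A1 \<in> {A1. {a} \<subseteq> A1 & A1 \<subseteq> A}"
		show "\<forall>M1\<in>{M1. M1 \<subseteq># M}. finite (fam W A1 M1 \<times> fam W (A - A1) (M - M1))" using fin A1 by auto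
		show "\<forall>M1\<in>{M1. M1 \<subseteq># M}. \<forall>M2\<in>{M1. M1 \<subseteq># M}. M1 ~= M2 -->
				(fam W A1 M1 \<times> fam W (A - A1) (M - M1)) \<inter> (fam W A1 M2 \<times> fam W (A - A1) (M - M2)) = {}" by (auto simp: fam_def)
	qed (rule finite_submultisets)
	also have "... = (\<Sum>A1\<in>{A1. a \<in> A1 & A1 \<subseteq> A}. \<Sum>M1\<in>{M1. M1 \<subseteq># M}. (\<Sum>s\<in>fam W A1 M1. f s) * (\<Sum>t\<in>fam W (A - A1) (M - M1). f t))"
		by (simp add: sum_product sum.cartesian_product)
	finally show ?thesis .
qed

lemma dvs_wfT: "wfT B t ==> dvs t ~= {#} & set_mset (dvs t) \<subseteq> B"
proof (induction t)
	case (Nd l ts)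
	have kid: "dvs c ~= {#} & set_mset (dvs c) \<subseteq> B" if "c \<in># ts" for c using Nd that by auto
	show ?case
	proof (cases l)
		case (Dv b)
		thus ?thesis using Nd.prems by (simp add: dvs_Nd)
	next case (Mk i)
		then obtain c where "ts = {#c#}" using Nd.prems size_1_singleton_mset[of ts] by auto
		thus ?thesis using kid[of c] Mk by (simp add: dvs_Nd)
	next case In
		then obtain c d where "ts = {#c, d#}" using Nd.prems size_two[of ts] by auto
		thus ?thesis using kid[of c] kid[of d] In by (simp add: dvs_Nd)
	qed
qed

lemma fam_wfT:
	assumes "finite A"
	shows "fam (wfT B) A M = (if A = {} & (\<exists>b\<in>B. M = {#b#}) then {Nd (Dv (THE b. M = {#b#})) {#}} else {}) \<union>
		(\<Union>i\<in>A. (%c. Nd (Mk i) {#c#}) ` fam (wfT B) (A - {i}) M) \<union> Nd In ` inpairs (wfT B) A M"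
proof (intro equalityI subsetI)
	fix t assume t: "t \<in> fam (wfT B) A M"
	obtain l ts where lt: "t = Nd l ts" by (cases t)
	have w: "wfT B (Nd l ts)" "mk (Nd l ts) = mset_set A" "dvs (Nd l ts) = M" using t unfolding lt fam_def by auto
	show "t \<in> (if A = {} & (\<exists>b\<in>B. M = {#b#}) then {Nd (Dv (THE b. M = {#b#})) {#}} else {}) \<union>
		(\<Union>i\<in>A. (%c. Nd (Mk i) {#c#}) ` fam (wfT B) (A - {i}) M) \<union> Nd In ` inpairs (wfT B) A M"
	proof (cases l)
		case (Dv b)
		hence "ts = {#}" "b \<in> B" "A = {}" "M = {#b#}" using w assms by (auto simp: mk_Nd dvs_Nd mset_set_empty_iff)
		thus ?thesis by (simp add: lt Dv)
	next case (Mk i)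
		then obtain c where c: "ts = {#c#}" using w(1) size_1_singleton_mset[of ts] by auto
		have m: "{#i#} + mk c = mset_set A" using w(2) by (simp add: mk_Nd Mk c)
		have "i \<in> A" "mk c = mset_set (A - {i})" using mset_set_split[OF assms m] by simp_all
		thus ?thesis using w Mk by (auto simp: lt c fam_def dvs_Nd)
	next case In
		thus ?thesis using w by (auto simp: lt inpairs_def mk_Nd dvs_Nd)
	qed
next
	fix t assume "t \<in> (if A = {} & (\<exists>b\<in>B. M = {#b#}) then {Nd (Dv (THE b. M = {#b#})) {#}} else {}) \<union>
		(\<Union>i\<in>A. (%c. Nd (Mk i) {#c#}) ` fam (wfT B) (A - {i}) M) \<union> Nd In ` inpairs (wfT B) A M"
	then consider b where "b \<in> B" "A = {}" "M = {#b#}" "t = Nd (Dv b) {#}"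
		| i c where "i \<in> A" "c \<in> fam (wfT B) (A - {i}) M" "t = Nd (Mk i) {#c#}"
		| ts where "ts \<in> inpairs (wfT B) A M" "t = Nd In ts" by (auto split: if_splits)
	thus "t \<in> fam (wfT B) A M"
	proof cases
		case 2
		have "add_mset i (mset_set (A - {i})) = mset_set A" using 2(1) assms by (metis mset_set.remove)
		thus ?thesis using 2 by (simp add: fam_def mk_Nd dvs_Nd)
	qed (auto simp: fam_def inpairs_def mk_Nd dvs_Nd)
qed

text \<open>A mark at the root uses up an element of \<open>A\<close>. At an unmarked root both
  branches have external edges by \<open>dvs_wfT\<close>, so each has fewer than the whole. Hence
  \<open>size M + card A\<close> decreases.\<close>

lemma fam_finite_wfT: "finite A ==> finite (fam (wfT B) A M)"
proof (induction "size M + card A" arbitrary: A M rule: less_induct)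
	case less
	have prod: "finite (fam (wfT B) A1 M1 \<times> fam (wfT B) (A - A1) (M - M1))" if A1: "A1 \<subseteq> A" and M1: "M1 \<subseteq># M" for A1 M1
	proof (cases "M1 = {#} | M - M1 = {#}")
		case True
		hence "fam (wfT B) A1 M1 = {} | fam (wfT B) (A - A1) (M - M1) = {}" using dvs_wfT by (auto simp: fam_def)
		thus ?thesis by auto
	next case False
		have "size M1 + size (M - M1) = size M" using M1 by (metis size_union subset_mset.add_diff_inverse)
		moreover have "size M1 ~= 0" "size (M - M1) ~= 0" using False by auto
		moreover have "card A1 \<le> card A" "card (A - A1) \<le> card A" using A1 less.prems by (auto intro: card_mono)
		ultimately have "size M1 + card A1 < size M + card A" "size (M - M1) + card (A - A1) < size M + card A" by linarith+
		thus ?thesis using less.hyps less.prems A1 by (meson finite_Diff finite_SigmaI finite_subset)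
	qed
	have "finite (opairs (wfT B) A {} M)" unfolding opairs_def using prod less.prems finite_submultisets[of M] by (intro finite_UN_I) auto
	hence "finite (inpairs (wfT B) A M)" unfolding inpairs_opairs[OF less.prems empty_subsetI empty_subsetI] by (rule finite_imageI)
	moreover have "finite (fam (wfT B) (A - {i}) M)" if "i \<in> A" for i
		using that less.prems card_Diff1_less[OF less.prems that] by (intro less.hyps) simp_all
	ultimately show ?case unfolding fam_wfT[OF less.prems] using less.prems by auto
qed

lemma co_mono0_mult: "co (mono0 c * v) M = c * co v M"
proof -
	have "co (mono0 c * v) M = (\<Sum>A | A \<subseteq># M. if A = {#} then c * co v M else 0)"
		unfolding co_mult mono0_def by (intro sum.cong refl) auto
	thus ?thesis using finite_submultisets[of M] by (simp add: sum.delta)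
qed

lemma kq_mono0 [simp]: "kq (mono0 c) = 0" by (rule mser_eqI) (simp add: kq_def mono0_def co_simps)

definition Phi :: "(int,'n::{finite,linorder}) vec set => (nat => 'n gf) => nat set => 'n qs" where
	"Phi B g A = Ser (%M. \<Sum>t\<in>fam (wfT B) A M. tv g t)"

text \<open>Without marks the root is an unmarked vertex, and by induction each of its two branches
  has the constant value \<open>0\<close> or \<open>1\<close>. The propagator kills their product by
  \<open>kap_1\<close>.\<close>

lemma tv_markless: "wfT B t ==> mk t = {#} ==> kids t ~= {#} ==> tv g t = 0"
proof (induction t)
	case (Nd l ts)
	hence l: "l = In" by (cases l) (auto simp: mk_Nd)
	then obtain c d where cd: "ts = {#c, d#}" using Nd.prems(1) size_two[of ts] by auto
	have tv1: "tv g e = (if kids e = {#} then 1 else 0)" if e: "e \<in># ts" for e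
	proof (cases "kids e = {#}")
		case True
		have "wfT B e" "mk e = {#}" using Nd.prems(1,2) e by (auto simp: mk_Nd)
		thus ?thesis using True by (cases e) (auto split: tl.splits)
	next case False
		thus ?thesis using Nd.IH[OF e] Nd.prems(1,2) e by (auto simp: mk_Nd)
	qed
	show ?case using tv1[of c] tv1[of d] by (simp add: l cd)
qed

lemma Phi_empty:
	assumes "finite B"
	shows "Phi B g {} = Wq B"
proof (rule mser_eqI)
	fix M
	let ?D = "if \<exists>b\<in>B. M = {#b#} then {Nd (Dv (THE b. M = {#b#})) {#}} else {}"
	have "co (Phi B g {}) M = (\<Sum>t\<in>?D. tv g t)" unfolding Phi_def co_Ser
	proof (rule sum.mono_neutral_right)
		show "?D \<subseteq> fam (wfT B) {} M" by (auto simp: fam_wfT)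
		show "\<forall>t\<in>fam (wfT B) {} M - ?D. tv g t = 0"
		proof
			fix t assume t: "t \<in> fam (wfT B) {} M - ?D"
			hence "t \<in> Nd In ` inpairs (wfT B) {} M" using fam_wfT[of "{}" B M] by auto
			hence "kids t ~= {#}" by (auto simp: inpairs_def)
			thus "tv g t = 0" using t tv_markless[of B t g] by (simp add: fam_def)
		qed
	qed (simp add: fam_finite_wfT)
	thus "co (Phi B g {}) M = co (Wq B) M" by (simp add: Wq_def)
qed

text \<open>Two subtrees are joined; that the first one carries the mark \<open>a\<close> orders the pair.\<close>

definition joins :: "(nat set => 'r::comm_ring_1) => nat => nat set => 'r" where
	"joins F a A = (\<Sum>A1\<in>{A1. a \<in> A1 & A1 \<subseteq> A}. F A1 * F (A - A1))"

lemma sum_joins_wfT: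
	assumes A: "finite A" "a \<in> A"
	shows "(\<Sum>ts\<in>inpairs (wfT B) A M. \<Prod>\<^sub># (image_mset (tv g) ts)) = co (joins (Phi B g) a A) M"
proof -
	have "(\<Sum>ts\<in>inpairs (wfT B) A M. \<Prod>\<^sub># (image_mset (tv g) ts)) =
		(\<Sum>A1\<in>{A1. a \<in> A1 & A1 \<subseteq> A}. \<Sum>M1\<in>{M1. M1 \<subseteq># M}.
			(\<Sum>s\<in>fam (wfT B) A1 M1. tv g s) * (\<Sum>t\<in>fam (wfT B) (A - A1) (M - M1). tv g t))"
		by (rule sum_inpairs[OF A]) (use A(1) finite_subset in "auto intro: fam_finite_wfT")
	thus ?thesis by (simp add: joins_def co_sum co_mult Phi_def)
qed

text \<open>The root of the branch is a mark with one child or an unmarked vertex with two; a single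
  external edge is excluded as \<open>A\<close> is not empty. All trees at the monomial
  \<open>M\<close> share the vector of the edge above, so one propagator comes out of the
  sum.\<close>

lemma Phi_rec:
	fixes g :: "nat => 'n::{finite,linorder} gf"
	assumes A: "finite A" "a \<in> A"
	shows "Phi B g A = kq ((\<Sum>i\<in>A. mono0 (g i) * Phi B g (A - {i})) + joins (Phi B g) a A)"
proof (rule mser_eqI)
	fix M
	let ?U = "\<Union>i\<in>A. (%c. Nd (Mk i) {#c#}) ` fam (wfT B) (A - {i}) M" and ?I = "Nd In ` inpairs (wfT B) A M"
	have fin: "finite (fam (wfT B) A M)" by (rule fam_finite_wfT[OF A(1)])
	have eq: "fam (wfT B) A M = ?U \<union> ?I" using fam_wfT[OF A(1), of B M] A(2) by auto
	have dM: "sum_mset (\<Sum>\<^sub># (image_mset dvs (kids t))) = sum_mset M" if "t \<in> fam (wfT B) A M" "!!b. lab t ~= Dv b" for t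
		using that by (cases t; cases "lab t") (auto simp: fam_def dvs_Nd)
	have "co (Phi B g A) M = (\<Sum>t\<in>?U. tv g t) + (\<Sum>t\<in>?I. tv g t)"
		unfolding Phi_def co_Ser eq by (rule sum.union_disjoint) (use fin eq in auto)
	also have "(\<Sum>t\<in>?U. tv g t) = (\<Sum>i\<in>A. \<Sum>t\<in>(%c. Nd (Mk i) {#c#}) ` fam (wfT B) (A - {i}) M. tv g t)"
		by (rule sum.UNION_disjoint) (use A(1) in "auto simp: fam_finite_wfT")
	also have "... = (\<Sum>i\<in>A. kap (sum_mset M) (co (mono0 (g i) * Phi B g (A - {i})) M))"
	proof (rule sum.cong[OF refl])
		fix i assume i: "i \<in> A"
		have "(\<Sum>t\<in>(%c. Nd (Mk i) {#c#}) ` fam (wfT B) (A - {i}) M. tv g t) = (\<Sum>c\<in>fam (wfT B) (A - {i}) M. tv g (Nd (Mk i) {#c#}))"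
			by (subst sum.reindex) (auto simp: inj_on_def)
		also have "... = (\<Sum>c\<in>fam (wfT B) (A - {i}) M. kap (sum_mset M) (g i * tv g c))"
			by (intro sum.cong refl) (auto simp: fam_def)
		finally show "(\<Sum>t\<in>(%c. Nd (Mk i) {#c#}) ` fam (wfT B) (A - {i}) M. tv g t) = kap (sum_mset M) (co (mono0 (g i) * Phi B g (A - {i})) M)"
			by (simp add: kap_sum co_mono0_mult Phi_def sum_distrib_left)
	qed
	also have "(\<Sum>t\<in>?I. tv g t) = (\<Sum>ts\<in>inpairs (wfT B) A M. tv g (Nd In ts))" by (subst sum.reindex) (auto simp: inj_on_def)
	also have "... = (\<Sum>ts\<in>inpairs (wfT B) A M. kap (sum_mset M) (\<Prod>\<^sub># (image_mset (tv g) ts)))"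
		by (intro sum.cong refl) (auto simp: inpairs_def)
	also have "... = kap (sum_mset M) (co (joins (Phi B g) a A) M)" unfolding kap_sum[symmetric] sum_joins_wfT[OF A] ..
	finally show "co (Phi B g A) M = co (kq ((\<Sum>i\<in>A. mono0 (g i) * Phi B g (A - {i})) + joins (Phi B g) a A)) M"
		by (simp add: kq_def co_simps co_sum kap_add kap_sum)
qed

subsection \<open>The B-model trees\<close>

lemma dvs_wfB: "wfB t ==> dvs t = {#}"
proof (induction t)
	case (Nd l ts)
	have "\<Sum>\<^sub># (image_mset dvs ts) = {#}" using Nd by (auto intro!: sum_mset.neutral)
	thus ?case using Nd.prems by (cases l) (auto simp: dvs_Nd)
qed

lemma fam_wfB: "fam wfB A {#} = btrees A" using dvs_wfB by (auto simp: fam_def btrees_def)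

lemma btrees_rec:
	fixes A :: "nat set"
	assumes "finite A"
	shows "(btrees A :: 'n::finite tl rt set) = (%i. Nd (Mk i) {#}) ` {i. A = {i}} \<union> Nd In ` inpairs wfB A {#}"
proof (intro equalityI subsetI)
	fix t :: "'n tl rt" assume t: "t \<in> btrees A"
	obtain l ts where lt: "t = Nd l ts" by (cases t)
	have w: "wfB (Nd l ts)" "mk (Nd l ts) = mset_set A" using t unfolding lt btrees_def by auto
	show "t \<in> (%i. Nd (Mk i) {#}) ` {i. A = {i}} \<union> Nd In ` inpairs wfB A {#}"
	proof (cases l)
		case (Mk i)
		hence "mset_set A = {#i#}" "ts = {#}" using w by (auto simp: mk_Nd)
		hence "A = {i}" "ts = {#}" using finite_set_mset_mset_set[OF assms] by simp_all
		thus ?thesis by (simp add: lt Mk)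
	next case In
		thus ?thesis using w dvs_wfB[OF w(1)] by (auto simp: lt inpairs_def mk_Nd dvs_Nd)
	qed (use w in simp)
next
	fix t :: "'n tl rt" assume "t \<in> (%i. Nd (Mk i) {#}) ` {i. A = {i}} \<union> Nd In ` inpairs wfB A {#}"
	thus "t \<in> btrees A" by (auto simp: btrees_def inpairs_def mk_Nd)
qed

lemma finite_btrees: "finite A ==> finite (btrees A :: 'n::finite tl rt set)"
proof (induction "card A" arbitrary: A rule: less_induct)
	case less
	have ne: "btrees {} = ({} :: 'n tl rt set)" using size_labs_wfB by (fastforce simp: btrees_def)
	have prod: "finite (fam wfB A1 M1 \<times> fam wfB (A - A1) ({#} - M1))" if A1: "A1 \<subseteq> A" and M1: "M1 \<subseteq># {#}"
		for A1 and M1 :: "(int,'n) vec multiset"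
	proof (cases "A1 = {} | A1 = A")
		case True
		thus ?thesis using M1 by (auto simp: fam_wfB ne)
	next case False
		hence "card A1 < card A" "card (A - A1) < card A" using A1 less.prems by (auto intro!: psubset_card_mono)
		hence "finite (btrees A1 :: 'n tl rt set)" "finite (btrees (A - A1) :: 'n tl rt set)"
			using less.hyps less.prems finite_subset[OF A1] by auto
		thus ?thesis using M1 by (simp add: fam_wfB)
	qed
	have "finite (opairs wfB A {} ({#} :: (int,'n) vec multiset))" unfolding opairs_def using prod less.prems by (intro finite_UN_I) auto
	hence "finite (inpairs wfB A ({#} :: (int,'n) vec multiset))"
		unfolding inpairs_opairs[OF less.prems empty_subsetI empty_subsetI] by (rule finite_imageI)
	moreover have "finite {i. A = {i}}" by (rule finite_subset[of _ A]) (use less.prems in auto)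
	ultimately show ?case unfolding btrees_rec[OF less.prems] by auto
qed

section \<open>Comparison of the two sums\<close>

context
	fixes B :: "(int,'n::{finite,linorder}) vec set" and g :: "nat => 'n gf"
	assumes B: "finite B"
begin

abbreviation "Ps i \<equiv> dressed B (mono0 (g i))"
abbreviation "Ph \<equiv> Phi B g"
abbreviation "Wb \<equiv> Wq B"

definition Fb :: "nat set => 'n qs" where
	"Fb A = (\<Sum>t\<in>btrees A. bv B Ps t)"

text \<open>The bare external state, not followed by a propagator. It exists for a single mark only,
  and the empty sum covers all other sets.\<close>

definition Es :: "nat set => 'n qs" where
	"Es A = (\<Sum>i\<in>{i. A = {i}}. mono0 (g i))"

lemma Es_single: "Es {i} = mono0 (g i)"
proof -
	have "{j. {i} = {j}} = {i}" by auto
	thus ?thesis by (simp add: Es_def)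
qed

lemma Es_neq: "(!!i. A ~= {i}) ==> Es A = 0" by (simp add: Es_def)

lemma mono0_mult: "mono0 c * mono0 d = (mono0 (c * d) :: 'n qs)" by (rule mser_eqI) (simp add: co_mono0_mult, simp add: mono0_def)

text \<open>Bare states live at the empty monomial, whose vector is zero, so \<open>kap_0\<close>
  applies to their product.\<close>

lemma kq_Es: "kq (Es S * Es T) = 0"
proof (cases "(\<exists>i. S = {i}) & (\<exists>j. T = {j})")
	case True
	thus ?thesis by (auto simp: Es_single mono0_mult)
next case False
	hence "Es S * Es T = 0" using Es_neq[of S] Es_neq[of T] by auto
	thus ?thesis by simp
qed

lemma Fb_empty: "Fb {} = 0"
proof -
	have "(btrees {} :: 'n tl rt set) = {}" using size_labs_wfB by (fastforce simp: btrees_def)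
	thus ?thesis by (simp add: Fb_def)
qed

lemma sum_joins_wfB:
	assumes A: "finite A" "a \<in> A"
	shows "(\<Sum>ts\<in>inpairs wfB A {#}. \<Prod>\<^sub># (image_mset (bv B Ps) ts)) = joins Fb a A"
proof -
	have e: "{M1. M1 \<subseteq># {#}} = {{#} :: (int,'n) vec multiset}" by auto
	have "(\<Sum>ts\<in>inpairs wfB A {#}. \<Prod>\<^sub># (image_mset (bv B Ps) ts)) =
		(\<Sum>A1\<in>{A1. a \<in> A1 & A1 \<subseteq> A}. \<Sum>M1\<in>{M1. M1 \<subseteq># {#}}.
			(\<Sum>s\<in>fam wfB A1 M1. bv B Ps s) * (\<Sum>t\<in>fam wfB (A - A1) ({#} - M1). bv B Ps t))"
		by (rule sum_inpairs[OF A]) (use A(1) finite_subset in "auto simp: fam_wfB intro: finite_btrees")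
	thus ?thesis unfolding e by (simp add: joins_def Fb_def fam_wfB)
qed

lemma Fb_rec:
	assumes A: "finite A" "a \<in> A"
	shows "Fb A = (\<Sum>i\<in>{i. A = {i}}. Ps i) + kX B (joins Fb a A)"
proof -
	have fin: "finite (btrees A :: 'n tl rt set)" by (rule finite_btrees[OF A(1)])
	have "Fb A = (\<Sum>t\<in>(%i. Nd (Mk i) {#}) ` {i. A = {i}}. bv B Ps t) + (\<Sum>t\<in>Nd In ` inpairs wfB A {#}. bv B Ps t)"
		unfolding Fb_def btrees_rec[OF A(1)] by (rule sum.union_disjoint) (use fin btrees_rec[OF A(1), where ?'n = 'n] in auto)
	also have "(\<Sum>t\<in>(%i. Nd (Mk i) {#}) ` {i. A = {i}}. bv B Ps t) = (\<Sum>i\<in>{i. A = {i}}. Ps i)"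
		by (subst sum.reindex) (auto simp: inj_on_def)
	also have "(\<Sum>t\<in>Nd In ` inpairs wfB A {#}. bv B Ps t) = (\<Sum>ts\<in>inpairs wfB A {#}. kX B (\<Prod>\<^sub># (image_mset (bv B Ps) ts)))"
		by (subst sum.reindex) (auto simp: inj_on_def)
	also have "... = kX B (joins Fb a A)" unfolding kX_sum[OF B, symmetric] sum_joins_wfB[OF A] ..
	finally show ?thesis .
qed

lemma joins_split:
	assumes "finite A" "a \<in> A"
	shows "joins F a A = F A * F {} + (\<Sum>A1\<in>{A1. a \<in> A1 & A1 \<subset> A}. F A1 * F (A - A1))"
proof -
	have "{A1. a \<in> A1 & A1 \<subseteq> A} = insert A {A1. a \<in> A1 & A1 \<subset> A}" using assms by auto
	moreover have "finite {A1. a \<in> A1 & A1 \<subset> A}" by (rule finite_subset[of _ "Pow A"]) (use assms in auto)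
	ultimately show ?thesis by (simp add: joins_def)
qed

text \<open>\<open>Es + Ph\<close> is substituted in both factors. Mixed products are the vertices
  with a 2-valent mark \<open>i\<close>: for \<open>i = a\<close> the bare state is the first
  factor, for the others it is the second. The products of two \<open>Ph\<close> lack only the case
  \<open>A1 = A\<close>, which is supplied by \<open>Wb * Ph A\<close>. Two bare states can meet
  only if \<open>A\<close> is a pair.\<close>

lemma joins_link:
	assumes A: "finite A" "a \<in> A" "A ~= {a}"
		and IH: "!!A1. A1 \<subset> A ==> A1 ~= {} ==> Fb A1 = Es A1 + Ph A1"
	shows "joins Fb a A + Wb * Ph A = joins Ph a A + (\<Sum>i\<in>A. mono0 (g i) * Ph (A - {i})) + Es {a} * Es (A - {a})"
proof -
	let ?X = "\<Sum>i\<in>A - {a}. mono0 (g i) * Ph (A - {i})"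
	let ?D = "{A1. a \<in> A1 & A1 \<subset> A}"
	have fin: "finite ?D" by (rule finite_subset[of _ "Pow A"]) (use A in auto)
	have aD: "{a} \<in> ?D" using A by auto
	have only: "Es A1 = 0" if "A1 \<in> ?D - {{a}}" for A1 by (rule Es_neq) (use that in auto)
	have E: "(\<Sum>A1\<in>?D. Es A1 * F (A - A1)) = Es {a} * F (A - {a})" for F
	proof -
		have "(\<Sum>A1\<in>?D. Es A1 * F (A - A1)) = (\<Sum>A1\<in>{{a}}. Es A1 * F (A - A1))"
			by (rule sum.mono_neutral_right[OF fin]) (use aD only in auto)
		thus ?thesis by simp
	qed
	have PE: "(\<Sum>A1\<in>?D. Ph A1 * Es (A - A1)) = ?X"
	proof -
		have inj: "inj_on (%i. A - {i}) (A - {a})" by (rule inj_onI) blast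
		have "(\<Sum>A1\<in>?D. Ph A1 * Es (A - A1)) = (\<Sum>A1\<in>(%i. A - {i}) ` (A - {a}). Ph A1 * Es (A - A1))"
		proof (rule sum.mono_neutral_right[OF fin])
			show "(%i. A - {i}) ` (A - {a}) \<subseteq> ?D" using A by auto
			show "\<forall>A1\<in>?D - (%i. A - {i}) ` (A - {a}). Ph A1 * Es (A - A1) = 0"
			proof
				fix A1 assume A1: "A1 \<in> ?D - (%i. A - {i}) ` (A - {a})"
				have "A - A1 ~= {i}" for i
				proof
					assume i: "A - A1 = {i}"
					hence "A1 = A - {i}" "i \<in> A - {a}" using A1 by auto
					thus False using A1 by blast
				qed
				thus "Ph A1 * Es (A - A1) = 0" using Es_neq by simp
			qed
		qed
		also have "... = (\<Sum>i\<in>A - {a}. Ph (A - {i}) * Es (A - (A - {i})))" by (subst sum.reindex[OF inj]) simp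
		also have "... = ?X"
		proof (rule sum.cong[OF refl])
			fix i assume "i \<in> A - {a}"
			hence "A - (A - {i}) = {i}" by auto
			thus "Ph (A - {i}) * Es (A - (A - {i})) = mono0 (g i) * Ph (A - {i})" by (simp add: Es_single mult.commute)
		qed
		finally show ?thesis .
	qed
	have "joins Fb a A = (\<Sum>A1\<in>?D. Fb A1 * Fb (A - A1))" by (simp add: joins_split[OF A(1,2)] Fb_empty)
	also have "... = (\<Sum>A1\<in>?D. (Es A1 + Ph A1) * (Es (A - A1) + Ph (A - A1)))"
	proof (rule sum.cong[OF refl])
		fix A1 assume "A1 \<in> ?D"
		hence "A1 \<subset> A" "A1 ~= {}" "A - A1 \<subset> A" "A - A1 ~= {}" by auto
		thus "Fb A1 * Fb (A - A1) = (Es A1 + Ph A1) * (Es (A - A1) + Ph (A - A1))" using IH by simp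
	qed
	also have "... = (\<Sum>A1\<in>?D. Es A1 * Es (A - A1)) + (\<Sum>A1\<in>?D. Es A1 * Ph (A - A1)) +
			(\<Sum>A1\<in>?D. Ph A1 * Es (A - A1)) + (\<Sum>A1\<in>?D. Ph A1 * Ph (A - A1))" by (simp add: algebra_simps sum.distrib)
	finally have "joins Fb a A = Es {a} * Es (A - {a}) + mono0 (g a) * Ph (A - {a}) +
			?X + (\<Sum>A1\<in>?D. Ph A1 * Ph (A - A1))" unfolding E PE by (simp add: Es_single)
	moreover have "joins Ph a A = Wb * Ph A + (\<Sum>A1\<in>?D. Ph A1 * Ph (A - A1))"
		by (simp add: joins_split[OF A(1,2)] Phi_empty[OF B] mult.commute)
	moreover have "(\<Sum>i\<in>A. mono0 (g i) * Ph (A - {i})) = mono0 (g a) * Ph (A - {a}) + ?X" by (rule sum.remove[OF A(1,2)])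
	ultimately show ?thesis by (simp add: algebra_simps)
qed

text \<open>Both sides solve the same fixed point equation. For a single mark it is the equation of
  the mirror state; for more marks it is the resolvent equation of \<open>kX\<close>, matched with
  \<open>Phi_rec\<close> through \<open>joins_link\<close>, where the induction hypothesis
  enters.\<close>

lemma Fb_eq: "finite A ==> A ~= {} ==> Fb A = Es A + Ph A"
proof (induction "card A" arbitrary: A rule: less_induct)
	case less
	obtain a where a: "a \<in> A" using less.prems(2) by blast
	note A = less.prems(1) a
	show ?case
	proof (cases "A = {a}")
		case True
		have "{i. {a} = {i}} = {a}" by auto
		hence "Fb {a} = Ps a + kX B (joins Fb a {a})" using Fb_rec[of "{a}" a] by simp
		moreover have "{A1. a \<in> A1 & A1 \<subseteq> {a}} = {{a}}" by auto
		hence j: "joins F a {a} = F {a} * F {}" for F :: "nat set => 'n qs" by (simp add: joins_def)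
		ultimately have F: "Fb {a} = Ps a" by (simp add: Fb_empty kX_zero[OF B])
		have P: "Ph {a} = kq (Wb * (mono0 (g a) + Ph {a}))" using Phi_rec[of "{a}" a B g] by (simp add: j Phi_empty[OF B] algebra_simps)
		have "Ps a = mono0 (g a) + Ph {a}"
		proof (rule Wq_fixpoint_unique[OF B])
			show "Ps a = mono0 (g a) + kq (Wb * Ps a)" by (rule dressed_eq[OF B])
			show "mono0 (g a) + Ph {a} = mono0 (g a) + kq (Wb * (mono0 (g a) + Ph {a}))" by (rule arg_cong[OF P])
		qed
		thus ?thesis using True F by (simp add: Es_single)
	next case False
		have ns: "A ~= {i}" for i using False a by blast
		have link: "joins Fb a A + Wb * Ph A = joins Ph a A + (\<Sum>i\<in>A. mono0 (g i) * Ph (A - {i})) + Es {a} * Es (A - {a})"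
		proof (rule joins_link[OF A False])
			fix A1 assume "A1 \<subset> A" "A1 ~= {}"
			thus "Fb A1 = Es A1 + Ph A1" by (intro less.hyps) (use less.prems in "auto intro: psubset_card_mono finite_subset")
		qed
		have F: "Fb A = kX B (joins Fb a A)" using Fb_rec[OF A] ns by simp
		have "Fb A = Ph A"
		proof (rule Wq_fixpoint_unique[OF B])
			show "Fb A = kq (joins Fb a A) + kq (Wb * Fb A)" unfolding F kq_add[symmetric] by (rule kX_eq[OF B])
			have "Ph A = kq (joins Ph a A + (\<Sum>i\<in>A. mono0 (g i) * Ph (A - {i})) + Es {a} * Es (A - {a}))"
				unfolding kq_add[of _ "Es {a} * Es (A - {a})"] kq_Es using Phi_rec[OF A, of B g] by (simp add: add.commute)
			thus "Ph A = kq (joins Fb a A) + kq (Wb * Ph A)" unfolding link[symmetric] kq_add .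
		qed
		thus ?thesis using Es_neq[OF ns] by simp
	qed
qed

text \<open>The dressing of a state at the root is absorbed by completing the opposite branch.\<close>

lemma TR_dressed:
	"TR (dressed B u * Q) M = TR (u * (Q + Wb * kX B Q)) M"
proof -
	let ?P = "dressed B u" and ?X = "kX B Q"
	have X: "?X = kq Q + kq (Wb * ?X)" using kX_eq[OF B, of Q] by (simp add: kq_add)
	have P: "?P = u + kq (Wb * ?P)" by (rule dressed_eq[OF B])
	\<comment> \<open>The pairing of \<open>Wb * ?P\<close> with \<open>?X\<close> is evaluated twice,
	  here by the equation for \<open>?X\<close> and next by the equation for \<open>?P\<close>;
	  comparing the two results eliminates the unwanted term.\<close>
	have "TR (kq (Wb * ?P) * Q) M + TR (kq (Wb * ?P) * (Wb * ?X)) M = TR (Wb * ?P * ?X) M"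
	proof -
		have "TR (Wb * ?P * ?X) M = TR (Wb * ?P * (kq Q + kq (Wb * ?X))) M" using X by simp
		thus ?thesis by (simp add: distrib_left TR_add TR_kq)
	qed
	moreover have "TR (Wb * ?P * ?X) M = TR (u * (Wb * ?X)) M + TR (kq (Wb * ?P) * (Wb * ?X)) M"
	proof -
		have "Wb * ?P * ?X = ?P * (Wb * ?X)" by (simp add: mult_ac)
		also have "... = (u + kq (Wb * ?P)) * (Wb * ?X)" using P by simp
		finally show ?thesis by (simp add: distrib_right TR_add)
	qed
	moreover have "TR (?P * Q) M = TR (u * Q) M + TR (kq (Wb * ?P) * Q) M"
	proof -
		have "?P * Q = (u + kq (Wb * ?P)) * Q" using P by simp
		thus ?thesis by (simp add: distrib_right TR_add)
	qed
	ultimately show ?thesis by (simp add: distrib_left TR_add)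
qed

text \<open>\<open>Ph A\<close> is a propagated state, and \<open>TR\<close> sees it only at total
  vector zero, where the propagator vanishes.\<close>

lemma TR_mono0_Ph:
	assumes "finite A" "A ~= {}"
	shows "TR (mono0 c * (mono0 d * Ph A)) M = 0"
proof -
	obtain a where "a \<in> A" using assms(2) by blast
	hence "co (Ph A) M = 0" if "sum_mset M = 0" using Phi_rec[OF assms(1), of a B g] that by (simp add: kq_def)
	thus ?thesis by (simp add: TR_def co_mono0_mult)
qed

text \<open>\<open>TR_dressed\<close> replaces the mirror state at mark 1 by the bare state at the
  price of a term with \<open>Wb\<close> and \<open>kX\<close>, which is just what
  \<open>joins_link\<close> needs. The terms with one further bare state vanish by
  \<open>TR_mono0_Ph\<close>; two further bare states leave the classical triple product for
  \<open>n = 3\<close>.\<close>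

lemma sum_amplitudes:
	assumes n: "3 \<le> n"
	shows "(\<Sum>y\<in>btrees {2..n}. TR (Ps 1 * \<Prod>\<^sub># (image_mset (bv B Ps) (kids y))) M) =
		TR (mono0 (g 1) * joins Ph 2 {2..n}) M + (if n = 3 & M = {#} then tr (g 1 * (g 2 * g 3)) else 0)"
proof -
	let ?A = "{2..n}" and ?J = "joins Fb 2 {2..n}"
	have A: "finite ?A" "2 \<in> ?A" using n by auto
	have ns: "?A ~= {i}" for i
	proof
		assume "?A = {i}"
		moreover have "2 \<in> ?A" "3 \<in> ?A" using n by auto
		ultimately show False by auto
	qed
	have none: "{i. ?A = {i}} = {}" using ns by blast
	have "(\<Sum>y\<in>btrees ?A. TR (Ps 1 * \<Prod>\<^sub># (image_mset (bv B Ps) (kids y))) M) =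
			(\<Sum>ts\<in>inpairs wfB ?A {#}. TR (Ps 1 * \<Prod>\<^sub># (image_mset (bv B Ps) ts)) M)"
	proof -
		have "(btrees ?A :: 'n tl rt set) = Nd In ` inpairs wfB ?A {#}"
			unfolding btrees_rec[OF A(1)] none by (simp only: image_empty Un_empty_left)
		thus ?thesis by (simp add: sum.reindex inj_on_def)
	qed
	also have "... = TR (Ps 1 * ?J) M" unfolding sum_joins_wfB[OF A, symmetric] sum_distrib_left TR_sum ..
	also have "... = TR (mono0 (g 1) * (?J + Wb * kX B ?J)) M" by (rule TR_dressed)
	also have "kX B ?J = Ph ?A" using Fb_rec[OF A, unfolded none] Fb_eq[of ?A] A Es_neq[OF ns] by (simp only: sum.empty add_0_left) blast
	also have "?J + Wb * Ph ?A = joins Ph 2 ?A + (\<Sum>i\<in>?A. mono0 (g i) * Ph (?A - {i})) + Es {2} * Es (?A - {2})"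
		by (rule joins_link[OF A ns]) (rule Fb_eq, auto intro: finite_subset)
	also have "TR (mono0 (g 1) * ...) M = TR (mono0 (g 1) * joins Ph 2 ?A) M +
			(\<Sum>i\<in>?A. TR (mono0 (g 1) * (mono0 (g i) * Ph (?A - {i}))) M) + TR (mono0 (g 1) * (Es {2} * Es (?A - {2}))) M"
		by (simp only: distrib_left TR_add sum_distrib_left TR_sum)
	also have "(\<Sum>i\<in>?A. TR (mono0 (g 1) * (mono0 (g i) * Ph (?A - {i}))) M) = 0"
	proof (rule sum.neutral, rule ballI, rule TR_mono0_Ph)
		show "?A - {i} ~= {}" if "i \<in> ?A" for i using ns[of i] that by blast
	qed simp
	also have "TR (mono0 (g 1) * (Es {2} * Es (?A - {2}))) M = (if n = 3 & M = {#} then tr (g 1 * (g 2 * g 3)) else 0)"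
	proof (cases "n = 3")
		case True
		hence "?A - {2} = {3}" by auto
		thus ?thesis using True by (simp only: Es_single mono0_mult) (simp add: TR_def mono0_def)
	next case False
		have "?A - {2} ~= {i}" for i
		proof
			assume "?A - {2} = {i}"
			moreover have "3 \<in> ?A - {2}" "4 \<in> ?A - {2}" using n False by auto
			ultimately show False by auto
		qed
		thus ?thesis using Es_neq False by simp
	qed
	finally show ?thesis by simp
qed

lemma sum_shapes:
	assumes n: "3 \<le> n"
	shows "(\<Sum>t\<in>shapes B n M. tr (g 1 * \<Prod>\<^sub># (image_mset (tv g) (kids t)))) = tr (co (mono0 (g 1) * joins Ph 2 {2..n}) M)"
		and "finite (shapes B n M)"
proof -
	let ?X = "\<Sum>t\<in>shapes B n M. tr (g 1 * \<Prod>\<^sub># (image_mset (tv g) (kids t)))"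
	have A: "finite {2..n}" "2 \<in> {2..n}" using n by auto
	have s: "shapes B n M = Nd (Mk 1) ` inpairs (wfT B) {2..n} M" by (auto simp: shapes_def inpairs_def)
	have "Nd In ` inpairs (wfT B) {2..n} M \<subseteq> fam (wfT B) {2..n} M" unfolding fam_wfT[OF A(1)] by blast
	hence "finite (Nd In ` inpairs (wfT B) {2..n} M)" by (rule finite_subset) (rule fam_finite_wfT[OF A(1)])
	hence "finite (inpairs (wfT B) {2..n} M)" by (rule finite_imageD) (simp add: inj_on_def)
	thus "finite (shapes B n M)" unfolding s by (rule finite_imageI)
	have "?X =
			(\<Sum>ts\<in>inpairs (wfT B) {2..n} M. tr (g 1 * \<Prod>\<^sub># (image_mset (tv g) ts)))"
		unfolding s by (simp add: sum.reindex inj_on_def)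
	also have "... = tr (g 1 * co (joins Ph 2 {2..n}) M)" unfolding sum_joins_wfT[OF A, symmetric] sum_distrib_left tr_sum ..
	finally show "?X = tr (co (mono0 (g 1) * joins Ph 2 {2..n}) M)" by (simp add: co_mono0_mult)
qed

end

text \<open>Every branch carries at least one external edge, and its vector lies in
  \<open>B\<close>.\<close>

lemma shapes_empty:
	assumes "M = {#} | ~ set_mset M \<subseteq> B"
	shows "shapes B n M = {}"
proof -
	have False if t: "size ts = 2" "\<forall>c\<in>#ts. wfT B c" "\<Sum>\<^sub># (image_mset dvs ts) = M" for ts :: "'a tl rt multiset"
	proof -
		obtain c d where "ts = {#c, d#}" using size_two[OF t(1)] by blast
		thus False using t(2,3) dvs_wfT[of B c] dvs_wfT[of B d] assms by auto
	qed
	thus ?thesis unfolding shapes_def by blast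
qed

section \<open>The comparison theorem\<close>

lemma branch_cong: "(!!v. v \<in> leaves G ==> \<Psi> v = \<Psi>' v) ==> branch D G \<Psi> k p v = branch D G \<Psi>' k p v"
proof (induction k arbitrary: p v)
	case (Suc k)
	from Suc.IH[OF Suc.prems] have eq: "branch D G \<Psi> k = branch D G \<Psi>' k" by - (rule ext, rule ext)
	show ?case unfolding branch.simps eq using Suc.prems by simp
qed simp

text \<open>States enter only at the leaves \<open>{1..n}\<close>. The comparison of mirror states
  is available only for these indices.\<close>

lemma total_amplitude_cong:
	assumes "!!\<alpha>. \<alpha> \<in> {1..n} ==> \<Psi> \<alpha> = \<Psi>' \<alpha>"
	shows "total_amplitude D n \<Psi> M = total_amplitude D n \<Psi>' M" unfolding total_amplitude_def Let_def
proof (intro sum.cong refl)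
	fix C \<sigma> assume C: "C \<in> trivalent_trees n // tree_iso n" and \<sigma>: "\<sigma> \<in> {\<sigma>. \<sigma> permutes {1..n}}"
	let ?G = "SOME G. G \<in> C"
	obtain H where H: "H \<in> trivalent_trees n" "C = tree_iso n `` {H}" using C by (auto simp: quotient_def)
	have "graph_iso id H H" by (simp add: graph_iso_def)
	hence "H \<in> C" using H by (auto simp: tree_iso_def)
	hence "?G \<in> C" by (rule someI)
	hence L: "leaves ?G = {1..n}" using H by (auto simp: tree_iso_def trivalent_trees_def)
	have "\<Psi> (\<sigma> v) = \<Psi>' (\<sigma> v)" if "v \<in> leaves ?G" for v
		using that \<sigma> assms permutes_in_image[of \<sigma> "{1..n}" v] unfolding L by simp
	from branch_cong[OF this] have "branch D ?G (%i. \<Psi> (\<sigma> i)) = branch D ?G (%i. \<Psi>' (\<sigma> i))"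
		by - (rule ext, rule ext, rule ext)
	thus "amplitude D ?G (tree_sink ?G) (%i. \<Psi> (\<sigma> i)) M / of_nat (card (automorphisms ?G)) =
			amplitude D ?G (tree_sink ?G) (%i. \<Psi>' (\<sigma> i)) M / of_nat (card (automorphisms ?G))" unfolding amplitude_def by simp
qed

lemma prod_mset_eq_0: "c \<in># ts ==> f c = 0 ==> \<Prod>\<^sub># (image_mset f ts) = 0" for f :: "'a => 'b::comm_ring_1"
	by (auto dest!: multi_member_split)

lemma tv_unbalanced: "wfT B t ==> kids t ~= {#} ==> sum_mset (dvs t) = 0 ==> tv g t = 0"
	by (cases t; cases "lab t") (auto simp: dvs_Nd)

text \<open>An internal edge with zero vector brings a vanishing propagator. So a sum over tropical
  shapes may be extended to all of \<open>shapes B n M\<close>, for which the recursion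
  holds.\<close>

lemma tv_not_nz: "wfT B t ==> ~ nzT t ==> tv g t = 0"
proof (induction t)
	case (Nd l ts)
	then obtain c where c: "c \<in># ts" "~ nzT c | kids c ~= {#} & sum_mset (dvs c) = 0" by auto
	have w: "wfT B c" using Nd.prems(1) c(1) by auto
	have "tv g c = 0" using c(2) Nd.IH[OF c(1) w] tv_unbalanced[OF w] by blast
	hence "\<Prod>\<^sub># (image_mset (tv g) ts) = 0" by (rule prod_mset_eq_0[OF c(1)])
	moreover have "\<forall>b. l ~= Dv b" using Nd.prems(1) c(1) by auto
	ultimately show ?case by (cases l) simp_all
qed

lemma shape_not_nz:
	assumes "t \<in> shapes B n M" "~ nzT t"
	shows "\<Prod>\<^sub># (image_mset (tv g) (kids t)) = 0"
proof -
	obtain ts where ts: "t = Nd (Mk 1) ts" "\<forall>c\<in>#ts. wfT B c" using assms(1) by (auto simp: shapes_def)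
	obtain c where c: "c \<in># ts" "~ nzT c | kids c ~= {#} & sum_mset (dvs c) = 0"
		using assms(2) unfolding ts(1) by auto
	have w: "wfT B c" using ts(2) c(1) by blast
	have "tv g c = 0" using c(2) tv_not_nz[OF w] tv_unbalanced[OF w] by blast
	thus ?thesis unfolding ts(1) rt.sel by (rule prod_mset_eq_0[OF c(1)])
qed

lemma sum_mset_counts:
	fixes M :: "(int,'n::finite) vec multiset"
	assumes "finite B" "set_mset M \<subseteq> B"
	shows "(\<Sum>b\<in>B. int (count M b) *s b) = sum_mset M" using assms(2)
proof (induction M)
	case (add x M)
	have "(\<Sum>b\<in>B. int (count (add_mset x M) b) *s b) = (\<Sum>b\<in>B. int (count M b) *s b + (if b = x then b else 0))"
		by (rule sum.cong[OF refl]) (simp add: vec_eq_iff algebra_simps)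
	also have "... = sum_mset M + x" using add assms(1) by (simp add: sum.distrib sum.delta)
	finally show ?case by simp
qed simp

lemma shapes_of_types:
	fixes B :: "(int,'n::{finite,linorder}) vec set"
	assumes n: "1 \<le> n" and M: "sum_mset M = 0" "set_mset M \<subseteq> B"
	shows "shape n ` trop_types B n (%b. int (count M b)) = {t \<in> shapes B n M. nzT t}"
proof (intro equalityI subsetI)
	fix t assume "t \<in> shape n ` trop_types B n (%b. int (count M b))"
	then obtain T where ty: "trop_type B n T" "has_degree B (%b. int (count M b)) T" "t = shape n T" by (auto simp: trop_types_def)
	interpret trop_tree B n T by standard (use ty n in auto)
	have "dvs t = M"
	proof (rule multiset_eqI)
		fix b
		show "count (dvs t) b = count M b"
		proof (cases "b \<in> B")
			case True
			thus ?thesis using ty(2) degree_count[of b] by (simp add: has_degree_def ty(3))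
		next case False
			have "set_mset (dvs t) \<subseteq> B"
			proof (rule ccontr)
				assume "~ set_mset (dvs t) \<subseteq> B"
				hence "shapes B n (dvs t) = {}" by (intro shapes_empty) simp
				thus False using shape_in(1) unfolding ty(3) by blast
			qed
			thus ?thesis using False M(2) by (metis count_eq_zero_iff subsetD)
		qed
	qed
	thus "t \<in> {t \<in> shapes B n M. nzT t}" using shape_in(1,2) unfolding ty(3) by simp
next
	fix t assume t: "t \<in> {t \<in> shapes B n M. nzT t}"
	then obtain T where ty: "trop_type B n T" "shape n T = t" using shape_surj[OF n _ _ M(1)] by blast
	interpret trop_tree B n T by standard (use ty n in auto)
	have "dvs t = M" using t by (auto simp: shapes_def dvs_Nd)
	hence "has_degree B (%b. int (count M b)) T" using degree_count ty(2) by (simp add: has_degree_def)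
	thus "t \<in> shape n ` trop_types B n (%b. int (count M b))" using ty by (auto simp: trop_types_def)
qed

lemma trop_iso_kernel:
	fixes B :: "(int,'n::{finite,linorder}) vec set"
	assumes "1 \<le> n"
	shows "trop_iso B n \<beta> = {(S, T) \<in> trop_types B n \<beta> \<times> trop_types B n \<beta>. shape n S = shape n T}"
proof -
	have "shape n S = shape n T \<longleftrightarrow> (\<exists>f. graph_iso f (tree S) (tree T) & (\<forall>\<alpha>\<in>{1..n}. f (mark S \<alpha>) = mark T \<alpha>) &
			(\<forall>(u, v)\<in>adj (tree S). trop.flow T (f u) (f v) = trop.flow S u v))"
		if "S \<in> trop_types B n \<beta>" "T \<in> trop_types B n \<beta>" for S T
		using shape_iso_iff[of B n S T] that assms by (simp add: trop_types_def trop_tree_def)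
	thus ?thesis unfolding trop_iso_def by blast
qed

lemma sum_trop_integrals:
	fixes B :: "(int,'n::{finite,linorder}) vec set"
	assumes B: "finite B" and n: "3 \<le> n" and M: "sum_mset M = 0" "set_mset M \<subseteq> B"
		and \<gamma>: "!!\<alpha>. \<alpha> \<in> {1..n} ==> good (\<gamma> \<alpha>) & (\<exists>p. homogeneous p (\<gamma> \<alpha>) & even p)"
	shows "(\<Sum>C\<in>trop_types B n (%b. int (count M b)) // trop_iso B n (%b. int (count M b)).
			let T = (SOME T. T \<in> C) in trop_integral T (trop_sink T) n \<gamma>) =
		TR (mono0 (gform (\<gamma> 1)) * joins (Phi B (%i. gform (\<gamma> i))) 2 {2..n}) M"
proof -
	let ?\<beta> = "%b. int (count M b)" and ?g = "%i. gform (\<gamma> i)"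
	let ?H = "%t. tr (?g 1 * \<Prod>\<^sub># (image_mset (tv ?g) (kids t)))"
	have n1: "1 \<le> n" using n by simp
	have "(\<Sum>C\<in>trop_types B n ?\<beta> // trop_iso B n ?\<beta>. let T = (SOME T. T \<in> C) in trop_integral T (trop_sink T) n \<gamma>) =
			(\<Sum>t\<in>shape n ` trop_types B n ?\<beta>. ?H t)" unfolding Let_def
	proof (rule sum_quotient_kernel[where h = "shape n" and H = ?H, OF trop_iso_kernel[OF n1]])
		fix T assume "T \<in> trop_types B n ?\<beta>"
		then interpret trop_tree B n T by unfold_locales (use n1 in "auto simp: trop_types_def")
		show "trop_integral T (trop_sink T) n \<gamma> = ?H (shape n T)" by (rule integral_shape[OF \<gamma>])
	qed
	also have "... = (\<Sum>t\<in>{t \<in> shapes B n M. nzT t}. ?H t)" unfolding shapes_of_types[OF n1 M] ..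
	also have "... = (\<Sum>t\<in>shapes B n M. ?H t)"
	proof (rule sum.mono_neutral_left)
		show "finite (shapes B n M)" by (rule sum_shapes(2)[OF B n])
		show "\<forall>t\<in>shapes B n M - {t \<in> shapes B n M. nzT t}. ?H t = 0" using shape_not_nz by fastforce
	qed auto
	also have "... = tr (co (mono0 (?g 1) * joins (Phi B ?g) 2 {2..n}) M)" by (rule sum_shapes(1)[OF B n])
	finally show ?thesis using M(1) by (simp add: TR_def)
qed

theorem theorem5p13:
  fixes \<Delta> :: "(real^'n::{finite,linorder}) set set"
    and n :: nat
    and \<gamma> :: "nat \<Rightarrow> 'n form"
  assumes "complete_fan \<Delta>"
    and "3 \<le> n"
    and "\<forall>\<alpha>\<in>{1..n}. \<exists>p k C. even p \<and> p + k = 2 * CARD('n) \<and> homogeneous p (\<gamma> \<alpha>) \<and>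
           cycle_on \<Delta> k C \<and> represents_poincare_dual \<Delta> C (\<gamma> \<alpha>)"
  shows "gw_generating \<Delta> n \<gamma> =
    qcoeff (total_amplitude (QX (rays \<Delta>)) n (\<lambda>\<alpha>. mirror_state (rays \<Delta>) (\<gamma> \<alpha>)))"
proof
	fix e :: "'n lvec => int"
	let ?B = "rays \<Delta>" and ?g = "%i. gform (\<gamma> i)"
	let ?J = "mono0 (?g 1) * joins (Phi ?B ?g) 2 {2..n}"
	let ?F = "total_amplitude (QX ?B) n (%\<alpha>. mirror_state ?B (\<gamma> \<alpha>))"
	have B: "finite ?B" using assms(1) by (intro finite_rays) (simp add: complete_fan_def)
	have \<gamma>: "good (\<gamma> \<alpha>) & (\<exists>p. homogeneous p (\<gamma> \<alpha>) & even p)" if "\<alpha> \<in> {1..n}" for \<alpha>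
		using bspec[OF assms(3) that] good_Omega_trop[OF assms(1)] by (auto simp: represents_poincare_dual_def)
	have n1: "1 \<le> n" using assms(2) by simp
	have F: "?F M = TR ?J M + (if n = 3 & M = {#} then tr (?g 1 * (?g 2 * ?g 3)) else 0)" for M
	proof -
		have "?F M = total_amplitude (QX ?B) n (%\<alpha>. toq (dressed ?B (mono0 (?g \<alpha>)))) M"
		proof (rule total_amplitude_cong)
			fix \<alpha> assume "\<alpha> \<in> {1..n}"
			from \<gamma>[OF this] show "mirror_state ?B (\<gamma> \<alpha>) = toq (dressed ?B (mono0 (?g \<alpha>)))"
				using mirror_state_toq[OF _ _ _ B] by blast
		qed
		also have "... = TR ?J M + (if n = 3 & M = {#} then tr (?g 1 * (?g 2 * ?g 3)) else 0)"
			unfolding total_amplitude_btrees[OF assms(2) B] by (rule sum_amplitudes[OF B assms(2)])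
		finally show ?thesis .
	qed
	have J0: "TR ?J M = 0" if "M = {#} | ~ set_mset M \<subseteq> ?B" for M
		using sum_shapes(1)[OF B assms(2), of ?g M] shapes_empty[OF that, of n] by (simp add: TR_def)
	have classical: "tr (?g 1 * (?g 2 * ?g 3)) = int_X (fwedge (\<gamma> 1) (fwedge (\<gamma> 2) (\<gamma> 3)))" if "n = 3"
	proof -
		have "cf (ev (?g \<alpha>) r) = \<gamma> \<alpha> r" if "\<alpha> \<in> {1..n}" for \<alpha> r using \<gamma>[OF that] cf_gform by blast
		hence "cf (ev (?g 1) r) = \<gamma> 1 r" "cf (ev (?g 2) r) = \<gamma> 2 r" "cf (ev (?g 3) r) = \<gamma> 3 r" for r using `n = 3` by auto
		thus ?thesis by (simp only: tr_def ev_simps cf_mult fwedge_def[abs_def])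
	qed
	\<comment> \<open>The class zero corresponds to the empty monomial. There the tropical sum
	  \<open>TR ?J\<close> is empty and only the classical term is left.\<close>
	have gw: "gw \<Delta> n (%b. int (count M b)) \<gamma> = ?F M" if M: "sum_mset M = 0" "set_mset M \<subseteq> ?B" for M
	proof (cases "M = {#}")
		case True
		hence z: "(%b. int (count M b)) = 0" by (simp add: fun_eq_iff)
		show ?thesis unfolding F z gw_def using True J0[of M] classical by simp
	next case False
		then obtain b where "b \<in># M" by (meson multiset_nonemptyE)
		hence "(%b. int (count M b)) ~= 0" by (auto simp: fun_eq_iff)
		thus ?thesis unfolding F gw_def using False sum_trop_integrals[OF B assms(2) M \<gamma>] by (simp only: if_False simp_thms add_0_right)
	qed
	have outside: "?F M = 0" if "sum_mset M ~= 0 | ~ set_mset M \<subseteq> ?B" for M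
	proof (cases "sum_mset M = 0")
		case True
		hence "TR ?J M = 0" "M ~= {#}" using that J0[of M] by auto
		thus ?thesis by (simp add: F)
	next case False
		thus ?thesis by (auto simp: F TR_def)
	qed
	have H2: "(%b. int (count M b)) \<in> H2 \<Delta> \<longleftrightarrow> sum_mset M = 0 & set_mset M \<subseteq> ?B" for M
	proof -
		have "(\<forall>b. b ~: ?B --> int (count M b) = 0) \<longleftrightarrow> set_mset M \<subseteq> ?B"
			by (auto simp: count_eq_zero_iff)
		thus ?thesis unfolding H2_def using sum_mset_counts[OF B, of M] by auto
	qed
	have gen: "gw_generating \<Delta> n \<gamma> e = (if e \<in> H2 \<Delta> then gw \<Delta> n e \<gamma> else 0)"
	proof -
		have "{\<beta>. \<beta> \<in> H2 \<Delta> & \<beta> = e} = (if e \<in> H2 \<Delta> then {e} else {})" by auto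
		thus ?thesis unfolding gw_generating_def by simp
	qed
	show "gw_generating \<Delta> n \<gamma> e = qcoeff ?F e"
	proof (cases "\<exists>M. (%b. int (count M b)) = e")
		case True
		then obtain M where M: "(%b. int (count M b)) = e" by blast
		have "{M. (%b. int (count M b)) = e} = {M}" unfolding M[symmetric] by (auto simp: fun_eq_iff multiset_eq_iff)
		hence q: "qcoeff ?F e = ?F M" by (simp add: qcoeff_def)
		have "gw \<Delta> n e \<gamma> = ?F M" if "e \<in> H2 \<Delta>" using gw[of M] H2[of M] that unfolding M by blast
		moreover have "?F M = 0" if "e ~: H2 \<Delta>" using outside[of M] H2[of M] that unfolding M by blast
		ultimately show ?thesis unfolding gen q by simp
	next case False
		\<comment> \<open>No monomial has these exponents. The degree of a tropical type counts external
		  edges and therefore always comes from a multiset, so no type has this degree.\<close>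
		have "gw \<Delta> n e \<gamma> = 0" if e: "e \<in> H2 \<Delta>"
		proof -
			have "trop_types ?B n e = {}"
			proof (rule ccontr)
				assume "trop_types ?B n e ~= {}"
				then obtain T where ty: "trop_type ?B n T" "has_degree ?B e T" by (auto simp: trop_types_def)
				interpret trop_tree ?B n T by standard (use ty n1 in auto)
				have "(%b. int (count (dvs (shape n T)) b)) = e"
				proof
					fix b
					show "int (count (dvs (shape n T)) b) = e b"
					proof (cases "b \<in> ?B")
						case True
						thus ?thesis using ty(2) degree_count[of b] by (simp add: has_degree_def)
					next case False
						have "set_mset (dvs (shape n T)) \<subseteq> ?B" using shape_in(1) shapes_empty[of "dvs (shape n T)" ?B n] by blast
						thus ?thesis using False e by (auto simp: H2_def count_eq_zero_iff)
					qed
				qed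
				thus False using False by blast
			qed
			moreover have "e ~= 0"
			proof
				assume "e = 0"
				hence "(%b. int (count {#} b)) = e" by (simp add: fun_eq_iff)
				thus False using False by blast
			qed
			ultimately show ?thesis by (simp add: gw_def)
		qed
		moreover have "{M. (%b. int (count M b)) = e} = {}" using False by blast
		ultimately show ?thesis unfolding gen qcoeff_def by simp
	qed
qed

end
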